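(* Let $m\ge 2$ be an integer, let $A$ be an $m\times m$ irreducible binary ($0$-$1$) matrix with rows and columns indexed by $\mathcal{A}=\{0,1,\dots,m-1\}$, let $\alpha,\gamma\in\mathbb{R}$ with $1\le\alpha<\gamma$ and let $\beta,\delta\in\mathbb{R}$. Let $X_A^{[\alpha,\beta,\gamma,\delta]}$ be the Beatty multiple shift, and let $d_i$ ($i\in\mathbb{N}\cup\{\infty\}$) be the densities of the sets $A_i$, both defined in the context. Assume that $d_i$ exists for all $i\in\mathbb{N}\cup\{\infty\}$. Then: (1) The Minkowski dimension of $X_A^{[\alpha,\beta,\gamma,\delta]}$ is $$\dim_M X_A^{[\alpha,\beta,\gamma,\delta]}=\sum_{i=1}^{\infty}\left\{\frac{1}{(\gamma/\alpha)^{i-1}}d_i+\left[\frac{1}{(\gamma/\alpha)^{i-1}}-\frac{1}{(\gamma/\alpha)^{i}}\right]\left(\sum_{j=i+1}^{\infty}d_j+d_\infty\right)\right\}\log_m|A^{i-1}|,$$ where $|M|$ denotes the sum of all entries of a matrix $M$. (2) If $A$ is primitive, then $$\dim_H X_A^{[\alpha,\beta,\gamma,\delta]}=d_1+\sum_{i=2}^{\infty}d_i\log_m t_{\emptyset;i}+d_\infty\log_m\sum_{i=0}^{m-1}t_i,$$ where the numbers $t_{\emptyset;i}$ are defined in the context and $(t_i)_{i=0}^{m-1}$ is the unique positive vector satisfying $t_i^{\gamma/\alpha}=\sum_{j=0}^{m-1}A(i,j)t_j$ for all $0\le i\le m-1$. (3) $\dim_H X_A^{[\alpha,\beta,\gamma,\delta]}=\dim_M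 X_A^{[\alpha,\beta,\gamma,\delta]}$ if and only if all row sums of $A$ are equal.
   Context: Notation: $\mathbb{N}=\{1,2,3,\dots\}$ and $\lfloor\cdot\rfloor$ is the floor function. The Beatty multiple shift is $$X_A^{[\alpha,\beta,\gamma,\delta]}=\{x=(x_i)_{i=1}^\infty\in\mathcal{A}^{\mathbb{N}}:A(x_{\lfloor\alpha k+\beta\rfloor},x_{\lfloor\gamma k+\delta\rfloor})=1\text{ for all }k\in\mathbb{N}\},$$ where the condition is imposed only for those $k$ for which both indices are positive integers. The space $\mathcal{A}^{\mathbb{N}}$ carries the standard metric in which two distinct sequences $x,y$ have distance $m^{-\min\{k:x_k\ne y_k\}+1}$. $\dim_H$ and $\dim_M$ denote the Hausdorff and Minkowski (box-counting) dimension, so $\dim_M X=\lim_{n\to\infty}\frac1n\log_m\#\{(x_1,\dots,x_n):x\in X\}$ when the limit exists. Define $S(\alpha,\beta)=\{\lfloor\alpha k+\beta\rfloor:k\in\mathbb{N}\}\cap\mathbb{N}$, and similarly $S(\gamma,\delta)$. Define the map $f:\{\lfloor\alpha k+\beta\rfloor:k\in\mathbb{N}\}\to\{\lfloor\gamma k+\delta\rfloor:k\in\mathbb{N}\}$ by $f(\lfloor\alpha k+\beta\rfloor)=\lfloor\gamma k+\delta\rfloor$ (well-defined since $\alpha\ge1$). Define - $A_1=\mathbb{N}\setminus[S(\alpha,\beta)\cup S(\gamma,\delta)]$; - $A_2=\{x\in S(\alpha,\beta)\setminus S(\gamma,\delta): f(x)\in S(\gamma,\delta)\setminus S(\alpha,\beta)\}$;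 - for $i\ge3$, $A_i=\{x\in S(\alpha,\beta)\setminus S(\gamma,\delta): f^j(x)\in S(\alpha,\beta)\cap S(\gamma,\delta)\text{ for all }1\le j\le i-2,\ f^{i-1}(x)\in S(\gamma,\delta)\setminus S(\alpha,\beta)\}$; - $A_\infty=\{x\in S(\alpha,\beta)\setminus S(\gamma,\delta): f^j(x)\in S(\alpha,\beta)\cap S(\gamma,\delta)\text{ for all }j\ge1\}$. (Subscripted $A_i$ are sets of integers; $A$ without subscript, and its powers $A^{i-1}$, are matrices.) For $i\in\mathbb{N}\cup\{\infty\}$ the density of $A_i$ is $$d_i=\lim_{|n_1-n_2|\to\infty}\frac{|A_i\cap[n_1,n_2]|}{|n_1-n_2|}\qquad(n_1<n_2\text{ in }\mathbb{N}),$$ a limit as $|n_1-n_2|\to\infty$ irrespective of the position of the interval, when it exists. For finite $i$ and $1\le j\le i$ put $$d_{i,j}=\lim_{n\to\infty}\frac1n\left|\{x\in A_i:|\{x,f(x),\dots,f^{i-1}(x)\}\cap[1,n]|=j\}\right|,$$ which exists whenever $d_i$ exists, and $d_i=\sum_{j=1}^i d_{i,j}$. Let $a_j=\sum_{\ell=0}^{m-1}A(j,\ell)$ be the row sums of $A$. For $i\ge2$ and $1\le k\le i-1$, define recursively in $k$, for $j\in\mathcal{A}$, $$f_k(j,i)=\left[\sum_{b_1,\dots,b_{k-1}=0}^{m-1}A(j,b_1)\prod_{e=1}^{k-2}A(b_e,b_{e+1})\,a_{b_{k-1}}\prod_{c=1}^{k-1}f_c(b_{k-c},i)\right]^{-d_{i,i-k}/\sum_{\ell=0}^{k}d_{i,i-\ell}},$$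 where for $k=1$ the bracket is read as $a_j$. Then set $t_{j_1,\dots,j_i;i}=\prod_{k=1}^{i-1}f_k(j_{i-k},i)$ and $$t_{\emptyset;i}=\sum_{j_1,\dots,j_i=0}^{m-1}A(j_1,j_2)A(j_2,j_3)\cdots A(j_{i-1},j_i)\,t_{j_1,\dots,j_i;i}.$$ Terms $d_i\log_m t_{\emptyset;i}$ with $d_i=0$ are read as $0$.
   Formalization: The shift is assumed non-empty (it can be empty, e.g. when A has zero diagonal and both indices coincide), and the dimension formulas in (1) and (2) assume that the sum of all d_i plus d_∞ equals 1 − 1/γ, which existence of the densities does not imply; both fail otherwise. *)

theory Defs
  imports "HOL-Analysis.Analysis" "Jordan_Normal_Form.Matrix"
begin

section \<open>Hausdorff and Minkowski dimension\<close>

context Metric_space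
begin

definition fine_set :: "real \<Rightarrow> 'a set \<Rightarrow> bool" where
  "fine_set e U \<longleftrightarrow> U \<subseteq> M \<and> (\<forall>x\<in>U. \<forall>y\<in>U. d x y \<le> e)"

definition mdiameter :: "'a set \<Rightarrow> real" where
  "mdiameter U = (if U = {} then 0 else (SUP (x, y)\<in>U \<times> U. d x y))"

definition hausdorff_premeasure :: "real \<Rightarrow> real \<Rightarrow> 'a set \<Rightarrow> ennreal" where
  "hausdorff_premeasure s e S =
     (INF U\<in>{U :: nat \<Rightarrow> 'a set. (\<forall>i. fine_set e (U i)) \<and> S \<subseteq> (\<Union>i. U i)}.
        (\<Sum>i. ennreal (mdiameter (U i) powr s)))"

definition hausdorff_measure :: "real \<Rightarrow> 'a set \<Rightarrow> ennreal" where
  "hausdorff_measure s S = (SUP e\<in>{0<..}. hausdorff_premeasure s e S)"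

text \<open>The exponent is kept positive because \<open>0 powr 0 = 0\<close>; the infimum is not affected.\<close>

definition hausdorff_dim :: "'a set \<Rightarrow> ereal" where
  "hausdorff_dim S = (INF s\<in>{s. 0 < s \<and> hausdorff_measure s S = 0}. ereal s)"

text \<open>Least number of sets of diameter at most \<open>e\<close> that cover \<open>S\<close>; meant for totally
  bounded \<open>S\<close>, where finite covers exist.\<close>

definition covering_number :: "real \<Rightarrow> 'a set \<Rightarrow> nat" where
  "covering_number e S =
     (LEAST n. \<exists>C. finite C \<and> card C = n \<and> (\<forall>U\<in>C. fine_set e U) \<and> S \<subseteq> \<Union>C)"

definition has_minkowski_dim :: "'a set \<Rightarrow> real \<Rightarrow> bool" where
  "has_minkowski_dim S D \<longleftrightarrow>
     ((\<lambda>e. ln (real (covering_number e S)) / ln (1 / e)) \<longlongrightarrow> D) (at_right 0)"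

end


section \<open>Sequences over a finite alphabet\<close>

text \<open>Sequences are indexed by the positive integers, hence extensional on \<open>{1..}\<close>.\<close>

definition full_shift :: "nat \<Rightarrow> (nat \<Rightarrow> nat) set" where
  "full_shift m = {1..} \<rightarrow>\<^sub>E {..<m}"

definition shift_dist :: "nat \<Rightarrow> (nat \<Rightarrow> nat) \<Rightarrow> (nat \<Rightarrow> nat) \<Rightarrow> real" where
  "shift_dist m x y =
     (if x = y then 0 else real m powi (1 - int (LEAST k. 1 \<le> k \<and> x k \<noteq> y k)))"

lemma Metric_space_full_shift:
  assumes "1 \<le> m"
  shows "Metric_space (full_shift m) (shift_dist m)"
proof
  fix x y
  show "0 \<le> shift_dist m x y" by (simp add: shift_dist_def)
  show "shift_dist m x y = shift_dist m y x" by (simp add: shift_dist_def eq_commute)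
next
  fix x y
  show "shift_dist m x y = 0 \<longleftrightarrow> x = y" using assms by (simp add: shift_dist_def)
next
  fix x y z
  assume xyz: "x \<in> full_shift m" "y \<in> full_shift m" "z \<in> full_shift m"
  define L where "L = (\<lambda>x y :: nat \<Rightarrow> nat. LEAST k. 1 \<le> k \<and> x k \<noteq> y k)"
  have ex: "\<exists>k. 1 \<le> k \<and> u k \<noteq> v k"
    if "u \<in> full_shift m" "v \<in> full_shift m" "u \<noteq> v" for u v
  proof -
    from that(3) have "\<exists>k. u k \<noteq> v k" by blast
    then obtain k where k: "u k \<noteq> v k" by blast
    have "k \<in> {1..}"
    proof (rule ccontr)
      assume "k \<notin> {1..}"
      then have "u k = undefined" "v k = undefined"
        using PiE_arb[OF that(1)[unfolded full_shift_def]] PiE_arb[OF that(2)[unfolded full_shift_def]]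
        by blast+
      with k show False by simp
    qed
    then show ?thesis using k by auto
  qed
  have L_le: "L u v \<le> k" if "1 \<le> k" "u k \<noteq> v k" for u v k
    unfolding L_def by (rule Least_le) (use that in blast)
  have anti: "real m powi (1 - int a) \<le> real m powi (1 - int b)" if "b \<le> a" for a b
    using assms that by (intro power_int_increasing) auto
  show "shift_dist m x z \<le> shift_dist m x y + shift_dist m y z"
  proof (cases "x = y \<or> y = z \<or> x = z")
    case True
    moreover have "shift_dist m u u = 0" "0 \<le> shift_dist m u v" for u v
      by (simp_all add: shift_dist_def)
    ultimately show ?thesis by force
  next
    case False
    have "1 \<le> L x z \<and> x (L x z) \<noteq> z (L x z)"
      unfolding L_def by (rule LeastI_ex[OF ex[OF xyz(1,3)]]) (use False in blast)
    then have "1 \<le> L x z" and "x (L x z) \<noteq> y (L x z) \<or> y (L x z) \<noteq> z (L x z)"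
      by metis+
    then have "L x y \<le> L x z \<or> L y z \<le> L x z"
      using L_le by blast
    moreover have "0 \<le> real m powi (1 - int (L x y))" "0 \<le> real m powi (1 - int (L y z))"
      by simp_all
    ultimately have "real m powi (1 - int (L x z)) \<le> real m powi (1 - int (L x y)) + real m powi (1 - int (L y z))"
      using anti[of "L x y" "L x z"] anti[of "L y z" "L x z"] by linarith
    then show ?thesis using False by (simp add: shift_dist_def L_def)
  qed
qed


section \<open>Irreducible and primitive matrices\<close>

definition binary_mat :: "real mat \<Rightarrow> bool" where
  "binary_mat A \<longleftrightarrow> (\<forall>i<dim_row A. \<forall>j<dim_col A. A $$ (i, j) \<in> {0, 1})"

definition irreducible_mat :: "real mat \<Rightarrow> bool" where
  "irreducible_mat A \<longleftrightarrow>
     square_mat A \<and> (\<forall>i<dim_row A. \<forall>j<dim_row A. \<exists>k\<ge>1. (A ^\<^sub>m k) $$ (i, j) > 0)"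

definition primitive_mat :: "real mat \<Rightarrow> bool" where
  "primitive_mat A \<longleftrightarrow>
     square_mat A \<and> (\<exists>k\<ge>1. \<forall>i<dim_row A. \<forall>j<dim_row A. (A ^\<^sub>m k) $$ (i, j) > 0)"

definition row_sum :: "real mat \<Rightarrow> nat \<Rightarrow> real" where
  "row_sum A j = (\<Sum>l<dim_col A. A $$ (j, l))"


section \<open>Beatty multiple shifts\<close>

definition beatty_shift :: "nat \<Rightarrow> real mat \<Rightarrow> real \<Rightarrow> real \<Rightarrow> real \<Rightarrow> real \<Rightarrow> (nat \<Rightarrow> nat) set" where
  "beatty_shift m A \<alpha> \<beta> \<gamma> \<delta> =
     {x \<in> full_shift m. \<forall>k::nat. 1 \<le> k \<longrightarrow> 0 < \<lfloor>\<alpha> * k + \<beta>\<rfloor> \<longrightarrow> 0 < \<lfloor>\<gamma> * k + \<delta>\<rfloor> \<longrightarrow>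
        A $$ (x (nat \<lfloor>\<alpha> * k + \<beta>\<rfloor>), x (nat \<lfloor>\<gamma> * k + \<delta>\<rfloor>)) = 1}"

definition beatty_set :: "real \<Rightarrow> real \<Rightarrow> int set" where
  "beatty_set \<alpha> \<beta> = {\<lfloor>\<alpha> * k + \<beta>\<rfloor> | k::nat. 1 \<le> k} \<inter> {0<..}"

text \<open>For \<open>\<alpha> \<ge> 1\<close> the index \<open>k\<close> is determined by \<open>x\<close>. Outside \<open>{\<lfloor>\<alpha> * k + \<beta>\<rfloor> | k. 1 \<le> k}\<close> the value
  is arbitrary; iterates below are only formed where the previous iterate lies in that set.\<close>

definition beatty_map :: "real \<Rightarrow> real \<Rightarrow> real \<Rightarrow> real \<Rightarrow> int \<Rightarrow> int" where
  "beatty_map \<alpha> \<beta> \<gamma> \<delta> x = \<lfloor>\<gamma> * (THE k::nat. 1 \<le> k \<and> \<lfloor>\<alpha> * k + \<beta>\<rfloor> = x) + \<delta>\<rfloor>"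

text \<open>Starting points of chains of length \<open>i \<ge> 1\<close>; for \<open>i = 2\<close> the condition on the intermediate
  iterates is vacuous.\<close>

definition chain_starts :: "real \<Rightarrow> real \<Rightarrow> real \<Rightarrow> real \<Rightarrow> nat \<Rightarrow> int set" where
  "chain_starts \<alpha> \<beta> \<gamma> \<delta> i =
     (if i = 1 then {0<..} - (beatty_set \<alpha> \<beta> \<union> beatty_set \<gamma> \<delta>)
      else {x \<in> beatty_set \<alpha> \<beta> - beatty_set \<gamma> \<delta>.
              (\<forall>j\<in>{1..i-2}. (beatty_map \<alpha> \<beta> \<gamma> \<delta> ^^ j) x \<in> beatty_set \<alpha> \<beta> \<inter> beatty_set \<gamma> \<delta>) \<and>
              (beatty_map \<alpha> \<beta> \<gamma> \<delta> ^^ (i-1)) x \<in> beatty_set \<gamma> \<delta> - beatty_set \<alpha> \<beta>})"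

definition chain_starts_inf :: "real \<Rightarrow> real \<Rightarrow> real \<Rightarrow> real \<Rightarrow> int set" where
  "chain_starts_inf \<alpha> \<beta> \<gamma> \<delta> =
     {x \<in> beatty_set \<alpha> \<beta> - beatty_set \<gamma> \<delta>.
        \<forall>j\<ge>1. (beatty_map \<alpha> \<beta> \<gamma> \<delta> ^^ j) x \<in> beatty_set \<alpha> \<beta> \<inter> beatty_set \<gamma> \<delta>}"

definition has_uniform_density :: "int set \<Rightarrow> real \<Rightarrow> bool" where
  "has_uniform_density S d \<longleftrightarrow>
     ((\<lambda>(n1, n2). real (card (S \<inter> {n1..n2})) / real_of_int (n2 - n1)) \<longlongrightarrow> d)
       (inf (filtercomap (\<lambda>(n1, n2). n2 - n1) at_top) (principal {(n1, n2). 1 \<le> n1 \<and> n1 < n2}))"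

text \<open>Up to finitely many points, the set of positive integers outside \<open>beatty_set \<gamma> \<delta>\<close>, which has
  density \<open>1 - 1 / \<gamma>\<close>, is the disjoint union of the sets of starting points of all chains.
  Density is not countably additive, so existence of all the densities \<open>d i\<close> and \<open>d_inf\<close> only
  yields that their total is at most \<open>1 - 1 / \<gamma>\<close>; a deficit would be carried by finite
  chains of unbounded length.\<close>

definition densities_add_up :: "real \<Rightarrow> (nat \<Rightarrow> real) \<Rightarrow> real \<Rightarrow> bool" where
  "densities_add_up \<gamma> d d_inf \<longleftrightarrow> (\<lambda>i. d (i+1)) sums (1 - 1 / \<gamma> - d_inf)"

definition chain_density :: "real \<Rightarrow> real \<Rightarrow> real \<Rightarrow> real \<Rightarrow> nat \<Rightarrow> nat \<Rightarrow> real" where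
  "chain_density \<alpha> \<beta> \<gamma> \<delta> i j =
     lim (\<lambda>n. real (card {x \<in> chain_starts \<alpha> \<beta> \<gamma> \<delta> i.
                card ((\<lambda>e. (beatty_map \<alpha> \<beta> \<gamma> \<delta> ^^ e) x) ` {..<i} \<inter> {1..int n}) = j}) / real n)"


section \<open>Weights in the Hausdorff dimension formula\<close>

text \<open>\<open>chain_weight A D i k j\<close> is $f_k(j,i)$, where \<open>D i j\<close> stands for $d_{i,j}$; it is meant for
  \<open>1 \<le> k < i\<close>. Tuples \<open>(b\<^sub>1, \<dots>, b\<^sub>k\<^sub>-\<^sub>1)\<close> are extensional functions on \<open>{1..k-1}\<close>.\<close>

function chain_weight :: "real mat \<Rightarrow> (nat \<Rightarrow> nat \<Rightarrow> real) \<Rightarrow> nat \<Rightarrow> nat \<Rightarrow> nat \<Rightarrow> real" where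
  "chain_weight A D i k j =
     (if k \<le> 1 then row_sum A j
      else (\<Sum>b \<in> {1..k-1} \<rightarrow>\<^sub>E {..<dim_row A}.
              A $$ (j, b 1) * (\<Prod>e = 1..k-2. A $$ (b e, b (e+1))) * row_sum A (b (k-1)) *
              (\<Prod>c = 1..k-1. chain_weight A D i c (b (k-c)))))
     powr (- D i (i-k) / (\<Sum>l = 0..k. D i (i-l)))"
  by pat_completeness auto
termination by (relation "Wellfounded.measure (\<lambda>(A, D, i, k, j). k)") auto

declare chain_weight.simps [simp del]

definition chain_total :: "real mat \<Rightarrow> (nat \<Rightarrow> nat \<Rightarrow> real) \<Rightarrow> nat \<Rightarrow> real" where
  "chain_total A D i =
     (\<Sum>J \<in> {1..i} \<rightarrow>\<^sub>E {..<dim_row A}.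
        (\<Prod>e = 1..i-1. A $$ (J e, J (e+1))) * (\<Prod>k = 1..i-1. chain_weight A D i k (J (i-k))))"

definition positive_solution :: "real mat \<Rightarrow> real \<Rightarrow> (nat \<Rightarrow> real) \<Rightarrow> bool" where
  "positive_solution A r t \<longleftrightarrow>
     t \<in> {..<dim_row A} \<rightarrow>\<^sub>E {0<..} \<and>
     (\<forall>i<dim_row A. t i powr r = (\<Sum>j<dim_col A. A $$ (i, j) * t j))"

end

theory Submission
  imports Defs "HOL-Real_Asymp.Real_Asymp"
begin

text \<open>
  The constraints split the positions into orbits of \<open>f\<close>, which stretches positions by the factor
  \<open>q = \<gamma> / \<alpha>\<close>; up to finitely many positions an orbit is a finite or infinite chain, and the words
  on different chains are independent. Existence of the densities, together with the absence of a
  deficit, makes averages of bounded quantities over the nodes of all chains converge: first over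
  the starts, then by induction over the depth, since each step contributes a factor \<open>1 / q\<close>.

  Words of length \<open>n\<close> are counted by comparison with a product of Markov measures. For the Hausdorff
  dimension the Markov weights solve \<open>u\<^sub>r\<^sup>q = A u\<^sub>r\<^sub>-\<^sub>1\<close> along the remaining length \<open>r\<close>, so that
  \<open>- ln\<close> of the measure of the cylinder of length \<open>n\<close> is \<open>S n + q \<Psi> (n / q) - \<Psi> n\<close> up to a constant,
  where \<open>S\<close> is deterministic and \<open>0 \<le> \<Psi> n = O (n)\<close>. Along \<open>n, q n, q\<^sup>2 n, \<dots>\<close> the defect telescopes, which
  gives the upper bound for every sequence; Chebyshev's inequality gives the lower bound.

  The comparison of the two dimensions uses no densities. If the row sums differ, the uniform
  distributions on words of lengths \<open>n\<close> and \<open>q n\<close> induce different symbol frequencies at the starts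
  of the chains with exactly one element up to \<open>n\<close> and exactly two up to \<open>q n\<close>. Hence every sequence has an
  atypical prefix at one of the two lengths, and covering by these prefixes saves an exponential factor.
\<close>

section \<open>Prefixes of sequences\<close>

text \<open>In the logarithm of a Markov measure up to level \<open>n\<close>, every node enters
  through the weight of its own symbol, and every edge through the normalisation at its end. The end
  of an edge from \<open>u\<close> lies near \<open>q * u\<close>, so the edges seen by level
  \<open>n\<close> start at nodes up to \<open>n / q\<close>. The equation for the weights makes the
  normalisation on an edge the \<open>q\<close>-th power of the weight at its beginning; both kinds
  of terms then become values of one function \<Psi>, and no optimisation over measures is required.
  The recursively defined \<open>chain_weight\<close> is recovered afterwards, because its exponent
  always equals \<open>1 / q - 1\<close>. No measure theory is involved: a measure is a consistent
  family of weights on finite words, and sequences are obtained from words by compactness. The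
  obstacle at small positions is that the orbit map may run backwards or leave the positive integers
  there. Everything up to a threshold \<open>K\<close> is kept as one block, constrained by
  \<open>adm K\<close>; the at most \<open>K\<close> edges leaving it upwards cause a bounded or
  logarithmic error.\<close>

definition words :: "nat \<Rightarrow> nat \<Rightarrow> (nat \<Rightarrow> nat) set" where
  "words m n = {1..n} \<rightarrow>\<^sub>E {..<m}"

definition pre :: "nat \<Rightarrow> (nat \<Rightarrow> nat) \<Rightarrow> nat \<Rightarrow> nat" where
  "pre n x = restrict x {1..n}"

lemma finite_words [simp, intro]: "finite (words m n)"
  unfolding words_def by (rule finite_PiE) auto

lemma card_words: "card (words m n) = m ^ n"
  unfolding words_def by (subst card_PiE) auto

lemma sum_words_Suc:
  "(\<Sum>x\<in>words m (Suc n). F x) = (\<Sum>x\<in>words m n. \<Sum>b<m. F (x(Suc n := b)))"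
proof -
  have "{1..Suc n} = insert (Suc n) {1..n}" by auto
  then have "words m (Suc n) = (\<lambda>(y, g). g(Suc n := y)) ` ({..<m} \<times> words m n)"
    unfolding words_def by (simp add: PiE_insert_eq)
  moreover have "inj_on (\<lambda>(y, g). g(Suc n := y)) ({..<m} \<times> words m n)"
    unfolding words_def by (rule inj_combinator) auto
  ultimately have "(\<Sum>x\<in>words m (Suc n). F x) = (\<Sum>(b, x)\<in>{..<m} \<times> words m n. F (x(Suc n := b)))"
    by (simp add: sum.reindex case_prod_beta' o_def)
  also have "\<dots> = (\<Sum>b<m. \<Sum>x\<in>words m n. F (x(Suc n := b)))"
    by (subst sum.cartesian_product) simp
  finally show ?thesis by (subst sum.swap) simp
qed

lemma pre_apply: "pre n x i = (if 1 \<le> i \<and> i \<le> n then x i else undefined)"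
  by (simp add: pre_def)

lemma pre_eq_iff: "pre n x = pre n y \<longleftrightarrow> (\<forall>i\<in>{1..n}. x i = y i)"
  by (auto simp: fun_eq_iff pre_def restrict_def)

lemma pre_words: "x \<in> words m n \<Longrightarrow> pre n x = x"
  by (auto simp: words_def pre_def PiE_def extensional_restrict)

lemma pre_pre [simp]: "k \<le> n \<Longrightarrow> pre k (pre n x) = pre k x"
  by (auto simp: pre_eq_iff pre_apply)

lemma pre_upd [simp]: "k \<le> n \<Longrightarrow> pre k (x(Suc n := b)) = pre k x"
  by (auto simp: pre_eq_iff)

lemma pre_in_words: "x \<in> full_shift m \<Longrightarrow> pre n x \<in> words m n"
  by (auto simp: full_shift_def words_def pre_def)

lemma pre_in_words': "x \<in> words m n \<Longrightarrow> k \<le> n \<Longrightarrow> pre k x \<in> words m k"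
  by (auto simp: words_def pre_def)

lemma words_upd: "x \<in> words m n \<Longrightarrow> b < m \<Longrightarrow> x(Suc n := b) \<in> words m (Suc n)"
  by (auto simp: words_def PiE_iff extensional_def)

lemma words_less: "x \<in> words m n \<Longrightarrow> 1 \<le> i \<Longrightarrow> i \<le> n \<Longrightarrow> x i < m"
  by (auto simp: words_def PiE_iff)

lemma full_eqI: "x \<in> full_shift m \<Longrightarrow> y \<in> full_shift m \<Longrightarrow> (\<And>i. 1 \<le> i \<Longrightarrow> x i = y i) \<Longrightarrow> x = y"
  unfolding full_shift_def by (rule PiE_ext) auto

lemma words_SucE:
  assumes "x \<in> words m (Suc n)"
  obtains y b where "y \<in> words m n" "b < m" "x = y(Suc n := b)" "y = pre n x"
proof (rule that[of "pre n x" "x (Suc n)"])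
  show "pre n x \<in> words m n" using assms pre_in_words' by simp
  show "x (Suc n) < m" using assms words_less[of x m "Suc n" "Suc n"] by simp
  show "x = (pre n x)(Suc n := x (Suc n))"
    using assms by (auto simp: fun_eq_iff pre_apply words_def PiE_iff extensional_def)
qed (rule refl)

text \<open>Compactness: a word with good extensions of every length has, among its finitely many
  one-letter extensions, one with the same property. Iterating this from \<open>z\<close> yields the
  sequence.\<close>

lemma koenig_words:
  fixes Q :: "nat \<Rightarrow> (nat \<Rightarrow> nat) \<Rightarrow> bool"
  assumes cong: "\<And>n x y. Q n x \<Longrightarrow> pre n x = pre n y \<Longrightarrow> Q n y"
    and down: "\<And>n x. Q (Suc n) x \<Longrightarrow> Q n x"
    and ex: "\<And>n. \<exists>x\<in>words m n. Q n x"
    and z: "Q k z" "z \<in> words m k" "\<And>n. n \<ge> k \<Longrightarrow> \<exists>x\<in>words m n. Q n x \<and> pre k x = pre k z"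
  shows "\<exists>x\<in>full_shift m. (\<forall>n. Q n x) \<and> pre k x = z"
proof -
  have down': "Q n x \<Longrightarrow> k \<le> n \<Longrightarrow> Q k x" for n k x
    by (induction n) (auto simp: le_Suc_eq intro: down)
  define P where "P n y \<longleftrightarrow> y \<in> words m n \<and> (\<forall>N\<ge>n. \<exists>x\<in>words m N. Q N x \<and> pre n x = y)" for n y
  have step: "\<exists>y'. P (Suc n) y' \<and> pre n y' = y" if Pny: "P n y" for n y
  proof (rule ccontr)
    assume contra: "\<not> ?thesis"
    define S where "S = (\<lambda>b. y(Suc n := b)) ` {..<m}"
    have "\<forall>y'\<in>S. \<exists>N\<ge>Suc n. \<not> (\<exists>x\<in>words m N. Q N x \<and> pre (Suc n) x = y')"
    proof
      fix y' assume "y' \<in> S"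
      then obtain b where b: "b < m" "y' = y(Suc n := b)" by (auto simp: S_def)
      have y: "y \<in> words m n" using Pny P_def by auto
      then have "y' \<in> words m (Suc n)" "pre n y' = y" using b words_upd pre_words[OF y] by auto
      then show "\<exists>N\<ge>Suc n. \<not> (\<exists>x\<in>words m N. Q N x \<and> pre (Suc n) x = y')"
        using contra unfolding P_def by blast
    qed
    then obtain N where N: "\<And>y'. y' \<in> S \<Longrightarrow> N y' \<ge> Suc n"
      "\<And>y' x. y' \<in> S \<Longrightarrow> x\<in>words m (N y') \<Longrightarrow> Q (N y') x \<Longrightarrow> pre (Suc n) x \<noteq> y'" by metis
    \<comment> \<open>\<open>M\<close> exceeds all the lengths at which the one-letter extensions of
      \<open>y\<close> die out, but \<open>y\<close> itself still extends to a good word of length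
      \<open>M\<close>.\<close>
    define M where "M = Max (insert (Suc n) (N ` S))"
    have finS: "finite S" by (simp add: S_def)
    have M: "Suc n \<le> M" "\<And>y'. y' \<in> S \<Longrightarrow> N y' \<le> M"
      unfolding M_def using finS by (auto intro: Max_ge)
    obtain x where x: "x \<in> words m M" "Q M x" "pre n x = y"
      using Pny Suc_leD[OF M(1)] unfolding P_def by blast
    define y' where "y' = pre (Suc n) x"
    have "y' \<in> words m (Suc n)" unfolding y'_def using x(1) M(1) pre_in_words' by blast
    then obtain u b where ub: "u \<in> words m n" "b < m" "y' = u(Suc n := b)" "u = pre n y'"
      by (rule words_SucE)
    have "u = y" using ub(4) x(3) by (simp add: y'_def)
    then have "y' \<in> S" using ub(2,3) unfolding S_def by blast
    have "pre (N y') x \<in> words m (N y')" "Q (N y') (pre (N y') x)"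
      using x M(2)[OF \<open>y' \<in> S\<close>] pre_in_words' apply blast
      using x M(2)[OF \<open>y' \<in> S\<close>] cong[of "N y'" x "pre (N y') x"] down' by simp
    moreover have "pre (Suc n) (pre (N y') x) = y'" using N(1)[OF \<open>y' \<in> S\<close>] by (simp add: y'_def)
    ultimately show False using N(2)[OF \<open>y' \<in> S\<close>] by blast
  qed
  define f where "f = rec_nat z (\<lambda>n y. SOME y'. P (k + Suc n) y' \<and> pre (k + n) y' = y)"
  have f0: "f 0 = z" by (simp add: f_def)
  have P0: "P k z"
    unfolding P_def using z pre_words[OF z(2)] by auto
  have fP: "P (k + n) (f n)" for n
  proof (induction n)
    case 0 show ?case using P0 f0 by simp
  next
    case (Suc n)
    from someI_ex[OF step[OF Suc]] show ?case by (simp add: f_def)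
  qed
  have fpre: "pre (k + n) (f (Suc n)) = f n" for n
    using someI_ex[OF step[OF fP[of n]]] by (simp add: f_def)
  have fpre': "pre (k + n) (f (n + j)) = f n" for n j
  proof (induction j)
    case 0
    have "f n \<in> words m (k + n)" using fP[of n] by (simp add: P_def)
    then show ?case by (simp add: pre_words)
  next
    case (Suc j)
    have "pre (k + n) (f (n + Suc j)) = pre (k + n) (pre (k + (n + j)) (f (Suc (n + j))))" by simp
    then show ?case using Suc fpre by simp
  qed
  define x where "x = (\<lambda>i. if 1 \<le> i then f i i else undefined)"
  have fi: "f n i = f i i" if "1 \<le> i" "i \<le> k + n" for n i
  proof -
    have "f n = pre (k + n) (f (n + i))" "f i = pre (k + i) (f (i + n))" by (simp_all add: fpre')
    then show ?thesis using that by (metis add.commute pre_apply le_add2)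
  qed
  have xpre: "pre (k + n) x = f n" for n
  proof -
    have "f n \<in> words m (k + n)" using fP[of n] by (simp add: P_def)
    then have "f n = pre (k + n) (f n)" by (rule pre_words[symmetric])
    moreover have "pre (k + n) x = pre (k + n) (f n)"
      unfolding pre_eq_iff
    proof
      fix i assume "i \<in> {1..k + n}"
      then show "x i = f n i" using fi[of i n] by (simp add: x_def)
    qed
    ultimately show ?thesis by metis
  qed
  have "x \<in> full_shift m"
    unfolding full_shift_def PiE_iff
  proof (intro conjI ballI)
    fix i assume i: "i \<in> {1::nat..}"
    have "f i \<in> words m (k + i)" using fP[of i] by (simp add: P_def)
    then show "x i \<in> {..<m}" using i words_less[of "f i" m "k+i" i] by (simp add: x_def)
  qed (auto simp: extensional_def x_def)
  moreover have "Q n x" for n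
  proof -
    obtain u where "u \<in> words m (k + n)" "Q (k + n) u" "pre (k + n) u = f n"
      using fP[of n] unfolding P_def by blast
    then have "Q (k + n) x" using xpre cong by simp
    then show ?thesis by (rule down') simp
  qed
  moreover have "pre k x = z" using xpre[of 0] f0 by simp
  ultimately show ?thesis by blast
qed

section \<open>Dimensions in terms of prefixes\<close>

locale alphabet =
  fixes m :: nat
  assumes m2: "2 \<le> m"

sublocale alphabet \<subseteq> Metric_space "full_shift m" "shift_dist m"
  using Metric_space_full_shift m2 by simp

context alphabet
begin

lemma shift_dist_neq:
  assumes "x \<in> full_shift m" "y \<in> full_shift m" "x \<noteq> y"
  shows "\<exists>k. shift_dist m x y = (1 / real m) ^ k \<and> pre k x = pre k y \<and> x (Suc k) \<noteq> y (Suc k)"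
proof -
  define l where "l = (LEAST k. 1 \<le> k \<and> x k \<noteq> y k)"
  have ex: "\<exists>k. 1 \<le> k \<and> x k \<noteq> y k" using assms full_eqI by metis
  have l: "1 \<le> l \<and> x l \<noteq> y l" unfolding l_def by (rule LeastI_ex[OF ex])
  have nl: "\<not> (1 \<le> k \<and> x k \<noteq> y k)" if "k < l" for k using not_less_Least[OF that[unfolded l_def]] .
  obtain k where k: "l = Suc k" using l by (cases l) auto
  have "shift_dist m x y = real m powi (1 - int l)" using assms by (simp add: shift_dist_def l_def)
  also have "1 - int l = - int k" using k by simp
  also have "real m powi (- int k) = (1 / real m) ^ k"
    by (simp add: power_int_minus power_one_over inverse_eq_divide)
  finally show ?thesis using l nl k by (intro exI[of _ k]) (auto simp: pre_eq_iff)
qed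

text \<open>All distances are powers of \<open>1 / m\<close>, so a scale between two consecutive
  powers acts like the smaller one.\<close>

lemma shift_dist_le_iff:
  assumes "x \<in> full_shift m" "y \<in> full_shift m"
    and e: "(1 / real m) ^ n \<le> e" "e < real m * (1 / real m) ^ n"
  shows "shift_dist m x y \<le> e \<longleftrightarrow> pre n x = pre n y"
proof (cases "x = y")
  case True
  have "0 \<le> e" using e(1) by (meson order_trans zero_le_divide_1_iff zero_le_power of_nat_0_le_iff)
  then show ?thesis using True by (simp add: shift_dist_def)
next
  case False
  obtain k where k: "shift_dist m x y = (1 / real m) ^ k" "pre k x = pre k y" "x (Suc k) \<noteq> y (Suc k)"
    using shift_dist_neq[OF assms(1,2) False] by blast
  have m0: "0 < real m" "1 / real m \<le> 1" using m2 by auto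
  show ?thesis
  proof (cases "n \<le> k")
    case True
    have "(1 / real m) ^ k \<le> (1 / real m) ^ n" using True m0 by (intro power_decreasing) auto
    moreover have "pre n x = pre n y" using k(2) True by (auto simp: pre_eq_iff)
    ultimately show ?thesis using k e by simp
  next
    case F: False
    then obtain n' where n': "n = Suc n'" "k \<le> n'" by (cases n) auto
    have "real m * (1 / real m) ^ n = (1 / real m) ^ n'" using n' m0 by simp
    also have "\<dots> \<le> (1 / real m) ^ k" using n' m0 by (intro power_decreasing) auto
    finally have "\<not> shift_dist m x y \<le> e" using k e by simp
    moreover have "pre n x \<noteq> pre n y" using k F unfolding pre_eq_iff by fastforce
    ultimately show ?thesis by simp
  qed
qed

lemma fine_set_iff:
  assumes "(1 / real m) ^ n \<le> e" "e < real m * (1 / real m) ^ n"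
  shows "fine_set e U \<longleftrightarrow> U \<subseteq> full_shift m \<and> (\<forall>x\<in>U. \<forall>y\<in>U. pre n x = pre n y)"
  unfolding fine_set_def using shift_dist_le_iff[OF _ _ assms] by blast

text \<open>At such a scale a fine set lies in a single cylinder of length \<open>n\<close>, so a
  cover needs one set for each prefix.\<close>

lemma covering_number_eq:
  assumes X: "X \<subseteq> full_shift m"
    and e: "(1 / real m) ^ n \<le> e" "e < real m * (1 / real m) ^ n"
  shows "covering_number e X = card (pre n ` X)"
  unfolding covering_number_def
proof (rule Least_equality)
  have fin: "finite (pre n ` X)"
    by (rule finite_subset[of _ "words m n"]) (use X pre_in_words in auto)
  define f where "f p = {x \<in> X. pre n x = p}" for p
  have "inj_on f (pre n ` X)" unfolding inj_on_def f_def by blast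
  then have "card (f ` pre n ` X) = card (pre n ` X)" by (rule card_image)
  moreover have "\<forall>U\<in>f ` pre n ` X. fine_set e U" using X by (auto simp: fine_set_iff[OF e] f_def)
  moreover have "X \<subseteq> \<Union>(f ` pre n ` X)" by (auto simp: f_def)
  ultimately show "\<exists>C. finite C \<and> card C = card (pre n ` X) \<and> (\<forall>U\<in>C. fine_set e U) \<and> X \<subseteq> \<Union>C"
    using fin by (intro exI[of _ "f ` pre n ` X"]) auto
next
  fix k assume "\<exists>C. finite C \<and> card C = k \<and> (\<forall>U\<in>C. fine_set e U) \<and> X \<subseteq> \<Union>C"
  then obtain C where C: "finite C" "card C = k" "\<And>U. U \<in> C \<Longrightarrow> fine_set e U" "X \<subseteq> \<Union>C" by blast
  have "pre n ` X \<subseteq> (\<lambda>U. pre n (SOME x. x \<in> U)) ` C"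
  proof
    fix p assume "p \<in> pre n ` X"
    then obtain x where x: "x \<in> X" "p = pre n x" by blast
    then obtain U where U: "U \<in> C" "x \<in> U" using C by blast
    have "(SOME x. x \<in> U) \<in> U" using U(2) by (rule someI[where P = "\<lambda>x. x \<in> U"])
    then have "pre n (SOME x. x \<in> U) = p" using C(3)[OF U(1)] U x unfolding fine_set_iff[OF e] by blast
    then show "p \<in> (\<lambda>U. pre n (SOME x. x \<in> U)) ` C" using U by blast
  qed
  then have "card (pre n ` X) \<le> card ((\<lambda>U. pre n (SOME x. x \<in> U)) ` C)" by (rule card_mono[rotated]) (use C in auto)
  also have "\<dots> \<le> k" using C card_image_le by blast
  finally show "card (pre n ` X) \<le> k" .
qed

lemma ln_m_pos: "0 < ln (real m)" using m2 by simp

text \<open>For the converse direction a scale \<open>e\<close> belongs to the level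
  \<open>N e\<close>, the logarithm \<open>t e\<close> of \<open>1 / e\<close> to the base
  \<open>m\<close> rounded up; the ratio of \<open>N e\<close> and \<open>t e\<close> tends to
  1.\<close>

lemma has_minkowski_dim_iff:
  assumes X: "X \<subseteq> full_shift m"
  shows "has_minkowski_dim X D \<longleftrightarrow>
    (\<lambda>n. ln (real (card (pre n ` X))) / (real n * ln (real m))) \<longlonglongrightarrow> D" (is "_ \<longleftrightarrow> ?f \<longlonglongrightarrow> D")
proof
  assume D: "has_minkowski_dim X D"
  have lim: "filterlim (\<lambda>n. (1 / real m) ^ n) (at_right 0) sequentially"
    unfolding filterlim_at
    using m2 by (auto intro!: LIMSEQ_power_zero)
  from filterlim_compose[OF D[unfolded has_minkowski_dim_def] lim]
  have "(\<lambda>n. ln (real (covering_number ((1 / real m) ^ n) X)) / ln (1 / (1 / real m) ^ n)) \<longlonglongrightarrow> D" .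
  moreover have "ln (real (covering_number ((1 / real m) ^ n) X)) / ln (1 / (1 / real m) ^ n) = ?f n" for n
    using m2 by (subst covering_number_eq[OF X, of n]) (auto simp: power_one_over ln_realpow ln_div divide_strict_right_mono)
  ultimately show "?f \<longlonglongrightarrow> D" by simp
next
  assume D: "?f \<longlonglongrightarrow> D"
  define t where "t e = ln (1 / e) / ln (real m)" for e :: real
  define N where "N e = nat \<lceil>t e\<rceil>" for e
  have tinf: "filterlim t at_top (at_right 0)"
  proof -
    have "filterlim (\<lambda>e::real. ln (1 / e)) at_top (at_right 0)" by real_asymp
    from filterlim_tendsto_pos_mult_at_top[OF tendsto_const[of "1 / ln (real m)"] _ this]
    show ?thesis using ln_m_pos unfolding t_def by (simp add: field_simps)
  qed
  have Ninf: "filterlim N at_top (at_right 0)"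
  proof -
    have "filterlim (\<lambda>x::real. nat \<lceil>x\<rceil>) at_top at_top" by real_asymp
    from filterlim_compose[OF this tinf] show ?thesis unfolding N_def .
  qed
  have ratio: "((\<lambda>e. real (N e) / t e) \<longlongrightarrow> 1) (at_right 0)"
  proof -
    have "((\<lambda>x::real. real (nat \<lceil>x\<rceil>) / x) \<longlongrightarrow> 1) at_top" by real_asymp
    from filterlim_compose[OF this tinf] show ?thesis unfolding N_def .
  qed
  have "((\<lambda>e. ?f (N e) * (real (N e) / t e)) \<longlongrightarrow> D * 1) (at_right 0)"
    by (intro tendsto_mult filterlim_compose[OF D Ninf] ratio)
  moreover have "\<forall>\<^sub>F e in at_right 0. ?f (N e) * (real (N e) / t e) = ln (real (covering_number e X)) / ln (1 / e)"
    using eventually_at_right_less[of "0::real"] filterlim_at_top_dense[THEN iffD1, OF tinf, rule_format, of 1]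
  proof eventually_elim
    case (elim e)
    have lnm: "0 < ln (real m)" by (rule ln_m_pos)
    have N: "real (N e) \<ge> t e" "real (N e) < t e + 1" "real (N e) > 0"
      using elim unfolding N_def by linarith+
    have lt: "ln (1 / e) = t e * ln (real m)" using lnm by (simp add: t_def)
    have le: "- ln e = t e * ln (real m)" using elim lt by (simp add: ln_div)
    have pw: "(1 / real m) ^ N e = exp (- (real (N e) * ln (real m)))"
      using m2 by (simp add: exp_minus exp_of_nat_mult power_one_over inverse_eq_divide)
    have "t e * ln (real m) = - ln e" using le by simp
    then have ee: "e = exp (- (t e * ln (real m)))" using elim by simp
    have "(1 / real m) ^ N e \<le> exp (- (t e * ln (real m)))"
      unfolding pw using N lnm by simp
    also have "\<dots> = e" by (rule ee[symmetric])
    finally have 1: "(1 / real m) ^ N e \<le> e" .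
    have "real m * (1 / real m) ^ N e = exp (ln (real m) - real (N e) * ln (real m))"
      unfolding pw using m2 by (simp add: exp_diff exp_minus field_simps)
    moreover have "exp (- (t e * ln (real m))) < exp (ln (real m) - real (N e) * ln (real m))"
    proof -
      have "real (N e) * ln (real m) < (t e + 1) * ln (real m)" using N lnm by simp
      then show ?thesis by (simp add: algebra_simps)
    qed
    moreover note ee[symmetric]
    ultimately have 2: "e < real m * (1 / real m) ^ N e" by simp
    show ?case
      unfolding covering_number_eq[OF X 1 2] lt using N lnm elim by (simp add: field_simps)
  qed
  ultimately have "((\<lambda>e. ln (real (covering_number e X)) / ln (1 / e)) \<longlongrightarrow> D * 1) (at_right 0)"
    by (rule Lim_transform_eventually)
  then show "has_minkowski_dim X D" by (simp add: has_minkowski_dim_def)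
qed

end

section \<open>Upper bounds for the Hausdorff dimension by cylinder covers\<close>

context alphabet
begin

lemma shift_dist_le_1:
  assumes "x \<in> full_shift m" "y \<in> full_shift m"
  shows "shift_dist m x y \<le> 1"
proof (cases "x = y")
  case False
  obtain k where "shift_dist m x y = (1 / real m) ^ k" using shift_dist_neq[OF assms False] by blast
  then show ?thesis using m2 by (simp add: power_le_one)
qed (simp add: shift_dist_def)

lemma shift_dist_le_mdiameter:
  assumes "U \<subseteq> full_shift m" "x \<in> U" "y \<in> U"
  shows "shift_dist m x y \<le> mdiameter U"
proof -
  have bdd: "bdd_above ((\<lambda>(x, y). shift_dist m x y) ` (U \<times> U))"
    by (rule bdd_aboveI2[where M = 1]) (use assms(1) shift_dist_le_1 in \<open>auto simp: subset_iff\<close>)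
  have "shift_dist m x y \<le> (SUP (x, y)\<in>U \<times> U. shift_dist m x y)"
    using cSUP_upper[OF _ bdd, of "(x, y)"] assms by simp
  then show ?thesis using assms by (auto simp: mdiameter_def)
qed

lemma mdiameter_le:
  assumes "U \<subseteq> full_shift m" "\<And>x y. x \<in> U \<Longrightarrow> y \<in> U \<Longrightarrow> shift_dist m x y \<le> e" "0 \<le> e"
  shows "mdiameter U \<le> e"
  unfolding mdiameter_def using assms by (auto intro!: cSUP_least)

lemma mdiameter_nonneg:
  assumes "U \<subseteq> full_shift m" shows "0 \<le> mdiameter U"
proof (cases "U = {}")
  case False
  then obtain x where "x \<in> U" by blast
  from shift_dist_le_mdiameter[OF assms this this] show ?thesis by (simp add: shift_dist_def)
qed (simp add: mdiameter_def)

lemma power_m_bounds: "(1 / real m) ^ n \<le> (1 / real m) ^ n" "(1 / real m) ^ n < real m * (1 / real m) ^ n"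
  using m2 by (auto simp: field_simps power_one_over)

lemma powr_m_power: "((1 / real m) ^ n) powr s = real m powr (- (s * real n))"
  using m2 by (simp add: powr_def ln_realpow ln_div)

text \<open>Every point meets the lists \<open>L n\<close> at arbitrarily high levels, so the
  cylinders over all levels from \<open>n0\<close> on form a cover. At an exponent above
  \<open>D\<close> their contributions are the tail of a geometric series with ratio
  \<open>r\<close>.\<close>

lemma hausdorff_dim_le:
  assumes X: "X \<subseteq> full_shift m"
    and L: "\<And>n. n \<ge> n1 \<Longrightarrow> L n \<subseteq> words m n"
    and card: "\<And>n. n \<ge> n1 \<Longrightarrow> real (card (L n)) \<le> C * real m powr (D * real n)"
    and inf: "\<And>x n. x \<in> X \<Longrightarrow> \<exists>k\<ge>n. pre k x \<in> L k"
    and D: "0 \<le> D"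
  shows "hausdorff_dim X \<le> ereal D"
proof (rule ereal_le_epsilon2)
  fix \<epsilon> :: real assume \<epsilon>: "0 < \<epsilon>"
  define s where "s = D + \<epsilon>"
  have C0: "0 \<le> C"
  proof -
    have "0 \<le> C * real m powr (D * real n1)" using card[of n1] by (meson of_nat_0_le_iff order_trans order_refl)
    then show ?thesis using m2 by (simp add: zero_le_mult_iff)
  qed
  define r where "r = real m powr (- \<epsilon>)"
  have r: "0 < r" "r < 1" using m2 \<epsilon> by (auto simp: r_def powr_less_one)
  have pm: "hausdorff_premeasure s e X = 0" if e: "0 < e" for e
  proof -
    have bnd: "hausdorff_premeasure s e X \<le> 0 + ennreal \<eta>" if \<eta>: "0 < \<eta>" for \<eta>
    proof -
      have "(\<lambda>n. C * (r ^ n / (1 - r))) \<longlonglongrightarrow> C * (0 / (1 - r))"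
        using r by (intro tendsto_intros LIMSEQ_power_zero) auto
      then have "\<forall>\<^sub>F n in sequentially. C * (r ^ n / (1 - r)) < \<eta>"
        using \<eta> by (simp add: order_tendstoD(2))
      moreover have "\<forall>\<^sub>F n in sequentially. (1 / real m) ^ n < e"
        using m2 e by (intro order_tendstoD(2)[OF LIMSEQ_power_zero]) auto
      ultimately have "\<forall>\<^sub>F n in sequentially. n \<ge> n1 \<and> (1 / real m) ^ n < e \<and> C * (r ^ n / (1 - r)) < \<eta>"
        using eventually_ge_at_top[of n1] by eventually_elim auto
      then obtain n0 where n0: "n1 \<le> n0" "(1 / real m) ^ n0 < e" "C * (r ^ n0 / (1 - r)) < \<eta>"
        unfolding eventually_sequentially by blast
      \<comment> \<open>The words of \<open>L n\<close> are enumerated by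
        \<open>from_nat_into\<close>; the remaining indices give empty sets, which contribute
        \<open>0\<close>. The double family is flattened by \<open>prod_decode\<close>.\<close>
      define V where "V = (\<lambda>(n, k). if n0 \<le> n \<and> k < card (L n)
          then {x \<in> full_shift m. pre n x = from_nat_into (L n) k} else {})"
      define U where "U i = V (prod_decode i)" for i
      have fin: "finite (L n)" if "n \<ge> n1" for n using L[OF that] finite_subset finite_words by blast
      have dist: "shift_dist m x y \<le> (1 / real m) ^ n" if "x \<in> V (n, k)" "y \<in> V (n, k)" for x y n k
        using that shift_dist_le_iff[OF _ _ power_m_bounds, of x y n] by (auto simp: V_def split: if_splits)
      have Vsub: "V p \<subseteq> full_shift m" for p by (auto simp: V_def split: if_splits prod.splits)
      have diam: "mdiameter (V (n, k)) \<le> (1 / real m) ^ n" for n k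
        using mdiameter_le[OF Vsub dist] by simp
      have "fine_set e (V p)" for p
      proof (cases p)
        case (Pair n k)
        have "shift_dist m x y \<le> e" if "x \<in> V (n, k)" "y \<in> V (n, k)" for x y
        proof -
          have "n0 \<le> n" using that by (auto simp: V_def split: if_splits)
          then have "(1 / real m) ^ n \<le> (1 / real m) ^ n0" using m2 by (intro power_decreasing) auto
          with dist[OF that] n0(2) show ?thesis by linarith
        qed
        then show ?thesis using Vsub Pair by (auto simp: fine_set_def)
      qed
      moreover have "X \<subseteq> (\<Union>i. U i)"
      proof
        fix x assume x: "x \<in> X"
        obtain k where k: "k \<ge> n0" "pre k x \<in> L k" using inf[OF x] by blast
        have "finite (L k)" "L k \<noteq> {}" using fin k n0 by auto
        then obtain j where j: "j < card (L k)" "from_nat_into (L k) j = pre k x"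
          using k(2) by (metis bij_betw_from_nat_into_finite bij_betw_imp_surj_on imageE lessThan_iff)
        have "x \<in> V (k, j)" using j k x X by (auto simp: V_def)
        then have "x \<in> U (prod_encode (k, j))" by (simp add: U_def)
        then show "x \<in> (\<Union>i. U i)" by blast
      qed
      ultimately have "hausdorff_premeasure s e X \<le> (\<Sum>i. ennreal (mdiameter (U i) powr s))"
        unfolding hausdorff_premeasure_def by (intro INF_lower) (auto simp: U_def)
      also have "\<dots> = (\<Sum>n. \<Sum>k. ennreal (mdiameter (V (n, k)) powr s))"
        unfolding U_def by (rule suminf_ennreal_2dimen[where f = "\<lambda>p. ennreal (mdiameter (V p) powr s)"]) simp
      also have "\<dots> \<le> (\<Sum>n. ennreal (if n0 \<le> n then C * r ^ n else 0))"
      proof (intro suminf_le summableI)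
        fix n
        show "(\<Sum>k. ennreal (mdiameter (V (n, k)) powr s)) \<le> ennreal (if n0 \<le> n then C * r ^ n else 0)"
        proof (cases "n0 \<le> n")
          case True
          have "(\<Sum>k. ennreal (mdiameter (V (n, k)) powr s)) = (\<Sum>k<card (L n). ennreal (mdiameter (V (n, k)) powr s))"
            by (rule suminf_finite) (auto simp: V_def mdiameter_def)
          also have "\<dots> \<le> (\<Sum>k<card (L n). ennreal (((1 / real m) ^ n) powr s))"
            using diam D \<epsilon> mdiameter_nonneg[OF Vsub]
            by (intro sum_mono ennreal_leI powr_mono2) (auto simp: s_def)
          also have "\<dots> = ennreal (real (card (L n)) * real m powr (- (s * real n)))"
            by (simp add: powr_m_power ennreal_mult ennreal_of_nat_eq_real_of_nat)
          also have "\<dots> \<le> ennreal (C * r ^ n)"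
          proof (rule ennreal_leI)
            have "real (card (L n)) * real m powr (- (s * real n))
                \<le> C * real m powr (D * real n) * real m powr (- (s * real n))"
              using card[of n] True n0 by (intro mult_right_mono) auto
            also have "\<dots> = C * r ^ n"
              using m2 by (simp add: r_def s_def powr_realpow[symmetric] powr_powr flip: powr_add) (simp add: algebra_simps)
            finally show "real (card (L n)) * real m powr (- (s * real n)) \<le> C * r ^ n" .
          qed
          finally show ?thesis using True by simp
        qed (simp add: V_def mdiameter_def)
      qed
      also have "\<dots> = ennreal (C * (r ^ n0 / (1 - r)))"
      proof (rule suminf_ennreal_eq)
        have "(\<lambda>n. C * r ^ n0 * r ^ n) sums (C * r ^ n0 * (1 / (1 - r)))"
          using r by (intro sums_mult geometric_sums) auto
        moreover have "(\<lambda>n. if n0 \<le> n + n0 then C * r ^ (n + n0) else 0) = (\<lambda>n. C * r ^ n0 * r ^ n)"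
          by (auto simp: power_add)
        ultimately have "(\<lambda>n. if n0 \<le> n + n0 then C * r ^ (n + n0) else 0) sums (C * (r ^ n0 / (1 - r)))"
          by simp
        then show "(\<lambda>n. if n0 \<le> n then C * r ^ n else 0) sums (C * (r ^ n0 / (1 - r)))"
          using sums_zero_iff_shift[of n0 "\<lambda>n. if n0 \<le> n then C * r ^ n else 0"] by simp
      qed (use C0 r in auto)
      also have "\<dots> \<le> ennreal \<eta>" using n0 by (intro ennreal_leI) simp
      finally show ?thesis by simp
    qed
    have "hausdorff_premeasure s e X \<le> 0"
      by (rule ennreal_le_epsilon) (rule bnd)
    then show ?thesis by simp
  qed
  have "hausdorff_measure s X = 0"
    unfolding hausdorff_measure_def using pm by (intro antisym SUP_least) auto
  then have "hausdorff_dim X \<le> ereal s"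
    unfolding hausdorff_dim_def using D \<epsilon> by (intro INF_lower) (auto simp: s_def)
  then show "hausdorff_dim X \<le> ereal D + ereal \<epsilon>" by (simp add: s_def)
qed

end

section \<open>Lower bounds for the Hausdorff dimension by mass distribution\<close>

text \<open>Cylinder weights from level \<open>K\<close> on: a finitely additive description of a measure.\<close>

locale weights = alphabet +
  fixes K :: nat and w :: "nat \<Rightarrow> (nat \<Rightarrow> nat) \<Rightarrow> real"
  assumes w_nonneg: "\<And>n x. K \<le> n \<Longrightarrow> x \<in> words m n \<Longrightarrow> 0 \<le> w n x"
    and w_Suc: "\<And>n x. K \<le> n \<Longrightarrow> x \<in> words m n \<Longrightarrow> (\<Sum>b<m. w (Suc n) (x(Suc n := b))) = w n x"
begin

lemma w_sum_pre:
  assumes "K \<le> n" "n \<le> N"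
  shows "(\<Sum>x\<in>words m N. w N x * F (pre n x)) = (\<Sum>x\<in>words m n. w n x * F x)"
  using assms(2)
proof (induction N rule: dec_induct)
  case base
  show ?case by (simp add: pre_words)
next
  case (step N)
  have "(\<Sum>x\<in>words m (Suc N). w (Suc N) x * F (pre n x)) =
        (\<Sum>x\<in>words m N. (\<Sum>b<m. w (Suc N) (x(Suc N := b))) * F (pre n x))"
    using step by (simp add: sum_words_Suc sum_distrib_right)
  also have "\<dots> = (\<Sum>x\<in>words m N. w N x * F (pre n x))"
    using step assms by (intro sum.cong) (auto simp: w_Suc)
  finally show ?case using step by simp
qed

lemma w_total: "K \<le> n \<Longrightarrow> (\<Sum>x\<in>words m n. w n x) = (\<Sum>x\<in>words m K. w K x)"
  using w_sum_pre[of K n "\<lambda>_. 1"] by simp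

lemma w_mono:
  assumes "K \<le> n" "n \<le> N" "x \<in> words m N"
  shows "w N x \<le> w n (pre n x)"
  using assms(2,3)
proof (induction N arbitrary: x rule: dec_induct)
  case base
  then show ?case by (simp add: pre_words)
next
  case (step N)
  obtain y b where y: "y \<in> words m N" "b < m" "x = y(Suc N := b)" "y = pre N x"
    using step.prems by (rule words_SucE)
  have "w (Suc N) x \<le> (\<Sum>b<m. w (Suc N) (y(Suc N := b)))"
    unfolding y(3) using y(1,2) step.hyps assms(1)
    by (intro member_le_sum[of b]) (auto intro!: w_nonneg words_upd)
  also have "\<dots> = w N y" using step.hyps assms(1) y(1) by (intro w_Suc) auto
  also have "\<dots> \<le> w n (pre n y)" by (rule step.IH) (rule y(1))
  also have "pre n y = pre n x" unfolding y(3) using step.hyps by simp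
  finally show ?case .
qed

end

context weights
begin

text \<open>In this form of the mass distribution principle only the levels \<open>k\<^sup>4\<close> are tested: they are
  dense enough for the exponent and sparse enough for the exceptional masses to be summable.\<close>

lemma hausdorff_dim_ge:
  assumes X: "X \<subseteq> full_shift m"
    and total: "(\<Sum>x\<in>words m K. w K x) = 1"
    and supp: "\<And>x. x \<in> full_shift m \<Longrightarrow> (\<And>n. K \<le> n \<Longrightarrow> 0 < w n (pre n x)) \<Longrightarrow> x \<in> X"
    and tail: "\<And>k. k0 \<le> k \<Longrightarrow> K \<le> k ^ 4 \<Longrightarrow>
      (\<Sum>x\<in>words m (k ^ 4). w (k ^ 4) x * (if real m powr (- (s * real (k ^ 4))) < w (k ^ 4) x then 1 else 0))
        \<le> C / real k ^ 2"
  shows "ereal s \<le> hausdorff_dim X"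
  unfolding hausdorff_dim_def
proof (rule INF_greatest)
  fix s' assume s'0: "s' \<in> {s. 0 < s \<and> hausdorff_measure s X = 0}"
  then have s': "0 < s'" "hausdorff_measure s' X = 0" by auto
  show "ereal s \<le> ereal s'"
  proof (rule ccontr)
    assume "\<not> ereal s \<le> ereal s'"
    then have ss: "s' < s" by simp
    have m0: "0 < real m" "1 < real m" using m2 by auto
    \<comment> \<open>Consecutive tested levels have ratio tending to 1, so the gap between
      \<open>s'\<close> and \<open>s\<close> pays for the lengths between \<open>k ^ 4\<close> and
      \<open>Suc k ^ 4\<close>.\<close>
    have "(\<lambda>k. ((real k + 1) / real k) ^ 4) \<longlonglongrightarrow> 1" by real_asymp
    then have "\<forall>\<^sub>F k in sequentially. ((real k + 1) / real k) ^ 4 < s / s'"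
      by (rule order_tendstoD) (use ss s' in simp)
    then have ev: "\<forall>\<^sub>F k in sequentially. s' * real ((Suc k) ^ 4) \<le> s * real (k ^ 4)"
      using eventually_gt_at_top[of 0]
    proof eventually_elim
      case (elim k)
      have "s' * (real k + 1) ^ 4 \<le> s * real k ^ 4" using elim s' by (simp add: field_simps)
      then show ?case by (simp add: add.commute)
    qed
    have "summable (\<lambda>k. C / real k ^ 2)"
      using summable_mult[OF inverse_power_summable[of 2, where 'a = real], of C] by (simp add: field_simps)
    from suminf_exist_split[OF _ this, of "1/2"] obtain k2 where
      k2: "norm (\<Sum>i. C / real (i + k2) ^ 2) < 1/2" by auto
    have sm2: "summable (\<lambda>i. C / real (i + k2) ^ 2)"
      using \<open>summable (\<lambda>k. C / real k ^ 2)\<close> by (subst summable_iff_shift[of "\<lambda>k. C / real k ^ 2" k2])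
    obtain k3 where k3: "\<And>k. k3 \<le> k \<Longrightarrow> s' * real ((Suc k) ^ 4) \<le> s * real (k ^ 4)"
      using ev unfolding eventually_sequentially by blast
    define k1 where "k1 = Max {1, K, k0, k2, k3}"
    have k1: "1 \<le> k1" "K \<le> k1" "k0 \<le> k1" "k2 \<le> k1" "k3 \<le> k1" unfolding k1_def by auto
    have pow4: "k \<le> k ^ 4" for k :: nat by (cases "k = 0") (auto intro: self_le_power)
    have "0 \<le> C / real k1 ^ 2" using tail[of k1] k1 pow4[of k1]
      by (intro order_trans[OF sum_nonneg tail]) (auto intro!: w_nonneg)
    then have C0: "0 \<le> C" using k1 by (simp add: zero_le_divide_iff)
    have tailsum: "(\<Sum>k\<in>A. C / real k ^ 2) < 1/2" if A: "finite A" "\<And>k. k \<in> A \<Longrightarrow> k1 \<le> k" for A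
    proof -
      have k2A: "k2 \<le> k" if "k \<in> A" for k using A(2)[OF that] k1 by linarith
      have "inj_on (\<lambda>k. k - k2) A"
      proof (rule inj_onI)
        fix x y assume "x \<in> A" "y \<in> A" "x - k2 = y - k2"
        then show "x = y" using k2A[of x] k2A[of y] by linarith
      qed
      then have "(\<Sum>k\<in>A. C / real k ^ 2) = (\<Sum>i\<in>(\<lambda>k. k - k2) ` A. C / real (i + k2) ^ 2)"
        using k2A by (simp add: sum.reindex del: of_nat_add)
      also have "\<dots> \<le> (\<Sum>i. C / real (i + k2) ^ 2)"
        using sm2 A C0 by (intro sum_le_suminf) auto
      also have "\<dots> < 1/2" using k2 by simp
      finally show ?thesis .
    qed
    define e where "e = (1 / real m) ^ (k1 ^ 4)"
    have e0: "0 < e" using m0 by (simp add: e_def)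
    have "hausdorff_premeasure s' e X \<le> hausdorff_measure s' X"
      unfolding hausdorff_measure_def using e0 by (intro SUP_upper) auto
    then have "hausdorff_premeasure s' e X < ennreal (1/4)" using s' by simp
    then obtain U where U: "\<And>i. fine_set e (U i)" "X \<subseteq> (\<Union>i. U i)"
      "(\<Sum>i. ennreal (mdiameter (U i) powr s')) < ennreal (1/4)"
      unfolding hausdorff_premeasure_def INF_less_iff by blast
    have Usub: "U i \<subseteq> full_shift m" for i using U(1) by (auto simp: fine_set_def)
    define I where "I = {i. U i \<noteq> {}}"
    \<comment> \<open>Each covering set is replaced by the cylinder of the longest prefix common to
      its points. A singleton has diameter \<open>0\<close>; its cylinder is taken so long that it
      fits into the slack \<open>(1/4) * (1/2) ^ Suc i\<close>, and all slacks together stay below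
      \<open>1/4\<close>.\<close>
    have "\<exists>n y. k1 ^ 4 \<le> n \<and> y \<in> full_shift m \<and> (\<forall>x\<in>U i. pre n x = pre n y) \<and>
        real m powr (- (s' * real n)) \<le> mdiameter (U i) powr s' + (1/4) * (1/2) ^ Suc i" if i: "i \<in> I" for i
    proof -
      obtain y where y: "y \<in> U i" using i by (auto simp: I_def)
      show ?thesis
      proof (cases "\<forall>x\<in>U i. x = y")
        case True
        have "(\<lambda>n. (real m powr (- s')) ^ n) \<longlonglongrightarrow> 0"
          using m0 s' by (intro LIMSEQ_power_zero) (simp add: powr_less_one)
        then have "\<forall>\<^sub>F n in sequentially. (real m powr (- s')) ^ n < (1/4) * (1/2) ^ Suc i"
          by (rule order_tendstoD) simp
        then obtain n where n: "k1 ^ 4 \<le> n" "(real m powr (- s')) ^ n < (1/4) * (1/2) ^ Suc i"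
          unfolding eventually_sequentially by (meson nat_le_linear order_refl)
        have "(real m powr (- s')) ^ n = real m powr (- (s' * real n))"
          using m0 by (simp add: powr_realpow[symmetric] powr_powr)
        then have "real m powr (- (s' * real n)) \<le> mdiameter (U i) powr s' + (1/4) * (1/2) ^ Suc i"
          using n(2) powr_ge_zero[of "mdiameter (U i)" s'] by linarith
        moreover have "y \<in> full_shift m" using y Usub[of i] by blast
        moreover have "\<forall>x\<in>U i. pre n x = pre n y" using True by metis
        ultimately show ?thesis using n(1) by blast
      next
        case False
        define P where "P k \<longleftrightarrow> (\<exists>x\<in>U i. \<exists>z\<in>U i. x \<noteq> z \<and> shift_dist m x z = (1 / real m) ^ k)" for k
        obtain x where x: "x \<in> U i" "x \<noteq> y" using False by blast
        then have "\<exists>k. P k" using shift_dist_neq[of x y] Usub[of i] y unfolding P_def by blast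
        then have Pn: "P (LEAST k. P k)" by (rule LeastI_ex)
        define n where "n = (LEAST k. P k)"
        obtain u v where uv: "u \<in> U i" "v \<in> U i" "u \<noteq> v" "shift_dist m u v = (1 / real m) ^ n"
          using Pn unfolding n_def[symmetric] unfolding P_def by blast
        have "(1 / real m) ^ n \<le> (1 / real m) ^ (k1 ^ 4)"
          using U(1)[of i] uv by (metis e_def fine_set_def)
        then have n: "k1 ^ 4 \<le> n" using m0 by (simp add: power_one_over power_le_imp_le_exp field_simps)
        have pren: "pre n x = pre n y" if x: "x \<in> U i" for x
        proof (cases "x = y")
          case False
          obtain k where k: "shift_dist m x y = (1 / real m) ^ k" "pre k x = pre k y"
            using shift_dist_neq[of x y] False Usub[of i] x y by blast
          then have "P k" using x y False unfolding P_def by blast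
          then have "n \<le> k" unfolding n_def by (rule Least_le)
          then show ?thesis using k by (metis pre_pre)
        qed simp
        have "real m powr (- (s' * real n)) \<le> mdiameter (U i) powr s'"
          unfolding powr_m_power[symmetric] using shift_dist_le_mdiameter[OF Usub uv(1,2)] uv(4) s'
          by (intro powr_mono2) auto
        then have "real m powr (- (s' * real n)) \<le> mdiameter (U i) powr s' + (1/4) * (1/2) ^ Suc i"
          by (rule add_increasing2[rotated]) simp
        moreover have "y \<in> full_shift m" using y Usub[of i] by blast
        ultimately show ?thesis using n pren by blast
      qed
    qed
    then obtain n y where ny: "\<And>i. i \<in> I \<Longrightarrow> k1 ^ 4 \<le> n i" "\<And>i. i \<in> I \<Longrightarrow> y i \<in> full_shift m"
      "\<And>i x. i \<in> I \<Longrightarrow> x \<in> U i \<Longrightarrow> pre (n i) x = pre (n i) (y i)"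
      "\<And>i. i \<in> I \<Longrightarrow> real m powr (- (s' * real (n i))) \<le> mdiameter (U i) powr s' + (1/4) * (1/2) ^ Suc i"
      by metis
    have sumI: "(\<Sum>i\<in>J. real m powr (- (s' * real (n i)))) \<le> 1/2" if J: "J \<subseteq> I" "J \<subseteq> {..<N}" for J N
    proof -
      have finJ: "finite J" using J finite_subset by blast
      have "ennreal (\<Sum>i\<in>J. mdiameter (U i) powr s') = (\<Sum>i\<in>J. ennreal (mdiameter (U i) powr s'))"
        by (subst sum_ennreal) auto
      also have "\<dots> \<le> (\<Sum>i. ennreal (mdiameter (U i) powr s'))"
        by (intro sum_le_suminf summableI finJ) auto
      also have "\<dots> \<le> ennreal (1/4)" using U(3) by simp
      finally have 1: "(\<Sum>i\<in>J. mdiameter (U i) powr s') \<le> 1/4" by (subst (asm) ennreal_le_iff) auto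
      have "(\<Sum>i\<in>J. (1/2::real) ^ Suc i) \<le> (\<Sum>i<N. (1/2) ^ Suc i)"
        using J by (intro sum_mono2) auto
      also have "\<dots> = 1 - (1/2) ^ N" by (induction N) (auto simp: field_simps)
      also have "\<dots> \<le> 1" by simp
      finally have "(\<Sum>i\<in>J. (1/2::real) ^ Suc i) \<le> 1" .
      moreover have "(\<Sum>i\<in>J. (1/4) * (1/2::real) ^ Suc i) = (1/4) * (\<Sum>i\<in>J. (1/2) ^ Suc i)"
        by (simp only: sum_distrib_left)
      ultimately have 2: "(\<Sum>i\<in>J. (1/4) * (1/2::real) ^ Suc i) \<le> 1/4" by linarith
      have "(\<Sum>i\<in>J. real m powr (- (s' * real (n i)))) \<le> (\<Sum>i\<in>J. mdiameter (U i) powr s' + (1/4) * (1/2) ^ Suc i)"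
        using J ny(4) by (intro sum_mono) blast
      also have "\<dots> \<le> 1/2" using 1 2 by (simp add: sum.distrib)
      finally show ?thesis .
    qed
    define b where "b k = real m powr (- (s * real (k ^ 4)))" for k :: nat
    \<comment> \<open>A sequence with \<open>Q N\<close> for all \<open>N\<close> would be a point
      of \<open>X\<close> outside the cover. The condition \<open>i < N\<close> leaves only finitely
      many cylinders to be avoided at each stage.\<close>
    define Q where "Q N x \<longleftrightarrow> (\<forall>n. K \<le> n \<and> n \<le> N \<longrightarrow> 0 < w n (pre n x)) \<and>
      (\<forall>k\<ge>k1. k ^ 4 \<le> N \<longrightarrow> w (k ^ 4) (pre (k ^ 4) x) \<le> b k) \<and>
      (\<forall>i\<in>I. i < N \<longrightarrow> n i \<le> N \<longrightarrow> pre (n i) x \<noteq> pre (n i) (y i))" for N x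
    have Qcong: "Q N z" if "Q N x" "pre N x = pre N z" for N x z
    proof -
      have "pre k x = pre k z" if "k \<le> N" for k using \<open>pre N x = pre N z\<close> that by (metis pre_pre)
      then show ?thesis using \<open>Q N x\<close> unfolding Q_def by metis
    qed
    have Qdown: "Q N x" if "Q (Suc N) x" for N x
      using that unfolding Q_def by (meson le_SucI less_SucI)
    have Qex': "\<exists>x\<in>words m N. Q N x" if N: "K \<le> N" for N
    proof (rule ccontr)
      assume nQ: "\<not> ?thesis"
      define Ks where "Ks = {k\<in>{k1..N}. k ^ 4 \<le> N}"
      \<comment> \<open>A word of positive weight that fails \<open>Q N\<close> is heavy at a tested
        level or lies in one of the cylinders. In the second case, if it is nowhere heavy, that
        cylinder has small weight itself, so the light cylinders suffice.\<close>
      define J where "J = {i\<in>I. i < N \<and> n i \<le> N \<and> w (n i) (pre (n i) (y i)) \<le> real m powr (- (s' * real (n i)))}"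
      define F where "F k p = (if b k < w (k ^ 4) p then 1 else 0 :: real)" for k p
      define G where "G i p = (if p = pre (n i) (y i) then 1 else 0 :: real)" for i p
      have Kk: "K \<le> k ^ 4" if "k \<ge> k1" for k using that k1 pow4[of k] by linarith
      have Kn: "K \<le> n i" if "i \<in> I" for i using ny(1)[OF that] Kk[of k1] by linarith
      have finJ: "finite J" "J \<subseteq> I" "J \<subseteq> {..<N}" by (auto simp: J_def)
      have finK: "finite Ks" "\<And>k. k \<in> Ks \<Longrightarrow> k1 \<le> k \<and> k ^ 4 \<le> N" by (auto simp: Ks_def)
      have pt: "w N x \<le> (\<Sum>k\<in>Ks. w N x * F k (pre (k ^ 4) x)) + (\<Sum>i\<in>J. w N x * G i (pre (n i) x))"
        if x: "x \<in> words m N" for x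
      proof -
        have w0: "0 \<le> w N x" using w_nonneg[OF N x] .
        have S0: "0 \<le> (\<Sum>k\<in>Ks. w N x * F k (pre (k ^ 4) x))" "0 \<le> (\<Sum>i\<in>J. w N x * G i (pre (n i) x))"
          using w0 by (auto intro!: sum_nonneg simp: F_def G_def)
        show ?thesis
        proof (cases "w N x = 0")
          case False
          then have wpos: "0 < w N x" using w0 by simp
          have wp: "0 < w l (pre l x)" if "K \<le> l" "l \<le> N" for l using w_mono[OF that x] wpos by linarith
          show ?thesis
          proof (cases "\<exists>k\<ge>k1. k ^ 4 \<le> N \<and> b k < w (k ^ 4) (pre (k ^ 4) x)")
            case True
            then obtain k where k: "k \<ge> k1" "k ^ 4 \<le> N" "b k < w (k ^ 4) (pre (k ^ 4) x)" by blast
            have "k \<in> Ks" using k pow4[of k] by (auto simp: Ks_def)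
            then have "w N x * F k (pre (k ^ 4) x) \<le> (\<Sum>k\<in>Ks. w N x * F k (pre (k ^ 4) x))"
              using w0 by (intro member_le_sum finK(1)) (auto simp: F_def)
            moreover have "F k (pre (k ^ 4) x) = 1" using k by (simp add: F_def)
            ultimately show ?thesis using S0 by simp
          next
            case nk: False
            have "\<not> Q N x" using nQ x by blast
            then obtain i where i: "i \<in> I" "i < N" "n i \<le> N" "pre (n i) x = pre (n i) (y i)"
              unfolding Q_def using wp nk by (meson linorder_not_le)
            \<comment> \<open>\<open>k ^ 4\<close> is the last tested level up to
              \<open>n i\<close>.\<close>
            define k where "k = (LEAST j. n i < (Suc j) ^ 4)"
            have "n i < (Suc (n i)) ^ 4" using pow4[of "Suc (n i)"] by linarith
            then have k: "n i < (Suc k) ^ 4" unfolding k_def by (rule LeastI)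
            have k': "k ^ 4 \<le> n i"
            proof (cases k)
              case (Suc j)
              then have "j < k" by simp
              from not_less_Least[OF this[unfolded k_def]] show ?thesis using Suc by simp
            qed simp
            have "k1 ^ 4 < (Suc k) ^ 4" using ny(1)[OF i(1)] k by linarith
            then have "k1 < Suc k" by (rule power_less_imp_less_base) simp
            then have kk1: "k1 \<le> k" by simp
            have "w (n i) (pre (n i) (y i)) = w (n i) (pre (n i) x)" using i by simp
            also have "\<dots> \<le> w (k ^ 4) (pre (k ^ 4) (pre (n i) x))"
              using k' Kk[OF kk1] i x by (intro w_mono pre_in_words') auto
            also have "\<dots> = w (k ^ 4) (pre (k ^ 4) x)" using k' by simp
            also have "\<dots> \<le> b k" using nk kk1 k' i by (meson linorder_not_le order_trans)
            also have "\<dots> \<le> real m powr (- (s' * real (n i)))"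
            proof -
              have "s' * real (n i) \<le> s' * real ((Suc k) ^ 4)" using k s' by (intro mult_left_mono) (auto simp del: of_nat_Suc power_Suc)
              also have "\<dots> \<le> s * real (k ^ 4)" using k3 kk1 k1 by simp
              finally show ?thesis unfolding b_def using m0 by (intro powr_mono) auto
            qed
            finally have "i \<in> J" using i by (simp add: J_def)
            then have "w N x * G i (pre (n i) x) \<le> (\<Sum>i\<in>J. w N x * G i (pre (n i) x))"
              using w0 by (intro member_le_sum finJ(1)) (auto simp: G_def)
            moreover have "G i (pre (n i) x) = 1" using i by (simp add: G_def)
            ultimately show ?thesis using S0 by simp
          qed
        qed (use S0 in simp)
      qed
      \<comment> \<open>Heavy words carry mass less than \<open>1/2\<close>, light cylinders at most
        \<open>1/2\<close>; they cannot exhaust the total mass.\<close>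
      have "1 = (\<Sum>x\<in>words m N. w N x)" using w_total[OF N] total by simp
      also have "\<dots> \<le> (\<Sum>x\<in>words m N. (\<Sum>k\<in>Ks. w N x * F k (pre (k ^ 4) x)) + (\<Sum>i\<in>J. w N x * G i (pre (n i) x)))"
        by (intro sum_mono pt)
      also have "\<dots> = (\<Sum>k\<in>Ks. \<Sum>x\<in>words m N. w N x * F k (pre (k ^ 4) x))
                     + (\<Sum>i\<in>J. \<Sum>x\<in>words m N. w N x * G i (pre (n i) x))"
        by (simp add: sum.distrib sum.swap[of _ _ "words m N"])
      also have "(\<Sum>k\<in>Ks. \<Sum>x\<in>words m N. w N x * F k (pre (k ^ 4) x)) =
                 (\<Sum>k\<in>Ks. \<Sum>x\<in>words m (k ^ 4). w (k ^ 4) x * F k x)"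
        using finK(2) Kk by (intro sum.cong w_sum_pre) auto
      also have "(\<Sum>i\<in>J. \<Sum>x\<in>words m N. w N x * G i (pre (n i) x)) = (\<Sum>i\<in>J. \<Sum>x\<in>words m (n i). w (n i) x * G i x)"
        using Kn by (intro sum.cong w_sum_pre) (auto simp: J_def)
      also have "\<dots> = (\<Sum>i\<in>J. w (n i) (pre (n i) (y i)))"
        using finJ(2) ny(2) by (intro sum.cong refl)
          (auto simp: G_def if_distrib[of "\<lambda>c. _ * c"] sum.delta' pre_in_words subset_iff cong: if_cong)
      also have "\<dots> \<le> (\<Sum>i\<in>J. real m powr (- (s' * real (n i))))"
        by (intro sum_mono) (auto simp: J_def)
      also have "\<dots> \<le> 1/2" by (rule sumI[OF finJ(2,3)])
      also have "(\<Sum>k\<in>Ks. \<Sum>x\<in>words m (k ^ 4). w (k ^ 4) x * F k x) \<le> (\<Sum>k\<in>Ks. C / real k ^ 2)"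
        using finK(2) Kk k1 unfolding F_def b_def by (intro sum_mono tail) (auto intro: order_trans)
      also have "\<dots> < 1/2" by (rule tailsum) (use finK in auto)
      finally show False by simp
    qed
    have Qex: "\<exists>x\<in>words m N. Q N x" for N
    proof -
      obtain x where x: "x \<in> words m (max K N)" "Q (max K N) x" using Qex'[of "max K N"] by auto
      have "Q (N + j) x \<Longrightarrow> Q N x" for j by (induction j) (auto intro: Qdown)
      from this[of "K - N"] have "Q N x" using x(2) by (simp add: max_def split: if_splits)
      then have "Q N (pre N x)" by (rule Qcong) simp
      then show ?thesis using x(1) by (meson max.cobounded2 pre_in_words')
    qed
    have "\<exists>x\<in>words m 0. Q 0 x" by (rule Qex)
    then obtain z where z: "Q 0 z" "z \<in> words m 0" by blast
    have "\<exists>x\<in>full_shift m. (\<forall>N. Q N x) \<and> pre 0 x = z"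
    proof (rule koenig_words[OF Qcong Qdown Qex z])
      fix N
      show "\<exists>x\<in>words m N. Q N x \<and> pre 0 x = pre 0 z" using Qex[of N] by (auto simp: pre_eq_iff)
    qed
    then obtain x where x: "x \<in> full_shift m" "\<And>N. Q N x" by blast
    have "x \<in> X" using x(2) by (intro supp[OF x(1)]) (auto simp: Q_def)
    then obtain i where i: "x \<in> U i" using U by blast
    then have "i \<in> I" by (auto simp: I_def)
    moreover have "Q (max (Suc i) (n i)) x" by (rule x)
    ultimately show False using ny(3)[OF _ i] unfolding Q_def by (simp add: less_max_iff_disj)
  qed
qed

end

section \<open>Shifts of finite type along the orbits of an expanding map\<close>

text \<open>Nodes are positions, and \<open>u\<close> in \<open>H\<close> carries a constraint
  towards \<open>sc u\<close>. Control is demanded above \<open>K\<close> only: \<open>sc_q\<close>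
  gives the exact stretch up to an additive error, \<open>lam\<close> an expansion without such an
  error, which makes depths logarithmic in the position.\<close>

locale forest = alphabet +
  fixes a :: "nat \<Rightarrow> nat \<Rightarrow> real" and H :: "nat set" and sc :: "nat \<Rightarrow> nat"
    and q Cq lam :: real and K :: nat
  assumes a01: "\<And>i j. i < m \<Longrightarrow> j < m \<Longrightarrow> a i j = 0 \<or> a i j = 1"
    and row: "\<And>i. i < m \<Longrightarrow> \<exists>j<m. a i j = 1"
    and H0: "0 \<notin> H"
    and inj: "\<And>u v. u \<in> H \<Longrightarrow> v \<in> H \<Longrightarrow> sc u = sc v \<Longrightarrow> K < sc u \<Longrightarrow> u = v"
    and sc_gt: "\<And>u. u \<in> H \<Longrightarrow> K < sc u \<Longrightarrow> u < sc u"
    and sc_lam: "\<And>u. u \<in> H \<Longrightarrow> K < u \<Longrightarrow> lam * real u \<le> real (sc u)"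
    and lam1: "1 < lam" and q1: "1 < q"
    and sc_q: "\<And>u. u \<in> H \<Longrightarrow> K < u \<Longrightarrow> \<bar>real (sc u) - q * real u\<bar> \<le> Cq"
begin

text \<open>The predecessor; \<open>0\<close> stands for none.\<close>

definition pr :: "nat \<Rightarrow> nat" where
  "pr v = (if \<exists>u\<in>H. sc u = v then (THE u. u \<in> H \<and> sc u = v) else 0)"

lemma sc_K: "u \<in> H \<Longrightarrow> K < u \<Longrightarrow> K < sc u"
proof -
  assume u: "u \<in> H" "K < u"
  have "real u \<le> lam * real u" using lam1 mult_right_mono[of 1 lam "real u"] by simp
  also have "\<dots> \<le> real (sc u)" by (rule sc_lam[OF u])
  finally show ?thesis using u by simp
qed

lemma pr_iff: "K < v \<Longrightarrow> u \<noteq> 0 \<Longrightarrow> pr v = u \<longleftrightarrow> u \<in> H \<and> sc u = v"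
proof -
  assume v: "K < v" and u0: "u \<noteq> 0"
  show ?thesis
  proof (cases "\<exists>u\<in>H. sc u = v")
    case True
    then obtain u' where u': "u' \<in> H" "sc u' = v" by blast
    then have "(THE u. u \<in> H \<and> sc u = v) = u'" using inj v by (intro the_equality) auto
    then show ?thesis using u' inj v by (auto simp: pr_def)
  qed (use u0 in \<open>auto simp: pr_def\<close>)
qed

lemma pr_sc: "u \<in> H \<Longrightarrow> K < sc u \<Longrightarrow> pr (sc u) = u"
  using pr_iff[of "sc u" u] H0 by metis

lemma pr_H: "K < v \<Longrightarrow> pr v \<noteq> 0 \<Longrightarrow> pr v \<in> H" and sc_pr: "K < v \<Longrightarrow> pr v \<noteq> 0 \<Longrightarrow> sc (pr v) = v"
  using pr_iff[of v "pr v"] by auto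

lemma pr_less: "K < v \<Longrightarrow> pr v < v"
  using pr_H[of v] sc_pr[of v] sc_gt[of "pr v"] by (cases "pr v = 0") auto

text \<open>The value \<open>sc u = 0\<close> encodes a successor that is not a positive position;
  such an edge imposes no constraint.\<close>

definition X :: "(nat \<Rightarrow> nat) set" where
  "X = {x \<in> full_shift m. \<forall>u\<in>H. 1 \<le> sc u \<longrightarrow> a (x u) (x (sc u)) = 1}"

definition adm :: "nat \<Rightarrow> (nat \<Rightarrow> nat) \<Rightarrow> bool" where
  "adm n x \<longleftrightarrow> (\<forall>u\<in>H. 1 \<le> sc u \<longrightarrow> sc u \<le> n \<longrightarrow> a (x u) (x (sc u)) = 1)"

definition Wd :: "nat \<Rightarrow> (nat \<Rightarrow> nat) set" where
  "Wd n = {x \<in> words m n. adm n x}"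

lemma finite_Wd [simp, intro]: "finite (Wd n)"
  unfolding Wd_def by auto

lemma X_full: "X \<subseteq> full_shift m" by (auto simp: X_def)

text \<open>Edges from above \<open>K\<close> stay above \<open>K\<close> and go up, so an edge that
  ends by \<open>n\<close> also starts by \<open>n\<close>. Hence \<open>adm n\<close> depends only
  on the first \<open>n\<close> letters once \<open>K \<le> n\<close>.\<close>

lemma edge_le: "u \<in> H \<Longrightarrow> sc u \<le> n \<Longrightarrow> K \<le> n \<Longrightarrow> u \<le> n"
  using sc_gt[of u] sc_K[of u] by (cases "K < sc u"; cases "K < u") auto

lemma adm_cong: "K \<le> n \<Longrightarrow> pre n x = pre n y \<Longrightarrow> adm n x \<longleftrightarrow> adm n y"
  unfolding adm_def pre_eq_iff
  using edge_le H0 by (intro ball_cong refl imp_cong) (metis atLeastAtMost_iff not_less_eq_eq le_zero_eq One_nat_def)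

lemma adm_pre: "adm n x \<Longrightarrow> k \<le> n \<Longrightarrow> adm k x"
  unfolding adm_def by auto

lemma adm_Suc:
  assumes "K \<le> n"
  shows "adm (Suc n) x \<longleftrightarrow> adm n x \<and> (pr (Suc n) \<noteq> 0 \<longrightarrow> a (x (pr (Suc n))) (x (Suc n)) = 1)"
proof -
  have "adm (Suc n) x \<longleftrightarrow> adm n x \<and> (\<forall>u\<in>H. sc u = Suc n \<longrightarrow> a (x u) (x (Suc n)) = 1)"
    unfolding adm_def by (auto simp: le_Suc_eq)
  also have "(\<forall>u\<in>H. sc u = Suc n \<longrightarrow> a (x u) (x (Suc n)) = 1) \<longleftrightarrow>
             (pr (Suc n) \<noteq> 0 \<longrightarrow> a (x (pr (Suc n))) (x (Suc n)) = 1)"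
    using pr_iff[of "Suc n"] assms H0 by (metis le_imp_less_Suc)
  finally show ?thesis .
qed

lemma adm_iff:
  assumes "K \<le> n"
  shows "adm n x \<longleftrightarrow> adm K x \<and> (\<forall>v\<in>{K<..n}. pr v \<noteq> 0 \<longrightarrow> a (x (pr v)) (x v) = 1)"
  using assms
proof (induction n rule: dec_induct)
  case (step n)
  have "{K<..Suc n} = insert (Suc n) {K<..n}" using step by auto
  then show ?case using step by (auto simp: adm_Suc)
qed simp

lemma X_iff: "x \<in> X \<longleftrightarrow> x \<in> full_shift m \<and> (\<forall>n\<ge>K. adm n x)"
  unfolding X_def adm_def by (auto intro: le_max_iff_disj[THEN iffD2])

lemma a_choose:
  assumes "i < m" obtains j where "j < m" "a i j = 1"
  using row[OF assms] by blast

text \<open>A new position above \<open>K\<close> is the end of at most one edge, and each row of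
  the matrix contains a one.\<close>

lemma Wd_extend_Suc:
  assumes "K \<le> n" "x \<in> Wd n"
  shows "\<exists>b<m. x(Suc n := b) \<in> Wd (Suc n)"
proof -
  have x: "x \<in> words m n" "adm n x" using assms by (auto simp: Wd_def)
  have p: "pr (Suc n) \<le> n" using pr_less[of "Suc n"] assms by auto
  have "\<exists>b<m. pr (Suc n) \<noteq> 0 \<longrightarrow> a (x (pr (Suc n))) b = 1"
  proof (cases "pr (Suc n) = 0")
    case True
    then show ?thesis using m2 by (intro exI[of _ 0]) auto
  next
    case False
    then have "x (pr (Suc n)) < m" using words_less[OF x(1)] p by simp
    then show ?thesis using row by blast
  qed
  then obtain b where b: "b < m" "pr (Suc n) \<noteq> 0 \<longrightarrow> a (x (pr (Suc n))) b = 1" by blast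
  have "adm n (x(Suc n := b))" using adm_cong[OF assms(1), of x "x(Suc n := b)"] x by simp
  then have "adm (Suc n) (x(Suc n := b))" using b p assms by (simp add: adm_Suc)
  then show ?thesis using b words_upd[OF x(1)] by (auto simp: Wd_def)
qed

lemma Wd_pre: "K \<le> k \<Longrightarrow> k \<le> n \<Longrightarrow> x \<in> Wd n \<Longrightarrow> pre k x \<in> Wd k"
  unfolding Wd_def using pre_in_words' adm_pre adm_cong[of k x "pre k x"] by auto

lemma Wd_extend:
  assumes "K \<le> n" "x \<in> Wd n"
  shows "\<exists>y\<in>X. pre n y = x"
proof -
  define Q where "Q N y \<longleftrightarrow> (K \<le> N \<longrightarrow> adm N y)" for N y
  have ext: "\<exists>y\<in>Wd N. pre n y = x" if "n \<le> N" for N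
    using that
  proof (induction N rule: dec_induct)
    case base
    then show ?case using assms pre_words by (auto simp: Wd_def)
  next
    case (step N)
    then obtain y where y: "y \<in> Wd N" "pre n y = x" by blast
    then obtain b where "y(Suc N := b) \<in> Wd (Suc N)" using Wd_extend_Suc[of N y] assms step by auto
    moreover have "pre n (y(Suc N := b)) = x" using y step by simp
    ultimately show ?case by blast
  qed
  have x: "x \<in> words m n" "adm n x" using assms by (auto simp: Wd_def)
  have Qd: "Q N y" if "Q (Suc N) y" for N y
    using that unfolding Q_def by (meson adm_pre le_Suc_eq order_refl)
  have Qe: "\<exists>y\<in>words m N. Q N y \<and> pre n y = pre n x" if "n \<le> N" for N
    using ext[OF that] pre_words[OF x(1)] by (auto simp: Wd_def Q_def)
  have "\<exists>y\<in>full_shift m. (\<forall>N. Q N y) \<and> pre n y = x"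
  proof (rule koenig_words[OF _ Qd _ _ x(1) Qe])
    show "Q N z" if "Q N y" "pre N y = pre N z" for N y z using that adm_cong[of N y z] by (auto simp: Q_def)
    show "Q n x" using x by (simp add: Q_def)
    show "\<exists>y\<in>words m N. Q N y" for N
    proof -
      obtain y where y: "y \<in> Wd (max n N)" using ext[of "max n N"] by auto
      have "pre N y \<in> words m N" using y pre_in_words'[of y m "max n N" N] by (auto simp: Wd_def)
      moreover have "Q N (pre N y)"
        using y adm_pre[of "max n N" y N] adm_cong[of N y "pre N y"] by (auto simp: Q_def Wd_def)
      ultimately show ?thesis by blast
    qed
  qed
  then show ?thesis using X_iff by (auto simp: Q_def)
qed

text \<open>No admissible word is a dead end, so prefixes of points can be counted as admissible
  words.\<close>

lemma pre_X: "K \<le> n \<Longrightarrow> pre n ` X = Wd n"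
proof (intro equalityI subsetI)
  fix z assume n: "K \<le> n" and "z \<in> pre n ` X"
  then obtain x where x: "x \<in> X" "z = pre n x" by blast
  then have "adm n x" "x \<in> full_shift m" using n X_iff by auto
  then show "z \<in> Wd n" using x n adm_cong[of n x z] pre_in_words by (auto simp: Wd_def)
next
  fix z assume n: "K \<le> n" and "z \<in> Wd n"
  then show "z \<in> pre n ` X" using Wd_extend by blast
qed

lemma a_nonneg: "i < m \<Longrightarrow> j < m \<Longrightarrow> 0 \<le> a i j"
  using a01[of i j] by auto

end

section \<open>Markov measures on the forest\<close>

locale forest_measure = forest +
  fixes V :: "nat \<Rightarrow> nat \<Rightarrow> real" and \<kappa> :: "(nat \<Rightarrow> nat) \<Rightarrow> real"
  assumes V_pos: "\<And>v b. b < m \<Longrightarrow> 0 < V v b"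
    and \<kappa>_nonneg: "\<And>x. 0 \<le> \<kappa> x"
begin

definition AV :: "nat \<Rightarrow> nat \<Rightarrow> real" where
  "AV v c = (\<Sum>b<m. a c b * V v b)"

definition SV :: "nat \<Rightarrow> real" where
  "SV v = (\<Sum>b<m. V v b)"

text \<open>The argument \<open>c\<close> will be \<open>x (pr v)\<close>, which is meaningless, but not used either, if \<open>pr v = 0\<close>.\<close>

definition tp :: "nat \<Rightarrow> nat \<Rightarrow> nat \<Rightarrow> real" where
  "tp v c b = (if pr v = 0 then V v b / SV v else a c b * V v b / AV v c)"

definition w :: "nat \<Rightarrow> (nat \<Rightarrow> nat) \<Rightarrow> real" where
  "w n x = \<kappa> (pre K x) * (\<Prod>v\<in>{K<..n}. tp v (x (pr v)) (x v))"

lemma SV_pos: "0 < SV v"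
  unfolding SV_def using V_pos m2 by (intro sum_pos) (auto simp: lessThan_empty_iff)

lemma AV_pos: "c < m \<Longrightarrow> 0 < AV v c"
proof -
  assume c: "c < m"
  obtain j where j: "j < m" "a c j = 1" using a_choose[OF c] .
  have "0 < a c j * V v j" using V_pos j by simp
  then show ?thesis unfolding AV_def
    using j mult_nonneg_nonneg[OF a_nonneg less_imp_le[OF V_pos]] c by (intro sum_pos2[of _ j]) auto
qed

lemma tp_nonneg: "b < m \<Longrightarrow> c < m \<or> pr v = 0 \<Longrightarrow> 0 \<le> tp v c b"
  unfolding tp_def using V_pos[of b v] SV_pos[of v] AV_pos[of c v] a_nonneg[of c b]
  by (auto intro!: divide_nonneg_pos mult_nonneg_nonneg)

lemma tp_sum: "c < m \<or> pr v = 0 \<Longrightarrow> (\<Sum>b<m. tp v c b) = 1"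
  using SV_pos[of v] AV_pos[of c v] unfolding tp_def
  by (cases "pr v = 0") (auto simp: sum_divide_distrib[symmetric] SV_def[symmetric] AV_def[symmetric])

lemma pr_val: "x \<in> words m n \<Longrightarrow> K < v \<Longrightarrow> v \<le> Suc n \<Longrightarrow> x (pr v) < m \<or> pr v = 0"
  using pr_less[of v] words_less[of x m n "pr v"] by auto

lemma w_step:
  assumes "K \<le> n"
  shows "w (Suc n) (x(Suc n := b)) = w n x * tp (Suc n) (x (pr (Suc n))) b"
proof -
  have 1: "{K<..Suc n} = insert (Suc n) {K<..n}" using assms by auto
  have pn: "pr (Suc n) \<noteq> Suc n" using pr_less[of "Suc n"] assms by auto
  have "(\<Prod>v\<in>{K<..n}. tp v ((x(Suc n := b)) (pr v)) ((x(Suc n := b)) v)) = (\<Prod>v\<in>{K<..n}. tp v (x (pr v)) (x v))"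
  proof (rule prod.cong[OF refl])
    fix v assume v: "v \<in> {K<..n}"
    then have "pr v < v" using pr_less by simp
    then show "tp v ((x(Suc n := b)) (pr v)) ((x(Suc n := b)) v) = tp v (x (pr v)) (x v)" using v by simp
  qed
  then show ?thesis unfolding w_def 1 using assms pn by simp
qed

lemma w_nonneg: "x \<in> words m n \<Longrightarrow> 0 \<le> w n x"
  unfolding w_def
proof (intro mult_nonneg_nonneg \<kappa>_nonneg prod_nonneg)
  fix v assume "x \<in> words m n" "v \<in> {K<..n}"
  then show "0 \<le> tp v (x (pr v)) (x v)"
    using words_less[of x m n v] pr_val[of x n v] by (intro tp_nonneg) auto
qed

sublocale weights m K w
proof
  show "K \<le> n \<Longrightarrow> x \<in> words m n \<Longrightarrow> 0 \<le> w n x" for n x by (rule w_nonneg)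
next
  fix n x assume "K \<le> n" "x \<in> words m n"
  then show "(\<Sum>b<m. w (Suc n) (x(Suc n := b))) = w n x"
    using tp_sum[of "x (pr (Suc n))" "Suc n"] pr_val[of x n "Suc n"]
    by (simp add: w_step sum_distrib_left[symmetric])
qed

lemma w_K: "x \<in> words m K \<Longrightarrow> w K x = \<kappa> x"
  by (simp add: w_def pre_words)

lemma w_pos_iff:
  assumes "K \<le> n" "x \<in> words m n"
  shows "0 < w n x \<longleftrightarrow> 0 < \<kappa> (pre K x) \<and> (\<forall>v\<in>{K<..n}. pr v \<noteq> 0 \<longrightarrow> a (x (pr v)) (x v) = 1)"
proof -
  have tpp: "0 < tp v (x (pr v)) (x v) \<longleftrightarrow> (pr v \<noteq> 0 \<longrightarrow> a (x (pr v)) (x v) = 1)" if v: "v \<in> {K<..n}" for v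
  proof (cases "pr v = 0")
    case True
    then show ?thesis using V_pos[of "x v" v] SV_pos words_less[OF assms(2), of v] v by (auto simp: tp_def)
  next
    case False
    have "x v < m" "x (pr v) < m" using words_less[OF assms(2), of v] v pr_val[OF assms(2), of v] False by auto
    then show ?thesis
      using V_pos[of "x v" v] AV_pos[of "x (pr v)" v] a01[of "x (pr v)" "x v"] False by (auto simp: tp_def)
  qed
  have nn: "0 \<le> tp v (x (pr v)) (x v)" if "v \<in> {K<..n}" for v
    using words_less[OF assms(2), of v] pr_val[OF assms(2), of v] that by (intro tp_nonneg) auto
  have "0 < (\<Prod>v\<in>{K<..n}. tp v (x (pr v)) (x v)) \<longleftrightarrow> (\<forall>v\<in>{K<..n}. 0 < tp v (x (pr v)) (x v))"
    using nn by (metis (no_types, lifting) finite_greaterThanAtMost less_le prod_nonneg prod_pos prod_zero_iff)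
  then show ?thesis using tpp \<kappa>_nonneg[of "pre K x"] unfolding w_def
    by (auto simp: zero_less_mult_iff)
qed

text \<open>Normalisations are separated from symbol weights. A suitable choice of \<open>V\<close>
  then makes the two kinds of terms cancel, or nearly cancel, along the edges.\<close>

lemma ln_w:
  assumes "K \<le> n" "x \<in> words m n" "\<kappa> (pre K x) = 1" "\<forall>v\<in>{K<..n}. pr v \<noteq> 0 \<longrightarrow> a (x (pr v)) (x v) = 1"
  shows "- ln (w n x) = (\<Sum>v | v \<in> {K<..n} \<and> pr v = 0. ln (SV v)) +
     (\<Sum>v | v \<in> {K<..n} \<and> pr v \<noteq> 0. ln (AV v (x (pr v)))) - (\<Sum>v\<in>{K<..n}. ln (V v (x v)))"
proof -
  have val: "x v < m" "pr v \<noteq> 0 \<Longrightarrow> x (pr v) < m" if "v \<in> {K<..n}" for v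
    using words_less[OF assms(2), of v] that pr_val[OF assms(2), of v] by auto
  have tp: "ln (tp v (x (pr v)) (x v)) = ln (V v (x v)) - (if pr v = 0 then ln (SV v) else ln (AV v (x (pr v))))"
    if v: "v \<in> {K<..n}" for v
    using val[OF v] assms(4) v V_pos[of "x v" v] SV_pos[of v] AV_pos[of "x (pr v)" v]
    by (auto simp: tp_def ln_div)
  have pos: "0 < tp v (x (pr v)) (x v)" if v: "v \<in> {K<..n}" for v
    using val[OF v] assms(4) v V_pos[of "x v" v] SV_pos[of v] AV_pos[of "x (pr v)" v]
    by (auto simp: tp_def)
  have "ln (w n x) = (\<Sum>v\<in>{K<..n}. ln (tp v (x (pr v)) (x v)))"
    unfolding w_def assms(3) mult_1_left by (rule ln_prod) (use pos in force)+
  also have "\<dots> = (\<Sum>v\<in>{K<..n}. ln (V v (x v))) -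
      (\<Sum>v\<in>{K<..n}. if pr v = 0 then ln (SV v) else ln (AV v (x (pr v))))"
    using tp by (simp add: sum_subtractf)
  also have "(\<Sum>v\<in>{K<..n}. if pr v = 0 then ln (SV v) else ln (AV v (x (pr v)))) =
     (\<Sum>v | v \<in> {K<..n} \<and> pr v = 0. ln (SV v)) + (\<Sum>v | v \<in> {K<..n} \<and> pr v \<noteq> 0. ln (AV v (x (pr v))))"
    by (subst sum.If_cases) (simp_all add: Int_def)
  finally show ?thesis by simp
qed

end

section \<open>Densities along orbits\<close>

lemma card_le_spread:
  fixes A :: "nat set"
  assumes "finite A" "\<And>u v. u \<in> A \<Longrightarrow> v \<in> A \<Longrightarrow> real u - real v \<le> D" "0 \<le> D"
  shows "real (card A) \<le> D + 1"
proof (cases "A = {}")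
  case False
  have "A \<subseteq> {Min A..Max A}" using assms(1) by auto
  then have "card A \<le> card {Min A..Max A}" by (rule card_mono[rotated]) simp
  moreover have "Min A \<le> Max A" using False assms(1) by simp
  ultimately have "real (card A) \<le> real (Max A) - real (Min A) + 1" by simp
  then show ?thesis using assms(2)[of "Max A" "Min A"] False assms(1) by simp
qed (use assms in simp)

lemma tendsto_bounded_over_n: "(\<And>n. \<bar>f n\<bar> \<le> C) \<Longrightarrow> (\<lambda>n. f n / real n) \<longlonglongrightarrow> 0"
proof (rule Lim_null_comparison[of _ "\<lambda>n. C / real n"])
  assume "\<And>n. \<bar>f n\<bar> \<le> C"
  then show "\<forall>\<^sub>F n in sequentially. norm (f n / real n) \<le> C / real n"
    by (auto intro!: always_eventually divide_right_mono)
qed real_asymp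

text \<open>A Fatou argument: finitely many classes already account for the limit up to
  \<open>e\<close>.\<close>

lemma scheffe_lower:
  fixes c :: "nat \<Rightarrow> nat \<Rightarrow> real" and g :: "nat \<Rightarrow> real"
  assumes lim: "\<And>i. (\<lambda>n. c i n) \<longlonglongrightarrow> dd i"
    and sm: "\<And>I n. (\<Sum>i<I. c i n * g i) \<le> S n"
    and sd: "summable (\<lambda>i. dd i * g i)" and e: "0 < e"
  shows "\<forall>\<^sub>F n in sequentially. (\<Sum>i. dd i * g i) - e < S n"
proof -
  have "\<forall>\<^sub>F I in sequentially. (\<Sum>i. dd i * g i) - e < (\<Sum>i<I. dd i * g i)"
    using summable_LIMSEQ[OF sd] by (rule order_tendstoD) (use e in simp)
  then obtain I where I: "(\<Sum>i. dd i * g i) - e < (\<Sum>i<I. dd i * g i)"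
    unfolding eventually_sequentially by blast
  have "(\<lambda>n. \<Sum>i<I. c i n * g i) \<longlonglongrightarrow> (\<Sum>i<I. dd i * g i)"
    by (intro tendsto_intros lim)
  then have "\<forall>\<^sub>F n in sequentially. (\<Sum>i. dd i * g i) - e < (\<Sum>i<I. c i n * g i)"
    using I by (rule order_tendstoD)
  then show ?thesis by eventually_elim (use sm order_less_le_trans in blast)
qed

context forest
begin

text \<open>The number of elements of the orbit from \<open>v\<close> on; \<open>0\<close> stands for infinity.\<close>

definition rl :: "nat \<Rightarrow> nat" where
  "rl v = (if \<exists>j. (sc ^^ j) v \<notin> H then Suc (LEAST j. (sc ^^ j) v \<notin> H) else 0)"

lemma rl_notin: "v \<notin> H \<Longrightarrow> rl v = 1"
proof -
  assume v: "v \<notin> H"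
  then have "(LEAST j. (sc ^^ j) v \<notin> H) = 0" by (intro Least_eq_0) simp
  moreover have "\<exists>j. (sc ^^ j) v \<notin> H" using v by (intro exI[of _ 0]) simp
  ultimately show ?thesis by (simp add: rl_def)
qed

lemma rl_in:
  assumes "v \<in> H"
  shows "rl v = (if rl (sc v) = 0 then 0 else Suc (rl (sc v)))"
proof (cases "\<exists>j. (sc ^^ j) (sc v) \<notin> H")
  case True
  then have ex: "\<exists>j. (sc ^^ Suc j) v \<notin> H" by (simp add: funpow_swap1)
  then have ex': "\<exists>j. (sc ^^ j) v \<notin> H" by blast
  have "(LEAST j. (sc ^^ j) v \<notin> H) = Suc (LEAST j. (sc ^^ Suc j) v \<notin> H)"
    using LeastI_ex[OF ex'] assms by (intro Least_Suc[where P = "\<lambda>j. (sc ^^ j) v \<notin> H"]) auto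
  also have "(\<lambda>j. (sc ^^ Suc j) v \<notin> H) = (\<lambda>j. (sc ^^ j) (sc v) \<notin> H)" by (simp add: funpow_swap1)
  finally show ?thesis using True ex' by (simp add: rl_def)
next
  case False
  have "(sc ^^ j) v \<in> H" for j
  proof (cases j)
    case (Suc i)
    then show ?thesis using False by (simp add: funpow_swap1)
  qed (use assms in simp)
  then show ?thesis using False by (simp add: rl_def)
qed

lemma rl_sc: "v \<in> H \<Longrightarrow> rl (sc v) = rl v - 1"
  using rl_in[of v] by simp

lemma rl_1_iff: "rl v = 1 \<longleftrightarrow> v \<notin> H"
  using rl_notin[of v] rl_in[of v] by (auto split: if_splits)

text \<open>Depth is counted from the first element above \<open>K\<close>, so the nodes of depth \<open>0\<close> comprise up to \<open>K\<close>
  nodes that are no starts.\<close>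

function dep :: "nat \<Rightarrow> nat" where
  "dep v = (if K < v \<and> K < pr v then Suc (dep (pr v)) else 0)"
  by auto
termination by (relation "Wellfounded.measure id") (auto simp: pr_less)

declare dep.simps [simp del]

definition Cls :: "nat \<Rightarrow> nat set" where
  "Cls p = {v. K < v \<and> dep v = p}"

lemma Cls_Suc: "Cls (Suc p) = sc ` (Cls p \<inter> H)"
proof (intro equalityI subsetI)
  fix v assume "v \<in> Cls (Suc p)"
  then have v: "K < v" "dep v = Suc p" by (auto simp: Cls_def)
  then have "K < pr v" "dep (pr v) = p" by (auto simp: dep.simps[of v] split: if_splits)
  then have "pr v \<in> Cls p \<inter> H" "sc (pr v) = v" using pr_H[of v] sc_pr[of v] v by (auto simp: Cls_def)
  then show "v \<in> sc ` (Cls p \<inter> H)" by force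
next
  fix v assume "v \<in> sc ` (Cls p \<inter> H)"
  then obtain u where u: "u \<in> Cls p" "u \<in> H" "v = sc u" by blast
  then have "K < u" "K < v" "pr v = u" "dep u = p" using sc_K pr_sc by (auto simp: Cls_def)
  then show "v \<in> Cls (Suc p)" by (simp add: Cls_def dep.simps[of v])
qed

lemma sc_inj: "inj_on sc (H \<inter> {K<..})"
  using inj sc_K by (auto intro!: inj_onI)

lemma lam_dep: "K < v \<Longrightarrow> lam ^ dep v \<le> real v"
proof (induction v rule: less_induct)
  case (less v)
  show ?case
  proof (cases "K < pr v")
    case True
    then have "lam ^ dep (pr v) \<le> real (pr v)" using less pr_less[OF less(2)] by auto
    then have "lam ^ dep v \<le> lam * real (pr v)" using True less(2) lam1 by (simp add: dep.simps[of v])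
    also have "\<dots> \<le> real (sc (pr v))" using True less(2) pr_H[of v] by (intro sc_lam) auto
    finally show ?thesis using sc_pr[of v] True less(2) by simp
  qed (use less in \<open>simp add: dep.simps[of v]\<close>)
qed

lemma finite_bounded_real [simp, intro]: "finite {v. P v \<and> real v \<le> x}"
proof (rule finite_subset)
  show "{v. P v \<and> real v \<le> x} \<subseteq> {..nat \<lfloor>x\<rfloor>}" by (auto simp: le_nat_floor)
qed simp

text \<open>One step back along an orbit divides the position by at least \<open>lam\<close>, so the
  classes thin out geometrically, uniformly in \<open>x\<close>. This domination later justifies the
  interchange of limit and sum over the depth.\<close>

lemma card_Cls: "0 \<le> x \<Longrightarrow> real (card {v. v \<in> Cls p \<and> real v \<le> x}) \<le> x / lam ^ p"
proof (induction p arbitrary: x)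
  case 0
  have "{v. v \<in> Cls 0 \<and> real v \<le> x} \<subseteq> {1..nat \<lfloor>x\<rfloor>}" by (auto simp: Cls_def le_nat_floor)
  then have "card {v. v \<in> Cls 0 \<and> real v \<le> x} \<le> card {1..nat \<lfloor>x\<rfloor>}" by (rule card_mono[rotated]) simp
  then show ?case using 0 by simp linarith
next
  case (Suc p)
  have lam0: "0 < lam" using lam1 by simp
  have "{v. v \<in> Cls (Suc p) \<and> real v \<le> x} \<subseteq> sc ` {u. u \<in> Cls p \<and> real u \<le> x / lam}"
  proof
    fix v assume "v \<in> {v. v \<in> Cls (Suc p) \<and> real v \<le> x}"
    then obtain u where u: "u \<in> Cls p" "u \<in> H" "v = sc u" "real v \<le> x" by (auto simp: Cls_Suc)
    then have "lam * real u \<le> real v" using sc_lam[of u] by (auto simp: Cls_def)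
    then have "real u \<le> x / lam" using lam0 u by (simp add: field_simps)
    then show "v \<in> sc ` {u. u \<in> Cls p \<and> real u \<le> x / lam}" using u by blast
  qed
  then have "card {v. v \<in> Cls (Suc p) \<and> real v \<le> x} \<le> card (sc ` {u. u \<in> Cls p \<and> real u \<le> x / lam})"
    by (intro card_mono finite_imageI) auto
  also have "\<dots> \<le> card {u. u \<in> Cls p \<and> real u \<le> x / lam}" by (intro card_image_le) auto
  finally have "real (card {v. v \<in> Cls (Suc p) \<and> real v \<le> x}) \<le> x / lam / lam ^ p"
    using Suc.IH[of "x / lam"] Suc.prems lam0 by (meson divide_nonneg_pos of_nat_mono order_trans)
  then show ?case by (simp add: mult.commute)
qed

definition fl :: "nat \<Rightarrow> nat" where "fl n = nat \<lfloor>real n / q\<rfloor>"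

lemma fl_iff: "u \<le> fl n \<longleftrightarrow> q * real u \<le> real n"
proof -
  have "u \<le> fl n \<longleftrightarrow> real u \<le> real n / q" unfolding fl_def
    using q1 by (subst le_nat_iff) (auto simp: le_floor_iff)
  then show ?thesis using q1 by (simp add: field_simps)
qed

text \<open>The conditions \<open>sc u \<le> n\<close> and \<open>q * u \<le> n\<close> disagree
  only where \<open>q * u\<close> is within \<open>\<bar>Cq\<bar>\<close> of \<open>n\<close>, hence
  at boundedly many nodes.\<close>

lemma sc_window:
  assumes h: "\<And>u. \<bar>h u\<bar> \<le> B" and S: "S \<subseteq> H \<inter> {K<..}"
  shows "\<bar>(\<Sum>u | u \<in> S \<and> sc u \<le> n. h u) - (\<Sum>u | u \<in> S \<and> u \<le> fl n. h u)\<bar> \<le> B * (2 * \<bar>Cq\<bar> / q + 1)"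
proof -
  define A1 where "A1 = {u. u \<in> S \<and> sc u \<le> n}"
  define A2 where "A2 = {u. u \<in> S \<and> u \<le> fl n}"
  have B0: "0 \<le> B" using h[of 0] by linarith
  have fin: "finite A1" "finite A2"
  proof -
    have "A1 \<subseteq> {..n}" using S sc_gt sc_K by (force simp: A1_def)
    then show "finite A1" using finite_subset by blast
  qed (simp add: A2_def)
  define D where "D = (A1 - A2) \<union> (A2 - A1)"
  have "real (card D) \<le> 2 * \<bar>Cq\<bar> / q + 1"
  proof (rule card_le_spread)
    have near: "\<bar>q * real u - real n\<bar> \<le> \<bar>Cq\<bar>" if "u \<in> D" for u
    proof -
      have u: "u \<in> H" "K < u" using that S by (auto simp: D_def A1_def A2_def)
      from that consider "sc u \<le> n" "\<not> q * real u \<le> real n" | "\<not> sc u \<le> n" "q * real u \<le> real n"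
        by (auto simp: D_def A1_def A2_def fl_iff)
      then show ?thesis using sc_q[OF u] by cases linarith+
    qed
    fix u v assume "u \<in> D" "v \<in> D"
    then have "q * real u - q * real v \<le> 2 * \<bar>Cq\<bar>" using near[of u] near[of v] by linarith
    then show "real u - real v \<le> 2 * \<bar>Cq\<bar> / q" using q1 by (simp add: field_simps)
  qed (use fin q1 in \<open>auto simp: D_def\<close>)
  moreover have "(\<Sum>u\<in>A1. h u) - (\<Sum>u\<in>A2. h u) = (\<Sum>u\<in>A1 - A2. h u) - (\<Sum>u\<in>A2 - A1. h u)"
    using fin by (simp add: sum.Int_Diff[of A1 h A2] sum.Int_Diff[of A2 h A1] Int_commute)
  moreover have "\<bar>(\<Sum>u\<in>A1 - A2. h u) - (\<Sum>u\<in>A2 - A1. h u)\<bar> \<le> (\<Sum>u\<in>A1 - A2. \<bar>h u\<bar>) + (\<Sum>u\<in>A2 - A1. \<bar>h u\<bar>)"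
    using sum_abs[of h "A1 - A2"] sum_abs[of h "A2 - A1"] by linarith
  moreover have "(\<Sum>u\<in>A1 - A2. \<bar>h u\<bar>) + (\<Sum>u\<in>A2 - A1. \<bar>h u\<bar>) = (\<Sum>u\<in>D. \<bar>h u\<bar>)"
    unfolding D_def using fin by (subst sum.union_disjoint) auto
  moreover have "(\<Sum>u\<in>D. \<bar>h u\<bar>) \<le> real (card D) * B" using h by (intro sum_bounded_above) auto
  moreover have "real (card D) * B \<le> B * (2 * \<bar>Cq\<bar> / q + 1)" using calculation(1) B0
    by (metis mult.commute mult_right_mono)
  ultimately show ?thesis unfolding A1_def A2_def by linarith
qed

lemma fl_lim: "(\<lambda>n. real (fl n) / real n) \<longlonglongrightarrow> 1 / q" and fl_inf: "filterlim fl at_top sequentially"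
proof -
  show "(\<lambda>n. real (fl n) / real n) \<longlonglongrightarrow> 1 / q"
  proof (rule real_tendsto_sandwich)
    have bnd: "real n / q - 1 \<le> real (fl n)" "real (fl n) \<le> real n / q" for n
      unfolding fl_def using q1 by (simp_all add: divide_nonneg_pos)
    show "\<forall>\<^sub>F n in sequentially. (real n / q - 1) / real n \<le> real (fl n) / real n"
      using bnd by (intro always_eventually allI divide_right_mono) auto
    show "\<forall>\<^sub>F n in sequentially. real (fl n) / real n \<le> (real n / q) / real n"
      using bnd by (intro always_eventually allI divide_right_mono) auto
    show "(\<lambda>n. (real n / q - 1) / real n) \<longlonglongrightarrow> 1 / q"
      using q1 by (real_asymp simp: field_simps)
    show "(\<lambda>n. (real n / q) / real n) \<longlonglongrightarrow> 1 / q"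
      using q1 by (real_asymp simp: field_simps)
  qed
  show "filterlim fl at_top sequentially" unfolding fl_def using q1 by real_asymp
qed

lemma avg_fl: "(\<lambda>n. F n / real n) \<longlonglongrightarrow> L \<Longrightarrow> (\<lambda>n. F (fl n) / real n) \<longlonglongrightarrow> L / q"
proof -
  assume "(\<lambda>n. F n / real n) \<longlonglongrightarrow> L"
  from filterlim_compose[OF this fl_inf] have "(\<lambda>n. F (fl n) / real (fl n)) \<longlonglongrightarrow> L" .
  from tendsto_mult[OF this fl_lim]
  have "(\<lambda>n. F (fl n) / real (fl n) * (real (fl n) / real n)) \<longlonglongrightarrow> L / q" by simp
  moreover have "\<forall>\<^sub>F n in sequentially. F (fl n) / real (fl n) * (real (fl n) / real n) = F (fl n) / real n"
    using fl_inf[unfolded filterlim_at_top, rule_format, of 1] by eventually_elim simp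
  ultimately show ?thesis by (rule Lim_transform_eventually)
qed

end

text \<open>In accordance with \<open>rl\<close>, the density of the starts of infinite orbits is \<open>dd 0\<close>.\<close>

locale density_forest = forest +
  fixes dd :: "nat \<Rightarrow> real" and T :: real
  assumes start_dens: "\<And>i. (\<lambda>n. real (card {v. K < v \<and> v \<le> n \<and> pr v = 0 \<and> rl v = i}) / real n) \<longlonglongrightarrow> dd i"
    and start_tot: "(\<lambda>n. real (card {v. K < v \<and> v \<le> n \<and> pr v = 0}) / real n) \<longlonglongrightarrow> T"
    and dd_sums: "dd sums T"
begin

lemma dd_nonneg: "0 \<le> dd i"
  by (rule tendsto_lowerbound[OF start_dens]) auto

lemma summable_dd: "summable dd"
  using dd_sums by (rule sums_summable)

lemma summable_dd_mult: "(\<And>i. \<bar>g i\<bar> \<le> B) \<Longrightarrow> summable (\<lambda>i. dd i * g i)"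
proof (rule summable_comparison_test[OF _ summable_mult[OF summable_dd, of B]], intro exI allI impI)
  fix i assume "\<And>i. \<bar>g i\<bar> \<le> B"
  then show "norm (dd i * g i) \<le> B * dd i"
    using mult_left_mono[of "\<bar>g i\<bar>" B "dd i"] dd_nonneg[of i] by (simp add: abs_mult mult.commute)
qed

text \<open>Scheffe's argument: as \<open>dd\<close> has the full total \<open>T\<close>, the lower bounds for \<open>B + g\<close> and \<open>B - g\<close> suffice.\<close>

lemma start_avg:
  assumes g: "\<And>i. \<bar>g i\<bar> \<le> B"
  shows "(\<lambda>n. (\<Sum>v | K < v \<and> v \<le> n \<and> pr v = 0. g (rl v)) / real n) \<longlonglongrightarrow> (\<Sum>i. dd i * g i)"
proof -
  define St where "St n = {v. K < v \<and> v \<le> n \<and> pr v = 0}" for n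
  define S where "S g n = (\<Sum>v\<in>St n. g (rl v)) / real n" for g :: "nat \<Rightarrow> real" and n
  have fin: "finite (St n)" for n by (rule finite_subset[of _ "{..n}"]) (auto simp: St_def)
  have low: "\<forall>\<^sub>F n in sequentially. (\<Sum>i. dd i * g i) - e < S g n"
    if g: "\<And>i. 0 \<le> g i" "\<And>i. g i \<le> B" and e: "0 < e" for g B e
  proof (rule scheffe_lower[OF start_dens _ _ e])
    show "summable (\<lambda>i. dd i * g i)" using g by (intro summable_dd_mult[of _ B]) auto
    fix I n
    have "(\<Sum>i<I. real (card {v. K < v \<and> v \<le> n \<and> pr v = 0 \<and> rl v = i}) * g i)
        = (\<Sum>i<I. \<Sum>v | v \<in> St n \<and> rl v = i. g (rl v))"
      by (intro sum.cong refl) (simp add: St_def conj_assoc)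
    also have "\<dots> = (\<Sum>v | v \<in> St n \<and> rl v \<in> {..<I}. g (rl v))"
    proof -
      have "{v. v \<in> St n \<and> rl v = i} = {v \<in> {v \<in> St n. rl v \<in> {..<I}}. rl v = i}" if "i < I" for i
        using that by auto
      then have "(\<Sum>i<I. \<Sum>v | v \<in> St n \<and> rl v = i. g (rl v)) =
          (\<Sum>i<I. \<Sum>v | v \<in> {v \<in> St n. rl v \<in> {..<I}} \<and> rl v = i. g (rl v))"
        by (intro sum.cong refl) simp_all
      also have "\<dots> = (\<Sum>v | v \<in> St n \<and> rl v \<in> {..<I}. g (rl v))"
        using fin by (intro sum.group) auto
      finally show ?thesis .
    qed
    also have "\<dots> \<le> (\<Sum>v\<in>St n. g (rl v))" using g fin by (intro sum_mono2) auto
    finally show "(\<Sum>i<I. real (card {v. K < v \<and> v \<le> n \<and> pr v = 0 \<and> rl v = i}) / real n * g i) \<le> S g n"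
      unfolding S_def by (simp add: sum_divide_distrib[symmetric] divide_right_mono)
  qed
  have B0: "0 \<le> B" using g[of 0] by linarith
  have gp: "0 \<le> B + g i" "0 \<le> B - g i" "B + g i \<le> 2 * B" "B - g i \<le> 2 * B" for i using g[of i] by linarith+
  have sg: "summable (\<lambda>i. dd i * g i)" using g by (rule summable_dd_mult)
  have tot: "(\<lambda>n. real (card (St n)) / real n * B) \<longlonglongrightarrow> T * B"
    unfolding St_def by (intro tendsto_intros start_tot)
  have sB: "(\<Sum>i. dd i * B) = T * B" using sums_unique[OF sums_mult2[OF dd_sums, of B]] by simp
  have Sp: "S (\<lambda>i. B + g i) n = real (card (St n)) / real n * B + S g n"
    and Sm: "S (\<lambda>i. B - g i) n = real (card (St n)) / real n * B - S g n" for n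
    by (simp_all add: S_def sum.distrib sum_subtractf add_divide_distrib diff_divide_distrib)
  have dp: "(\<Sum>i. dd i * (B + g i)) = T * B + (\<Sum>i. dd i * g i)"
    and dm: "(\<Sum>i. dd i * (B - g i)) = T * B - (\<Sum>i. dd i * g i)"
    using suminf_add[OF summable_mult2[OF summable_dd, of B] sg, unfolded sB]
      suminf_diff[OF summable_mult2[OF summable_dd, of B] sg, unfolded sB]
    by (simp_all add: distrib_left right_diff_distrib)
  have "S g \<longlonglongrightarrow> (\<Sum>i. dd i * g i)"
  proof (rule order_tendstoI)
    fix y assume y: "y < (\<Sum>i. dd i * g i)"
    define e where "e = ((\<Sum>i. dd i * g i) - y) / 2"
    have e: "0 < e" using y by (simp add: e_def)
    have 1: "\<forall>\<^sub>F n in sequentially. (\<Sum>i. dd i * (B + g i)) - e < S (\<lambda>i. B + g i) n"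
      by (rule low[of _ "2 * B"]) (use gp e in auto)
    have 2: "\<forall>\<^sub>F n in sequentially. real (card (St n)) / real n * B < T * B + e"
      using tot by (rule order_tendstoD) (use e in simp)
    from 1 2 show "\<forall>\<^sub>F n in sequentially. y < S g n"
    proof eventually_elim
      case (elim n)
      then show ?case unfolding Sp dp using e_def by (simp add: field_simps)
    qed
  next
    fix y assume y: "(\<Sum>i. dd i * g i) < y"
    define e where "e = (y - (\<Sum>i. dd i * g i)) / 2"
    have e: "0 < e" using y by (simp add: e_def)
    have 1: "\<forall>\<^sub>F n in sequentially. (\<Sum>i. dd i * (B - g i)) - e < S (\<lambda>i. B - g i) n"
      by (rule low[of _ "2 * B"]) (use gp e in auto)
    have 2: "\<forall>\<^sub>F n in sequentially. real (card (St n)) / real n * B < T * B + e"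
      using tot by (rule order_tendstoD) (use e in simp)
    from 1 2 show "\<forall>\<^sub>F n in sequentially. S g n < y"
    proof eventually_elim
      case (elim n)
      then show ?case unfolding Sm dm using e_def by (simp add: field_simps)
    qed
  qed
  then show ?thesis unfolding S_def St_def .
qed

text \<open>Average over the nodes of depth \<open>p\<close>: an element of remaining length \<open>r\<close> at depth \<open>p\<close> comes
  from a start of remaining length \<open>r + p\<close>, and each step stretches positions by the factor \<open>q\<close>.\<close>

definition L :: "nat \<Rightarrow> (nat \<Rightarrow> real) \<Rightarrow> real" where
  "L p g = (\<Sum>i. dd i * (if i = 0 then g 0 else if p < i then g (i - p) else 0)) / q ^ p"

text \<open>Induction over the depth. By \<open>Cls_Suc\<close> the next class consists of the
  images of the nodes with a successor, and \<open>sc_window\<close> moves the cutoff from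
  \<open>n\<close> to \<open>fl n\<close>, which costs a factor \<open>q\<close>.\<close>

lemma Cls_avg:
  assumes g: "\<And>i. \<bar>g i\<bar> \<le> B"
  shows "(\<lambda>n. (\<Sum>v | v \<in> Cls p \<and> v \<le> n. g (rl v)) / real n) \<longlonglongrightarrow> L p g"
  using g
proof (induction p arbitrary: g)
  case 0
  \<comment> \<open>These nodes of depth \<open>0\<close> are no starts: they are entered from
    \<open>{1..K}\<close>, so there are at most \<open>K\<close> of them.\<close>
  define R where "R n = {v. K < v \<and> v \<le> n \<and> 1 \<le> pr v \<and> pr v \<le> K}" for n
  have R: "R n \<subseteq> sc ` {1..K}" for n
  proof
    fix v assume "v \<in> R n"
    then have "v = sc (pr v)" "pr v \<in> {1..K}" using sc_pr[of v] by (auto simp: R_def)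
    then show "v \<in> sc ` {1..K}" by blast
  qed
  have cR: "real (card (R n)) \<le> real K" for n
    using card_mono[OF _ R[of n]] card_image_le[of "{1..K}" sc] by simp
  have "(\<Sum>v | v \<in> Cls 0 \<and> v \<le> n. g (rl v)) = (\<Sum>v | K < v \<and> v \<le> n \<and> pr v = 0. g (rl v)) + (\<Sum>v\<in>R n. g (rl v))" for n
  proof -
    have eq: "{v. v \<in> Cls 0 \<and> v \<le> n} = {v. K < v \<and> v \<le> n \<and> pr v = 0} \<union> R n"
    proof (rule Set.set_eqI)
      fix v
      show "v \<in> {v. v \<in> Cls 0 \<and> v \<le> n} \<longleftrightarrow> v \<in> {v. K < v \<and> v \<le> n \<and> pr v = 0} \<union> R n"
        by (auto simp: Cls_def R_def dep.simps[of v] split: if_splits)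
    qed
    have fin: "finite {v. K < v \<and> v \<le> n \<and> pr v = 0}" "finite (R n)"
      by (auto simp: R_def intro: finite_subset[of _ "{..n}"])
    show ?thesis unfolding eq by (rule sum.union_disjoint[OF fin]) (auto simp: R_def)
  qed
  moreover have "(\<lambda>n. (\<Sum>v\<in>R n. g (rl v)) / real n) \<longlonglongrightarrow> 0"
  proof (rule tendsto_bounded_over_n)
    fix n
    have "\<bar>\<Sum>v\<in>R n. g (rl v)\<bar> \<le> (\<Sum>v\<in>R n. \<bar>g (rl v)\<bar>)" by (rule sum_abs)
    also have "\<dots> \<le> real (card (R n)) * B" by (rule sum_bounded_above) (use 0 in auto)
    also have "\<dots> \<le> real K * B" using cR 0[of 0] by (intro mult_right_mono) auto
    finally show "\<bar>\<Sum>v\<in>R n. g (rl v)\<bar> \<le> real K * B" .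
  qed
  from tendsto_add[OF start_avg[OF 0] this]
  have "(\<lambda>n. (\<Sum>v | K < v \<and> v \<le> n \<and> pr v = 0. g (rl v)) / real n + (\<Sum>v\<in>R n. g (rl v)) / real n) \<longlonglongrightarrow> (\<Sum>i. dd i * g i)"
    by simp
  moreover have "L 0 g = (\<Sum>i. dd i * g i)" by (simp add: L_def) (rule suminf_cong, auto)
  ultimately show ?case by (simp add: add_divide_distrib)
next
  case (Suc p)
  \<comment> \<open>The value \<open>0\<close> at \<open>r = 1\<close> removes the nodes without a
    successor; since \<open>0 - 1 = 0\<close> on naturals, infinite orbits keep their code.\<close>
  define g' where "g' r = (if r = 1 then 0 else g (r - 1))" for r
  have B0: "0 \<le> B" using Suc.prems[of 0] by linarith
  have g': "\<bar>g' r\<bar> \<le> B" for r using Suc.prems B0 by (simp add: g'_def)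
  have "(\<Sum>v | v \<in> Cls (Suc p) \<and> v \<le> n. g (rl v)) = (\<Sum>u | u \<in> Cls p \<inter> H \<and> sc u \<le> n. g' (rl u))" for n
  proof -
    have "{v. v \<in> Cls (Suc p) \<and> v \<le> n} = sc ` {u. u \<in> Cls p \<inter> H \<and> sc u \<le> n}"
      by (auto simp: Cls_Suc)
    moreover have "inj_on sc {u. u \<in> Cls p \<inter> H \<and> sc u \<le> n}"
      using sc_inj by (rule inj_on_subset) (auto simp: Cls_def)
    ultimately have "(\<Sum>v | v \<in> Cls (Suc p) \<and> v \<le> n. g (rl v)) = (\<Sum>u | u \<in> Cls p \<inter> H \<and> sc u \<le> n. g (rl (sc u)))"
      by (simp add: sum.reindex)
    also have "\<dots> = (\<Sum>u | u \<in> Cls p \<inter> H \<and> sc u \<le> n. g' (rl u))"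
      by (intro sum.cong) (auto simp: g'_def rl_sc rl_1_iff[unfolded One_nat_def])
    finally show ?thesis .
  qed
  moreover have "(\<Sum>u | u \<in> Cls p \<inter> H \<and> u \<le> k. g' (rl u)) = (\<Sum>u | u \<in> Cls p \<and> u \<le> k. g' (rl u))" for k
    using rl_notin by (intro sum.mono_neutral_left) (auto simp: g'_def)
  ultimately have eq: "(\<Sum>v | v \<in> Cls (Suc p) \<and> v \<le> n. g (rl v)) =
     ((\<Sum>u | u \<in> Cls p \<inter> H \<and> sc u \<le> n. g' (rl u)) - (\<Sum>u | u \<in> Cls p \<inter> H \<and> u \<le> fl n. g' (rl u)))
     + (\<Sum>u | u \<in> Cls p \<and> u \<le> fl n. g' (rl u))" for n by simp
  have "(\<lambda>n. ((\<Sum>u | u \<in> Cls p \<inter> H \<and> sc u \<le> n. g' (rl u)) - (\<Sum>u | u \<in> Cls p \<inter> H \<and> u \<le> fl n. g' (rl u))) / real n) \<longlonglongrightarrow> 0"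
    by (rule tendsto_bounded_over_n, rule sc_window) (use g' in \<open>auto simp: Cls_def\<close>)
  from tendsto_add[OF this avg_fl[OF Suc.IH[of g']]] g'
  have "(\<lambda>n. (\<Sum>v | v \<in> Cls (Suc p) \<and> v \<le> n. g (rl v)) / real n) \<longlonglongrightarrow> L p g' / q"
    unfolding eq by (simp add: add_divide_distrib)
  moreover have "L p g' / q = L (Suc p) g"
  proof -
    have "(\<lambda>i. dd i * (if i = 0 then g' 0 else if p < i then g' (i - p) else 0)) =
          (\<lambda>i. dd i * (if i = 0 then g 0 else if Suc p < i then g (i - Suc p) else 0))"
      by (rule ext) (auto simp: g'_def)
    then show ?thesis unfolding L_def by (simp add: mult.commute)
  qed
  ultimately show ?case by simp
qed

text \<open>Dominated convergence over the depth, with \<open>card_Cls\<close> as the bound.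
  Finitely many exceptions in each class are allowed, because nodes descending from
  \<open>{1..K}\<close> feel the initial word.\<close>

lemma avg:
  assumes h: "\<And>v. \<bar>h v\<bar> \<le> B" and g: "\<And>p i. \<bar>g p i\<bar> \<le> B"
    and fin: "\<And>p. finite {v \<in> Cls p. h v \<noteq> g p (rl v)}"
  shows "(\<lambda>n. (\<Sum>v\<in>{K<..n}. h v) / real n) \<longlonglongrightarrow> (\<Sum>p. L p (g p))" and "summable (\<lambda>p. L p (g p))"
proof -
  define s where "s p n = (\<Sum>v | v \<in> Cls p \<and> v \<le> n. h v) / real n" for p n
  have B0: "0 \<le> B" using h[of 0] by linarith
  have lim: "s p \<longlonglongrightarrow> L p (g p)" for p
  proof -
    define E where "E = {v \<in> Cls p. h v \<noteq> g p (rl v)}"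
    have finE: "finite E" using fin by (simp add: E_def)
    have "(\<lambda>n. ((\<Sum>v | v \<in> Cls p \<and> v \<le> n. h v) - (\<Sum>v | v \<in> Cls p \<and> v \<le> n. g p (rl v))) / real n) \<longlonglongrightarrow> 0"
    proof (rule tendsto_bounded_over_n)
      fix n
      have "(\<Sum>v | v \<in> Cls p \<and> v \<le> n. h v) - (\<Sum>v | v \<in> Cls p \<and> v \<le> n. g p (rl v))
        = (\<Sum>v | v \<in> Cls p \<and> v \<le> n. h v - g p (rl v))" by (simp add: sum_subtractf)
      also have "\<dots> = (\<Sum>v | v \<in> E \<and> v \<le> n. h v - g p (rl v))"
        by (rule sum.mono_neutral_right) (auto simp: E_def)
      also have "\<bar>\<dots>\<bar> \<le> (\<Sum>v | v \<in> E \<and> v \<le> n. \<bar>h v - g p (rl v)\<bar>)" by (rule sum_abs)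
      also have "\<dots> \<le> real (card {v. v \<in> E \<and> v \<le> n}) * (2 * B)"
      proof (rule sum_bounded_above)
        fix v show "\<bar>h v - g p (rl v)\<bar> \<le> 2 * B" using h[of v] g[of p "rl v"] by linarith
      qed
      also have "\<dots> \<le> real (card E) * (2 * B)"
        using finE B0 by (intro mult_right_mono) (auto intro: card_mono)
      finally show "\<bar>(\<Sum>v | v \<in> Cls p \<and> v \<le> n. h v) - (\<Sum>v | v \<in> Cls p \<and> v \<le> n. g p (rl v))\<bar> \<le> real (card E) * (2 * B)" .
    qed
    from tendsto_add[OF this Cls_avg[of "g p" B p]] g
    show ?thesis unfolding s_def by (simp add: diff_divide_distrib)
  qed
  have bound: "norm (s p n) \<le> B * (1 / lam) ^ p" for p n
  proof (cases "n = 0")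
    case False
    have "\<bar>\<Sum>v | v \<in> Cls p \<and> v \<le> n. h v\<bar> \<le> (\<Sum>v | v \<in> Cls p \<and> v \<le> n. \<bar>h v\<bar>)" by (rule sum_abs)
    also have "\<dots> \<le> real (card {v. v \<in> Cls p \<and> v \<le> n}) * B" by (rule sum_bounded_above) (use h in auto)
    also have "\<dots> \<le> (real n / lam ^ p) * B" using card_Cls[of "real n" p] B0 by (intro mult_right_mono) auto
    finally show ?thesis using False by (simp add: s_def field_simps power_one_over)
  qed (use B0 lam1 in \<open>simp add: s_def\<close>)
  have sm: "summable (\<lambda>p. B * (1 / lam) ^ p)" using lam1 by (intro summable_mult summable_geometric) auto
  have T: "summable (\<lambda>p. norm (L p (g p))) \<and> (\<lambda>n. \<Sum>p. s p n) \<longlonglongrightarrow> (\<Sum>p. L p (g p))"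
  proof -
    have "\<forall>\<^sub>F (p, n) in at_top \<times>\<^sub>F sequentially. norm (s p n) \<le> B * (1 / lam) ^ p"
      using bound by (intro always_eventually) auto
    from tannerys_theorem[OF lim this sm] show ?thesis by simp
  qed
  show "summable (\<lambda>p. L p (g p))" by (intro summable_norm_cancel[OF conjunct1[OF T]])
  have "(\<Sum>p. s p n) = (\<Sum>v\<in>{K<..n}. h v) / real n" for n
  proof -
    have dn: "dep v \<le> v" for v
    proof (induction v rule: less_induct)
      case (less v)
      show ?case
      proof (cases "K < v \<and> K < pr v")
        case True
        then show ?thesis using less[of "pr v"] pr_less[of v] by (simp add: dep.simps[of v])
      next
        case False
        then show ?thesis by (subst dep.simps) auto
      qed
    qed
    have "(\<Sum>p. s p n) = (\<Sum>p\<le>n. s p n)"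
    proof (rule suminf_finite)
      fix p assume p: "p \<notin> {..n}"
      have e: "{v. v \<in> Cls p \<and> v \<le> n} = {}"
      proof (rule equals0I)
        fix v assume "v \<in> {v. v \<in> Cls p \<and> v \<le> n}"
        then show False using dn[of v] p by (auto simp: Cls_def)
      qed
      show "s p n = 0" unfolding s_def e by simp
    qed simp
    also have "\<dots> = (\<Sum>p\<le>n. \<Sum>v | v \<in> {K<..n} \<and> dep v = p. h v) / real n"
      unfolding s_def by (simp add: sum_divide_distrib[symmetric] Cls_def conj_commute conj_left_commute)
    also have "(\<Sum>p\<le>n. \<Sum>v | v \<in> {K<..n} \<and> dep v = p. h v) = (\<Sum>v\<in>{K<..n}. h v)"
      by (rule sum.group) (use dn le_trans in \<open>auto, blast\<close>)
    finally show ?thesis .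
  qed
  then show "(\<lambda>n. (\<Sum>v\<in>{K<..n}. h v) / real n) \<longlonglongrightarrow> (\<Sum>p. L p (g p))" using T by simp
qed

end

section \<open>Comparison of the two dimensions\<close>

lemma (in alphabet) card_pre_le:
  assumes D: "(\<lambda>n. ln (real (card (pre n ` X))) / (real n * ln (real m))) \<longlonglongrightarrow> D" and D': "D < D'"
  shows "\<forall>\<^sub>F n in sequentially. real (card (pre n ` X)) \<le> real m powr (D' * real n)"
  using order_tendstoD(2)[OF D D'] eventually_gt_at_top[of 0]
proof eventually_elim
  case (elim n)
  show ?case
  proof (cases "card (pre n ` X) = 0")
    case False
    have "ln (real (card (pre n ` X))) < D' * (real n * ln (real m))"
      using elim ln_m_pos by (simp add: pos_divide_less_eq)
    then have "exp (ln (real (card (pre n ` X)))) \<le> exp (D' * real n * ln (real m))"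
      by (simp add: mult.assoc)
    moreover have "exp (ln (real (card (pre n ` X)))) = real (card (pre n ` X))" using False by (intro exp_ln) auto
    ultimately show ?thesis using m2 by (simp add: powr_def)
  qed (metis of_nat_0 powr_ge_zero)
qed

lemma (in alphabet) minkowski_nonneg:
  assumes D: "(\<lambda>n. ln (real (card (pre n ` X))) / (real n * ln (real m))) \<longlonglongrightarrow> D"
  shows "0 \<le> D"
proof (rule tendsto_lowerbound[OF D])
  have "0 \<le> ln (real k)" for k by (cases k) auto
  then show "\<forall>\<^sub>F n in sequentially. 0 \<le> ln (real (card (pre n ` X))) / (real n * ln (real m))"
    using ln_m_pos by (intro always_eventually) simp
qed simp

lemma (in alphabet) hausdorff_dim_le_minkowski:
  assumes X: "X \<subseteq> full_shift m" and "has_minkowski_dim X D"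
  shows "hausdorff_dim X \<le> ereal D"
proof (rule ereal_le_epsilon2)
  fix e :: real assume e: "0 < e"
  have D: "(\<lambda>n. ln (real (card (pre n ` X))) / (real n * ln (real m))) \<longlonglongrightarrow> D"
    using assms has_minkowski_dim_iff by simp
  obtain n1 where n1: "\<And>n. n1 \<le> n \<Longrightarrow> real (card (pre n ` X)) \<le> real m powr ((D + e) * real n)"
    using card_pre_le[OF D, of "D + e"] e unfolding eventually_sequentially by auto
  have "hausdorff_dim X \<le> ereal (D + e)"
  proof (rule hausdorff_dim_le[OF X, of n1 "\<lambda>n. pre n ` X" 1])
    show "pre n ` X \<subseteq> words m n" for n using X pre_in_words by auto
    show "real (card (pre n ` X)) \<le> 1 * real m powr ((D + e) * real n)" if "n1 \<le> n" for n using n1[OF that] by simp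
    show "\<exists>k\<ge>n. pre k x \<in> pre k ` X" if "x \<in> X" for x n using that by blast
    show "0 \<le> D + e" using minkowski_nonneg[OF D] e by simp
  qed
  then show "hausdorff_dim X \<le> ereal D + ereal e" by simp
qed

text \<open>The exchange of \<open>(x, p)\<close> with \<open>(put x p, get x)\<close> is an
  involution that preserves \<open>G\<close>. In other words, for the uniform distribution on
  \<open>W\<close> the value of \<open>get\<close> is uniform on \<open>P\<close> and uncorrelated
  with \<open>G\<close>.\<close>

lemma sum_resample:
  fixes G :: "'x \<Rightarrow> real" and h :: "'p \<Rightarrow> real"
  assumes "finite W" "finite P"
    and get: "\<And>x. x \<in> W \<Longrightarrow> get x \<in> P" and put: "\<And>x p. x \<in> W \<Longrightarrow> p \<in> P \<Longrightarrow> put x p \<in> W"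
    and gp: "\<And>x p. x \<in> W \<Longrightarrow> p \<in> P \<Longrightarrow> get (put x p) = p"
    and pp: "\<And>x p. x \<in> W \<Longrightarrow> p \<in> P \<Longrightarrow> put (put x p) (get x) = x"
    and G: "\<And>x p. x \<in> W \<Longrightarrow> p \<in> P \<Longrightarrow> G (put x p) = G x"
  shows "real (card P) * (\<Sum>x\<in>W. G x * h (get x)) = (\<Sum>p\<in>P. h p) * (\<Sum>x\<in>W. G x)"
proof -
  have "real (card P) * (\<Sum>x\<in>W. G x * h (get x)) = (\<Sum>(x, p)\<in>W \<times> P. G x * h (get x))"
    by (simp add: sum.cartesian_product[symmetric] sum_distrib_left)
  also have "\<dots> = (\<Sum>(x, p)\<in>W \<times> P. G x * h p)"
    by (rule sum.reindex_bij_witness[of _ "\<lambda>(x, p). (put x p, get x)" "\<lambda>(x, p). (put x p, get x)"])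
       (auto simp: get put gp pp G)
  also have "\<dots> = (\<Sum>p\<in>P. h p) * (\<Sum>x\<in>W. G x)"
    by (simp add: sum.cartesian_product[symmetric] sum_distrib_left[symmetric] sum_distrib_right[symmetric] mult.commute)
  finally show ?thesis .
qed

context forest
begin

lemma row_sum_pos: "i < m \<Longrightarrow> 1 \<le> (\<Sum>j<m. a i j)"
proof -
  assume i: "i < m"
  obtain j where j: "j < m" "a i j = 1" using a_choose[OF i] .
  then have "a i j \<le> (\<Sum>j<m. a i j)" using a_nonneg[OF i] by (intro member_le_sum) auto
  then show ?thesis using j by simp
qed

text \<open>With mass 1 on every admissible initial word, the weights vanish off
  \<open>Wd n\<close>; the left-hand side is therefore the total mass.\<close>

lemma sum_w_Wd:
  assumes V: "\<And>v b. b < m \<Longrightarrow> 0 < V v b" and n: "K \<le> n"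
  defines "\<kappa> \<equiv> \<lambda>x. if adm K x then 1 else 0"
  shows "(\<Sum>x\<in>Wd n. forest_measure.w m a H sc K V \<kappa> n x) = real (card (Wd K))"
proof -
  interpret forest_measure m a H sc q Cq lam K V \<kappa>
    by unfold_locales (auto simp: V \<kappa>_def)
  have ak: "adm K (pre K x) = adm K x" for x by (rule adm_cong) simp_all
  have "(\<Sum>x\<in>Wd n. w n x) = (\<Sum>x\<in>words m n. w n x)"
  proof (rule sum.mono_neutral_left)
    show "\<forall>x\<in>words m n - Wd n. w n x = 0"
    proof
      fix x assume x: "x \<in> words m n - Wd n"
      then have "\<not> adm n x" by (simp add: Wd_def)
      then have "\<not> 0 < w n x" using w_pos_iff[OF n, of x] adm_iff[OF n, of x] x ak by (auto simp: \<kappa>_def split: if_splits)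
      then show "w n x = 0" using w_nonneg[of x n] x by auto
    qed
  qed (auto simp: Wd_def)
  also have "\<dots> = (\<Sum>x\<in>words m K. w K x)" by (rule w_total[OF n])
  also have "\<dots> = (\<Sum>x\<in>words m K. if adm K x then 1 else 0)" by (intro sum.cong refl) (simp add: w_K, simp add: \<kappa>_def)
  also have "\<dots> = real (card (Wd K))" by (simp add: sum.If_cases Wd_def Int_def)
  finally show ?thesis .
qed

lemma Wd_nonempty: "X \<noteq> {} \<Longrightarrow> K \<le> n \<Longrightarrow> 0 < card (Wd n)"
  using pre_X[of n] by (auto simp: card_gt_0_iff)

lemma adm_alt: "K \<le> n \<Longrightarrow> x \<in> Wd n \<Longrightarrow> \<forall>v\<in>{K<..n}. pr v \<noteq> 0 \<longrightarrow> a (x (pr v)) (x v) = 1"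
  using adm_iff[of n x] by (auto simp: Wd_def)

text \<open>For \<open>V = 1\<close> every edge is normalised by \<open>r\<close>, so all admissible
  words that extend an initial word of mass 1 get the same weight \<open>exp (- E n)\<close>. This
  uniform measure counts the words, and at the same time it satisfies the mass distribution
  principle.\<close>

lemma equal_rows:
  assumes r: "\<And>i. i < m \<Longrightarrow> (\<Sum>j<m. a i j) = r" and X: "X \<noteq> {}"
    and T: "(\<lambda>n. real (card {v. K < v \<and> v \<le> n \<and> pr v = 0}) / real n) \<longlonglongrightarrow> T"
  shows "\<exists>D. has_minkowski_dim X D \<and> hausdorff_dim X = ereal D"
proof -
  have r1: "1 \<le> r" using row_sum_pos[of 0] r[of 0] m2 by simp
  define c where "c n = card {v. v \<in> {K<..n} \<and> pr v = 0}" for n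
  define e where "e n = card {v. v \<in> {K<..n} \<and> pr v \<noteq> 0}" for n
  define E where "E n = real (c n) * ln (real m) + real (e n) * ln r" for n
  define D where "D = (T * ln (real m) + (1 - T) * ln r) / ln (real m)"
  have ce: "c n + e n = n - K" for n
  proof -
    have "card {K<..n} = card ({v. v \<in> {K<..n} \<and> pr v = 0} \<union> {v. v \<in> {K<..n} \<and> pr v \<noteq> 0})"
      by (rule arg_cong[where f = card]) auto
    also have "\<dots> = c n + e n" unfolding c_def e_def by (rule card_Un_disjoint) auto
    finally have "card {K<..n} = c n + e n" .
    then show ?thesis by simp
  qed
  have cl: "(\<lambda>n. real (c n) / real n) \<longlonglongrightarrow> T" using T by (simp add: c_def conj_assoc)
  have "(\<lambda>n. (real n - real K) / real n - real (c n) / real n) \<longlonglongrightarrow> 1 - T"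
    by (intro tendsto_diff cl) real_asymp
  moreover have "\<forall>\<^sub>F n in sequentially. (real n - real K) / real n - real (c n) / real n = real (e n) / real n"
    using eventually_ge_at_top[of K]
  proof eventually_elim
    case (elim n)
    have "real (c n + e n) = real n - real K" using ce elim by (simp add: of_nat_diff)
    then show ?case by (simp add: diff_divide_distrib[symmetric])
  qed
  ultimately have el: "(\<lambda>n. real (e n) / real n) \<longlonglongrightarrow> 1 - T" by (rule Lim_transform_eventually)
  have El: "(\<lambda>n. E n / real n) \<longlonglongrightarrow> T * ln (real m) + (1 - T) * ln r"
    using tendsto_add[OF tendsto_mult_right[OF cl, of "ln (real m)"] tendsto_mult_right[OF el, of "ln r"]]
    by (simp add: E_def add_divide_distrib)
  have w: "forest_measure.w m a H sc K (\<lambda>_ _. 1) \<kappa> n x = exp (- E n)"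
    if n: "K \<le> n" and x: "x \<in> Wd n" and \<kappa>: "\<And>x. 0 \<le> \<kappa> x" "\<kappa> (pre K x) = 1" for \<kappa> n x
  proof -
    interpret forest_measure m a H sc q Cq lam K "\<lambda>_ _. 1" \<kappa>
      by unfold_locales (auto simp: \<kappa>)
    have xw: "x \<in> words m n" using x by (simp add: Wd_def)
    have "AV v (x (pr v)) = r" if "v \<in> {K<..n}" "pr v \<noteq> 0" for v
      using r[of "x (pr v)"] pr_val[OF xw, of v] that by (auto simp: AV_def)
    then have "- ln (w n x) = E n"
      using ln_w[OF n xw \<kappa>(2) adm_alt[OF n x]] by (simp add: E_def SV_def c_def e_def)
    moreover have "0 < w n x" using w_pos_iff[OF n xw] adm_alt[OF n x] \<kappa> by simp
    ultimately show ?thesis by (metis exp_ln minus_minus)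
  qed
  have NK: "0 < card (Wd K)" using Wd_nonempty[OF X] by simp
  have cardW: "ln (real (card (Wd n))) = ln (real (card (Wd K))) + E n" if n: "K \<le> n" for n
  proof -
    have "real (card (Wd K)) = (\<Sum>x\<in>Wd n. exp (- E n))"
      unfolding sum_w_Wd[of "\<lambda>_ _. 1", OF _ n, simplified, symmetric]
    proof (rule sum.cong[OF refl])
      fix x assume x: "x \<in> Wd n"
      have "adm K (pre K x)" using x n Wd_pre[of K n x] by (simp add: Wd_def)
      then show "forest_measure.w m a H sc K (\<lambda>_ _. 1) (\<lambda>x. if adm K x then 1 else 0) n x = exp (- E n)"
        by (intro w[OF n x]) auto
    qed
    then have "ln (real (card (Wd K))) = ln (real (card (Wd n)) * exp (- E n))" by simp
    also have "\<dots> = ln (real (card (Wd n))) - E n" using Wd_nonempty[OF X n] by (auto simp: ln_mult)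
    finally show ?thesis by simp
  qed
  have "(\<lambda>n. (ln (real (card (Wd K))) / real n + E n / real n) / ln (real m)) \<longlonglongrightarrow> (0 + (T * ln (real m) + (1 - T) * ln r)) / ln (real m)"
    using ln_m_pos by (intro tendsto_divide tendsto_add El tendsto_const
      tendsto_bounded_over_n[of "\<lambda>_. ln (real (card (Wd K)))" "\<bar>ln (real (card (Wd K)))\<bar>"]) auto
  moreover have "\<forall>\<^sub>F n in sequentially. (ln (real (card (Wd K))) / real n + E n / real n) / ln (real m)
      = ln (real (card (pre n ` X))) / (real n * ln (real m))"
    using eventually_ge_at_top[of K]
  proof eventually_elim
    case (elim n)
    show ?case unfolding pre_X[OF elim] cardW[OF elim] by (simp add: add_divide_distrib)
  qed
  ultimately have "(\<lambda>n. ln (real (card (pre n ` X))) / (real n * ln (real m))) \<longlonglongrightarrow>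
      (0 + (T * ln (real m) + (1 - T) * ln r)) / ln (real m)"
    by (rule Lim_transform_eventually)
  then have lim: "(\<lambda>n. ln (real (card (pre n ` X))) / (real n * ln (real m))) \<longlonglongrightarrow> D"
    by (simp add: D_def)
  then have mink: "has_minkowski_dim X D" using has_minkowski_dim_iff[OF X_full] by simp
  have "ereal D \<le> hausdorff_dim X"
  proof (rule ereal_le_epsilon2)
    fix \<epsilon> :: real assume \<epsilon>: "0 < \<epsilon>"
    obtain x0 where x0: "x0 \<in> Wd K" using NK by (auto simp: card_gt_0_iff)
    \<comment> \<open>All mass is put on one initial word, so that the total is 1.\<close>
    define \<kappa> where "\<kappa> x = (if x = x0 then 1 else 0 :: real)" for x
    interpret forest_measure m a H sc q Cq lam K "\<lambda>_ _. 1" \<kappa>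
      by unfold_locales (auto simp: \<kappa>_def)
    define s where "s = D - \<epsilon>"
    have "s * ln (real m) < T * ln (real m) + (1 - T) * ln r"
      using \<epsilon> ln_m_pos by (simp add: s_def D_def field_simps)
    from order_tendstoD(1)[OF El this] obtain k0 where k0: "\<And>n. k0 \<le> n \<Longrightarrow> s * ln (real m) < E n / real n"
      unfolding eventually_sequentially by blast
    have xadm: "x \<in> Wd n" if "K \<le> n" "x \<in> words m n" "0 < w n x" for n x
    proof -
      have "pre K x = x0" using w_pos_iff[OF that(1,2)] that by (auto simp: \<kappa>_def split: if_splits)
      then have "adm K x" using x0 adm_cong[of K x "pre K x"] by (auto simp: Wd_def)
      then show ?thesis using w_pos_iff[OF that(1,2)] that adm_iff[OF that(1)] by (auto simp: Wd_def)
    qed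
    have "ereal s \<le> hausdorff_dim X"
    proof (rule hausdorff_dim_ge[OF X_full, of "max 1 k0" s 0])
      have "(\<Sum>x\<in>words m K. w K x) = (\<Sum>x\<in>words m K. if x = x0 then 1 else 0)"
        by (intro sum.cong) (auto simp: w_K \<kappa>_def)
      then show "(\<Sum>x\<in>words m K. w K x) = 1" using x0 by (simp add: Wd_def)
    next
      fix x assume x: "x \<in> full_shift m" "\<And>n. K \<le> n \<Longrightarrow> 0 < w n (pre n x)"
      have "adm n x" if "K \<le> n" for n
        using xadm[OF that pre_in_words[OF x(1)] x(2)[OF that]] adm_cong[OF that, of x "pre n x"] by (auto simp: Wd_def)
      then show "x \<in> X" using x X_iff by auto
    next
      fix k assume k: "max 1 k0 \<le> k" "K \<le> k ^ 4"
      have kk: "k \<le> k ^ 4" using k by (intro self_le_power) auto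
      have le: "w (k ^ 4) x \<le> real m powr (- (s * real (k ^ 4)))" if x: "x \<in> words m (k ^ 4)" for x
      proof (cases "0 < w (k ^ 4) x")
        case True
        then have "x \<in> Wd (k ^ 4)" using xadm k x by blast
        moreover have "\<kappa> (pre K x) = 1" using True w_pos_iff[OF k(2) x] by (auto simp: \<kappa>_def split: if_splits)
        ultimately have "w (k ^ 4) x = exp (- E (k ^ 4))" using k by (intro w) (auto simp: \<kappa>_def)
        also have "s * ln (real m) * real (k ^ 4) \<le> E (k ^ 4)"
          using k0[of "k ^ 4"] k kk by (auto simp: field_simps)
        then have "exp (- E (k ^ 4)) \<le> exp (- (s * real (k ^ 4)) * ln (real m))" by (simp add: mult.commute mult.left_commute)
        finally show ?thesis using m2 by (simp add: powr_def)
      qed (metis linorder_not_le order.trans order_less_imp_le powr_ge_zero)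
      have "(\<Sum>x\<in>words m (k ^ 4). w (k ^ 4) x * (if real m powr (- (s * real (k ^ 4))) < w (k ^ 4) x then 1 else 0)) = 0"
      proof (intro sum.neutral ballI)
        fix x assume "x \<in> words m (k ^ 4)"
        from le[OF this] show "w (k ^ 4) x * (if real m powr (- (s * real (k ^ 4))) < w (k ^ 4) x then 1 else 0) = 0"
          by simp
      qed
      then show "(\<Sum>x\<in>words m (k ^ 4). w (k ^ 4) x * (if real m powr (- (s * real (k ^ 4))) < w (k ^ 4) x then 1 else 0)) \<le> 0 / (real k)\<^sup>2"
        by simp
    qed
    then have "ereal s + ereal \<epsilon> \<le> hausdorff_dim X + ereal \<epsilon>" by (rule add_right_mono)
    then show "ereal D \<le> hausdorff_dim X + ereal \<epsilon>" by (simp add: s_def)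
  qed
  then show ?thesis using mink hausdorff_dim_le_minkowski[OF X_full mink] antisym by blast
qed

end

section \<open>Strict inequality of the dimensions for unequal row sums\<close>

text \<open>The Cauchy-Schwarz inequality, with strictness from the positive variance of the values
  \<open>sqrt (f i)\<close>.\<close>

lemma sum_sqrt_less:
  fixes f :: "nat \<Rightarrow> real"
  assumes "\<And>i. i < m \<Longrightarrow> 0 < f i" "i0 < m" "j0 < m" "f i0 \<noteq> f j0"
  shows "(\<Sum>i<m. sqrt (f i))\<^sup>2 < real m * (\<Sum>i<m. f i)"
proof -
  define Q where "Q = (\<Sum>i<m. sqrt (f i))"
  define \<mu> where "\<mu> = Q / real m"
  have m0: "0 < real m" using assms by simp
  have "sqrt (f i0) \<noteq> \<mu> \<or> sqrt (f j0) \<noteq> \<mu>" using assms by auto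
  then obtain i where i: "i < m" "sqrt (f i) \<noteq> \<mu>" using assms by blast
  have "0 < (\<Sum>i<m. (sqrt (f i) - \<mu>)\<^sup>2)" using i by (intro sum_pos2[of _ i]) auto
  also have "\<dots> = (\<Sum>i<m. f i - 2 * \<mu> * sqrt (f i) + \<mu>\<^sup>2)"
    using assms(1) by (intro sum.cong refl) (auto simp: power2_diff less_imp_le)
  also have "\<dots> = (\<Sum>i<m. f i) - 2 * \<mu> * Q + real m * \<mu>\<^sup>2"
    by (simp add: sum.distrib sum_subtractf sum_distrib_left Q_def)
  also have "\<dots> = (\<Sum>i<m. f i) - Q\<^sup>2 / real m"
    using m0 by (simp add: \<mu>_def power2_eq_square field_simps)
  finally show ?thesis using m0 by (simp add: Q_def field_simps)
qed

context forest
begin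

lemma words_upd': "x \<in> words m n \<Longrightarrow> 1 \<le> s \<Longrightarrow> s \<le> n \<Longrightarrow> b < m \<Longrightarrow> x(s := b) \<in> words m n"
  by (auto simp: words_def PiE_iff extensional_def)

text \<open>No edge that ends by \<open>n\<close> touches \<open>s\<close>, so its symbol may be
  replaced at will.\<close>

lemma free_resample:
  assumes s: "K < s" "s \<le> n" "pr s = 0" "s \<in> H \<Longrightarrow> n < sc s"
    and G: "\<And>x b. G (x(s := b)) = (G x :: real)"
  shows "real m * (\<Sum>x\<in>Wd n. G x * h (x s)) = (\<Sum>b<m. h b) * (\<Sum>x\<in>Wd n. G x)"
proof -
  have s1: "1 \<le> s" using s by simp
  have "real (card {..<m}) * (\<Sum>x\<in>Wd n. G x * h (x s)) = (\<Sum>b<m. h b) * (\<Sum>x\<in>Wd n. G x)"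
  proof (rule sum_resample[where put = "\<lambda>x b. x(s := b)"])
    fix x b assume x: "x \<in> Wd n" and b: "b \<in> {..<m}"
    have "adm n (x(s := b))" unfolding adm_def
    proof (intro ballI impI)
      fix u assume u: "u \<in> H" "1 \<le> sc u" "sc u \<le> n"
      have "u \<noteq> s" using s(4) u by auto
      moreover have "sc u \<noteq> s" using pr_sc[of u] s u H0 by metis
      ultimately show "a ((x(s := b)) u) ((x(s := b)) (sc u)) = 1" using x u by (auto simp: Wd_def adm_def)
    qed
    then show "x(s := b) \<in> Wd n" using words_upd'[of x n s b] x b s1 s by (auto simp: Wd_def)
  qed (use s1 s G words_less in \<open>auto simp: Wd_def\<close>)
  then show ?thesis by simp
qed

text \<open>Up to \<open>n\<close> the orbit of \<open>s\<close> consists of \<open>s\<close> and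
  \<open>sc s\<close>, so the pairs of symbols fitting this edge may be exchanged at will. A symbol
  \<open>b\<close> at \<open>s\<close> occurs in as many such pairs as its row sum says.\<close>

lemma pair_resample:
  assumes s: "K < s" "s \<in> H" "pr s = 0" "sc s \<le> n" "sc s \<in> H \<Longrightarrow> n < sc (sc s)"
    and G: "\<And>x b c. G (x(s := b, sc s := c)) = (G x :: real)"
  shows "(\<Sum>b<m. \<Sum>c<m. a b c) * (\<Sum>x\<in>Wd n. G x * h (x s)) = (\<Sum>b<m. (\<Sum>c<m. a b c) * h b) * (\<Sum>x\<in>Wd n. G x)"
proof -
  define t where "t = sc s"
  define P where "P = {p \<in> {..<m} \<times> {..<m}. a (fst p) (snd p) = 1}"
  have st: "s < t" "1 \<le> s" "t \<le> n" using sc_gt[of s] sc_K[of s] s by (auto simp: t_def)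
  have prt: "pr t = s" unfolding t_def using s sc_K by (intro pr_sc) auto
  have Kt: "K < t" using st s by simp
  have sumP: "(\<Sum>p\<in>P. f (fst p)) = (\<Sum>b<m. (\<Sum>c<m. a b c) * f b)" for f :: "nat \<Rightarrow> real"
  proof -
    have "(\<Sum>p\<in>P. f (fst p)) = (\<Sum>p\<in>{..<m} \<times> {..<m}. if a (fst p) (snd p) = 1 then f (fst p) else 0)"
      unfolding P_def by (subst sum.inter_filter) auto
    also have "\<dots> = (\<Sum>p\<in>{..<m} \<times> {..<m}. a (fst p) (snd p) * f (fst p))"
      using a01 by (intro sum.cong refl) fastforce
    also have "\<dots> = (\<Sum>b<m. \<Sum>c<m. a b c * f b)" by (simp add: sum.cartesian_product case_prod_beta)
    finally show ?thesis by (simp add: sum_distrib_right)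
  qed
  have finP: "finite P" by (simp add: P_def)
  have "real (card P) * (\<Sum>x\<in>Wd n. G x * h (fst (x s, x t))) = (\<Sum>p\<in>P. h (fst p)) * (\<Sum>x\<in>Wd n. G x)"
  proof (rule sum_resample[where get = "\<lambda>x. (x s, x t)" and h = "\<lambda>p. h (fst p)" and put = "\<lambda>x p. x(s := fst p, t := snd p)"])
    show "(x s, x t) \<in> P" if "x \<in> Wd n" for x
      using that st s words_less[of x m n s] words_less[of x m n t] by (auto simp: P_def Wd_def adm_def t_def)
    fix x p assume x: "x \<in> Wd n" and p: "p \<in> P"
    have "adm n (x(s := fst p, t := snd p))" unfolding adm_def
    proof (intro ballI impI)
      fix u assume u: "u \<in> H" "1 \<le> sc u" "sc u \<le> n"
      show "a ((x(s := fst p, t := snd p)) u) ((x(s := fst p, t := snd p)) (sc u)) = 1"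
      proof (cases "u = s")
        case True
        then show ?thesis using p st by (auto simp: P_def t_def)
      next
        case False
        have "u \<noteq> t" using s(5) u by (auto simp: t_def)
        moreover have "sc u \<noteq> s" using pr_sc[of u] s u H0 by metis
        moreover have "sc u \<noteq> t" using pr_sc[of u] u prt False Kt by auto
        ultimately show ?thesis using x u False by (auto simp: Wd_def adm_def)
      qed
    qed
    then show "x(s := fst p, t := snd p) \<in> Wd n"
      using words_upd'[OF words_upd', of x n s "fst p" t "snd p"] x p st by (auto simp: Wd_def P_def)
    show "x(s := fst p, t := snd p, s := fst (x s, x t), t := snd (x s, x t)) = x"
      using st by (auto simp: fun_eq_iff)
    show "((x(s := fst p, t := snd p)) s, (x(s := fst p, t := snd p)) t) = p" using st by auto
  qed (use finP G in \<open>auto simp: t_def\<close>)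
  moreover have "real (card P) = (\<Sum>b<m. \<Sum>c<m. a b c)" using sumP[of "\<lambda>_. 1"] by simp
  ultimately show ?thesis using sumP[of h] by simp
qed

lemma free_product:
  assumes "finite W" "\<And>s. s \<in> W \<Longrightarrow> K < s \<and> s \<le> n \<and> pr s = 0 \<and> (s \<in> H \<longrightarrow> n < sc s)"
  shows "(\<Sum>x\<in>Wd n. \<Prod>s\<in>W. h (x s)) = ((\<Sum>b<m. h b) / real m) ^ card W * real (card (Wd n))"
  using assms
proof (induction W rule: finite_induct)
  case (insert s W)
  have m0: "0 < real m" using m2 by simp
  have "(\<Sum>x\<in>Wd n. \<Prod>s\<in>insert s W. h (x s)) = (\<Sum>x\<in>Wd n. (\<Prod>s\<in>W. h (x s)) * h (x s))"
    using insert by (simp add: mult.commute)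
  also have "\<dots> = (\<Sum>b<m. h b) / real m * (\<Sum>x\<in>Wd n. \<Prod>s\<in>W. h (x s))"
  proof -
    have "real m * (\<Sum>x\<in>Wd n. (\<Prod>s\<in>W. h (x s)) * h (x s)) = (\<Sum>b<m. h b) * (\<Sum>x\<in>Wd n. \<Prod>s\<in>W. h (x s))"
      using insert by (intro free_resample) (auto intro!: prod.cong)
    then show ?thesis using m0 by (simp add: field_simps)
  qed
  finally show ?case using insert by simp
qed simp

lemma pair_product:
  assumes "finite W" "\<And>s. s \<in> W \<Longrightarrow> K < s \<and> s \<in> H \<and> pr s = 0 \<and> sc s \<le> n \<and> (sc s \<in> H \<longrightarrow> n < sc (sc s))"
  shows "(\<Sum>x\<in>Wd n. \<Prod>s\<in>W. h (x s)) =
    ((\<Sum>b<m. (\<Sum>c<m. a b c) * h b) / (\<Sum>b<m. \<Sum>c<m. a b c)) ^ card W * real (card (Wd n))"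
  using assms
proof (induction W rule: finite_induct)
  case (insert s W)
  have S0: "0 < (\<Sum>b<m. \<Sum>c<m. a b c)"
  proof (rule sum_pos)
    show "0 < (\<Sum>c<m. a b c)" if "b \<in> {..<m}" for b using row_sum_pos[of b] that by simp
  qed (use m2 in \<open>auto simp: lessThan_empty_iff\<close>)
  have "(\<Sum>x\<in>Wd n. \<Prod>s\<in>insert s W. h (x s)) = (\<Sum>x\<in>Wd n. (\<Prod>s\<in>W. h (x s)) * h (x s))"
    using insert by (simp add: mult.commute)
  also have "\<dots> = (\<Sum>b<m. (\<Sum>c<m. a b c) * h b) / (\<Sum>b<m. \<Sum>c<m. a b c) * (\<Sum>x\<in>Wd n. \<Prod>s\<in>W. h (x s))"
  proof -
    have "pr (sc s) = s" "s \<noteq> 0" using insert.prems[of s] sc_K[of s] pr_sc[of s] H0 by auto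
    \<comment> \<open>The pair resampling also changes the symbol at \<open>sc s\<close>, which must
      not enter the remaining product.\<close>
    then have nin: "sc s \<notin> W" using insert.prems[of "sc s"] by auto
    have "(\<Sum>b<m. \<Sum>c<m. a b c) * (\<Sum>x\<in>Wd n. (\<Prod>s\<in>W. h (x s)) * h (x s)) =
       (\<Sum>b<m. (\<Sum>c<m. a b c) * h b) * (\<Sum>x\<in>Wd n. \<Prod>s\<in>W. h (x s))"
      using insert nin by (intro pair_resample) (auto intro!: prod.cong)
    then show ?thesis using S0 by (simp add: field_simps)
  qed
  finally show ?case using insert by simp
qed simp

text \<open>Words of length \<open>n\<close> prefer the uniform distribution on starts whose successor lies beyond \<open>n\<close>,
  words of length about \<open>q * n\<close> prefer there the distribution proportional to the row sums.
  Weighting symbols by the square root of the row sum separates the two.\<close>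

lemma unequal_rows:
  assumes rows: "i0 < m" "j0 < m" "(\<Sum>c<m. a i0 c) \<noteq> (\<Sum>c<m. a j0 c)"
    and X: "X \<noteq> {}"
    and \<theta>: "0 < \<theta>"
    and starts: "\<And>x y. K \<le> x \<Longrightarrow> x \<le> y \<Longrightarrow>
      \<theta> * (real y - real x) - c0 \<le> real (card {s \<in> H. pr s = 0 \<and> x < s \<and> s \<le> y})"
    and mink: "has_minkowski_dim X D"
  shows "hausdorff_dim X < ereal D"
proof -
  define rs where "rs b = (\<Sum>c<m. a b c)" for b
  define S where "S = (\<Sum>b<m. rs b)"
  define Q where "Q = (\<Sum>b<m. sqrt (rs b))"
  \<comment> \<open>This normalisation gives \<open>g\<close> under the uniform distribution and
    \<open>1 / g\<close> under the row-sum distribution the same mean \<rho>.\<close>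
  define c where "c = sqrt (real m) / sqrt S"
  define g where "g b = c * sqrt (rs b)" for b
  define \<rho> where "\<rho> = Q / (sqrt (real m) * sqrt S)"
  have m0: "0 < real m" using m2 by simp
  have rs1: "1 \<le> rs b" if "b < m" for b using row_sum_pos[OF that] by (simp add: rs_def)
  have rs0: "0 < rs b" if "b < m" for b using rs1[OF that] by simp
  have S0: "0 < S" unfolding S_def using rs0 m2 by (intro sum_pos) (auto simp: lessThan_empty_iff)
  have Q0: "0 < Q" unfolding Q_def using rs0 m2 by (intro sum_pos) (auto simp: lessThan_empty_iff)
  have c0: "0 < c" using m0 S0 by (simp add: c_def)
  have g0: "0 < g b" if "b < m" for b using c0 rs0[OF that] by (simp add: g_def)
  have \<rho>0: "0 < \<rho>" using Q0 m0 S0 by (simp add: \<rho>_def)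
  have "Q\<^sup>2 < real m * S" unfolding Q_def S_def using rs0 rows by (intro sum_sqrt_less) (auto simp: rs_def)
  then have "Q < sqrt (real m) * sqrt S" using real_less_rsqrt by (simp add: real_sqrt_mult[symmetric])
  then have \<rho>1: "\<rho> < 1" using m0 S0 by (simp add: \<rho>_def)
  have sq: "sqrt (real m) * sqrt (real m) = real m" "sqrt S * sqrt S = S" using m0 S0 by auto
  have m_g: "(\<Sum>b<m. g b) / real m = \<rho>"
  proof -
    have "(\<Sum>b<m. g b) = c * Q" by (simp add: g_def Q_def sum_distrib_left)
    then show ?thesis using m0 S0 by (simp add: \<rho>_def c_def real_div_sqrt divide_simps) (metis sq(1) mult.assoc mult.commute)
  qed
  have m_g': "(\<Sum>b<m. rs b * (1 / g b)) / S = \<rho>"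
  proof -
    have "rs b * (1 / g b) = sqrt (rs b) / c" if "b < m" for b
      using rs0[OF that] c0 real_sqrt_mult_self[of "rs b"] by (simp add: g_def field_simps)
    then have "(\<Sum>b<m. rs b * (1 / g b)) = Q / c" by (simp add: Q_def sum_divide_distrib)
    then show ?thesis using m0 S0 by (simp add: \<rho>_def c_def divide_simps) (metis sq(2) mult.assoc mult.commute)
  qed

  \<comment> \<open>The margin in \<open>Cp\<close> makes the successor of a start beyond
    \<open>xn n\<close> pass \<open>n\<close>, and the second successor pass \<open>n2 n\<close>, in
    spite of the error \<open>Cq\<close> in every step.\<close>
  define Cp where "Cp = \<bar>Cq\<bar> + (2 * \<bar>Cq\<bar> + 1) / q + 1"
  define xn where "xn n = nat \<lceil>(real n + Cp) / q\<rceil> + K" for n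
  define n2 where "n2 n = nat \<lceil>q * real n + \<bar>Cq\<bar>\<rceil>" for n
  define W where "W n = {s \<in> H. pr s = 0 \<and> xn n < s \<and> s \<le> n}" for n
  have q0: "0 < q" using q1 by simp
  have finW: "finite (W n)" for n by (rule finite_subset[of _ "{..n}"]) (auto simp: W_def)
  have n2b: "q * real n + \<bar>Cq\<bar> \<le> real (n2 n)" "real (n2 n) < q * real n + \<bar>Cq\<bar> + 1" for n
  proof -
    have "0 \<le> q * real n + \<bar>Cq\<bar>" using q0 by simp
    then show "q * real n + \<bar>Cq\<bar> \<le> real (n2 n)" "real (n2 n) < q * real n + \<bar>Cq\<bar> + 1"
      unfolding n2_def by linarith+
  qed
  have n_n2: "n \<le> n2 n" for n
  proof -
    have "real n \<le> q * real n" using q1 mult_right_mono[of 1 q "real n"] by simp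
    then have "real n \<le> real (n2 n)" using n2b(1)[of n] by linarith
    then show ?thesis by simp
  qed
  have Wprop: "K < s" "s \<in> H" "pr s = 0" "s \<le> n" "n < sc s" "sc s \<le> n2 n" "sc s \<in> H \<Longrightarrow> n2 n < sc (sc s)"
    if "s \<in> W n" for s n
  proof -
    have s: "s \<in> H" "pr s = 0" "xn n < s" "s \<le> n" using that by (auto simp: W_def)
    show sK: "K < s" and "s \<in> H" "pr s = 0" "s \<le> n" using s by (auto simp: xn_def)
    have "(real n + Cp) / q \<le> real (xn n)" unfolding xn_def by linarith
    also have "real (xn n) < real s" using s by simp
    finally have "real n + Cp < q * real s" using q0 by (simp add: field_simps)
    then have t: "real n + (2 * \<bar>Cq\<bar> + 1) / q + 1 < real (sc s)"
      using sc_q[OF s(1) sK] unfolding Cp_def by linarith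
    moreover have "0 \<le> (2 * \<bar>Cq\<bar> + 1) / q" using q0 by simp
    ultimately show "n < sc s" by linarith
    have "q * real s \<le> q * real n" using s q0 by simp
    then have "real (sc s) \<le> q * real n + \<bar>Cq\<bar>" using sc_q[OF s(1) sK] by linarith
    then show "sc s \<le> n2 n" using n2b(1)[of n] by linarith
    assume H2: "sc s \<in> H"
    have "q * (real n + (2 * \<bar>Cq\<bar> + 1) / q + 1) < q * real (sc s)" using t q0 by simp
    moreover have "q * (real n + (2 * \<bar>Cq\<bar> + 1) / q + 1) = q * real n + (2 * \<bar>Cq\<bar> + 1) + q"
      using q0 by (simp add: distrib_left add_divide_distrib)
    ultimately have "q * real n + 2 * \<bar>Cq\<bar> + 1 + q < q * real (sc s)" by linarith
    then have "q * real n + \<bar>Cq\<bar> + 1 < real (sc (sc s))" using sc_q[OF H2 sc_K[OF s(1) sK]] q0 by linarith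
    then show "n2 n < sc (sc s)" using n2b(2)[of n] by linarith
  qed
  \<comment> \<open>Every sequence has product at least 1 or below 1. The first is atypical at
    length \<open>n\<close>, where each factor has mean \<rho>, the second at length
    \<open>n2 n\<close>, where each reciprocal has mean \<rho>. Markov's inequality bounds both sets
    of words.\<close>
  define bad1 where "bad1 n = {x \<in> Wd n. 1 \<le> (\<Prod>s\<in>W n. g (x s))}" for n
  define bad2 where "bad2 n = {x \<in> Wd (n2 n). (\<Prod>s\<in>W n. g (x s)) < 1}" for n
  have xW: "x s < m" if "x \<in> Wd k" "s \<in> W n" "n \<le> k" for x s k n
    using that Wprop(1,4)[OF that(2)] words_less[of x m k s] by (auto simp: Wd_def)
  have card1: "real (card (bad1 n)) \<le> \<rho> ^ card (W n) * real (card (Wd n))" for n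
  proof -
    have "real (card (bad1 n)) = (\<Sum>x\<in>bad1 n. 1)" by simp
    also have "\<dots> \<le> (\<Sum>x\<in>bad1 n. \<Prod>s\<in>W n. g (x s))" by (intro sum_mono) (auto simp: bad1_def)
    also have "\<dots> \<le> (\<Sum>x\<in>Wd n. \<Prod>s\<in>W n. g (x s))"
    proof (intro sum_mono2 prod_nonneg finite_Wd)
      fix x s assume "x \<in> Wd n - bad1 n" "s \<in> W n"
      then have "x s < m" using xW by blast
      then show "0 \<le> g (x s)" using g0 by (simp add: less_imp_le)
    qed (auto simp: bad1_def)
    also have "\<dots> = \<rho> ^ card (W n) * real (card (Wd n))"
      unfolding m_g[symmetric] using Wprop by (intro free_product finW) auto
    finally show ?thesis .
  qed
  have card2: "real (card (bad2 n)) \<le> \<rho> ^ card (W n) * real (card (Wd (n2 n)))" for n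
  proof -
    have "real (card (bad2 n)) = (\<Sum>x\<in>bad2 n. 1)" by simp
    also have "\<dots> \<le> (\<Sum>x\<in>bad2 n. \<Prod>s\<in>W n. 1 / g (x s))"
    proof (intro sum_mono)
      fix x assume x: "x \<in> bad2 n"
      then have xw: "x s < m" if "s \<in> W n" for s using xW[OF _ that n_n2] by (auto simp: bad2_def)
      have "0 < (\<Prod>s\<in>W n. g (x s))" using xw by (intro prod_pos) (auto intro: g0)
      moreover have "(\<Prod>s\<in>W n. g (x s)) < 1" using x by (simp add: bad2_def)
      ultimately show "1 \<le> (\<Prod>s\<in>W n. 1 / g (x s))" by (simp add: prod_dividef)
    qed
    also have "\<dots> \<le> (\<Sum>x\<in>Wd (n2 n). \<Prod>s\<in>W n. 1 / g (x s))"
    proof (intro sum_mono2 prod_nonneg finite_Wd)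
      fix x s assume "x \<in> Wd (n2 n) - bad2 n" "s \<in> W n"
      then have "x s < m" using xW[OF _ _ n_n2] by blast
      then show "0 \<le> 1 / g (x s)" using g0 by (simp add: less_imp_le)
    qed (auto simp: bad2_def)
    also have "\<dots> = \<rho> ^ card (W n) * real (card (Wd (n2 n)))"
      unfolding m_g'[symmetric] S_def rs_def using Wprop by (intro pair_product finW) auto
    finally show ?thesis .
  qed

  define \<eta> where "\<eta> = \<theta> * (1 - 1 / q) / 2"
  have \<eta>0: "0 < \<eta>" using \<theta> q1 by (simp add: \<eta>_def)
  \<comment> \<open>The starts in question lie between about \<open>n / q\<close> and
    \<open>n\<close>. Halving their density in the definition of \<eta> absorbs all additive
    constants.\<close>
  have "(\<lambda>n. (\<theta> * (real n - ((real n + Cp) / q + 1 + real K)) - c0) / real n) \<longlonglongrightarrow> \<theta> * (1 - 1 / q)"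
    using q1 by (real_asymp simp: field_simps)
  then have "\<forall>\<^sub>F n in sequentially. \<eta> < (\<theta> * (real n - ((real n + Cp) / q + 1 + real K)) - c0) / real n"
    by (rule order_tendstoD) (use \<eta>0 in \<open>simp add: \<eta>_def\<close>)
  moreover have "\<forall>\<^sub>F n in sequentially. nat \<lceil>- c0 / \<eta>\<rceil> \<le> n" by (rule eventually_ge_at_top)
  ultimately have "\<forall>\<^sub>F n in sequentially. \<eta> * real n \<le> real (card (W n)) \<and> K \<le> n"
    using eventually_gt_at_top[of 0] eventually_ge_at_top[of K]
  proof eventually_elim
    case (elim n)
    have Cp0: "0 \<le> Cp" using q0 by (simp add: Cp_def)
    then have "0 \<le> (real n + Cp) / q" using q0 by simp
    then have xb: "real (xn n) \<le> (real n + Cp) / q + 1 + real K" unfolding xn_def by linarith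
    have le: "\<eta> * real n \<le> \<theta> * (real n - ((real n + Cp) / q + 1 + real K)) - c0" using elim by (simp add: pos_less_divide_eq)
    have "- c0 / \<eta> \<le> real n" using elim by linarith
    then have "- c0 / \<eta> * \<eta> \<le> real n * \<eta>" using \<eta>0 by (intro mult_right_mono) auto
    then have "- c0 \<le> \<eta> * real n" using \<eta>0 by (simp add: mult.commute)
    then have "0 \<le> \<theta> * (real n - ((real n + Cp) / q + 1 + real K))" using le by linarith
    then have "0 \<le> real n - ((real n + Cp) / q + 1 + real K)" using \<theta> by (simp only: zero_le_mult_iff) linarith
    then have xn: "xn n \<le> n" using xb by linarith
    have "\<eta> * real n \<le> \<theta> * (real n - ((real n + Cp) / q + 1 + real K)) - c0" by (rule le)
    also have "\<dots> \<le> \<theta> * (real n - real (xn n)) - c0" using xb \<theta> by simp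
    also have "\<dots> \<le> real (card (W n))" unfolding W_def by (rule starts) (use xn in \<open>auto simp: xn_def\<close>)
    finally show ?case using elim by simp
  qed
  then obtain n0 where n0: "\<And>n. n0 \<le> n \<Longrightarrow> \<eta> * real n \<le> real (card (W n))" "\<And>n. n0 \<le> n \<Longrightarrow> K \<le> n"
    unfolding eventually_sequentially by blast
  have \<rho>W: "\<rho> ^ card (W n) \<le> \<rho> powr (\<eta> * real n)" if "n0 \<le> n" for n
    using n0(1)[OF that] \<rho>0 \<rho>1 by (simp add: powr_realpow[symmetric] powr_le_cancel_iff powr_mono')

  \<comment> \<open>The saving at level \<open>k\<close> is at least of order
    \<open>\<rho> powr (\<eta> / q * k)\<close>, which equals
    \<open>m powr (- 2 * \<epsilon> * k)\<close>. One \<epsilon> pays for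
    \<open>D + \<epsilon>\<close> in the count of words, the other one is the gain.\<close>
  define \<epsilon> where "\<epsilon> = - (\<eta> / q) * ln \<rho> / (2 * ln (real m))"
  have "0 < - (\<eta> * ln \<rho>) / (q * (2 * ln (real m)))"
    using \<eta>0 q0 \<rho>0 \<rho>1 ln_m_pos by (intro divide_pos_pos) (auto simp: mult_pos_neg)
  then have \<epsilon>0: "0 < \<epsilon>" by (simp add: \<epsilon>_def)
  have \<rho>m: "\<rho> powr (\<eta> / q * t) = real m powr (- 2 * \<epsilon> * t)" for t
    using \<rho>0 m0 ln_m_pos by (simp add: powr_def \<epsilon>_def)
  have D: "(\<lambda>n. ln (real (card (pre n ` X))) / (real n * ln (real m))) \<longlonglongrightarrow> D"
    using mink has_minkowski_dim_iff[OF X_full] by simp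
  obtain n1 where n1: "\<And>n. n1 \<le> n \<Longrightarrow> real (card (pre n ` X)) \<le> real m powr ((D + \<epsilon>) * real n)"
    using card_pre_le[OF D, of "D + \<epsilon>"] \<epsilon>0 unfolding eventually_sequentially by auto
  define C2 where "C2 = \<rho> powr (- \<eta> * (\<bar>Cq\<bar> + 1) / q)"
  have C21: "1 \<le> C2" unfolding C2_def using \<rho>0 \<rho>1 \<eta>0 q0 by (simp add: powr_def mult_nonneg_nonpos divide_nonpos_pos mult_nonpos_nonneg)
  \<comment> \<open>A level can play both roles: it is itself a length \<open>n\<close>, and it may
    be \<open>n2 n\<close> for one further \<open>n\<close>.\<close>
  define L where "L k = bad1 k \<union> (if k \<in> range n2 then bad2 (inv_into UNIV n2 k) else {})" for k
  have inj_n2: "inj n2"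
  proof (rule strict_mono_imp_inj_on, rule strict_monoI_Suc)
    fix n
    have "q * real (Suc n) + \<bar>Cq\<bar> = q * real n + \<bar>Cq\<bar> + q" by (simp add: algebra_simps)
    then have "real (n2 n) < real (n2 (Suc n))" using n2b(2)[of n] n2b(1)[of "Suc n"] q1 by linarith
    then show "n2 n < n2 (Suc n)" by simp
  qed
  define k1 where "k1 = Max {n0, n1, K, nat \<lceil>q * real n0 + \<bar>Cq\<bar> + 1\<rceil>}"
  have k1: "n0 \<le> k1" "n1 \<le> k1" "K \<le> k1" "q * real n0 + \<bar>Cq\<bar> + 1 \<le> real k1"
  proof -
    show "n0 \<le> k1" "n1 \<le> k1" "K \<le> k1" by (auto simp: k1_def)
    have "nat \<lceil>q * real n0 + \<bar>Cq\<bar> + 1\<rceil> \<le> k1" unfolding k1_def by (intro Max_ge) auto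
    then show "q * real n0 + \<bar>Cq\<bar> + 1 \<le> real k1" by linarith
  qed
  have cardL: "real (card (L k)) \<le> 2 * C2 * real m powr ((D - \<epsilon>) * real k)" if k: "k1 \<le> k" for k
  proof -
    have N: "real (card (Wd k)) \<le> real m powr ((D + \<epsilon>) * real k)" using n1[of k] pre_X[of k] k k1 by simp
    define M where "M = C2 * real m powr ((D - \<epsilon>) * real k)"
    have M: "C2 * \<rho> powr (\<eta> / q * real k) * real m powr ((D + \<epsilon>) * real k) = M"
      unfolding \<rho>m M_def using m0 by (simp add: powr_add[symmetric]) (simp add: algebra_simps)
    have "real (card (bad1 k)) \<le> \<rho> powr (\<eta> * real k) * real m powr ((D + \<epsilon>) * real k)"
      using card1[of k] \<rho>W[of k] N k k1 \<rho>0 by (auto intro: order_trans[OF _ mult_mono])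
    also have "\<dots> \<le> C2 * \<rho> powr (\<eta> / q * real k) * real m powr ((D + \<epsilon>) * real k)"
    proof (rule mult_right_mono)
      have "\<eta> / q * real k \<le> \<eta> * real k" using \<eta>0 q1 by (intro mult_right_mono) (auto simp: field_simps)
      then have "\<rho> powr (\<eta> * real k) \<le> 1 * \<rho> powr (\<eta> / q * real k)" using \<rho>0 \<rho>1 by (simp add: powr_mono')
      also have "\<dots> \<le> C2 * \<rho> powr (\<eta> / q * real k)" using C21 by (intro mult_right_mono) auto
      finally show "\<rho> powr (\<eta> * real k) \<le> C2 * \<rho> powr (\<eta> / q * real k)" .
    qed simp
    finally have b1: "real (card (bad1 k)) \<le> M" using M by simp
    have b2: "real (card (if k \<in> range n2 then bad2 (inv_into UNIV n2 k) else {})) \<le> M"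
    proof (cases "k \<in> range n2")
      case True
      then obtain n where n: "k = n2 n" by blast
      then have inv: "inv_into UNIV n2 k = n" using inj_n2 by simp
      have "q * real n0 < q * real n" using n2b(2)[of n] n k k1 by linarith
      then have nn0: "n0 \<le> n" using q0 by simp
      have "real (card (bad2 n)) \<le> \<rho> powr (\<eta> * real n) * real m powr ((D + \<epsilon>) * real k)"
        using card2[of n] \<rho>W[OF nn0] N n \<rho>0 by (auto intro: order_trans[OF _ mult_mono])
      also have "\<dots> \<le> C2 * \<rho> powr (\<eta> / q * real k) * real m powr ((D + \<epsilon>) * real k)"
      proof (rule mult_right_mono)
        have "real k - (\<bar>Cq\<bar> + 1) \<le> q * real n" using n2b(2)[of n] n by linarith
        then have "\<eta> / q * (real k - (\<bar>Cq\<bar> + 1)) \<le> \<eta> / q * (q * real n)" using \<eta>0 q0 by (intro mult_left_mono) auto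
        then have "\<rho> powr (\<eta> * real n) \<le> \<rho> powr (\<eta> / q * (real k - (\<bar>Cq\<bar> + 1)))"
          using \<rho>0 \<rho>1 q0 by (intro powr_mono') auto
        also have "\<dots> = C2 * \<rho> powr (\<eta> / q * real k)"
          unfolding C2_def using \<rho>0 by (simp add: powr_add[symmetric]) (simp add: algebra_simps diff_divide_distrib add_divide_distrib)
        finally show "\<rho> powr (\<eta> * real n) \<le> C2 * \<rho> powr (\<eta> / q * real k)" .
      qed simp
      finally show ?thesis using True inv M by simp
    qed (use C21 in \<open>simp add: M_def\<close>)
    have "card (L k) \<le> card (bad1 k) + card (if k \<in> range n2 then bad2 (inv_into UNIV n2 k) else {})"
      unfolding L_def by (rule card_Un_le)
    then show ?thesis using b1 b2 unfolding M_def by linarith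
  qed
  have Lw: "L k \<subseteq> words m k" for k
    using inj_n2 by (auto simp: L_def bad1_def bad2_def Wd_def)
  have cover: "\<exists>k\<ge>n. pre k x \<in> L k" if x: "x \<in> X" for x n
  proof -
    define N where "N = max n K"
    have N: "n \<le> N" "K \<le> N" "K \<le> n2 N" using n_n2[of N] by (auto simp: N_def)
    have in1: "pre N x \<in> Wd N" "pre (n2 N) x \<in> Wd (n2 N)" using pre_X N x by blast+
    have eq: "(\<Prod>s\<in>W N. g (pre k x s)) = (\<Prod>s\<in>W N. g (x s))" if "N \<le> k" for k
    proof (rule prod.cong[OF refl])
      fix s assume "s \<in> W N"
      then show "g (pre k x s) = g (x s)" using Wprop(1,4)[of s N] that by (simp add: pre_apply)
    qed
    show ?thesis
    proof (cases "1 \<le> (\<Prod>s\<in>W N. g (x s))")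
      case True
      then have "pre N x \<in> L N" using in1 eq[of N] by (simp add: L_def bad1_def)
      then show ?thesis using N by blast
    next
      case False
      then have "pre (n2 N) x \<in> bad2 N" using in1 eq[of "n2 N"] n_n2 by (simp add: bad2_def)
      then have "pre (n2 N) x \<in> L (n2 N)" using inj_n2 by (simp add: L_def)
      then show ?thesis using N n_n2[of N] by (intro exI[of _ "n2 N"]) auto
    qed
  qed
  \<comment> \<open>Otherwise the bound on \<open>card (L k)\<close> would fall below 1, although a
    point of \<open>X\<close> provides nonempty lists at arbitrarily high levels.\<close>
  have De: "0 \<le> D - \<epsilon>"
  proof (rule ccontr)
    assume neg: "\<not> 0 \<le> D - \<epsilon>"
    have "(\<lambda>k. 2 * C2 * (real m powr (D - \<epsilon>)) ^ k) \<longlonglongrightarrow> 2 * C2 * 0"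
      using neg m2 by (intro tendsto_intros LIMSEQ_power_zero) (auto simp: powr_less_one)
    then have "\<forall>\<^sub>F k in sequentially. 2 * C2 * (real m powr (D - \<epsilon>)) ^ k < 1"
      by (rule order_tendstoD) simp
    then obtain k2 where k2: "\<And>k. k2 \<le> k \<Longrightarrow> 2 * C2 * (real m powr (D - \<epsilon>)) ^ k < 1"
      unfolding eventually_sequentially by blast
    obtain x where "x \<in> X" using X by blast
    from cover[OF this, of "max k1 k2"] obtain k where k: "k1 \<le> k" "k2 \<le> k" "pre k x \<in> L k" by auto
    have "finite (L k)" using Lw finite_words finite_subset by blast
    then have "1 \<le> real (card (L k))" using k(3) by (metis One_nat_def Suc_leI card_gt_0_iff empty_iff of_nat_1 of_nat_mono)
    moreover have "(real m powr (D - \<epsilon>)) ^ k = real m powr ((D - \<epsilon>) * real k)"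
      using m0 by (simp add: powr_realpow[symmetric] powr_powr)
    ultimately show False using cardL[OF k(1)] k2[OF k(2)] by simp
  qed
  have "hausdorff_dim X \<le> ereal (D - \<epsilon>)"
    by (rule hausdorff_dim_le[OF X_full Lw cardL cover De])
  also have "\<dots> < ereal D" using \<epsilon>0 by simp
  finally show ?thesis .
qed

end

section \<open>The Minkowski dimension\<close>

context forest
begin

text \<open>Passing from the ends of edges to their beginnings is what lets normalisations meet
  symbol weights.\<close>

lemma sum_pr:
  fixes F :: "nat \<Rightarrow> real"
  shows "(\<Sum>v | v \<in> {K<..n} \<and> K < pr v. F (pr v)) = (\<Sum>u | u \<in> H \<and> K < u \<and> sc u \<le> n. F u)"
proof (rule sum.reindex_bij_witness[of _ sc pr])
  fix v assume "v \<in> {v. v \<in> {K<..n} \<and> K < pr v}"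
  then have v: "K < v" "v \<le> n" "pr v \<noteq> 0" "K < pr v" by auto
  then show "sc (pr v) = v" "pr v \<in> {u. u \<in> H \<and> K < u \<and> sc u \<le> n}"
    using sc_pr[of v] pr_H[of v] by auto
next
  fix u assume "u \<in> {u. u \<in> H \<and> K < u \<and> sc u \<le> n}"
  then have u: "u \<in> H" "K < u" "sc u \<le> n" by auto
  then show "pr (sc u) = u" "sc u \<in> {v. v \<in> {K<..n} \<and> K < pr v}"
    using pr_sc[of u] sc_K[of u] by auto
qed simp

lemma card_pr_small: "card {v. v \<in> {K<..n} \<and> pr v \<noteq> 0 \<and> pr v \<le> K} \<le> K"
proof -
  have "{v. v \<in> {K<..n} \<and> pr v \<noteq> 0 \<and> pr v \<le> K} \<subseteq> sc ` {1..K}"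
  proof
    fix v assume "v \<in> {v. v \<in> {K<..n} \<and> pr v \<noteq> 0 \<and> pr v \<le> K}"
    then have "v = sc (pr v)" "pr v \<in> {1..K}" using sc_pr[of v] by auto
    then show "v \<in> sc ` {1..K}" by blast
  qed
  from card_mono[OF _ this] card_image_le[of "{1..K}" sc] show ?thesis by simp
qed

lemma sum_pr_split:
  fixes F :: "nat \<Rightarrow> real"
  shows "(\<Sum>v | v \<in> {K<..n} \<and> pr v \<noteq> 0. F v) =
    (\<Sum>v | v \<in> {K<..n} \<and> K < pr v. F v) + (\<Sum>v | v \<in> {K<..n} \<and> pr v \<noteq> 0 \<and> pr v \<le> K. F v)"
  by (subst sum.union_disjoint[symmetric]) (auto intro!: sum.cong)

text \<open>The number of elements after \<open>v\<close> in its orbit that are at most \<open>n\<close>.\<close>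

function lft :: "nat \<Rightarrow> nat \<Rightarrow> nat" where
  "lft n v = (if v \<in> H \<and> K < v \<and> sc v \<le> n then Suc (lft n (sc v)) else 0)"
  by auto
termination
  by (relation "Wellfounded.measure (\<lambda>(n, v). n - v)") (use sc_gt sc_K in fastforce)+

declare lft.simps [simp del]

lemma lam_lft: "K < v \<Longrightarrow> v \<le> n \<Longrightarrow> lam ^ lft n v * real v \<le> real n"
proof (induction n v rule: lft.induct)
  case (1 n v)
  show ?case
  proof (cases "v \<in> H \<and> K < v \<and> sc v \<le> n")
    case True
    have "lam ^ lft n v * real v = lam ^ lft n (sc v) * (lam * real v)" using True by (simp add: lft.simps[of n v])
    also have "\<dots> \<le> lam ^ lft n (sc v) * real (sc v)"
      using True sc_lam[of v] lam1 by (intro mult_left_mono) auto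
    also have "\<dots> \<le> real n" using 1(1)[OF True] True sc_K[of v] by simp
    finally show ?thesis .
  next
    case False
    then have "lft n v = 0" by (subst lft.simps) simp
    then show ?thesis using 1 by simp
  qed
qed

lemma ln_lam_pos: "0 < ln lam" using lam1 by simp

lemma lft_le: "K < v \<Longrightarrow> v \<le> n \<Longrightarrow> real (lft n v) \<le> ln (real n) / ln lam"
proof -
  assume v: "K < v" "v \<le> n"
  have "lam ^ lft n v * 1 \<le> lam ^ lft n v * real v" using v lam1 by (intro mult_left_mono) auto
  then have "lam ^ lft n v \<le> real n" using lam_lft[OF v] by simp
  then have "ln (lam ^ lft n v) \<le> ln (real n)" using lam1 by (intro ln_mono) auto
  then show ?thesis using ln_lam_pos lam1 by (simp add: ln_realpow pos_le_divide_eq)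
qed

text \<open>The number of words \<open>j = j_0, ..., j_p\<close> all of whose transitions are
  allowed by the matrix.\<close>

primrec R :: "nat \<Rightarrow> nat \<Rightarrow> real" where
  "R 0 j = 1"
| "R (Suc p) j = (\<Sum>b<m. a j b * R p b)"

definition Q :: "nat \<Rightarrow> real" where "Q p = (\<Sum>j<m. R p j)"

lemma R_mono: "j < m \<Longrightarrow> R p j \<le> R (Suc p) j"
proof (induction p arbitrary: j)
  case 0
  then show ?case using row_sum_pos[of j] by simp
next
  case (Suc p)
  have "R (Suc p) j \<le> (\<Sum>b<m. a j b * R (Suc p) b)" unfolding R.simps(2)[of p j]
    using Suc a_nonneg by (intro sum_mono mult_left_mono) auto
  then show ?case by simp
qed

lemma R_ge_1: "j < m \<Longrightarrow> 1 \<le> R p j"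
proof (induction p)
  case (Suc p)
  then show ?case using R_mono[of j p] by linarith
qed simp

lemma a_le_1: "i < m \<Longrightarrow> j < m \<Longrightarrow> a i j \<le> 1"
  using a01[of i j] by auto

lemma R_le_Q: "j < m \<Longrightarrow> R (Suc p) j \<le> Q p"
proof -
  assume j: "j < m"
  have "a j b * R p b \<le> 1 * R p b" if "b < m" for b
    using a_le_1[OF j that] R_ge_1[OF that, of p] by (intro mult_right_mono) auto
  then show ?thesis unfolding Q_def R.simps by (intro sum_mono) auto
qed

lemma Q_bounds: "1 \<le> Q p" "Q p \<le> Q (Suc p)" "Q (Suc p) \<le> real m * Q p" "Q 0 = real m"
proof -
  have "(\<Sum>j<m. 1) \<le> Q p" unfolding Q_def using R_ge_1 by (intro sum_mono) auto
  then show "1 \<le> Q p" using m2 by simp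
  show "Q p \<le> Q (Suc p)" unfolding Q_def using R_mono by (intro sum_mono) auto
  have "Q (Suc p) \<le> (\<Sum>j<m. Q p)" unfolding Q_def[of "Suc p"] using R_le_Q by (intro sum_mono) auto
  then show "Q (Suc p) \<le> real m * Q p" by simp
  show "Q 0 = real m" by (simp add: Q_def)
qed

lemma Q_le: "Q p \<le> real m ^ Suc p"
proof (induction p)
  case (Suc p)
  have "Q (Suc p) \<le> real m * Q p" by (rule Q_bounds)
  also have "\<dots> \<le> real m * real m ^ Suc p" using Suc by (intro mult_left_mono) auto
  finally show ?case by simp
qed (simp add: Q_bounds)

lemma ln_Q_bounds: "0 \<le> ln (Q p)" "ln (Q p) \<le> real (Suc p) * ln (real m)"
proof -
  show "0 \<le> ln (Q p)" using Q_bounds(1) by simp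
  have "ln (Q p) \<le> ln (real m ^ Suc p)" using Q_le[of p] Q_bounds(1)[of p] by (intro ln_mono) auto
  then show "ln (Q p) \<le> real (Suc p) * ln (real m)" using m2 by (simp add: ln_realpow del: power_Suc)
qed

text \<open>The cost of an element of depth \<open>p\<close>: summed over the depths from
  \<open>0\<close> to \<open>p\<close>, it gives \<open>ln (Q p)\<close>.\<close>

definition cQ :: "nat \<Rightarrow> real" where
  "cQ p = ln (Q p) - (if p = 0 then 0 else ln (Q (p - 1)))"

lemma cQ_bounds: "\<bar>cQ p\<bar> \<le> ln (real m)"
proof (cases p)
  case 0
  then show ?thesis using ln_m_pos by (simp add: cQ_def Q_bounds)
next
  case (Suc r)
  have "ln (Q r) \<le> ln (Q (Suc r))" using Q_bounds(1,2)[of r] by (intro ln_mono) auto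
  moreover have "ln (Q (Suc r)) \<le> ln (real m * Q r)" using Q_bounds(1)[of "Suc r"] Q_bounds(3)[of r] by (intro ln_mono) auto
  moreover have "ln (real m * Q r) = ln (real m) + ln (Q r)" using Q_bounds(1)[of r] m2 by (subst ln_mult) auto
  ultimately show ?thesis using Suc by (simp add: cQ_def)
qed

text \<open>Along an orbit above \<open>K\<close> the sum \<open>dep v + lft n v\<close> is
  constant, namely the depth of the last element up to \<open>n\<close>. Subtracting the sum of
  \<open>G\<close> over edges from its sum over nodes leaves one term per orbit, which can be read
  at the first or at the last element. The second reading telescopes into \<open>cQ\<close>.\<close>

lemma sum_starts_Q:
  "(\<Sum>v | v \<in> {K<..n} \<and> pr v \<le> K. ln (Q (lft n v))) = (\<Sum>v\<in>{K<..n}. cQ (dep v))"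
proof -
  define G where "G v = ln (Q (dep v + lft n v))" for v
  define Hn where "Hn = {u. u \<in> H \<and> K < u \<and> sc u \<le> n}"
  have sub: "Hn \<subseteq> {K<..n}" using sc_gt sc_K by (fastforce simp: Hn_def)
  have G_pr: "G (pr v) = G v" if v: "v \<in> {K<..n}" "K < pr v" for v
  proof -
    have "pr v \<in> H" "sc (pr v) = v" using pr_H[of v] sc_pr[of v] v by auto
    then have "lft n (pr v) = Suc (lft n v)" using v by (simp add: lft.simps[of n "pr v"])
    moreover have "dep v = Suc (dep (pr v))" using v by (simp add: dep.simps[of v])
    ultimately show ?thesis by (simp add: G_def)
  qed
  have split: "(\<Sum>v\<in>{K<..n}. F v) = (\<Sum>v | v \<in> {K<..n} \<and> pr v \<le> K. F v) + (\<Sum>v | v \<in> {K<..n} \<and> K < pr v. F v)"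
    for F :: "nat \<Rightarrow> real"
    by (subst sum.union_disjoint[symmetric]) (auto intro!: sum.cong)
  have last: "F (dep v + lft n v) = F (dep v)" if "v \<in> {K<..n} - Hn" for v and F :: "nat \<Rightarrow> real"
  proof -
    have "lft n v = 0" using that by (subst lft.simps) (auto simp: Hn_def)
    then show ?thesis by simp
  qed
  have "(\<Sum>v | v \<in> {K<..n} \<and> pr v \<le> K. ln (Q (lft n v))) = (\<Sum>v | v \<in> {K<..n} \<and> pr v \<le> K. G v)"
    by (intro sum.cong refl) (simp add: G_def dep.simps)
  also have "\<dots> = (\<Sum>v\<in>{K<..n}. G v) - (\<Sum>v | v \<in> {K<..n} \<and> K < pr v. G (pr v))"
    unfolding split[of G] using G_pr by simp
  also have "\<dots> = (\<Sum>v\<in>{K<..n}. G v) - (\<Sum>v\<in>Hn. G v)" unfolding sum_pr Hn_def ..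
  also have "\<dots> = (\<Sum>v\<in>{K<..n} - Hn. G v)" using sub by (subst sum_diff) auto
  also have "\<dots> = (\<Sum>v\<in>{K<..n} - Hn. ln (Q (dep v)))"
    unfolding G_def using last[of _ "\<lambda>k. ln (Q k)"] by (intro sum.cong refl) blast
  also have "\<dots> = (\<Sum>v\<in>{K<..n}. ln (Q (dep v))) - (\<Sum>v\<in>Hn. ln (Q (dep v)))"
    using sub by (subst sum_diff) auto
  also have "(\<Sum>v\<in>Hn. ln (Q (dep v))) = (\<Sum>v | v \<in> {K<..n} \<and> K < pr v. ln (Q (dep (pr v))))"
    unfolding Hn_def by (rule sum_pr[where F = "\<lambda>u. ln (Q (dep u))" and n = n, symmetric])
  also have "\<dots> = (\<Sum>v\<in>{K<..n}. if K < pr v then ln (Q (dep (pr v))) else 0)"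
    by (subst sum.If_cases) (simp_all add: Int_def)
  also have "(\<Sum>v\<in>{K<..n}. ln (Q (dep v))) - \<dots> = (\<Sum>v\<in>{K<..n}. cQ (dep v))"
    unfolding sum_subtractf[symmetric]
  proof (rule sum.cong[OF refl])
    fix v assume v: "v \<in> {K<..n}"
    show "ln (Q (dep v)) - (if K < pr v then ln (Q (dep (pr v))) else 0) = cQ (dep v)"
    proof (cases "K < pr v")
      case True
      then have "dep v = Suc (dep (pr v))" using v by (simp add: dep.simps[of v])
      then show ?thesis using True by (simp add: cQ_def)
    next
      case False
      then have "dep v = 0" by (subst dep.simps) simp
      then show ?thesis using False by (simp add: cQ_def)
    qed
  qed
  finally show ?thesis .
qed

text \<open>With \<open>V v = R (lft n v)\<close>, which depends on \<open>n\<close>, the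
  normalisation on an edge from above \<open>K\<close> equals the weight at its beginning. All
  admissible words then have nearly the same weight, and the total mass determines their
  number.\<close>

lemma card_Wd_bound:
  assumes X: "X \<noteq> {}" and n: "K \<le> n" "1 \<le> n"
  shows "\<bar>ln (real (card (Wd n))) - (\<Sum>v\<in>{K<..n}. cQ (dep v)) - ln (real (card (Wd K)))\<bar>
     \<le> real K * ((2 + ln (real n) / ln lam) * ln (real m))" (is "\<bar>_ - ?\<Theta> - _\<bar> \<le> ?err")
proof -
  define V where "V v b = (if b < m then R (lft n v) b else 1)" for v b
  define \<kappa> where "\<kappa> = (\<lambda>x. if adm K x then 1 else 0 :: real)"
  have V0: "0 < V v b" for v b using R_ge_1[of b "lft n v"] by (auto simp: V_def)
  interpret forest_measure m a H sc q Cq lam K V \<kappa>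
    by unfold_locales (auto simp: V0 \<kappa>_def)
  have lnm: "0 < ln (real m)" by (rule ln_m_pos)
  \<comment> \<open>Nodes entered from \<open>{1..K}\<close> begin chains in
    \<open>sum_starts_Q\<close> but are no starts for the measure. There are at most
    \<open>K\<close> of them, each with a logarithmic correction.\<close>
  define small where "small = {v. v \<in> {K<..n} \<and> pr v \<noteq> 0 \<and> pr v \<le> K}"
  have fin_small: "finite small" "card small \<le> K" using card_pr_small[of n] by (simp_all add: small_def)
  have smallb: "0 \<le> (\<Sum>v\<in>small. f v) \<and> (\<Sum>v\<in>small. f v) \<le> ?err"
    if f: "\<And>v. v \<in> small \<Longrightarrow> 0 \<le> f v \<and> f v \<le> real (lft n v + 2) * ln (real m)" for f :: "nat \<Rightarrow> real"
  proof
    show "0 \<le> (\<Sum>v\<in>small. f v)" using f by (intro sum_nonneg) auto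
    have e0: "0 \<le> (2 + ln (real n) / ln lam) * ln (real m)"
      using n lnm ln_lam_pos by (intro mult_nonneg_nonneg add_nonneg_nonneg) auto
    have "(\<Sum>v\<in>small. f v) \<le> real (card small) * ((2 + ln (real n) / ln lam) * ln (real m))"
    proof (rule sum_bounded_above)
      fix v assume v: "v \<in> small"
      have "f v \<le> real (lft n v + 2) * ln (real m)" using f[OF v] by simp
      also have "\<dots> \<le> (2 + ln (real n) / ln lam) * ln (real m)"
        using lft_le[of v n] v lnm by (intro mult_right_mono) (auto simp: small_def)
      finally show "f v \<le> (2 + ln (real n) / ln lam) * ln (real m)" .
    qed
    also have "\<dots> \<le> ?err" using fin_small e0 by (intro mult_right_mono) auto
    finally show "(\<Sum>v\<in>small. f v) \<le> ?err" .
  qed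
  have AV: "AV v c = R (Suc (lft n v)) c" if "c < m" for v c
    unfolding AV_def R.simps V_def by (intro sum.cong) auto
  have SV: "SV v = Q (lft n v)" for v
    unfolding SV_def Q_def V_def by (intro sum.cong) auto
  have lnw: "\<bar>- ln (w n x) - ?\<Theta>\<bar> \<le> ?err" if x: "x \<in> Wd n" for x
  proof -
    have xw: "x \<in> words m n" "adm n x" using x by (auto simp: Wd_def)
    have xv: "x v < m" if "v \<in> {K<..n}" for v using words_less[OF xw(1), of v] that by auto
    have xp: "x (pr v) < m" if "v \<in> {K<..n}" "pr v \<noteq> 0" for v using pr_val[OF xw(1), of v] that by auto
    have \<kappa>1: "\<kappa> (pre K x) = 1" using adm_pre[OF xw(2) n(1)] adm_cong[of K x "pre K x"] by (simp add: \<kappa>_def)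
    have "- ln (w n x) = (\<Sum>v | v \<in> {K<..n} \<and> pr v = 0. ln (SV v)) +
      (\<Sum>v | v \<in> {K<..n} \<and> pr v \<noteq> 0. ln (AV v (x (pr v)))) - (\<Sum>v\<in>{K<..n}. ln (V v (x v)))"
      by (rule ln_w[OF n(1) xw(1) \<kappa>1 adm_alt[OF n(1) x]])
    also have "(\<Sum>v | v \<in> {K<..n} \<and> pr v = 0. ln (SV v)) = ?\<Theta> - (\<Sum>v\<in>small. ln (Q (lft n v)))"
      unfolding sum_starts_Q[symmetric] small_def SV
      by (subst eq_diff_eq, subst sum.union_disjoint[symmetric]) (auto intro!: sum.cong)
    also have "(\<Sum>v | v \<in> {K<..n} \<and> pr v \<noteq> 0. ln (AV v (x (pr v)))) =
        (\<Sum>v | v \<in> {K<..n} \<and> K < pr v. ln (AV v (x (pr v)))) + (\<Sum>v\<in>small. ln (AV v (x (pr v))))"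
      unfolding small_def by (rule sum_pr_split)
    also have "(\<Sum>v | v \<in> {K<..n} \<and> K < pr v. ln (AV v (x (pr v)))) =
        (\<Sum>v | v \<in> {K<..n} \<and> K < pr v. ln (R (lft n (pr v)) (x (pr v))))"
    proof (rule sum.cong[OF refl])
      fix v assume "v \<in> {v. v \<in> {K<..n} \<and> K < pr v}"
      then have v: "v \<in> {K<..n}" "K < pr v" by auto
      then have "lft n (pr v) = Suc (lft n v)" using pr_H[of v] sc_pr[of v] by (simp add: lft.simps[of n "pr v"])
      then show "ln (AV v (x (pr v))) = ln (R (lft n (pr v)) (x (pr v)))" using AV xp v by simp
    qed
    also have "\<dots> = (\<Sum>u | u \<in> H \<and> K < u \<and> sc u \<le> n. ln (R (lft n u) (x u)))" by (rule sum_pr)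
    also have "\<dots> = (\<Sum>u\<in>{K<..n}. ln (R (lft n u) (x u)))"
    proof (rule sum.mono_neutral_left)
      show "{u. u \<in> H \<and> K < u \<and> sc u \<le> n} \<subseteq> {K<..n}" using sc_gt sc_K by fastforce
      show "\<forall>u\<in>{K<..n} - {u. u \<in> H \<and> K < u \<and> sc u \<le> n}. ln (R (lft n u) (x u)) = 0"
      proof
        fix u assume "u \<in> {K<..n} - {u. u \<in> H \<and> K < u \<and> sc u \<le> n}"
        then have "lft n u = 0" by (subst lft.simps) auto
        then show "ln (R (lft n u) (x u)) = 0" by simp
      qed
    qed simp
    also have "\<dots> = (\<Sum>v\<in>{K<..n}. ln (V v (x v)))" using xv by (intro sum.cong) (auto simp: V_def)
    finally have eq: "- ln (w n x) - ?\<Theta> = (\<Sum>v\<in>small. ln (AV v (x (pr v)))) - (\<Sum>v\<in>small. ln (Q (lft n v)))" by simp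
    have lnmono: "real (lft n v + 1) * ln (real m) \<le> real (lft n v + 2) * ln (real m)" for v
      using lnm by (intro mult_right_mono) auto
    have 1: "0 \<le> (\<Sum>v\<in>small. ln (Q (lft n v))) \<and> (\<Sum>v\<in>small. ln (Q (lft n v))) \<le> ?err"
      using ln_Q_bounds lnmono by (intro smallb) (metis Suc_eq_plus1 order_trans)
    have 2: "0 \<le> (\<Sum>v\<in>small. ln (AV v (x (pr v)))) \<and> (\<Sum>v\<in>small. ln (AV v (x (pr v)))) \<le> ?err"
    proof (rule smallb)
      fix v assume "v \<in> small"
      then have c: "x (pr v) < m" using xp by (auto simp: small_def)
      have "1 \<le> AV v (x (pr v))" "AV v (x (pr v)) \<le> Q (lft n v)"
        using AV[OF c] R_ge_1[OF c, of "Suc (lft n v)"] R_le_Q[OF c] by auto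
      then have "0 \<le> ln (AV v (x (pr v)))" "ln (AV v (x (pr v))) \<le> ln (Q (lft n v))" by auto
      then show "0 \<le> ln (AV v (x (pr v))) \<and> ln (AV v (x (pr v))) \<le> real (lft n v + 2) * ln (real m)"
        using ln_Q_bounds(2)[of "lft n v"] lnmono[of v] by simp
    qed
    show ?thesis using eq 1 2 by linarith
  qed
  have NK: "0 < real (card (Wd K))" "0 < real (card (Wd n))" using Wd_nonempty[OF X] n by auto
  have sum: "(\<Sum>x\<in>Wd n. w n x) = real (card (Wd K))"
    unfolding \<kappa>_def by (rule sum_w_Wd) (use V0 n in auto)
  have wpos: "0 < w n x" if x: "x \<in> Wd n" for x
  proof -
    have xw: "x \<in> words m n" "adm n x" using x by (auto simp: Wd_def)
    have "\<kappa> (pre K x) = 1" using adm_pre[OF xw(2) n(1)] adm_cong[of K x "pre K x"] by (simp add: \<kappa>_def)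
    then show ?thesis using w_pos_iff[OF n(1) xw(1)] adm_alt[OF n(1) x] by simp
  qed
  have "real (card (Wd n)) * exp (- ?\<Theta> - ?err) \<le> real (card (Wd K))"
    unfolding sum[symmetric]
  proof (rule sum_bounded_below)
    fix x assume x: "x \<in> Wd n"
    have "- ?\<Theta> - ?err \<le> ln (w n x)" using lnw[OF x] by linarith
    then show "exp (- ?\<Theta> - ?err) \<le> w n x" using wpos[OF x] by (metis exp_le_cancel_iff exp_ln)
  qed
  then have "ln (real (card (Wd n)) * exp (- ?\<Theta> - ?err)) \<le> ln (real (card (Wd K)))" using NK by (intro ln_mono) auto
  then have l: "ln (real (card (Wd n))) - ?\<Theta> - ?err \<le> ln (real (card (Wd K)))" using NK by (auto simp: ln_mult split: if_splits)
  have "real (card (Wd K)) \<le> real (card (Wd n)) * exp (- ?\<Theta> + ?err)"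
    unfolding sum[symmetric]
  proof (rule sum_bounded_above)
    fix x assume x: "x \<in> Wd n"
    have "ln (w n x) \<le> - ?\<Theta> + ?err" using lnw[OF x] by linarith
    then show "w n x \<le> exp (- ?\<Theta> + ?err)" using wpos[OF x] by (metis exp_le_cancel_iff exp_ln)
  qed
  then have "ln (real (card (Wd K))) \<le> ln (real (card (Wd n)) * exp (- ?\<Theta> + ?err))" using NK by (intro ln_mono) auto
  then have "ln (real (card (Wd K))) \<le> ln (real (card (Wd n))) - ?\<Theta> + ?err" using NK by (auto simp: ln_mult split: if_splits)
  with l show ?thesis by linarith
qed

end

context density_forest
begin

text \<open>The density of the starts of orbits with more than \<open>p\<close> elements, infinite
  ones included; \<open>tau p / q ^ p\<close> is thus the density of the nodes of depth
  \<open>p\<close>.\<close>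

definition tau :: "nat \<Rightarrow> real" where
  "tau p = (\<Sum>i. dd i * (if i = 0 \<or> p < i then 1 else 0))"

lemma tau_bounds: "0 \<le> tau p" "tau p \<le> T"
proof -
  have s: "summable (\<lambda>i. dd i * (if i = 0 \<or> p < i then 1 else 0))" by (rule summable_dd_mult[of _ 1]) auto
  show "0 \<le> tau p" unfolding tau_def using s dd_nonneg by (intro suminf_nonneg) auto
  have "tau p \<le> suminf dd" unfolding tau_def using s summable_dd dd_nonneg by (intro suminf_le) auto
  then show "tau p \<le> T" using sums_unique[OF dd_sums] by simp
qed

lemma L_const: "L p (\<lambda>_. c) = c * (tau p / q ^ p)"
proof -
  have "summable (\<lambda>i. dd i * (if i = 0 \<or> p < i then 1 else 0))" by (rule summable_dd_mult[of _ 1]) auto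
  from suminf_mult[OF this, of c]
  have "c * tau p = (\<Sum>i. c * (dd i * (if i = 0 \<or> p < i then 1 else 0)))" by (simp add: tau_def)
  also have "\<dots> = (\<Sum>i. dd i * (if i = 0 then c else if p < i then c else 0))" by (rule suminf_cong) auto
  finally show ?thesis by (simp add: L_def)
qed

text \<open>The average cost \<open>cQ\<close> over all nodes gives the growth of the words as a sum
  over depths. Summation by parts moves the differences from \<open>ln (Q p)\<close> to the
  densities.\<close>

lemma minkowski_dim:
  assumes X: "X \<noteq> {}"
  shows "\<exists>D. (\<lambda>i. (tau i / q ^ i - tau (Suc i) / q ^ Suc i) * ln (Q i) / ln (real m)) sums D \<and> has_minkowski_dim X D"
proof -
  define E where "E = (\<Sum>p. L p (\<lambda>_. cQ p))"
  define \<Theta> where "\<Theta> n = (\<Sum>v\<in>{K<..n}. cQ (dep v))" for n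
  have avg: "(\<lambda>n. \<Theta> n / real n) \<longlonglongrightarrow> E" "summable (\<lambda>p. L p (\<lambda>_. cQ p))"
  proof -
    have "finite {v \<in> Cls p. cQ (dep v) \<noteq> cQ p}" for p
      by (rule finite_subset[of _ "{}"]) (auto simp: Cls_def)
    from avg[of "\<lambda>v. cQ (dep v)" "ln (real m)" "\<lambda>p _. cQ p", OF cQ_bounds cQ_bounds this]
    show "(\<lambda>n. \<Theta> n / real n) \<longlonglongrightarrow> E" "summable (\<lambda>p. L p (\<lambda>_. cQ p))"
      unfolding E_def \<Theta>_def by auto
  qed
  define err where "err n = real K * ((2 + ln (real n) / ln lam) * ln (real m))" for n :: nat
  have err: "(\<lambda>n. err n / real n) \<longlonglongrightarrow> 0"
  proof -
    have "(\<lambda>n. ln (real n) / real n) \<longlonglongrightarrow> 0" "(\<lambda>n. 1 / real n) \<longlonglongrightarrow> 0" by real_asymp+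
    then have "(\<lambda>n. real K * ln (real m) * (2 * (1 / real n) + ln (real n) / real n / ln lam))
        \<longlonglongrightarrow> real K * ln (real m) * (2 * 0 + 0 / ln lam)"
      using ln_lam_pos by (intro tendsto_intros) auto
    moreover have "real K * ln (real m) * (2 * (1 / real n) + ln (real n) / real n / ln lam) = err n / real n" for n
      using ln_lam_pos by (cases "n = 0") (simp_all add: err_def field_simps)
    ultimately show ?thesis by simp
  qed
  have "(\<lambda>n. (ln (real (card (pre n ` X))) - \<Theta> n - ln (real (card (Wd K)))) / real n) \<longlonglongrightarrow> 0"
  proof (rule Lim_null_comparison[OF _ err])
    show "\<forall>\<^sub>F n in sequentially. norm ((ln (real (card (pre n ` X))) - \<Theta> n - ln (real (card (Wd K)))) / real n) \<le> err n / real n"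
      using eventually_ge_at_top[of "max 1 K"]
    proof eventually_elim
      case (elim n)
      then have n: "K \<le> n" "1 \<le> n" by auto
      show ?case using card_Wd_bound[OF X n] n unfolding pre_X[OF n(1)] \<Theta>_def err_def
        by (simp add: divide_right_mono)
    qed
  qed
  moreover have "(\<lambda>n. ln (real (card (Wd K))) / real n) \<longlonglongrightarrow> 0"
    by (rule tendsto_bounded_over_n[of _ "\<bar>ln (real (card (Wd K)))\<bar>"]) simp
  ultimately have "(\<lambda>n. (ln (real (card (pre n ` X))) - \<Theta> n - ln (real (card (Wd K)))) / real n
      + ln (real (card (Wd K))) / real n + \<Theta> n / real n) \<longlonglongrightarrow> 0 + 0 + E"
    using avg(1) by (intro tendsto_add)
  then have "(\<lambda>n. ln (real (card (pre n ` X))) / real n) \<longlonglongrightarrow> E"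
    by (simp add: add_divide_distrib[symmetric])
  then have "(\<lambda>n. ln (real (card (pre n ` X))) / real n / ln (real m)) \<longlonglongrightarrow> E / ln (real m)"
    using ln_m_pos by (intro tendsto_divide) auto
  then have mink: "has_minkowski_dim X (E / ln (real m))"
    using has_minkowski_dim_iff[OF X_full] by simp
  define e where "e i = tau i / q ^ i" for i
  \<comment> \<open>Abel summation; the boundary term vanishes in the limit, since
    \<open>ln (Q n)\<close> grows at most linearly and \<open>e n\<close> decays
    geometrically.\<close>
  have partial: "(\<Sum>i<n. (e i - e (Suc i)) * ln (Q i)) = (\<Sum>i<n. cQ i * e i) - (if n = 0 then 0 else e n * ln (Q (n - 1)))" for n
  proof (induction n)
    case (Suc n)
    then show ?case by (cases n) (auto simp: cQ_def algebra_simps)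
  qed simp
  have "(\<lambda>n. if n = 0 then 0 else e n * ln (Q (n - 1))) \<longlonglongrightarrow> 0"
  proof (rule Lim_null_comparison)
    show "\<forall>\<^sub>F n in sequentially. norm (if n = 0 then 0 else e n * ln (Q (n - 1))) \<le> T * ln (real m) * (real n / q ^ n)"
    proof (rule eventually_mono[OF eventually_gt_at_top[of 0]])
      fix n :: nat assume n: "0 < n"
      have "\<bar>e n * ln (Q (n - 1))\<bar> \<le> (T / q ^ n) * (real n * ln (real m))"
        unfolding abs_mult
      proof (rule mult_mono)
        show "\<bar>e n\<bar> \<le> T / q ^ n" using tau_bounds[of n] q1 by (simp add: e_def divide_right_mono)
        show "\<bar>ln (Q (n - 1))\<bar> \<le> real n * ln (real m)" using ln_Q_bounds[of "n - 1"] n by simp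
        show "0 \<le> T / q ^ n" using order_trans[OF tau_bounds] q1 by simp
      qed simp
      then show "norm (if n = 0 then 0 else e n * ln (Q (n - 1))) \<le> T * ln (real m) * (real n / q ^ n)"
        using n by (simp add: mult_ac)
    qed
    have "(\<lambda>n. real n / q ^ n) \<longlonglongrightarrow> 0" using q1 by real_asymp
    then show "(\<lambda>n. T * ln (real m) * (real n / q ^ n)) \<longlonglongrightarrow> 0" by (rule tendsto_mult_right_zero)
  qed
  moreover have "(\<lambda>n. \<Sum>i<n. cQ i * e i) \<longlonglongrightarrow> E"
    using summable_LIMSEQ[OF avg(2)] unfolding E_def e_def L_const .
  ultimately have "(\<lambda>n. \<Sum>i<n. (e i - e (Suc i)) * ln (Q i)) \<longlonglongrightarrow> E - 0"
    unfolding partial by (intro tendsto_diff)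
  then have "(\<lambda>i. (e i - e (Suc i)) * ln (Q i)) sums E" by (simp add: sums_def)
  then have "(\<lambda>i. (e i - e (Suc i)) * ln (Q i) / ln (real m)) sums (E / ln (real m))" by (rule sums_divide)
  then show ?thesis using mink unfolding e_def by blast
qed

end

section \<open>Independence of different orbits\<close>

context forest
begin

text \<open>A node together with all its ancestors above \<open>K\<close>.\<close>

function chn :: "nat \<Rightarrow> nat set" where
  "chn v = insert v (if K < v \<and> K < pr v then chn (pr v) else {})"
  by auto
termination by (relation "Wellfounded.measure id") (auto simp: pr_less)

declare chn.simps [simp del]

lemma chn_refl: "v \<in> chn v"
  by (subst chn.simps) simp

lemma chn_sc: "z \<in> chn v \<Longrightarrow> z \<noteq> v \<Longrightarrow> K < z \<and> z \<in> H \<and> sc z \<in> chn v"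
proof (induction v rule: chn.induct)
  case (1 v)
  have v: "K < v" "K < pr v" "z \<in> chn (pr v)" using 1(2,3) by (auto simp: chn.simps[of v] split: if_splits)
  have sub: "chn (pr v) \<subseteq> chn v" using v by (subst (2) chn.simps) auto
  show ?case
  proof (cases "z = pr v")
    case True
    then show ?thesis using v pr_H[of v] sc_pr[of v] chn_refl by auto
  next
    case False
    then show ?thesis using 1(1) v sub by blast
  qed
qed

lemma finite_card_chn: "finite (chn v) \<and> card (chn v) \<le> Suc (dep v)"
proof (induction v rule: chn.induct)
  case (1 v)
  show ?case
  proof (cases "K < v \<and> K < pr v")
    case True
    then have "chn v = insert v (chn (pr v))" "dep v = Suc (dep (pr v))"
      by (simp_all add: chn.simps[of v] dep.simps[of v])
    then show ?thesis using 1 True card_insert_le_m1[of "Suc (dep v)" "chn (pr v)" v] by simp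
  next
    case False
    then have "chn v = {v}" by (subst chn.simps) auto
    then show ?thesis by simp
  qed
qed

end

context forest_measure
begin

definition Ex :: "nat \<Rightarrow> ((nat \<Rightarrow> nat) \<Rightarrow> real) \<Rightarrow> real" where
  "Ex n F = (\<Sum>x\<in>words m n. w n x * F x)"

lemma Ex_level:
  assumes "K \<le> k" "k \<le> n" "\<And>x. F (pre k x) = F x"
  shows "Ex n F = Ex k F"
  using w_sum_pre[OF assms(1,2), of F] by (simp add: Ex_def assms(3))

lemma Ex_add: "Ex n (\<lambda>x. F x + G x) = Ex n F + Ex n G"
  by (simp add: Ex_def distrib_left sum.distrib)

lemma Ex_diff: "Ex n (\<lambda>x. F x - G x) = Ex n F - Ex n G"
  by (simp add: Ex_def right_diff_distrib sum_subtractf)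

lemma Ex_cmult: "Ex n (\<lambda>x. c * F x) = c * Ex n F"
  by (simp add: Ex_def sum_distrib_left mult.left_commute)

lemma Ex_sum: "Ex n (\<lambda>x. \<Sum>i\<in>I. F i x) = (\<Sum>i\<in>I. Ex n (F i))"
  by (simp add: Ex_def sum_distrib_left sum.swap[of _ I])

lemma Ex_mono: "(\<And>x. x \<in> words m n \<Longrightarrow> 0 < w n x \<Longrightarrow> F x \<le> G x) \<Longrightarrow> Ex n F \<le> Ex n G"
  unfolding Ex_def
proof (rule sum_mono)
  fix x assume FG: "\<And>x. x \<in> words m n \<Longrightarrow> 0 < w n x \<Longrightarrow> F x \<le> G x" and x: "x \<in> words m n"
  show "w n x * F x \<le> w n x * G x"
    using w_nonneg[OF x] FG[OF x] by (cases "w n x = 0") (auto intro: mult_left_mono)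
qed

lemma Ex_cong: "(\<And>x. x \<in> words m n \<Longrightarrow> 0 < w n x \<Longrightarrow> F x = G x) \<Longrightarrow> Ex n F = Ex n G"
  using Ex_mono[of n F G] Ex_mono[of n G F] by fastforce

definition Tr :: "nat \<Rightarrow> (nat \<Rightarrow> real) \<Rightarrow> nat \<Rightarrow> real" where
  "Tr u g c = (\<Sum>b<m. tp u c b * g b)"

text \<open>The Markov property: given the earlier positions, the symbol at \<open>u\<close> is
  averaged by a kernel that sees only the symbol at the predecessor.\<close>

lemma Ex_step:
  assumes u: "K < u" "u \<le> n" and F: "\<And>x. F (pre (u - 1) x) = F x"
  shows "Ex n (\<lambda>x. F x * g (x u)) = Ex n (\<lambda>x. F x * Tr u g (x (pr u)))"
proof -
  obtain k where k: "u = Suc k" "K \<le> k" using u by (cases u) auto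
  have pk: "pr u \<le> k" using pr_less[OF u(1)] k by simp
  have Fk: "F (pre k x) = F x" for x using F k by simp
  have Fu: "F (pre u x) = F x" for x
  proof -
    have "F (pre u x) = F (pre k (pre u x))" by (simp add: Fk)
    also have "\<dots> = F x" using k by (simp add: Fk)
    finally show ?thesis .
  qed
  have Fupd: "F (x(u := b)) = F x" for x b
    using Fk[of "x(u := b)"] Fk[of x] k by simp
  have "Ex n (\<lambda>x. F x * g (x u)) = Ex u (\<lambda>x. F x * g (x u))"
    using u by (intro Ex_level) (auto simp: Fu pre_apply)
  also have "\<dots> = (\<Sum>x\<in>words m k. \<Sum>b<m. w u (x(u := b)) * (F (x(u := b)) * g b))"
    by (simp add: Ex_def k sum_words_Suc)
  also have "\<dots> = (\<Sum>x\<in>words m k. \<Sum>b<m. w k x * (F x * (tp u (x (pr u)) b * g b)))"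
    unfolding Fupd using w_step[OF k(2)] k by (simp add: mult_ac)
  also have "\<dots> = Ex k (\<lambda>x. F x * Tr u g (x (pr u)))"
    by (simp add: Ex_def Tr_def sum_distrib_left)
  also have "\<dots> = Ex n (\<lambda>x. F x * Tr u g (x (pr u)))"
  proof (cases "pr u = 0")
    case True
    \<comment> \<open>For a start \<open>x (pr u)\<close> is the meaningless \<open>x 0\<close>, but
      then the kernel does not depend on it.\<close>
    then have "Tr u g c = Tr u g 0" for c by (simp add: Tr_def tp_def)
    then obtain \<tau> where "\<And>c. Tr u g c = \<tau>" by blast
    then show ?thesis using k u by (intro Ex_level[symmetric]) (auto simp: Fk)
  next
    case False
    then show ?thesis using k u pk by (intro Ex_level[symmetric]) (auto simp: Fk pre_apply)
  qed
  finally show ?thesis .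
qed

end

text \<open>A point mass on one admissible initial word gives total mass 1 and makes the symbols up
  to \<open>K\<close> deterministic.\<close>

locale forest_prob = forest +
  fixes V :: "nat \<Rightarrow> nat \<Rightarrow> real" and x0 :: "nat \<Rightarrow> nat"
  assumes Vpos: "\<And>v b. b < m \<Longrightarrow> 0 < V v b" and x0: "x0 \<in> Wd K"

sublocale forest_prob \<subseteq> forest_measure m a H sc q Cq lam K V "\<lambda>x. if x = x0 then 1 else 0"
  by unfold_locales (auto simp: Vpos)

context forest_prob
begin

lemma total_1: "(\<Sum>x\<in>words m K. w K x) = 1"
proof -
  have "(\<Sum>x\<in>words m K. w K x) = (\<Sum>x\<in>words m K. if x = x0 then 1 else 0)"
    by (intro sum.cong) (auto simp: w_K)
  then show ?thesis using x0 by (simp add: Wd_def)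
qed

lemma Ex_const: "K \<le> n \<Longrightarrow> Ex n (\<lambda>_. c) = c"
  using w_total[of n] total_1 by (simp add: Ex_def sum_distrib_right[symmetric])

lemma w_pos_Wd: "K \<le> n \<Longrightarrow> x \<in> words m n \<Longrightarrow> 0 < w n x \<Longrightarrow> x \<in> Wd n \<and> pre K x = x0"
proof -
  assume n: "K \<le> n" and x: "x \<in> words m n" and w: "0 < w n x"
  have p: "pre K x = x0" using w w_pos_iff[OF n x] by (auto split: if_splits)
  then have "adm K x" using x0 adm_cong[of K x "pre K x"] by (auto simp: Wd_def)
  then show ?thesis using w w_pos_iff[OF n x] x adm_iff[OF n] p by (auto simp: Wd_def)
qed

lemma w_pos_X:
  assumes x: "x \<in> full_shift m" "\<And>n. K \<le> n \<Longrightarrow> 0 < w n (pre n x)"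
  shows "x \<in> X"
proof -
  have "adm n x" if "K \<le> n" for n
    using w_pos_Wd[OF that pre_in_words[OF x(1)] x(2)[OF that]] adm_cong[OF that, of x "pre n x"]
    by (auto simp: Wd_def)
  then show ?thesis using x X_iff by auto
qed

lemma x0_val: "K \<le> n \<Longrightarrow> x \<in> words m n \<Longrightarrow> 0 < w n x \<Longrightarrow> 1 \<le> v \<Longrightarrow> v \<le> K \<Longrightarrow> x v = x0 v"
  using w_pos_Wd[of n x] by (metis pre_apply)

lemma Ex_det:
  assumes "K \<le> n" "1 \<le> v" "v \<le> K"
  shows "Ex n (\<lambda>x. F x * g (x v)) = g (x0 v) * Ex n F"
  unfolding Ex_cmult[symmetric] using x0_val[OF assms(1) _ _ assms(2,3)] by (intro Ex_cong) auto

text \<open>The later node is replaced by its predecessor and its function by the averaged one,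
  until it is a start, where the average is constant, or one of the nodes lies in
  \<open>{1..K}\<close>, where symbols are deterministic. If neither node is an ancestor of the
  other, this persists under the replacement, so the two never meet.\<close>

lemma indep:
  assumes n: "K \<le> n" and "1 \<le> v" "v \<le> n" "1 \<le> u" "u \<le> n"
    and "v \<le> K \<or> u \<le> K \<or> (v \<notin> chn u \<and> u \<notin> chn v)"
  shows "Ex n (\<lambda>x. f (x v) * g (x u)) = Ex n (\<lambda>x. f (x v)) * Ex n (\<lambda>x. g (x u))"
proof -
  have det: "Ex n (\<lambda>x. f (x v) * g (x u)) = Ex n (\<lambda>x. f (x v)) * Ex n (\<lambda>x. g (x u))"
    if "1 \<le> u" "u \<le> K" for v u f g
    using Ex_det[OF n that, of "\<lambda>x. f (x v)" g] Ex_det[OF n that, of "\<lambda>_. 1" g] Ex_const[OF n, of 1] by simp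
  have sym: "Ex n (\<lambda>x. f (x v) * g (x u)) = Ex n (\<lambda>x. g (x u) * f (x v))" for v u f g
    by (simp add: mult.commute)
  have main: "Ex n (\<lambda>x. f (x v) * g (x u)) = Ex n (\<lambda>x. f (x v)) * Ex n (\<lambda>x. g (x u))"
    if IH: "\<And>v' u' f g. v' + u' < v + u \<Longrightarrow> 1 \<le> v' \<Longrightarrow> v' \<le> n \<Longrightarrow> 1 \<le> u' \<Longrightarrow> u' \<le> n \<Longrightarrow>
        v' \<le> K \<or> u' \<le> K \<or> (v' \<notin> chn u' \<and> u' \<notin> chn v') \<Longrightarrow>
        Ex n (\<lambda>x. f (x v') * g (x u')) = Ex n (\<lambda>x. f (x v')) * Ex n (\<lambda>x. g (x u'))"
      and v: "K < v" "v < u" and u: "u \<le> n" and nc: "v \<notin> chn u" "u \<notin> chn v" for v u f g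
  proof -
    have Ku: "K < u" using v by simp
    have s1: "Ex n (\<lambda>x. f (x v) * g (x u)) = Ex n (\<lambda>x. f (x v) * Tr u g (x (pr u)))"
      using v by (intro Ex_step[OF Ku u]) (auto simp: pre_apply)
    have s2: "Ex n (\<lambda>x. g (x u)) = Ex n (\<lambda>x. Tr u g (x (pr u)))"
      using Ex_step[OF Ku u, of "\<lambda>_. 1" g] by simp
    show ?thesis
    proof (cases "pr u = 0")
      case True
      then have "Tr u g c = Tr u g 0" for c by (simp add: Tr_def tp_def)
      then obtain \<tau> where T: "\<And>c. Tr u g c = \<tau>" by blast
      have "Ex n (\<lambda>x. f (x v) * \<tau>) = \<tau> * Ex n (\<lambda>x. f (x v))"
        unfolding Ex_cmult[symmetric] by (simp add: mult.commute)
      then show ?thesis using s1 s2 Ex_const[OF n, of \<tau>] by (simp add: T)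
    next
      case False
      have pu: "pr u < u" by (rule pr_less[OF Ku])
      have "pr u \<le> K \<or> (v \<notin> chn (pr u) \<and> pr u \<notin> chn v)"
      proof (cases "pr u \<le> K")
        case F: False
        then have "chn u = insert u (chn (pr u))" using Ku by (simp add: chn.simps[of u])
        then have 1: "v \<notin> chn (pr u)" using nc by auto
        have "pr u \<noteq> v" using 1 chn_refl by metis
        then have "pr u \<notin> chn v" using chn_sc[of "pr u" v] nc sc_pr[OF Ku False] by auto
        then show ?thesis using 1 by simp
      qed simp
      then have "Ex n (\<lambda>x. f (x v) * Tr u g (x (pr u))) = Ex n (\<lambda>x. f (x v)) * Ex n (\<lambda>x. Tr u g (x (pr u)))"
        using pu v u False by (intro IH) auto
      then show ?thesis using s1 s2 by simp
    qed
  qed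
  show ?thesis using assms(2-)
  proof (induction "v + u" arbitrary: v u f g rule: less_induct)
    case less
    consider "u \<le> K" | "v \<le> K" | "K < v" "K < u" "v \<notin> chn u" "u \<notin> chn v" using less.prems(5) by linarith
    then show ?case
    proof cases
      case 1
      show ?thesis by (rule det[OF less.prems(3) 1])
    next
      case 2
      show ?thesis unfolding sym[of f v g u] det[OF less.prems(1) 2, of g u f] by (rule mult.commute)
    next
      case 3
      have "v \<noteq> u" using 3 chn_refl by metis
      then consider "v < u" | "u < v" by linarith
      then show ?thesis
      proof cases
        case 1
        show ?thesis by (rule main[OF less.hyps]) (use 1 3 less.prems in auto)
      next
        case 2
        have "Ex n (\<lambda>x. g (x u) * f (x v)) = Ex n (\<lambda>x. g (x u)) * Ex n (\<lambda>x. f (x v))"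
          by (rule main[OF less.hyps]) (use 2 3 less.prems in auto)
        then show ?thesis unfolding sym[of f v g u] by (simp only: mult.commute)
      qed
    qed
  qed
qed

text \<open>Only nodes of which one is an ancestor of the other can be correlated, and
  \<open>v\<close> has at most \<open>dep v\<close> proper ancestors. The constant 8 is the square
  of the bound \<open>2 * B\<close> for centred values, times 2 for the two orders of a
  pair.\<close>

lemma variance_bound:
  assumes n: "K \<le> n" and f: "\<And>v b. \<bar>f v b\<bar> \<le> B"
  shows "Ex n (\<lambda>x. ((\<Sum>v\<in>{K<..n}. f v (x v)) - (\<Sum>v\<in>{K<..n}. Ex n (\<lambda>x. f v (x v))))\<^sup>2)
    \<le> 8 * B\<^sup>2 * (\<Sum>v\<in>{K<..n}. real (Suc (dep v)))"
proof -
  define e where "e v = Ex n (\<lambda>x. f v (x v))" for v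
  define Y where "Y v b = f v b - e v" for v b
  have eB: "\<bar>e v\<bar> \<le> B" for v
  proof -
    have "e v \<le> Ex n (\<lambda>_. B)" "Ex n (\<lambda>_. - B) \<le> e v"
      unfolding e_def by (rule Ex_mono, use f[of v] abs_le_iff minus_le_iff in metis)+
    then show ?thesis using Ex_const[OF n] by simp
  qed
  have B0: "0 \<le> B" using f[of 0 0] by linarith
  have YB: "\<bar>Y v b\<bar> \<le> 2 * B" for v b using f[of v b] eB[of v] by (simp add: Y_def)
  have Y0: "Ex n (\<lambda>x. Y v (x v)) = 0" for v
    unfolding Y_def Ex_diff using Ex_const[OF n] by (simp add: e_def)
  have cov0: "Ex n (\<lambda>x. Y v (x v) * Y u (x u)) = 0"
    if "v \<in> {K<..n}" "u \<in> {K<..n}" "v \<notin> chn u" "u \<notin> chn v" for v u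
    using indep[OF n, of v u "Y v" "Y u"] that Y0 by simp
  have cov: "Ex n (\<lambda>x. Y v (x v) * Y u (x u)) \<le> (2 * B)\<^sup>2" for v u
  proof -
    have "Y v b * Y u c \<le> (2 * B)\<^sup>2" for b c
    proof -
      have "Y v b * Y u c \<le> \<bar>Y v b\<bar> * \<bar>Y u c\<bar>" by (simp add: abs_mult[symmetric])
      also have "\<dots> \<le> (2 * B) * (2 * B)" using YB B0 by (intro mult_mono) auto
      finally show ?thesis by (simp add: power2_eq_square)
    qed
    then have "Ex n (\<lambda>x. Y v (x v) * Y u (x u)) \<le> Ex n (\<lambda>_. (2 * B)\<^sup>2)" by (intro Ex_mono)
    then show ?thesis using Ex_const[OF n] by simp
  qed
  have ind: "Ex n (\<lambda>x. Y v (x v) * Y u (x u)) \<le> (2 * B)\<^sup>2 * ((if u \<in> chn v then 1 else 0) + (if v \<in> chn u then 1 else 0))"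
    if "v \<in> {K<..n}" "u \<in> {K<..n}" for v u
    using cov[of v u] cov0[OF that] by (auto intro: order_trans)
  have cnt: "(\<Sum>u\<in>{K<..n}. if u \<in> chn v then 1 else 0 :: real) \<le> real (Suc (dep v))" for v
  proof -
    have "(\<Sum>u\<in>{K<..n}. if u \<in> chn v then 1 else 0 :: real) = real (card ({K<..n} \<inter> chn v))"
      by (simp add: sum.If_cases)
    also have "\<dots> \<le> real (card (chn v))" using finite_card_chn[of v] by (simp add: card_mono)
    finally show ?thesis using finite_card_chn[of v] by linarith
  qed
  have "Ex n (\<lambda>x. ((\<Sum>v\<in>{K<..n}. f v (x v)) - (\<Sum>v\<in>{K<..n}. e v))\<^sup>2)
      = Ex n (\<lambda>x. \<Sum>v\<in>{K<..n}. \<Sum>u\<in>{K<..n}. Y v (x v) * Y u (x u))"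
    by (simp add: Y_def sum_subtractf[symmetric] power2_eq_square sum_product)
  also have "\<dots> = (\<Sum>v\<in>{K<..n}. \<Sum>u\<in>{K<..n}. Ex n (\<lambda>x. Y v (x v) * Y u (x u)))"
    by (simp add: Ex_sum)
  also have "\<dots> \<le> (\<Sum>v\<in>{K<..n}. \<Sum>u\<in>{K<..n}. (2 * B)\<^sup>2 * ((if u \<in> chn v then 1 else 0) + (if v \<in> chn u then 1 else 0)))"
    by (intro sum_mono ind)
  also have "\<dots> = (2 * B)\<^sup>2 * ((\<Sum>v\<in>{K<..n}. \<Sum>u\<in>{K<..n}. if u \<in> chn v then 1 else 0)
      + (\<Sum>v\<in>{K<..n}. \<Sum>u\<in>{K<..n}. if v \<in> chn u then 1 else 0))"
    by (simp add: sum_distrib_left[symmetric] sum.distrib del: sum.If_cases)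
  also have "(\<Sum>v\<in>{K<..n}. \<Sum>u\<in>{K<..n}. if v \<in> chn u then 1 else 0 :: real) =
      (\<Sum>v\<in>{K<..n}. \<Sum>u\<in>{K<..n}. if u \<in> chn v then 1 else 0)" by (rule sum.swap)
  also have "(2 * B)\<^sup>2 * ((\<Sum>v\<in>{K<..n}. \<Sum>u\<in>{K<..n}. if u \<in> chn v then 1 else 0)
      + (\<Sum>v\<in>{K<..n}. \<Sum>u\<in>{K<..n}. if u \<in> chn v then 1 else 0))
      \<le> (2 * B)\<^sup>2 * ((\<Sum>v\<in>{K<..n}. real (Suc (dep v))) + (\<Sum>v\<in>{K<..n}. real (Suc (dep v))))"
    by (intro mult_left_mono add_mono sum_mono cnt) auto
  also have "\<dots> = 8 * B\<^sup>2 * (\<Sum>v\<in>{K<..n}. real (Suc (dep v)))" by (simp add: power_mult_distrib)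
  finally show ?thesis by (simp add: e_def)
qed

end

section \<open>The Hausdorff dimension\<close>

context forest
begin

text \<open>Weights for a node that is followed by exactly \<open>r\<close> further elements of its
  orbit; as a sequence in \<open>r\<close>, the iterates of the map whose fixed point is the vector
  \<open>t\<close>.\<close>

primrec Us :: "nat \<Rightarrow> nat \<Rightarrow> real" where
  "Us 0 j = 1"
| "Us (Suc r) j = (\<Sum>b<m. a j b * Us r b) powr (1 / q)"

text \<open>The positive fixed point of \<open>x \<mapsto> (m * x) powr (1 / q)\<close>, which
  dominates the iteration.\<close>

definition Umax :: real where "Umax = real m powr (1 / (q - 1))"

lemma Us_mono_aux:
  assumes "\<And>b. b < m \<Longrightarrow> 1 \<le> f b" "\<And>b. b < m \<Longrightarrow> f b \<le> g b" "j < m"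
  shows "1 \<le> (\<Sum>b<m. a j b * f b) powr (1 / q)"
    and "(\<Sum>b<m. a j b * f b) powr (1 / q) \<le> (\<Sum>b<m. a j b * g b) powr (1 / q)"
proof -
  have "(\<Sum>b<m. a j b * 1) \<le> (\<Sum>b<m. a j b * f b)"
    using assms a_nonneg[OF assms(3)] by (intro sum_mono mult_left_mono) auto
  then have 1: "1 \<le> (\<Sum>b<m. a j b * f b)" using row_sum_pos[OF assms(3)] by simp
  then show "1 \<le> (\<Sum>b<m. a j b * f b) powr (1 / q)" using q1 by (intro ge_one_powr_ge_zero) auto
  have "(\<Sum>b<m. a j b * f b) \<le> (\<Sum>b<m. a j b * g b)"
    using assms a_nonneg[OF assms(3)] by (intro sum_mono mult_left_mono) auto
  then show "(\<Sum>b<m. a j b * f b) powr (1 / q) \<le> (\<Sum>b<m. a j b * g b) powr (1 / q)"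
    using 1 q1 by (intro powr_mono2) auto
qed

lemma Us_ge_1: "j < m \<Longrightarrow> 1 \<le> Us r j"
proof (induction r arbitrary: j)
  case (Suc r)
  then show ?case using Us_mono_aux(1)[of "Us r" "Us r" j] by simp
qed simp

lemma Us_incr: "j < m \<Longrightarrow> Us r j \<le> Us (Suc r) j"
proof (induction r arbitrary: j)
  case 0
  then show ?case using Us_ge_1[of j "Suc 0"] by simp
next
  case (Suc r)
  show ?case unfolding Us.simps(2)[of r] Us.simps(2)[of "Suc r"]
    by (rule Us_mono_aux(2)) (use Suc Us_ge_1 in auto)
qed

lemma Us_le: "j < m \<Longrightarrow> Us r j \<le> Umax"
proof (induction r arbitrary: j)
  case 0
  then show ?case using q1 m2 by (auto simp: Umax_def intro: ge_one_powr_ge_zero)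
next
  case (Suc r)
  have m0: "0 < real m" using m2 by simp
  have "a j b * Us r b \<le> 1 * Umax" if "b < m" for b
    using a_le_1[OF Suc.prems that] a_nonneg[OF Suc.prems that] Suc.IH[OF that] Us_ge_1[OF that, of r]
    by (intro mult_mono) auto
  then have "(\<Sum>b<m. a j b * Us r b) \<le> (\<Sum>b<m. Umax)" by (intro sum_mono) auto
  then have le: "(\<Sum>b<m. a j b * Us r b) \<le> real m * Umax" by simp
  have "0 \<le> (\<Sum>b<m. a j b * Us r b)"
    using a_nonneg[OF Suc.prems] Us_ge_1[of _ r] by (intro sum_nonneg mult_nonneg_nonneg) (auto intro: order_trans[OF zero_le_one])
  then have "Us (Suc r) j \<le> (real m * Umax) powr (1 / q)" using le q1 by (simp add: powr_mono2)
  also have "real m * Umax = real m powr (q / (q - 1))"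
  proof -
    have "real m * Umax = real m powr (1 + 1 / (q - 1))" using m0 by (simp add: Umax_def powr_add)
    also have "1 + 1 / (q - 1) = q / (q - 1)" using q1 by (simp add: field_simps)
    finally show ?thesis .
  qed
  also have "(real m powr (q / (q - 1))) powr (1 / q) = Umax" using q1 by (simp add: powr_powr Umax_def)
  finally show ?case .
qed

definition is_sol :: "(nat \<Rightarrow> real) \<Rightarrow> bool" where
  "is_sol t \<longleftrightarrow> (\<forall>i<m. 0 < t i \<and> t i powr q = (\<Sum>j<m. a i j * t j))"

text \<open>The iterates \<open>Us r\<close> increase and are bounded by \<open>Umax\<close>; their
  limit is a solution.\<close>

lemma sol_exists: "\<exists>t. is_sol t"
proof -
  have "\<exists>l. (\<lambda>r. Us r j) \<longlonglongrightarrow> l" if "j < m" for j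
  proof -
    have "incseq (\<lambda>r. Us r j)" by (rule incseq_SucI) (rule Us_incr[OF that])
    then show ?thesis using incseq_convergent[of "\<lambda>r. Us r j" Umax] Us_le[OF that] by metis
  qed
  then obtain t where t: "\<And>j. j < m \<Longrightarrow> (\<lambda>r. Us r j) \<longlonglongrightarrow> t j" by metis
  have t1: "1 \<le> t j" if "j < m" for j
    by (rule tendsto_lowerbound[OF t[OF that]]) (use Us_ge_1[OF that] in auto)
  have "t i powr q = (\<Sum>j<m. a i j * t j)" if i: "i < m" for i
  proof -
    have sp: "0 < (\<Sum>j<m. a i j * t j)"
    proof -
      have "(\<Sum>b<m. a i b * 1) \<le> (\<Sum>b<m. a i b * t b)"
        using t1 a_nonneg[OF i] by (intro sum_mono mult_left_mono) auto
      then show ?thesis using row_sum_pos[OF i] by simp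
    qed
    have "(\<lambda>r. Us (Suc r) i) \<longlonglongrightarrow> (\<Sum>j<m. a i j * t j) powr (1 / q)"
      unfolding Us.simps using sp t by (intro tendsto_intros) auto
    moreover have "(\<lambda>r. Us (Suc r) i) \<longlonglongrightarrow> t i" using t[OF i] by (rule LIMSEQ_Suc)
    ultimately have "t i = (\<Sum>j<m. a i j * t j) powr (1 / q)" using LIMSEQ_unique by blast
    then show ?thesis using sp q1 by (simp add: powr_powr)
  qed
  moreover have "0 < t j" if "j < m" for j using t1[OF that] by simp
  ultimately show ?thesis unfolding is_sol_def by blast
qed

text \<open>At an index where the ratio \<open>t / s\<close> attains its maximum \<open>c\<close>,
  the equations give \<open>c powr q \<le> c\<close>, hence \<open>c \<le> 1\<close>.\<close>

lemma sol_le: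
  assumes s: "is_sol s" and t: "is_sol t" and i: "i < m"
  shows "t i \<le> s i"
proof -
  define c where "c = Max ((\<lambda>j. t j / s j) ` {..<m})"
  have ne: "(\<lambda>j. t j / s j) ` {..<m} \<noteq> {}" using i by auto
  have c: "t j / s j \<le> c" if "j < m" for j unfolding c_def using that by (intro Max_ge) auto
  have "c \<in> (\<lambda>j. t j / s j) ` {..<m}" unfolding c_def by (rule Max_in) (use ne in auto)
  then obtain k where k: "k < m" "c = t k / s k" by auto
  have pos: "0 < s j" "0 < t j" if "j < m" for j using s t that by (auto simp: is_sol_def)
  have c0: "0 < c" using k pos by simp
  have "t k powr q = (\<Sum>j<m. a k j * t j)" using t k by (simp add: is_sol_def)
  also have "\<dots> \<le> (\<Sum>j<m. a k j * (c * s j))"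
    using c pos a_nonneg[OF k(1)] by (intro sum_mono mult_left_mono) (auto simp: pos_divide_le_eq)
  also have "\<dots> = c * s k powr q" using s k by (simp add: is_sol_def sum_distrib_left mult_ac)
  finally have "(t k / s k) powr q \<le> c" using pos[OF k(1)] by (simp add: powr_divide pos_divide_le_eq)
  then have "c powr q \<le> c" by (simp only: k(2))
  then have "c powr q \<le> c powr 1" using c0 by simp
  then have "c \<le> 1" using q1 c0 by (metis linorder_not_le powr_less_cancel_iff)
  then have "t i / s i \<le> 1" using c[OF i] by simp
  then show ?thesis using pos[OF i] by simp
qed

lemma sol_unique: "is_sol s \<Longrightarrow> is_sol t \<Longrightarrow> i < m \<Longrightarrow> s i = t i"
  using sol_le antisym by metis

text \<open>At an index where \<open>t\<close> takes its minimum \<open>c\<close>, the equation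
  gives \<open>c \<le> c powr q\<close>, because the row sum there is at least 1.\<close>

lemma sol_ge_1:
  assumes t: "is_sol t" and i: "i < m"
  shows "1 \<le> t i"
proof -
  define c where "c = Min (t ` {..<m})"
  have c: "c \<le> t j" if "j < m" for j unfolding c_def using that by (intro Min_le) auto
  have "c \<in> t ` {..<m}" unfolding c_def by (rule Min_in) (use i in auto)
  then obtain k where k: "k < m" "c = t k" by auto
  have c0: "0 < c" using k t by (simp add: is_sol_def)
  have "c * 1 \<le> c * (\<Sum>j<m. a k j)" using row_sum_pos[OF k(1)] c0 by (intro mult_left_mono) auto
  also have "\<dots> \<le> (\<Sum>j<m. a k j * t j)"
    unfolding sum_distrib_left
  proof (rule sum_mono)
    fix j assume "j \<in> {..<m}"
    then show "c * a k j \<le> a k j * t j"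
      using c[of j] a_nonneg[OF k(1), of j] by (simp add: mult.commute[of c] mult_left_mono)
  qed
  also have "\<dots> = c powr q" using t k by (simp add: is_sol_def)
  finally have "c powr 1 \<le> c powr q" using c0 by simp
  then have "1 \<le> c" using q1 c0 by (metis less_le_not_le linorder_not_le powr_less_mono')
  then show ?thesis using c[OF i] by simp
qed

end

locale density_sol = density_forest +
  fixes t :: "nat \<Rightarrow> real"
  assumes sol: "is_sol t"
begin

text \<open>\<open>r\<close> is the remaining length in the sense of \<open>rl\<close>, so it counts
  the node itself: the last element has weight 1, and \<open>r = 0\<close>, an infinite orbit, takes
  the stationary weights \<open>t\<close>.\<close>

definition U :: "nat \<Rightarrow> nat \<Rightarrow> real" where
  "U r j = (if j < m then if r = 0 then t j else Us (r - 1) j else 1)"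

definition \<sigma> :: "nat \<Rightarrow> real" where "\<sigma> r = (\<Sum>j<m. U r j)"

definition BU :: real where "BU = ln Umax + (\<Sum>j<m. ln (t j))"

lemma U_ge_1: "1 \<le> U r j"
  using sol_ge_1[OF sol] Us_ge_1 by (simp add: U_def)

lemma U_pos: "0 < U r j"
  using U_ge_1[of r j] by linarith

lemma Umax_ge_1: "1 \<le> Umax"
  using Us_ge_1[of 0 0] Us_le[of 0 0] m2 by linarith

lemma BU_nonneg: "0 \<le> BU"
  unfolding BU_def using Umax_ge_1 sol_ge_1[OF sol] by (intro add_nonneg_nonneg sum_nonneg) auto

lemma ln_U_bounds: "0 \<le> ln (U r j)" "ln (U r j) \<le> BU"
proof -
  show "0 \<le> ln (U r j)" using U_ge_1 by simp
  have nn: "0 \<le> ln (t j)" if "j < m" for j using sol_ge_1[OF sol that] by simp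
  show "ln (U r j) \<le> BU"
  proof (cases "j < m")
    case True
    have s: "ln (t j) \<le> (\<Sum>j<m. ln (t j))" using True nn by (intro member_le_sum) auto
    have s0: "0 \<le> (\<Sum>j<m. ln (t j))" using nn by (intro sum_nonneg) auto
    have u: "0 \<le> ln Umax" using Umax_ge_1 by simp
    have "ln (Us (r - 1) j) \<le> ln Umax" using Us_le[OF True] Us_ge_1[OF True, of "r - 1"] by (intro ln_mono) auto
    then show ?thesis using True s s0 u by (auto simp: U_def BU_def)
  qed (use BU_nonneg in \<open>simp add: U_def\<close>)
qed

lemma abs_ln_U: "\<bar>ln (U r j)\<bar> \<le> BU"
  using ln_U_bounds[of r j] by simp

lemma U_1: "U (Suc 0) j = 1"
  by (simp add: U_def)

text \<open>One equation for both kinds of orbits: since \<open>0 - 1 = 0\<close> on naturals, it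
  reads as the fixed point equation of \<open>t\<close> for \<open>r = 0\<close>.\<close>

lemma U_rec:
  assumes "r \<noteq> 1" "c < m"
  shows "(\<Sum>b<m. a c b * U (r - 1) b) = U r c powr q"
proof (cases "r = 0")
  case True
  then show ?thesis using sol assms by (simp add: U_def is_sol_def)
next
  case False
  then obtain k where k: "r = Suc (Suc k)" using assms(1) by (metis One_nat_def not0_implies_Suc)
  have "(\<Sum>b<m. a c b * Us k b) > 0"
  proof -
    have "(\<Sum>b<m. a c b * 1) \<le> (\<Sum>b<m. a c b * Us k b)"
      using Us_ge_1 a_nonneg[OF assms(2)] by (intro sum_mono mult_left_mono) auto
    then show ?thesis using row_sum_pos[OF assms(2)] by simp
  qed
  then show ?thesis using k assms q1 by (simp add: U_def powr_powr)
qed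

lemma \<sigma>_bounds: "1 \<le> \<sigma> r" "\<bar>ln (\<sigma> r)\<bar> \<le> ln (real m) + BU"
proof -
  have "(\<Sum>j<m. 1) \<le> \<sigma> r" unfolding \<sigma>_def using U_ge_1 by (intro sum_mono) auto
  then show 1: "1 \<le> \<sigma> r" using m2 by simp
  have "U r j \<le> exp BU" for j using ln_U_bounds(2)[of r j] U_pos[of r j] by (metis exp_le_cancel_iff exp_ln)
  then have "\<sigma> r \<le> (\<Sum>j<m. exp BU)" unfolding \<sigma>_def by (intro sum_mono) auto
  then have "ln (\<sigma> r) \<le> ln (real m * exp BU)" using 1 by (intro ln_mono) auto
  also have "\<dots> = ln (real m) + BU" using m2 by (simp add: ln_mult)
  finally show "\<bar>ln (\<sigma> r)\<bar> \<le> ln (real m) + BU" using 1 by simp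
qed

definition hdim :: real where "hdim = (\<Sum>i. dd i * ln (\<sigma> i))"

lemma hdim_nonneg: "0 \<le> hdim"
  unfolding hdim_def
  using summable_dd_mult[OF \<sigma>_bounds(2)] dd_nonneg \<sigma>_bounds(1) by (intro suminf_nonneg) auto

definition S :: "nat \<Rightarrow> real" where
  "S n = (\<Sum>v | v \<in> {K<..n} \<and> pr v = 0. ln (\<sigma> (rl v)))"

definition \<Psi> :: "nat \<Rightarrow> (nat \<Rightarrow> nat) \<Rightarrow> real" where
  "\<Psi> n x = (\<Sum>v\<in>{K<..n}. ln (U (rl v) (x v)))"

lemma S_lim: "(\<lambda>n. S n / real n) \<longlonglongrightarrow> hdim"
  using start_avg[OF \<sigma>_bounds(2)] unfolding S_def hdim_def by (simp add: conj_assoc)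

lemma \<Psi>_nonneg: "0 \<le> \<Psi> n x"
  unfolding \<Psi>_def using ln_U_bounds(1) by (intro sum_nonneg) auto

lemma \<Psi>_pre: "k \<le> n \<Longrightarrow> \<Psi> k (pre n x) = \<Psi> k x"
  unfolding \<Psi>_def by (intro sum.cong) (auto simp: pre_apply)

definition C0 :: real where
  "C0 = q * (BU * (2 * \<bar>Cq\<bar> / q + 1)) + real K * (ln (real m) + BU)"

lemma fl_le: "fl n \<le> n"
proof -
  have "q * real (fl n) \<le> real n" using fl_iff by blast
  moreover have "1 * real (fl n) \<le> q * real (fl n)" using q1 by (intro mult_right_mono) auto
  ultimately show ?thesis by linarith
qed

text \<open>By \<open>U_rec\<close> the normalisation on an edge from above \<open>K\<close> is the
  \<open>q\<close>-th power of the weight at its beginning, and \<open>sc_window\<close> turns the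
  edges ending by \<open>n\<close> into nodes up to \<open>fl n\<close>. The error \<open>C0\<close>
  comes from this window and from the at most \<open>K\<close> edges out of
  \<open>{1..K}\<close>.\<close>

lemma ln_weight:
  assumes \<kappa>: "\<And>x. 0 \<le> \<kappa> x" "\<kappa> (pre K x) = 1" and n: "K \<le> n" and x: "x \<in> Wd n"
  shows "\<bar>- ln (forest_measure.w m a H sc K (\<lambda>v. U (rl v)) \<kappa> n x) - (S n + q * \<Psi> (fl n) x - \<Psi> n x)\<bar> \<le> C0"
proof -
  interpret forest_measure m a H sc q Cq lam K "\<lambda>v. U (rl v)" \<kappa>
    by unfold_locales (auto simp: U_pos \<kappa>)
  have xw: "x \<in> words m n" using x by (simp add: Wd_def)
  have xp: "x (pr v) < m" if "v \<in> {K<..n}" "pr v \<noteq> 0" for v using pr_val[OF xw, of v] that by auto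
  define small where "small = {v. v \<in> {K<..n} \<and> pr v \<noteq> 0 \<and> pr v \<le> K}"
  define h where "h u = ln (U (rl u) (x u))" for u
  have eq: "- ln (w n x) = S n +
     ((\<Sum>v | v \<in> {K<..n} \<and> K < pr v. ln (AV v (x (pr v)))) + (\<Sum>v\<in>small. ln (AV v (x (pr v))))) - \<Psi> n x"
    unfolding ln_w[OF n xw \<kappa>(2) adm_alt[OF n x]] S_def \<Psi>_def small_def
    by (simp only: sum_pr_split) (simp add: SV_def \<sigma>_def)
  have "(\<Sum>v | v \<in> {K<..n} \<and> K < pr v. ln (AV v (x (pr v)))) = (\<Sum>v | v \<in> {K<..n} \<and> K < pr v. q * h (pr v))"
  proof (rule sum.cong[OF refl])
    fix v assume "v \<in> {v. v \<in> {K<..n} \<and> K < pr v}"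
    then have v: "v \<in> {K<..n}" "K < pr v" "K < v" "pr v \<noteq> 0" by auto
    have pH: "pr v \<in> H" "sc (pr v) = v" using pr_H[OF v(3,4)] sc_pr[OF v(3,4)] by auto
    have "AV v (x (pr v)) = U (rl (pr v)) (x (pr v)) powr q"
      unfolding AV_def using U_rec[OF _ xp[OF v(1,4)], of "rl (pr v)"] rl_sc[OF pH(1)] pH rl_1_iff[of "pr v"] by simp
    then show "ln (AV v (x (pr v))) = q * h (pr v)" using U_pos by (simp add: h_def ln_powr)
  qed
  also have "\<dots> = (\<Sum>u | u \<in> H \<and> K < u \<and> sc u \<le> n. q * h u)" by (rule sum_pr[where F = "\<lambda>u. q * h u"])
  also have "\<dots> = q * (\<Sum>u | u \<in> H \<inter> {K<..} \<and> sc u \<le> n. h u)" by (simp add: sum_distrib_left)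
  finally have m1: "(\<Sum>v | v \<in> {K<..n} \<and> K < pr v. ln (AV v (x (pr v)))) = q * (\<Sum>u | u \<in> H \<inter> {K<..} \<and> sc u \<le> n. h u)" .
  have "\<Psi> (fl n) x = (\<Sum>u\<in>{K<..fl n}. h u)" by (simp add: \<Psi>_def h_def)
  also have "\<dots> = (\<Sum>u | u \<in> H \<inter> {K<..} \<and> u \<le> fl n. h u)"
  proof (rule sum.mono_neutral_right)
    show "\<forall>u\<in>{K<..fl n} - {u. u \<in> H \<inter> {K<..} \<and> u \<le> fl n}. h u = 0"
    proof
      fix u assume "u \<in> {K<..fl n} - {u. u \<in> H \<inter> {K<..} \<and> u \<le> fl n}"
      \<comment> \<open>Last elements start no edge, but their weight is 1, so including them
        changes nothing.\<close>
      then have "rl u = Suc 0" using rl_notin[of u] by auto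
      then show "h u = 0" by (simp add: h_def U_1)
    qed
  qed auto
  finally have m2': "\<Psi> (fl n) x = (\<Sum>u | u \<in> H \<inter> {K<..} \<and> u \<le> fl n. h u)" .
  have "\<bar>(\<Sum>u | u \<in> H \<inter> {K<..} \<and> sc u \<le> n. h u) - \<Psi> (fl n) x\<bar> \<le> BU * (2 * \<bar>Cq\<bar> / q + 1)"
    unfolding m2' by (rule sc_window) (auto simp: h_def abs_ln_U)
  then have b1: "\<bar>q * (\<Sum>u | u \<in> H \<inter> {K<..} \<and> sc u \<le> n. h u) - q * \<Psi> (fl n) x\<bar> \<le> q * (BU * (2 * \<bar>Cq\<bar> / q + 1))"
    unfolding right_diff_distrib[symmetric] abs_mult using q1 by simp
  have b2: "\<bar>\<Sum>v\<in>small. ln (AV v (x (pr v)))\<bar> \<le> real K * (ln (real m) + BU)"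
  proof -
    have "\<bar>\<Sum>v\<in>small. ln (AV v (x (pr v)))\<bar> \<le> (\<Sum>v\<in>small. \<bar>ln (AV v (x (pr v)))\<bar>)" by (rule sum_abs)
    also have "\<dots> \<le> real (card small) * (ln (real m) + BU)"
    proof (rule sum_bounded_above)
      fix v assume "v \<in> small"
      then have c: "x (pr v) < m" using xp by (auto simp: small_def)
      have "(\<Sum>b<m. a (x (pr v)) b * 1) \<le> AV v (x (pr v))"
        unfolding AV_def using U_ge_1 a_nonneg[OF c] by (intro sum_mono mult_left_mono) auto
      then have ge: "1 \<le> AV v (x (pr v))" using row_sum_pos[OF c] by simp
      have "a (x (pr v)) b * U (rl v) b \<le> 1 * U (rl v) b" if "b < m" for b
        using a_le_1[OF c that] U_pos by (intro mult_right_mono) (auto intro: less_imp_le)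
      then have "AV v (x (pr v)) \<le> \<sigma> (rl v)" unfolding AV_def \<sigma>_def by (intro sum_mono) auto
      then have "ln (AV v (x (pr v))) \<le> ln (\<sigma> (rl v))" using ge by (intro ln_mono) auto
      then show "\<bar>ln (AV v (x (pr v)))\<bar> \<le> ln (real m) + BU" using ge \<sigma>_bounds(2)[of "rl v"] by simp
    qed
    also have "\<dots> \<le> real K * (ln (real m) + BU)"
      using card_pr_small[of n] BU_nonneg ln_m_pos by (intro mult_right_mono) (auto simp: small_def)
    finally show ?thesis .
  qed
  show ?thesis using eq m1 b1 b2 unfolding C0_def by linarith
qed

text \<open>Along \<open>n\<^sub>k\<^sub>+\<^sub>1 = \<lceil>q * n\<^sub>k\<rceil>\<close> the defects telescope.\<close>

lemma telescope:
  fixes G :: "nat \<Rightarrow> real"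
  assumes G: "\<And>n. 0 \<le> G n" and \<eta>: "0 < \<eta>"
  shows "\<exists>n\<ge>N. q * G (fl n) - G n \<le> \<eta> * real n"
proof (rule ccontr)
  assume "\<not> ?thesis"
  then have lt: "G n < q * G (fl n) - \<eta> * real n" if "N \<le> n" for n using that by force
  define nx where "nx n = nat \<lceil>q * real n\<rceil>" for n
  have q0: "0 < q" using q1 by simp
  have nxb: "q * real n \<le> real (nx n)" "real (nx n) < q * real n + 1" for n
  proof -
    have "0 \<le> q * real n" using q0 by simp
    then show "q * real n \<le> real (nx n)" "real (nx n) < q * real n + 1" unfolding nx_def by linarith+
  qed
  \<comment> \<open>Consecutive multiples of \<open>q\<close> differ by more than 1, so rounding
    \<open>q * n\<close> up does not reach the next one.\<close>
  have fl_nx: "fl (nx n) = n" for n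
  proof (rule antisym)
    show "n \<le> fl (nx n)" using fl_iff nxb by simp
    show "fl (nx n) \<le> n"
    proof (rule ccontr)
      assume "\<not> fl (nx n) \<le> n"
      then have "Suc n \<le> fl (nx n)" by simp
      then have "q * real (Suc n) \<le> real (nx n)" using fl_iff by blast
      then have "q * real n + q \<le> real (nx n)" by (simp add: algebra_simps)
      then show False using nxb(2)[of n] q1 by linarith
    qed
  qed
  define s where "s k = (nx ^^ k) (Suc N)" for k
  have s_Suc: "s (Suc k) = nx (s k)" for k by (simp add: s_def)
  have s_ge: "q ^ k * real (Suc N) \<le> real (s k)" for k
  proof (induction k)
    case (Suc k)
    have "q ^ Suc k * real (Suc N) \<le> q * real (s k)" using Suc q0 by (simp add: mult.assoc mult_left_mono)
    also have "\<dots> \<le> real (s (Suc k))" using nxb s_Suc by simp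
    finally show ?case .
  qed (simp add: s_def)
  have s_N: "N \<le> s k" for k
  proof -
    have "1 * real (Suc N) \<le> q ^ k * real (Suc N)" using q1 by (intro mult_right_mono one_le_power) auto
    from order_trans[OF this s_ge[of k]] show ?thesis by simp
  qed
  \<comment> \<open>If all the defects were larger than claimed, each step would lower this
    nonnegative quotient by at least the fixed amount \<open>\<eta> * Suc N\<close>.\<close>
  have "G (s k) / q ^ k \<le> G (s 0) - real k * (\<eta> * real (Suc N))" for k
  proof (induction k)
    case (Suc k)
    have "G (s (Suc k)) < q * G (s k) - \<eta> * real (s (Suc k))" using lt[OF s_N[of "Suc k"]] s_Suc fl_nx by simp
    moreover have "\<eta> * (q ^ Suc k * real (Suc N)) \<le> \<eta> * real (s (Suc k))" using s_ge[of "Suc k"] \<eta> by (intro mult_left_mono) auto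
    ultimately have "G (s (Suc k)) \<le> q * G (s k) - \<eta> * (q ^ Suc k * real (Suc N))" by linarith
    then have "G (s (Suc k)) / q ^ Suc k \<le> (q * G (s k) - \<eta> * (q ^ Suc k * real (Suc N))) / q ^ Suc k"
      using q0 by (intro divide_right_mono) auto
    also have "\<dots> = G (s k) / q ^ k - \<eta> * real (Suc N)" using q0 by (simp add: diff_divide_distrib)
    finally show ?case using Suc by (simp add: algebra_simps)
  qed simp
  moreover have "0 \<le> G (s k) / q ^ k" for k using G q0 by simp
  ultimately have bd: "real k * (\<eta> * real (Suc N)) \<le> G (s 0)" for k by (meson diff_ge_0_iff_ge order_trans)
  obtain k :: nat where "G (s 0) / (\<eta> * real (Suc N)) < real k" using reals_Archimedean2 by blast
  moreover have "0 < \<eta> * real (Suc N)" using \<eta> by simp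
  ultimately have "G (s 0) < real k * (\<eta> * real (Suc N))" by (simp add: pos_divide_less_eq del: of_nat_Suc)
  then show False using bd[of k] by linarith
qed

text \<open>By \<open>telescope\<close> every point has infinitely many prefixes of weight at least
  \<open>m powr (- (s * n))\<close>. The total mass bounds the number of words of such weight, so
  these prefixes form an efficient cover.\<close>

lemma hausdorff_upper:
  assumes X: "X \<noteq> {}"
  shows "hausdorff_dim X \<le> ereal (hdim / ln (real m))"
proof (rule ereal_le_epsilon2)
  fix \<epsilon> :: real assume \<epsilon>: "0 < \<epsilon>"
  define \<kappa> where "\<kappa> = (\<lambda>x. if adm K x then 1 else 0 :: real)"
  interpret forest_measure m a H sc q Cq lam K "\<lambda>v. U (rl v)" \<kappa>
    by unfold_locales (auto simp: U_pos \<kappa>_def)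
  \<comment> \<open>One third each for the deviation of \<open>S n\<close>, the telescoped defect
    and the constant \<open>C0\<close>.\<close>
  define \<delta> where "\<delta> = \<epsilon> * ln (real m) / 3"
  have \<delta>: "0 < \<delta>" using \<epsilon> ln_m_pos by (simp add: \<delta>_def)
  define s where "s = hdim / ln (real m) + \<epsilon>"
  have s_ln: "s * ln (real m) = hdim + 3 * \<delta>" using ln_m_pos by (simp add: s_def \<delta>_def field_simps)
  have ev: "\<forall>\<^sub>F n in sequentially. S n / real n < hdim + \<delta> \<and> C0 / real n < \<delta> \<and> 0 < n"
  proof (intro eventually_conj)
    show "\<forall>\<^sub>F n in sequentially. S n / real n < hdim + \<delta>" using S_lim by (rule order_tendstoD) (use \<delta> in simp)
    have "(\<lambda>n. C0 / real n) \<longlonglongrightarrow> 0" by (rule tendsto_bounded_over_n[of _ "\<bar>C0\<bar>"]) simp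
    then show "\<forall>\<^sub>F n in sequentially. C0 / real n < \<delta>" by (rule order_tendstoD) (rule \<delta>)
    show "\<forall>\<^sub>F n :: nat in sequentially. 0 < n" by (rule eventually_gt_at_top)
  qed
  then obtain n0 where n0: "\<And>n. n0 \<le> n \<Longrightarrow> S n < (hdim + \<delta>) * real n \<and> C0 < \<delta> * real n"
    unfolding eventually_sequentially by (metis of_nat_0_less_iff pos_divide_less_eq)
  define L where "L n = {y \<in> Wd n. real m powr (- (s * real n)) \<le> w n y}" for n
  have "hausdorff_dim X \<le> ereal s"
  proof (rule hausdorff_dim_le[OF X_full, of K L "real (card (Wd K))" s])
    show "L n \<subseteq> words m n" for n by (auto simp: L_def Wd_def)
    show "real (card (L n)) \<le> real (card (Wd K)) * real m powr (s * real n)" if n: "K \<le> n" for n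
    proof -
      have "real (card (L n)) * real m powr (- (s * real n)) \<le> (\<Sum>y\<in>L n. w n y)"
        by (rule sum_bounded_below) (simp add: L_def)
      also have "\<dots> \<le> (\<Sum>y\<in>Wd n. w n y)"
        by (rule sum_mono2) (auto simp: L_def Wd_def intro: w_nonneg)
      also have "\<dots> = real (card (Wd K))" unfolding \<kappa>_def by (rule sum_w_Wd) (use U_pos n in auto)
      finally show ?thesis using m2 by (simp add: powr_minus field_simps)
    qed
    show "\<exists>k\<ge>n. pre k x \<in> L k" if x: "x \<in> X" for x n
    proof -
      obtain k where k: "max n (max n0 (Suc K)) \<le> k" "q * \<Psi> (fl k) x - \<Psi> k x \<le> \<delta> * real k"
        using telescope[of "\<lambda>n. \<Psi> n x" \<delta> "max n (max n0 (Suc K))"] \<Psi>_nonneg \<delta> by blast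
      have kK: "K \<le> k" using k by simp
      have y: "pre k x \<in> Wd k" using x pre_X[OF kK] by blast
      have yw: "pre k x \<in> words m k" "adm k (pre k x)" using y by (auto simp: Wd_def)
      have \<kappa>1: "\<kappa> (pre K (pre k x)) = 1"
        using adm_pre[OF yw(2) kK] adm_cong[of K "pre k x" "pre K (pre k x)"] by (simp add: \<kappa>_def)
      have "0 < w k (pre k x)" using w_pos_iff[OF kK yw(1)] adm_alt[OF kK y] \<kappa>1 by simp
      moreover have "- ln (w k (pre k x)) \<le> s * real k * ln (real m)"
      proof -
        have "\<bar>- ln (w k (pre k x)) - (S k + q * \<Psi> (fl k) (pre k x) - \<Psi> k (pre k x))\<bar> \<le> C0"
          by (rule ln_weight[where \<kappa> = \<kappa>, OF _ \<kappa>1 kK y]) (simp add: \<kappa>_def)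
        then have "- ln (w k (pre k x)) \<le> S k + (q * \<Psi> (fl k) x - \<Psi> k x) + C0"
          using \<Psi>_pre[of "fl k" k x] \<Psi>_pre[of k k x] fl_le[of k] by simp
        also have "\<dots> \<le> (hdim + \<delta>) * real k + \<delta> * real k + \<delta> * real k" using k n0[of k] by simp
        also have "\<dots> = (s * ln (real m)) * real k" unfolding s_ln by (simp add: algebra_simps)
        finally show ?thesis by (simp add: mult_ac)
      qed
      ultimately have "real m powr (- (s * real k)) \<le> w k (pre k x)"
        using m2 exp_le_cancel_iff[of "- (s * real k * ln (real m))" "ln (w k (pre k x))"] by (simp add: powr_def)
      then show ?thesis using y k by (auto simp: L_def)
    qed
    show "0 \<le> s" using hdim_nonneg \<epsilon> ln_m_pos by (simp add: s_def)
  qed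
  then show "hausdorff_dim X \<le> ereal (hdim / ln (real m)) + ereal \<epsilon>" by (simp add: s_def)
qed

end

text \<open>Used to bound depths by a multiple of \<open>sqrt n\<close>. The variance is then of
  order \<open>n * sqrt n\<close>, and Chebyshev's inequality yields \<open>1 / sqrt n\<close>,
  which is \<open>1 / k ^ 2\<close> at the level \<open>n = k ^ 4\<close>.\<close>

lemma ln_le_2_sqrt: "1 \<le> x \<Longrightarrow> ln x \<le> 2 * sqrt (x :: real)"
  using ln_le_minus_one[of "sqrt x"] by (simp add: ln_sqrt)

context density_sol
begin

text \<open>The distribution of the symbol at a node of depth \<open>p\<close> and remaining length \<open>r\<close>.\<close>

primrec Mg :: "nat \<Rightarrow> nat \<Rightarrow> nat \<Rightarrow> real" where
  "Mg 0 = (\<lambda>r b. U r b / \<sigma> r)"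
| "Mg (Suc p) = (\<lambda>r b. \<Sum>c<m. Mg p (if r = 0 then 0 else Suc r) c * (a c b * U r b / (\<Sum>b'<m. a c b' * U r b')))"

text \<open>The mean \<open>E n\<close> of \<open>\<Psi> n\<close> is asymptotically linear.
  Whatever its slope \<open>l\<close> is, it cancels in the mean defect, since
  \<open>q * (l / q) - l = 0\<close>; the fluctuations are handled by the variance bound.\<close>

lemma hausdorff_lower:
  assumes X: "X \<noteq> {}"
  shows "ereal (hdim / ln (real m)) \<le> hausdorff_dim X"
proof (rule ereal_le_epsilon2)
  fix \<epsilon> :: real assume \<epsilon>: "0 < \<epsilon>"
  obtain x0 where x0: "x0 \<in> Wd K" using Wd_nonempty[OF X, of K] by (auto simp: card_gt_0_iff)
  interpret forest_prob m a H sc q Cq lam K "\<lambda>v. U (rl v)" x0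
    by unfold_locales (auto simp: U_pos x0)
  define mb where "mb v b = Ex v (\<lambda>x. if x v = b then 1 else 0)" for v b
  have Ex_val: "Ex n (\<lambda>x. F (x v)) = (\<Sum>c<m. mb v c * F c)" if v: "K < v" "v \<le> n" for F :: "nat \<Rightarrow> real" and n v
  proof -
    have "Ex n (\<lambda>x. F (x v)) = Ex n (\<lambda>x. \<Sum>c<m. F c * (if x v = c then 1 else 0))"
    proof (rule Ex_cong)
      fix x assume "x \<in> words m n"
      then have "x v < m" using words_less[of x m n v] v by simp
      then show "F (x v) = (\<Sum>c<m. F c * (if x v = c then 1 else 0))"
        by (simp add: if_distrib[of "\<lambda>y. F _ * y"] cong: if_cong)
    qed
    also have "\<dots> = (\<Sum>c<m. F c * Ex n (\<lambda>x. if x v = c then 1 else 0))" by (simp add: Ex_sum Ex_cmult)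
    also have "\<dots> = (\<Sum>c<m. mb v c * F c)"
    proof (rule sum.cong[OF refl])
      fix c
      have "Ex n (\<lambda>x. if x v = c then 1 else 0) = mb v c"
        unfolding mb_def using v by (intro Ex_level) (auto simp: pre_apply)
      then show "F c * Ex n (\<lambda>x. if x v = c then 1 else 0) = mb v c * F c" by simp
    qed
    finally show ?thesis .
  qed
  have mb_step: "mb v b = Ex v (\<lambda>x. tp v (x (pr v)) b)" if v: "K < v" and b: "b < m" for v b
  proof -
    have "mb v b = Ex v (\<lambda>x. Tr v (\<lambda>c. if c = b then 1 else 0) (x (pr v)))"
      unfolding mb_def using Ex_step[OF v order_refl, of "\<lambda>_. 1" "\<lambda>c. if c = b then 1 else 0"] by simp
    also have "Tr v (\<lambda>c. if c = b then 1 else 0) = (\<lambda>c. tp v c b)"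
      using b by (auto simp: Tr_def if_distrib[of "\<lambda>y. tp _ _ _ * y"] cong: if_cong)
    finally show ?thesis .
  qed
  \<comment> \<open>At depth \<open>p\<close> the law of the symbol depends on the remaining length
    alone, except at descendants of the at most \<open>K\<close> nodes entered from
    \<open>{1..K}\<close>, where it depends on \<open>x0\<close>.\<close>
  have finE: "finite {v \<in> Cls p. \<exists>b<m. mb v b \<noteq> Mg p (rl v) b}" for p
  proof (induction p)
    case 0
    have "{v \<in> Cls 0. \<exists>b<m. mb v b \<noteq> Mg 0 (rl v) b} \<subseteq> sc ` {1..K}"
    proof
      fix v assume "v \<in> {v \<in> Cls 0. \<exists>b<m. mb v b \<noteq> Mg 0 (rl v) b}"
      then obtain b where v: "K < v" "dep v = 0" "b < m" "mb v b \<noteq> Mg 0 (rl v) b" by (auto simp: Cls_def)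
      have "pr v \<noteq> 0"
      proof
        assume "pr v = 0"
        then have "mb v b = U (rl v) b / \<sigma> (rl v)"
          using mb_step[OF v(1,3)] Ex_const[of v] v(1) by (simp add: tp_def SV_def \<sigma>_def)
        then show False using v by simp
      qed
      moreover have "pr v \<le> K" using v by (simp add: dep.simps[of v] split: if_splits)
      ultimately have "pr v \<in> {1..K}" "v = sc (pr v)" using sc_pr[OF v(1)] by auto
      then show "v \<in> sc ` {1..K}" by blast
    qed
    then show ?case by (rule finite_subset) simp
  next
    case (Suc p)
    have "{v \<in> Cls (Suc p). \<exists>b<m. mb v b \<noteq> Mg (Suc p) (rl v) b} \<subseteq> sc ` {v \<in> Cls p. \<exists>b<m. mb v b \<noteq> Mg p (rl v) b}"
    proof
      fix v assume "v \<in> {v \<in> Cls (Suc p). \<exists>b<m. mb v b \<noteq> Mg (Suc p) (rl v) b}"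
      then obtain b where v: "v \<in> Cls (Suc p)" "b < m" "mb v b \<noteq> Mg (Suc p) (rl v) b" by blast
      then obtain u where u: "u \<in> Cls p" "u \<in> H" "v = sc u" by (auto simp: Cls_Suc)
      have uK: "K < u" "K < v" "pr v = u" "u < v" using u sc_K[of u] pr_sc[of u] sc_gt[of u] by (auto simp: Cls_def)
      have rlu: "rl u = (if rl v = 0 then 0 else Suc (rl v))" using rl_in[OF u(2)] u(3) by simp
      have u0: "u \<noteq> 0" using uK by simp
      have "mb v b = Ex v (\<lambda>x. tp v (x u) b)" using mb_step[OF uK(2) v(2)] uK by simp
      also have "\<dots> = (\<Sum>c<m. mb u c * tp v c b)" using uK by (intro Ex_val) auto
      finally have mbv: "mb v b = (\<Sum>c<m. mb u c * (a c b * U (rl v) b / (\<Sum>b'<m. a c b' * U (rl v) b')))"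
        using uK u0 by (simp add: tp_def AV_def)
      have "\<exists>c<m. mb u c \<noteq> Mg p (rl u) c"
      proof (rule ccontr)
        assume "\<not> ?thesis"
        then have "mb v b = Mg (Suc p) (rl v) b" unfolding mbv Mg.simps rlu[symmetric] by (intro sum.cong) auto
        then show False using v by simp
      qed
      then show "v \<in> sc ` {v \<in> Cls p. \<exists>b<m. mb v b \<noteq> Mg p (rl v) b}" using u by blast
    qed
    then show ?case by (rule finite_subset) (use Suc in simp)
  qed
  define e where "e v = (if K < v then Ex v (\<lambda>x. ln (U (rl v) (x v))) else 0)" for v
  have eB: "\<bar>e v\<bar> \<le> BU" for v
  proof (cases "K < v")
    case True
    have "e v \<le> Ex v (\<lambda>_. BU)" "Ex v (\<lambda>_. 0) \<le> e v"
      using True unfolding e_def by (auto intro!: Ex_mono ln_U_bounds)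
    then show ?thesis using Ex_const[of v] True by simp
  qed (use BU_nonneg in \<open>simp add: e_def\<close>)
  \<comment> \<open>The truncation supplies the uniform bound required by \<open>avg\<close>. It
    does not alter values equal to some \<open>e v\<close>, as these lie in the same range.\<close>
  define g where "g p r = max (- BU) (min BU (\<Sum>b<m. Mg p r b * ln (U r b)))" for p r
  have gB: "\<bar>g p r\<bar> \<le> BU" for p r using BU_nonneg by (auto simp: g_def)
  have fin: "finite {v \<in> Cls p. e v \<noteq> g p (rl v)}" for p
  proof (rule finite_subset[OF _ finE[of p]], rule subsetI)
    fix v assume v: "v \<in> {v \<in> Cls p. e v \<noteq> g p (rl v)}"
    then have K: "K < v" by (auto simp: Cls_def)
    have "\<exists>b<m. mb v b \<noteq> Mg p (rl v) b"
    proof (rule ccontr)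
      assume "\<not> ?thesis"
      then have "e v = (\<Sum>b<m. Mg p (rl v) b * ln (U (rl v) b))"
        using Ex_val[of v v "\<lambda>c. ln (U (rl v) c)"] K by (simp add: e_def)
      then have "e v = g p (rl v)" using eB[of v] by (simp add: g_def max_def min_def abs_le_iff)
      then show False using v by simp
    qed
    then show "v \<in> {v \<in> Cls p. \<exists>b<m. mb v b \<noteq> Mg p (rl v) b}" using v by simp
  qed
  define E where "E n = (\<Sum>v\<in>{K<..n}. e v)" for n
  obtain l where El: "(\<lambda>n. E n / real n) \<longlonglongrightarrow> l"
    using avg(1)[of e BU g, OF eB gB fin] unfolding E_def by blast
  have E_Ex: "(\<Sum>v\<in>{K<..n}. Ex n (\<lambda>x. ln (U (rl v) (x v)))) = E n" for n
    unfolding E_def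
  proof (rule sum.cong[OF refl])
    fix v assume v: "v \<in> {K<..n}"
    then have "Ex n (\<lambda>x. ln (U (rl v) (x v))) = Ex v (\<lambda>x. ln (U (rl v) (x v)))"
      by (intro Ex_level) (auto simp: pre_apply)
    then show "Ex n (\<lambda>x. ln (U (rl v) (x v))) = e v" using v by (simp add: e_def)
  qed
  define C1 where "C1 = 8 * BU\<^sup>2 * (1 + 2 / ln lam)"
  have C1: "0 \<le> C1" using ln_lam_pos by (simp add: C1_def)
  have var: "Ex n (\<lambda>x. (\<Psi> n x - E n)\<^sup>2) \<le> C1 * (real n * sqrt (real n))" if n: "K \<le> n" "1 \<le> n" for n
  proof -
    have sn: "1 \<le> sqrt (real n)" using n by simp
    have d: "real (Suc (dep v)) \<le> (1 + 2 / ln lam) * sqrt (real n)" if v: "v \<in> {K<..n}" for v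
    proof -
      have "lam ^ dep v \<le> real n" using lam_dep[of v] v by auto
      then have "ln (lam ^ dep v) \<le> ln (real n)" using lam1 by (intro ln_mono) auto
      also have "\<dots> \<le> 2 * sqrt (real n)" using n by (intro ln_le_2_sqrt) simp
      finally have "real (dep v) * ln lam \<le> 2 * sqrt (real n)" using lam1 by (simp add: ln_realpow)
      then have "real (dep v) \<le> 2 * sqrt (real n) / ln lam" using ln_lam_pos by (simp add: pos_le_divide_eq)
      moreover have "(1 + 2 / ln lam) * sqrt (real n) = sqrt (real n) + 2 * sqrt (real n) / ln lam"
        by (simp add: algebra_simps)
      moreover have "real (Suc (dep v)) = 1 + real (dep v)" by simp
      ultimately show ?thesis using sn by linarith
    qed
    have "(\<Sum>v\<in>{K<..n}. real (Suc (dep v))) \<le> real (card {K<..n}) * ((1 + 2 / ln lam) * sqrt (real n))"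
      by (rule sum_bounded_above) (rule d)
    also have "\<dots> \<le> real n * ((1 + 2 / ln lam) * sqrt (real n))" using ln_lam_pos by (intro mult_right_mono) auto
    finally have "8 * BU\<^sup>2 * (\<Sum>v\<in>{K<..n}. real (Suc (dep v))) \<le> 8 * BU\<^sup>2 * (real n * ((1 + 2 / ln lam) * sqrt (real n)))"
      by (intro mult_left_mono) auto
    moreover have "Ex n (\<lambda>x. (\<Psi> n x - E n)\<^sup>2) \<le> 8 * BU\<^sup>2 * (\<Sum>v\<in>{K<..n}. real (Suc (dep v)))"
      unfolding \<Psi>_def E_Ex[symmetric] by (rule variance_bound[OF n(1)]) (rule abs_ln_U)
    moreover have "8 * BU\<^sup>2 * (real n * ((1 + 2 / ln lam) * sqrt (real n))) = C1 * (real n * sqrt (real n))"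
      by (simp add: C1_def)
    ultimately show ?thesis by linarith
  qed
  \<comment> \<open>One fifth each is lost to \<open>S n\<close>, to \<open>C0\<close> and to the
    mean defect. What remains is a deviation of \<open>2 * \<delta> * n\<close>, so one of the two
    fluctuations must reach \<open>\<delta> * n\<close>.\<close>
  define \<delta> where "\<delta> = \<epsilon> * ln (real m) / 5"
  have \<delta>: "0 < \<delta>" using \<epsilon> ln_m_pos by (simp add: \<delta>_def)
  define s where "s = hdim / ln (real m) - \<epsilon>"
  have s_ln: "s * ln (real m) = hdim - 5 * \<delta>" using ln_m_pos by (simp add: s_def \<delta>_def field_simps)
  have ev: "\<forall>\<^sub>F n in sequentially. hdim - \<delta> < S n / real n \<and> C0 / real n < \<delta> \<and>
     \<bar>q * (E (fl n) / real n) - E n / real n\<bar> < \<delta> \<and> max K 1 \<le> fl n \<and> 0 < n"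
  proof (intro eventually_conj)
    show "\<forall>\<^sub>F n in sequentially. hdim - \<delta> < S n / real n" using S_lim by (rule order_tendstoD) (use \<delta> in simp)
    have "(\<lambda>n. C0 / real n) \<longlonglongrightarrow> 0" by (rule tendsto_bounded_over_n[of _ "\<bar>C0\<bar>"]) simp
    then show "\<forall>\<^sub>F n in sequentially. C0 / real n < \<delta>" by (rule order_tendstoD) (rule \<delta>)
    have "(\<lambda>n. \<bar>q * (E (fl n) / real n) - E n / real n\<bar>) \<longlonglongrightarrow> \<bar>q * (l / q) - l\<bar>"
      by (intro tendsto_intros avg_fl El)
    then show "\<forall>\<^sub>F n in sequentially. \<bar>q * (E (fl n) / real n) - E n / real n\<bar> < \<delta>"
      by (rule order_tendstoD) (use q1 \<delta> in simp)
    show "\<forall>\<^sub>F n in sequentially. max K 1 \<le> fl n" using fl_inf unfolding filterlim_at_top by blast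
    show "\<forall>\<^sub>F n :: nat in sequentially. 0 < n" by (rule eventually_gt_at_top)
  qed
  then obtain k0 where k0: "\<And>n. k0 \<le> n \<Longrightarrow> hdim - \<delta> < S n / real n \<and> C0 / real n < \<delta> \<and>
     \<bar>q * (E (fl n) / real n) - E n / real n\<bar> < \<delta> \<and> max K 1 \<le> fl n \<and> 0 < n"
    unfolding eventually_sequentially by blast
  have bad: "Ex n (\<lambda>x. if real m powr (- (s * real n)) < w n x then 1 else 0) \<le> (q\<^sup>2 + 1) * C1 / \<delta>\<^sup>2 / sqrt (real n)"
    if n: "k0 \<le> n" "K \<le> n" for n
  proof -
    have n0: "0 < real n" and fK: "K \<le> fl n" "1 \<le> fl n" using k0[OF n(1)] by auto
    have kS: "(hdim - \<delta>) * real n < S n" "C0 < \<delta> * real n" using k0[OF n(1)] n0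
      by (auto simp: pos_less_divide_eq pos_divide_less_eq)
    have "\<bar>q * (E (fl n) / real n) - E n / real n\<bar> = \<bar>q * E (fl n) - E n\<bar> / real n"
      using n0 by (simp add: diff_divide_distrib[symmetric])
    then have kE: "\<bar>q * E (fl n) - E n\<bar> < \<delta> * real n" using k0[OF n(1)] n0 by (simp add: pos_divide_less_eq)
    define A where "A x = \<Psi> (fl n) x - E (fl n)" for x
    define B where "B x = \<Psi> n x - E n" for x
    have "Ex n (\<lambda>x. if real m powr (- (s * real n)) < w n x then 1 else 0)
        \<le> Ex n (\<lambda>x. 1 / (\<delta> * real n)\<^sup>2 * (q\<^sup>2 * (A x)\<^sup>2 + (B x)\<^sup>2))"
    proof (rule Ex_mono)
      fix x assume x: "x \<in> words m n" "0 < w n x"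
      show "(if real m powr (- (s * real n)) < w n x then 1 else 0) \<le> 1 / (\<delta> * real n)\<^sup>2 * (q\<^sup>2 * (A x)\<^sup>2 + (B x)\<^sup>2)"
      proof (cases "real m powr (- (s * real n)) < w n x")
        case True
        have xW: "x \<in> Wd n" "pre K x = x0" using w_pos_Wd[OF n(2) x] by auto
        have "0 < real m powr (- (s * real n))" using m2 by simp
        then have "ln (real m powr (- (s * real n))) < ln (w n x)" using True x(2) by (subst ln_less_cancel_iff)
        moreover have "ln (real m powr (- (s * real n))) = - ((hdim - 5 * \<delta>) * real n)"
          using m2 by (simp add: ln_powr s_ln[symmetric])
        ultimately have lw: "- ln (w n x) < (hdim - 5 * \<delta>) * real n" by linarith
        have "\<bar>- ln (w n x) - (S n + q * \<Psi> (fl n) x - \<Psi> n x)\<bar> \<le> C0"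
          by (rule ln_weight[where \<kappa> = "\<lambda>x. if x = x0 then 1 else 0", OF _ _ n(2) xW(1)]) (auto simp: xW)
        then have "q * \<Psi> (fl n) x - \<Psi> n x < (hdim - 5 * \<delta>) * real n - (hdim - \<delta>) * real n + \<delta> * real n"
          using lw kS by linarith
        also have "\<dots> = - 3 * (\<delta> * real n)" by (simp add: algebra_simps)
        finally have qAB: "q * A x - B x < - 2 * (\<delta> * real n)" using kE unfolding A_def B_def right_diff_distrib by linarith
        have dn: "0 < \<delta> * real n" using \<delta> n0 by simp
        have "\<delta> * real n \<le> \<bar>q * A x\<bar> \<or> \<delta> * real n \<le> \<bar>B x\<bar>" using qAB dn by linarith
        then have "(\<delta> * real n)\<^sup>2 \<le> \<bar>q * A x\<bar>\<^sup>2 \<or> (\<delta> * real n)\<^sup>2 \<le> \<bar>B x\<bar>\<^sup>2"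
          using dn power_mono[of "\<delta> * real n" _ 2] by fastforce
        then have "(\<delta> * real n)\<^sup>2 \<le> q\<^sup>2 * (A x)\<^sup>2 + (B x)\<^sup>2"
        proof
          assume "(\<delta> * real n)\<^sup>2 \<le> \<bar>q * A x\<bar>\<^sup>2"
          then have "(\<delta> * real n)\<^sup>2 \<le> q\<^sup>2 * (A x)\<^sup>2" by (simp add: power_mult_distrib)
          then show ?thesis using zero_le_power2[of "B x"] by linarith
        next
          assume "(\<delta> * real n)\<^sup>2 \<le> \<bar>B x\<bar>\<^sup>2"
          then have "(\<delta> * real n)\<^sup>2 \<le> (B x)\<^sup>2" by simp
          moreover have "0 \<le> q\<^sup>2 * (A x)\<^sup>2" by simp
          ultimately show ?thesis by linarith
        qed
        moreover have "0 < (\<delta> * real n)\<^sup>2" using dn by (rule zero_less_power)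
        ultimately show ?thesis using True by (simp add: pos_le_divide_eq del: power_mult_distrib)
      qed simp
    qed
    also have "\<dots> = 1 / (\<delta> * real n)\<^sup>2 * (q\<^sup>2 * Ex n (\<lambda>x. (A x)\<^sup>2) + Ex n (\<lambda>x. (B x)\<^sup>2))"
      by (simp only: Ex_cmult Ex_add)
    also have "\<dots> \<le> 1 / (\<delta> * real n)\<^sup>2 * (q\<^sup>2 * (C1 * (real n * sqrt (real n))) + C1 * (real n * sqrt (real n)))"
    proof (intro mult_left_mono add_mono)
      have "Ex n (\<lambda>x. (A x)\<^sup>2) = Ex (fl n) (\<lambda>x. (A x)\<^sup>2)"
        using fK fl_le[of n] by (intro Ex_level) (auto simp: A_def \<Psi>_pre)
      also have "\<dots> \<le> C1 * (real (fl n) * sqrt (real (fl n)))" unfolding A_def by (rule var) (use fK in auto)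
      also have "\<dots> \<le> C1 * (real n * sqrt (real n))"
        using C1 fl_le[of n] by (intro mult_left_mono mult_mono) auto
      finally show "Ex n (\<lambda>x. (A x)\<^sup>2) \<le> C1 * (real n * sqrt (real n))" .
      show "Ex n (\<lambda>x. (B x)\<^sup>2) \<le> C1 * (real n * sqrt (real n))" unfolding B_def by (rule var) (use n n0 in auto)
    qed auto
    also have "\<dots> = (q\<^sup>2 + 1) * C1 / \<delta>\<^sup>2 / sqrt (real n)"
    proof -
      have r: "real n = sqrt (real n) * sqrt (real n)" by simp
      have sp: "0 < sqrt (real n)" using n0 by simp
      define z where "z = sqrt (real n)"
      have "real n = z * z" "0 < z" using r sp by (simp_all add: z_def)
      then show ?thesis unfolding z_def[symmetric] using \<delta>
        by (simp add: power2_eq_square divide_simps) (simp add: algebra_simps)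
    qed
    finally show ?thesis .
  qed
  have "ereal s \<le> hausdorff_dim X"
  proof (rule hausdorff_dim_ge[OF X_full total_1 w_pos_X, of "max 1 k0" s "(q\<^sup>2 + 1) * C1 / \<delta>\<^sup>2"])
    fix k assume k: "max 1 k0 \<le> k" "K \<le> k ^ 4"
    have kk: "k \<le> k ^ 4" using k by (intro self_le_power) auto
    have "sqrt (real (k ^ 4)) = (real k)\<^sup>2"
      by (rule real_sqrt_unique) (auto simp: power_mult[symmetric])
    then show "(\<Sum>x\<in>words m (k ^ 4). w (k ^ 4) x * (if real m powr (- (s * real (k ^ 4))) < w (k ^ 4) x then 1 else 0))
        \<le> (q\<^sup>2 + 1) * C1 / \<delta>\<^sup>2 / (real k)\<^sup>2"
      using bad[of "k ^ 4"] k kk unfolding Ex_def by simp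
  qed
  then have "ereal s + ereal \<epsilon> \<le> hausdorff_dim X + ereal \<epsilon>" by (rule add_right_mono)
  then show "ereal (hdim / ln (real m)) \<le> hausdorff_dim X + ereal \<epsilon>" by (simp add: s_def)
qed

theorem hausdorff_dim_eq: "X \<noteq> {} \<Longrightarrow> hausdorff_dim X = ereal (hdim / ln (real m))"
  using hausdorff_upper hausdorff_lower antisym by blast

end

section \<open>The combinatorial formulas\<close>

lemma pow_mat_Suc_left:
  assumes "A \<in> carrier_mat n n"
  shows "A ^\<^sub>m Suc k = A * A ^\<^sub>m k"
proof (induction k)
  case (Suc k)
  have "A ^\<^sub>m Suc (Suc k) = (A * A ^\<^sub>m k) * A" using Suc by simp
  also have "\<dots> = A * (A ^\<^sub>m k * A)" using assms by (intro assoc_mult_mat) auto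
  finally show ?case by simp
qed (use assms in simp)

lemma index_mult_sum:
  assumes "A \<in> carrier_mat n n" "B \<in> carrier_mat n n" "i < n" "j < n"
  shows "(A * B) $$ (i, j) = (\<Sum>l<n. A $$ (i, l) * B $$ (l, j))"
  using assms by (simp add: scalar_prod_def atLeast0LessThan)

text \<open>A transfer matrix evaluation. The weight \<open>w c\<close> sits on the
  \<open>c\<close>-th letter from the end; summing out the last letter lowers the indices of the
  weights by one and changes the end factor from \<open>g\<close> to \<open>g'\<close>.\<close>

lemma path_sum:
  fixes a :: "nat \<Rightarrow> nat \<Rightarrow> real" and w It :: "nat \<Rightarrow> nat \<Rightarrow> real"
  assumes "\<And>j. It 0 j = g j" "\<And>n j. It (Suc n) j = (\<Sum>y<m. a j y * w (Suc n) y * It n y)"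
  shows "(\<Sum>b\<in>words m (Suc n). h (b 1) * (\<Prod>e=1..n. a (b e) (b (e + 1))) * g (b (Suc n)) *
      (\<Prod>c=1..Suc n. w c (b (Suc (Suc n) - c)))) = (\<Sum>y<m. h y * w (Suc n) y * It n y)"
  using assms
proof (induction n arbitrary: w g It)
  case 0
  have "(\<Sum>b\<in>words m (Suc 0). h (b 1) * (\<Prod>e=1..0. a (b e) (b (e + 1))) * g (b (Suc 0)) *
      (\<Prod>c=1..Suc 0. w c (b (Suc (Suc 0) - c)))) = (\<Sum>b\<in>words m 0. \<Sum>y<m. h y * g y * w 1 y)"
    by (simp add: sum_words_Suc)
  also have "\<dots> = (\<Sum>y<m. h y * g y * w 1 y)" by (simp add: card_words)
  finally show ?case using 0 by (simp add: mult_ac)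
next
  case (Suc n)
  define w' where "w' c = w (Suc c)" for c
  define g' where "g' x = (\<Sum>y<m. a x y * w 1 y * g y)" for x
  define It' where "It' k = It (Suc k)" for k
  have It': "It' 0 j = g' j" "It' (Suc k) j = (\<Sum>y<m. a j y * w' (Suc k) y * It' k y)" for j k
    using Suc.prems by (simp_all add: It'_def g'_def w'_def)
  have pw: "(\<Prod>c=1..Suc (Suc n). w c ((x(Suc (Suc n) := y)) (Suc (Suc (Suc n)) - c))) =
      w 1 y * (\<Prod>c=1..Suc n. w' c (x (Suc (Suc n) - c)))" for x y
  proof -
    have "(\<Prod>c=1..Suc (Suc n). w c ((x(Suc (Suc n) := y)) (Suc (Suc (Suc n)) - c))) =
       w 1 y * (\<Prod>c=Suc 1..Suc (Suc n). w c ((x(Suc (Suc n) := y)) (Suc (Suc (Suc n)) - c)))"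
      by (subst prod.atLeast_Suc_atMost) auto
    also have "(\<Prod>c=Suc 1..Suc (Suc n). w c ((x(Suc (Suc n) := y)) (Suc (Suc (Suc n)) - c))) =
       (\<Prod>c=1..Suc n. w (Suc c) ((x(Suc (Suc n) := y)) (Suc (Suc (Suc n)) - Suc c)))"
      by (rule prod.shift_bounds_cl_Suc_ivl)
    also have "\<dots> = (\<Prod>c=1..Suc n. w' c (x (Suc (Suc n) - c)))"
      by (intro prod.cong refl) (auto simp: w'_def)
    finally show ?thesis .
  qed
  have pa: "(\<Prod>e=1..Suc n. a ((x(Suc (Suc n) := y)) e) ((x(Suc (Suc n) := y)) (e + 1))) =
      (\<Prod>e=1..n. a (x e) (x (e + 1))) * a (x (Suc n)) y" for x y
  proof -
    have "(\<Prod>e=1..n. a ((x(Suc (Suc n) := y)) e) ((x(Suc (Suc n) := y)) (e + 1))) = (\<Prod>e=1..n. a (x e) (x (e + 1)))"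
      by (intro prod.cong refl) auto
    then show ?thesis by simp
  qed
  have "(\<Sum>b\<in>words m (Suc (Suc n)). h (b 1) * (\<Prod>e=1..Suc n. a (b e) (b (e + 1))) * g (b (Suc (Suc n))) *
      (\<Prod>c=1..Suc (Suc n). w c (b (Suc (Suc (Suc n)) - c)))) =
    (\<Sum>x\<in>words m (Suc n). \<Sum>y<m. h (x 1) * ((\<Prod>e=1..n. a (x e) (x (e + 1))) * a (x (Suc n)) y) * g y *
      (w 1 y * (\<Prod>c=1..Suc n. w' c (x (Suc (Suc n) - c)))))"
    unfolding sum_words_Suc[of _ m "Suc n"] pw pa by simp
  also have "\<dots> = (\<Sum>x\<in>words m (Suc n). h (x 1) * (\<Prod>e=1..n. a (x e) (x (e + 1))) * g' (x (Suc n)) *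
      (\<Prod>c=1..Suc n. w' c (x (Suc (Suc n) - c))))"
    by (intro sum.cong refl) (simp add: g'_def sum_distrib_left sum_distrib_right mult_ac)
  also have "\<dots> = (\<Sum>y<m. h y * w' (Suc n) y * It' n y)" by (rule Suc.IH[OF It'])
  finally show ?case by (simp add: w'_def It'_def)
qed

context forest
begin

lemma pow_mat_R:
  assumes A: "A \<in> carrier_mat m m" and aA: "\<And>i j. i < m \<Longrightarrow> j < m \<Longrightarrow> a i j = A $$ (i, j)"
    and j: "j < m"
  shows "(\<Sum>l<m. (A ^\<^sub>m p) $$ (j, l)) = R p j"
  using j
proof (induction p arbitrary: j)
  case 0
  have "(\<Sum>l<m. (A ^\<^sub>m 0) $$ (j, l)) = (\<Sum>l<m. if j = l then 1 else 0)"
    using A 0 by (intro sum.cong) auto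
  then show ?case using 0 by simp
next
  case (Suc p)
  have "(\<Sum>l<m. (A ^\<^sub>m Suc p) $$ (j, l)) = (\<Sum>l<m. \<Sum>b<m. a j b * (A ^\<^sub>m p) $$ (b, l))"
    unfolding pow_mat_Suc_left[OF A] using Suc.prems
    by (intro sum.cong refl) (simp add: index_mult_sum[OF A pow_carrier_mat[OF A]] aA del: index_mult_mat)
  also have "\<dots> = (\<Sum>b<m. a j b * (\<Sum>l<m. (A ^\<^sub>m p) $$ (b, l)))"
    by (subst sum.swap) (simp add: sum_distrib_left)
  also have "\<dots> = R (Suc p) j" using Suc.IH by simp
  finally show ?case .
qed

lemma sum_mat_Q:
  assumes A: "A \<in> carrier_mat m m" and aA: "\<And>i j. i < m \<Longrightarrow> j < m \<Longrightarrow> a i j = A $$ (i, j)"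
  shows "sum_mat (A ^\<^sub>m p) = Q p"
proof -
  have "sum_mat (A ^\<^sub>m p) = (\<Sum>j<m. \<Sum>l<m. (A ^\<^sub>m p) $$ (j, l))"
    using A by (simp add: sum_mat_def sum.cartesian_product atLeast0LessThan case_prod_beta')
  then show ?thesis using pow_mat_R[OF A aA] by (simp add: Q_def)
qed

text \<open>It turns out to be the bracket in \<open>chain_weight\<close> at index
  \<open>k + 1\<close>.\<close>

definition Zs :: "nat \<Rightarrow> nat \<Rightarrow> real" where "Zs k j = (\<Sum>b<m. a j b * Us k b)"

lemma Zs_pos: "j < m \<Longrightarrow> 1 \<le> Zs k j"
proof -
  assume j: "j < m"
  have "(\<Sum>b<m. a j b * 1) \<le> Zs k j"
    unfolding Zs_def using Us_ge_1 a_nonneg[OF j] by (intro sum_mono mult_left_mono) auto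
  then show ?thesis using row_sum_pos[OF j] by simp
qed

text \<open>A bracket times the weight made from it is the next iterate; this collapses the nested
  sums.\<close>

lemma Zs_powr: "j < m \<Longrightarrow> Zs k j powr (1 / q - 1) * Zs k j = Us (Suc k) j"
  using Zs_pos[of j k] by (simp add: Zs_def[symmetric] powr_diff)

text \<open>The densities enter through \<open>ex\<close> alone: all the exponents agree, as
  \<open>chain_exponent\<close> shows for the Beatty chains.\<close>

context
  fixes A :: "real mat" and D :: "nat \<Rightarrow> nat \<Rightarrow> real" and i :: nat
  assumes A: "A \<in> carrier_mat m m" and aA: "\<And>i j. i < m \<Longrightarrow> j < m \<Longrightarrow> a i j = A $$ (i, j)"
    and ex: "\<And>k. 1 \<le> k \<Longrightarrow> k < i \<Longrightarrow> - D i (i - k) / (\<Sum>l=0..k. D i (i - l)) = 1 / q - 1"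
begin

lemma row_sum_eq: "j < m \<Longrightarrow> row_sum A j = Zs 0 j"
  using A aA by (simp add: row_sum_def Zs_def)

lemma weight_path_sum:
  assumes cw: "\<And>c y. 1 \<le> c \<Longrightarrow> c \<le> Suc n \<Longrightarrow> y < m \<Longrightarrow> chain_weight A D i c y = Zs (c - 1) y powr (1 / q - 1)"
  shows "(\<Sum>b\<in>words m (Suc n). h (b 1) * (\<Prod>e=1..n. A $$ (b e, b (e + 1))) * row_sum A (b (Suc n)) *
      (\<Prod>c=1..Suc n. chain_weight A D i c (b (Suc (Suc n) - c)))) = (\<Sum>y<m. h y * Us (Suc n) y)"
proof -
  define w where "w c y = Zs (c - 1) y powr (1 / q - 1)" for c y
  have "(\<Sum>b\<in>words m (Suc n). h (b 1) * (\<Prod>e=1..n. A $$ (b e, b (e + 1))) * row_sum A (b (Suc n)) *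
      (\<Prod>c=1..Suc n. chain_weight A D i c (b (Suc (Suc n) - c)))) =
    (\<Sum>b\<in>words m (Suc n). h (b 1) * (\<Prod>e=1..n. a (b e) (b (e + 1))) * Zs 0 (b (Suc n)) *
      (\<Prod>c=1..Suc n. w c (b (Suc (Suc n) - c))))"
  proof (rule sum.cong[OF refl])
    fix b assume b: "b \<in> words m (Suc n)"
    have bm: "b e < m" if "1 \<le> e" "e \<le> Suc n" for e using words_less[OF b that] .
    have 1: "(\<Prod>e=1..n. A $$ (b e, b (e + 1))) = (\<Prod>e=1..n. a (b e) (b (e + 1)))"
      using bm by (intro prod.cong refl) (auto simp: aA)
    have 2: "(\<Prod>c=1..Suc n. chain_weight A D i c (b (Suc (Suc n) - c))) = (\<Prod>c=1..Suc n. w c (b (Suc (Suc n) - c)))"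
      using bm cw by (intro prod.cong refl) (auto simp: w_def)
    show "h (b 1) * (\<Prod>e=1..n. A $$ (b e, b (e + 1))) * row_sum A (b (Suc n)) *
      (\<Prod>c=1..Suc n. chain_weight A D i c (b (Suc (Suc n) - c))) =
      h (b 1) * (\<Prod>e=1..n. a (b e) (b (e + 1))) * Zs 0 (b (Suc n)) * (\<Prod>c=1..Suc n. w c (b (Suc (Suc n) - c)))"
      unfolding 1 2 using row_sum_eq[of "b (Suc n)"] bm by simp
  qed
  also have "\<dots> = (\<Sum>y<m. h y * w (Suc n) y * Zs n y)"
  proof (rule path_sum)
    fix k j
    show "Zs (Suc k) j = (\<Sum>y<m. a j y * w (Suc k) y * Zs k y)"
      unfolding Zs_def[of "Suc k"] using Zs_powr by (intro sum.cong refl) (simp add: w_def mult.assoc)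
  qed simp
  also have "\<dots> = (\<Sum>y<m. h y * Us (Suc n) y)"
    using Zs_powr by (intro sum.cong refl) (simp add: w_def mult.assoc)
  finally show ?thesis .
qed

text \<open>Inductively the bracket is a path sum with the weights already known, and
  \<open>weight_path_sum\<close> evaluates it to the next \<open>Zs\<close>.\<close>

lemma chain_weight_eq:
  "1 \<le> k \<Longrightarrow> k < i \<Longrightarrow> j < m \<Longrightarrow> chain_weight A D i k j = Zs (k - 1) j powr (1 / q - 1)"
proof (induction k arbitrary: j rule: less_induct)
  case (less k)
  show ?case
  proof (cases "k = 1")
    case True
    then show ?thesis using row_sum_eq[OF less.prems(3)] ex[of k] less.prems
      by (subst chain_weight.simps) simp
  next
    case False
    then obtain n where n: "k = Suc (Suc n)" using less.prems by (metis One_nat_def Suc_le_D le_antisym not_less_eq_eq)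
    have dA: "dim_row A = m" using A by simp
    have "(\<Sum>b \<in> {1..k-1} \<rightarrow>\<^sub>E {..<dim_row A}.
              A $$ (j, b 1) * (\<Prod>e = 1..k-2. A $$ (b e, b (e+1))) * row_sum A (b (k-1)) *
              (\<Prod>c = 1..k-1. chain_weight A D i c (b (k-c)))) =
          (\<Sum>y<m. A $$ (j, y) * Us (Suc n) y)"
      using weight_path_sum[of n "\<lambda>y. A $$ (j, y)"] less.IH less.prems n unfolding words_def dA by simp
    also have "\<dots> = Zs (k - 1) j" using n less.prems aA by (simp add: Zs_def)
    finally show ?thesis using False less.prems ex[of k]
      by (subst chain_weight.simps) (simp add: not_le)
  qed
qed

text \<open>The last letter carries no weight; summing it out produces a row sum, and the rest is a
  path sum without a start factor.\<close>

lemma chain_total_eq: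
  assumes i: "2 \<le> i"
  shows "chain_total A D i = (\<Sum>y<m. Us (i - 1) y)"
proof -
  obtain n where n: "i = Suc (Suc n)" using i by (metis add_2_eq_Suc le_Suc_ex)
  have dA: "dim_row A = m" using A by simp
  have "chain_total A D i = (\<Sum>J\<in>words m (Suc (Suc n)).
        (\<Prod>e = 1..Suc n. A $$ (J e, J (e+1))) * (\<Prod>k = 1..Suc n. chain_weight A D i k (J (Suc (Suc n) - k))))"
    unfolding chain_total_def words_def dA n by simp
  also have "\<dots> = (\<Sum>x\<in>words m (Suc n). \<Sum>y<m.
        ((\<Prod>e = 1..n. A $$ (x e, x (e+1))) * A $$ (x (Suc n), y)) * (\<Prod>k = 1..Suc n. chain_weight A D i k (x (Suc (Suc n) - k))))"
  proof -
    have 1: "(\<Prod>e = 1..Suc n. A $$ ((x(Suc (Suc n) := y)) e, (x(Suc (Suc n) := y)) (e+1))) =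
        (\<Prod>e = 1..n. A $$ (x e, x (e+1))) * A $$ (x (Suc n), y)" for x y
    proof -
      have "(\<Prod>e = 1..n. A $$ ((x(Suc (Suc n) := y)) e, (x(Suc (Suc n) := y)) (e+1))) = (\<Prod>e = 1..n. A $$ (x e, x (e+1)))"
        by (intro prod.cong refl) auto
      then show ?thesis by simp
    qed
    have 2: "(\<Prod>k = 1..Suc n. chain_weight A D i k ((x(Suc (Suc n) := y)) (Suc (Suc n) - k))) =
        (\<Prod>k = 1..Suc n. chain_weight A D i k (x (Suc (Suc n) - k)))" for x y
      by (intro prod.cong refl) auto
    show ?thesis unfolding sum_words_Suc[of _ m "Suc n"] 1 2 ..
  qed
  also have "\<dots> = (\<Sum>x\<in>words m (Suc n). 1 * (\<Prod>e = 1..n. A $$ (x e, x (e+1))) * row_sum A (x (Suc n)) *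
       (\<Prod>k = 1..Suc n. chain_weight A D i k (x (Suc (Suc n) - k))))"
    using A by (intro sum.cong refl) (simp add: row_sum_def sum_distrib_left sum_distrib_right mult_ac)
  also have "\<dots> = (\<Sum>y<m. 1 * Us (Suc n) y)"
    using weight_path_sum[of n "\<lambda>_. 1"] chain_weight_eq n by simp
  finally show ?thesis using n by simp
qed

end

end

section \<open>Beatty sequences\<close>

lemma floor_slope_less:
  fixes s b :: real and k l :: nat
  assumes "1 \<le> s" "k < l"
  shows "\<lfloor>s * real k + b\<rfloor> < \<lfloor>s * real l + b\<rfloor>"
proof -
  have "real k + 1 \<le> real l" using assms(2) by simp
  then have "s * (real k + 1) \<le> s * real l" using assms(1) by (intro mult_left_mono) auto
  then have "s * real k + b + 1 \<le> s * real l + b" using assms(1) by (simp add: algebra_simps)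
  then have "\<lfloor>s * real k + b + 1\<rfloor> \<le> \<lfloor>s * real l + b\<rfloor>" by (rule floor_mono)
  then show ?thesis by simp
qed

lemma floor_slope_inj:
  fixes s b :: real and k l :: nat
  assumes "1 \<le> s" "\<lfloor>s * real k + b\<rfloor> = \<lfloor>s * real l + b\<rfloor>"
  shows "k = l"
  using floor_slope_less[OF assms(1), of k l b] floor_slope_less[OF assms(1), of l k b] assms(2)
  by (cases k l rule: linorder_cases) auto

text \<open>The indices with values in the window form the interval from \<open>P\<close> to
  \<open>Q\<close>, the bounds being rounded-up values of an affine function. As
  \<open>\<lfloor>b\<rfloor> \<le> x\<close>, the excluded index \<open>0\<close> falls below the
  window.\<close>

lemma count_beatty:
  fixes s b :: real and x y :: nat
  assumes s: "1 \<le> s" and xy: "x \<le> y" and x: "\<lfloor>b\<rfloor> \<le> int x"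
  shows "\<bar>real (card {v. x < v \<and> v \<le> y \<and> (\<exists>k::nat. 1 \<le> k \<and> \<lfloor>s * real k + b\<rfloor> = int v)}) - (real y - real x) / s\<bar> \<le> 1"
proof -
  define P where "P = nat \<lceil>(real x + 1 - b) / s\<rceil>"
  define Q where "Q = nat \<lceil>(real y + 1 - b) / s\<rceil>"
  have s0: "0 < s" using s by simp
  have b: "b < real x + 1" using x by linarith
  then have p0: "0 < (real x + 1 - b) / s" "(real x + 1 - b) / s \<le> (real y + 1 - b) / s"
    using s0 xy by (auto intro: divide_right_mono)
  have P: "real P - 1 < (real x + 1 - b) / s" "(real x + 1 - b) / s \<le> real P" "1 \<le> P"
    unfolding P_def using p0 by linarith+
  have Q: "real Q - 1 < (real y + 1 - b) / s" "(real y + 1 - b) / s \<le> real Q"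
    unfolding Q_def using p0 by linarith+
  have PQ: "P \<le> Q" unfolding P_def Q_def using p0 by (intro nat_mono ceiling_mono)
  have "{v. x < v \<and> v \<le> y \<and> (\<exists>k::nat. 1 \<le> k \<and> \<lfloor>s * real k + b\<rfloor> = int v)} = (\<lambda>k. nat \<lfloor>s * real k + b\<rfloor>) ` {P..<Q}"
  proof (intro equalityI subsetI)
    fix v assume "v \<in> {v. x < v \<and> v \<le> y \<and> (\<exists>k::nat. 1 \<le> k \<and> \<lfloor>s * real k + b\<rfloor> = int v)}"
    then obtain k :: nat where k: "x < v" "v \<le> y" "\<lfloor>s * real k + b\<rfloor> = int v" by blast
    have "real x + 1 \<le> s * real k + b" "s * real k + b < real y + 1" using k by linarith+
    then have "(real x + 1 - b) / s \<le> real k" "real k < (real y + 1 - b) / s"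
      using s0 by (simp_all add: pos_divide_le_eq pos_less_divide_eq mult.commute)
    then have "P \<le> k" "k < Q" using P Q by linarith+
    then show "v \<in> (\<lambda>k. nat \<lfloor>s * real k + b\<rfloor>) ` {P..<Q}" using k by (intro image_eqI[of _ _ k]) auto
  next
    fix v assume "v \<in> (\<lambda>k. nat \<lfloor>s * real k + b\<rfloor>) ` {P..<Q}"
    then obtain k where k: "P \<le> k" "k < Q" "v = nat \<lfloor>s * real k + b\<rfloor>" by auto
    have "(real x + 1 - b) / s \<le> real k" "real k < (real y + 1 - b) / s" using k P Q by linarith+
    then have "real x + 1 \<le> s * real k + b" "s * real k + b < real y + 1"
      using s0 by (simp_all add: pos_divide_le_eq pos_less_divide_eq mult.commute)
    then have "int x < \<lfloor>s * real k + b\<rfloor>" "\<lfloor>s * real k + b\<rfloor> \<le> int y" by linarith+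
    moreover from this have "0 \<le> \<lfloor>s * real k + b\<rfloor>" by linarith
    then have "int v = \<lfloor>s * real k + b\<rfloor>" unfolding k(3) by (rule nat_0_le)
    moreover have "1 \<le> k" using k P(3) by linarith
    ultimately show "v \<in> {v. x < v \<and> v \<le> y \<and> (\<exists>k::nat. 1 \<le> k \<and> \<lfloor>s * real k + b\<rfloor> = int v)}"
      by auto
  qed
  moreover have "inj_on (\<lambda>k. nat \<lfloor>s * real k + b\<rfloor>) {P..<Q}"
  proof (rule inj_onI)
    fix k l assume kl: "k \<in> {P..<Q}" "l \<in> {P..<Q}" "nat \<lfloor>s * real k + b\<rfloor> = nat \<lfloor>s * real l + b\<rfloor>"
    have pos: "0 < \<lfloor>s * real k + b\<rfloor>" if "P \<le> k" for k :: nat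
    proof -
      have "(real x + 1 - b) / s \<le> real k" using that P by linarith
      then have "real x + 1 \<le> s * real k + b" using s0 by (simp add: pos_divide_le_eq mult.commute)
      then show ?thesis by linarith
    qed
    have "\<lfloor>s * real k + b\<rfloor> = \<lfloor>s * real l + b\<rfloor>"
      by (rule iffD1[OF eq_nat_nat_iff kl(3)]) (use kl pos[of k] pos[of l] in \<open>auto intro: less_imp_le\<close>)
    then show "k = l" by (rule floor_slope_inj[OF s])
  qed
  ultimately have "card {v. x < v \<and> v \<le> y \<and> (\<exists>k::nat. 1 \<le> k \<and> \<lfloor>s * real k + b\<rfloor> = int v)} = Q - P"
    by (simp add: card_image)
  moreover have "(real y + 1 - b) / s - (real x + 1 - b) / s = (real y - real x) / s"
    by (simp add: diff_divide_distrib[symmetric])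
  ultimately show ?thesis using P Q PQ by (simp add: of_nat_diff)
qed

lemma beatty_set_iff:
  "0 < v \<Longrightarrow> int v \<in> beatty_set s b \<longleftrightarrow> (\<exists>k::nat. 1 \<le> k \<and> \<lfloor>s * real k + b\<rfloor> = int v)"
  by (auto simp: beatty_set_def eq_commute)

locale beatty = alphabet +
  fixes A :: "real mat" and \<alpha> \<beta> \<gamma> \<delta> :: real
  assumes A: "A \<in> carrier_mat m m" "binary_mat A" "irreducible_mat A"
    and \<alpha>1: "1 \<le> \<alpha>" and \<alpha>\<gamma>: "\<alpha> < \<gamma>"
begin

definition ia :: "nat \<Rightarrow> int" where "ia k = \<lfloor>\<alpha> * real k + \<beta>\<rfloor>"

definition ic :: "nat \<Rightarrow> int" where "ic k = \<lfloor>\<gamma> * real k + \<delta>\<rfloor>"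

definition rq :: real where "rq = \<gamma> / \<alpha>"

definition Hs :: "nat set" where "Hs = {v. 1 \<le> v \<and> (\<exists>k\<ge>1. ia k = int v)}"

definition suc :: "nat \<Rightarrow> nat" where "suc v = nat (beatty_map \<alpha> \<beta> \<gamma> \<delta> (int v))"

text \<open>The offsets \<beta> and \<delta> and the two roundings bound the distance between
  \<open>ic k\<close> and \<open>rq * ia k\<close>.\<close>

definition Cb :: real where "Cb = \<bar>\<delta>\<bar> + rq * \<bar>\<beta>\<bar> + rq + 1"

text \<open>A value strictly between 1 and \<open>rq\<close>; the difference
  \<open>rq - lamb\<close> absorbs \<open>Cb\<close> at large positions.\<close>

definition lamb :: real where "lamb = (1 + rq) / 2"

text \<open>From index \<open>k0\<close> on both sequences are positive and the second one is ahead of the first.\<close>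

definition k0 :: nat where "k0 = nat \<lceil>max ((\<beta> - \<delta> + 1) / (\<gamma> - \<alpha>)) ((1 - \<beta>) / \<alpha>)\<rceil> + 1"

text \<open>Values of either sequence beyond \<open>K0\<close> have indices beyond
  \<open>k0\<close>, and there \<open>lamb * u\<close> is at most
  \<open>rq * u - Cb\<close>.\<close>

definition K0 :: nat where
  "K0 = nat (max (max (ia k0) (ic k0)) \<lceil>Cb / (rq - lamb)\<rceil>)"

lemma \<gamma>1: "1 \<le> \<gamma>" using \<alpha>1 \<alpha>\<gamma> by simp

lemma rq1: "1 < rq" using \<alpha>1 \<alpha>\<gamma> by (simp add: rq_def)

lemma lamb1: "1 < lamb" "lamb < rq" using rq1 by (auto simp: lamb_def)

lemma ia_less: "k < l \<Longrightarrow> ia k < ia l" and ic_less: "k < l \<Longrightarrow> ic k < ic l"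
  unfolding ia_def ic_def using floor_slope_less \<alpha>1 \<gamma>1 by auto

lemma ia_inj: "ia k = ia l \<Longrightarrow> k = l" and ic_inj: "ic k = ic l \<Longrightarrow> k = l"
  unfolding ia_def ic_def using floor_slope_inj \<alpha>1 \<gamma>1 by metis+

lemma ia_mono: "k \<le> l \<Longrightarrow> ia k \<le> ia l" and ic_mono: "k \<le> l \<Longrightarrow> ic k \<le> ic l"
  using ia_less[of k l] ic_less[of k l] by (cases "k = l"; simp)+

lemma map_ia: "1 \<le> k \<Longrightarrow> beatty_map \<alpha> \<beta> \<gamma> \<delta> (ia k) = ic k"
proof -
  assume k: "1 \<le> k"
  have "(THE k'::nat. 1 \<le> k' \<and> \<lfloor>\<alpha> * real k' + \<beta>\<rfloor> = ia k) = k"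
    using k ia_inj[unfolded ia_def] by (intro the_equality) (auto simp: ia_def)
  then show ?thesis by (simp add: beatty_map_def ic_def)
qed

lemma k0_large:
  assumes "k0 \<le> k"
  shows "ia k < ic k" "0 < ia k"
proof -
  have "(\<beta> - \<delta> + 1) / (\<gamma> - \<alpha>) < real k" "(1 - \<beta>) / \<alpha> < real k"
    using assms unfolding k0_def by linarith+
  then have 1: "\<beta> - \<delta> + 1 < (\<gamma> - \<alpha>) * real k" and 2: "1 - \<beta> < \<alpha> * real k"
    using \<alpha>\<gamma> \<alpha>1 by (simp_all add: pos_divide_less_eq mult.commute)
  show "0 < ia k" unfolding ia_def using 2 by linarith
  have "\<alpha> * real k + \<beta> + 1 \<le> \<gamma> * real k + \<delta>" using 1 by (simp add: algebra_simps)
  then have "\<lfloor>\<alpha> * real k + \<beta> + 1\<rfloor> \<le> ic k" unfolding ic_def by (rule floor_mono)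
  then show "ia k < ic k" unfolding ia_def by simp
qed

lemma K0_ia: "k \<le> k0 \<Longrightarrow> ia k \<le> int K0" and K0_ic: "k \<le> k0 \<Longrightarrow> ic k \<le> int K0"
  using ia_mono[of k k0] ic_mono[of k k0] unfolding K0_def by linarith+

lemma K0_Cb: "Cb / (rq - lamb) \<le> real K0"
  unfolding K0_def by linarith

lemma above_ia: "int K0 < ia k \<Longrightarrow> ia k < ic k \<and> 1 \<le> k"
proof -
  assume "int K0 < ia k"
  then have "k0 < k" using K0_ia[of k] by (meson not_le)
  then show ?thesis using k0_large[of k] by simp
qed

lemma above_ic: "int K0 < ic k \<Longrightarrow> ia k < ic k \<and> 0 < ia k \<and> 1 \<le> k"
proof -
  assume "int K0 < ic k"
  then have "k0 < k" using K0_ic[of k] by (meson not_le)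
  then show ?thesis using k0_large[of k] by simp
qed

lemma ic_near: "\<bar>real_of_int (ic k) - rq * real_of_int (ia k)\<bar> \<le> Cb"
proof -
  have r0: "0 < rq" using rq1 by simp
  have "rq * \<alpha> = \<gamma>" using \<alpha>1 by (simp add: rq_def)
  then have eq: "rq * (\<alpha> * real k + \<beta>) = \<gamma> * real k + rq * \<beta>" by (simp add: distrib_left mult.assoc[symmetric])
  have "real_of_int (ia k) \<le> \<alpha> * real k + \<beta>" "\<alpha> * real k + \<beta> - 1 \<le> real_of_int (ia k)"
    unfolding ia_def by linarith+
  then have "rq * real_of_int (ia k) \<le> rq * (\<alpha> * real k + \<beta>)" "rq * (\<alpha> * real k + \<beta> - 1) \<le> rq * real_of_int (ia k)"
    using r0 by (simp_all add: mult_left_mono)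
  then have 1: "rq * real_of_int (ia k) \<le> \<gamma> * real k + rq * \<beta>" "\<gamma> * real k + rq * \<beta> - rq \<le> rq * real_of_int (ia k)"
    using eq by (simp_all add: right_diff_distrib)
  have 2: "real_of_int (ic k) \<le> \<gamma> * real k + \<delta>" "\<gamma> * real k + \<delta> - 1 \<le> real_of_int (ic k)"
    unfolding ic_def by linarith+
  have "\<bar>rq * \<beta>\<bar> = rq * \<bar>\<beta>\<bar>" using r0 by (simp add: abs_mult)
  then show ?thesis using 1 2 unfolding Cb_def by linarith
qed

lemma Hs_obtain:
  assumes "v \<in> Hs"
  obtains k where "1 \<le> k" "ia k = int v" "suc v = nat (ic k)" "beatty_map \<alpha> \<beta> \<gamma> \<delta> (int v) = ic k"
proof -
  obtain k where k: "1 \<le> k" "ia k = int v" using assms by (auto simp: Hs_def)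
  then have "beatty_map \<alpha> \<beta> \<gamma> \<delta> (int v) = ic k" using map_ia[OF k(1)] by simp
  then show ?thesis using that[OF k] by (simp add: suc_def)
qed

lemma A_01: "i < m \<Longrightarrow> j < m \<Longrightarrow> A $$ (i, j) = 0 \<or> A $$ (i, j) = 1"
  using A by (auto simp: binary_mat_def)

text \<open>A zero row would remain zero in all positive powers, against irreducibility.\<close>

lemma A_row: "i < m \<Longrightarrow> \<exists>j<m. A $$ (i, j) = 1"
proof (rule ccontr)
  assume i: "i < m" and "\<not> (\<exists>j<m. A $$ (i, j) = 1)"
  then have zero: "A $$ (i, j) = 0" if "j < m" for j using A_01[OF i that] that by blast
  have "\<exists>k\<ge>1. (A ^\<^sub>m k) $$ (i, i) > 0" using A i by (auto simp: irreducible_mat_def)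
  then obtain k where k: "1 \<le> k" "(A ^\<^sub>m k) $$ (i, i) > 0" by blast
  then obtain k' where "k = Suc k'" by (cases k) auto
  then have "(A ^\<^sub>m k) $$ (i, i) = (\<Sum>l<m. A $$ (i, l) * (A ^\<^sub>m k') $$ (l, i))"
    using index_mult_sum[OF A(1) pow_carrier_mat[OF A(1)] i i] by (simp only: pow_mat_Suc_left[OF A(1)])
  then show False using k zero by simp
qed

end

sublocale beatty \<subseteq> forest m "\<lambda>i j. A $$ (i, j)" Hs suc rq Cb lamb K0
proof
  show "0 \<notin> Hs" by (simp add: Hs_def)
  show "1 < lamb" "1 < rq" using lamb1 rq1 by auto
  show "A $$ (i, j) = 0 \<or> A $$ (i, j) = 1" if "i < m" "j < m" for i j by (rule A_01[OF that])
  show "\<exists>j<m. A $$ (i, j) = 1" if "i < m" for i by (rule A_row[OF that])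
  show "u = v" if uv: "u \<in> Hs" "v \<in> Hs" "suc u = suc v" "K0 < suc u" for u v
  proof -
    obtain k where k: "1 \<le> k" "ia k = int u" "suc u = nat (ic k)" using Hs_obtain[OF uv(1)] by metis
    obtain l where l: "1 \<le> l" "ia l = int v" "suc v = nat (ic l)" using Hs_obtain[OF uv(2)] by metis
    have "ic k = ic l" using uv(3,4) k l by linarith
    then show ?thesis using ic_inj k l by (metis of_nat_eq_iff)
  qed
  show "u < suc u" if u: "u \<in> Hs" "K0 < suc u" for u
  proof -
    obtain k where k: "1 \<le> k" "ia k = int u" "suc u = nat (ic k)" using Hs_obtain[OF u(1)] by metis
    then have "int K0 < ic k" using u(2) by linarith
    then show ?thesis using above_ic[of k] k by linarith
  qed
  have near: "\<bar>real (suc u) - rq * real u\<bar> \<le> Cb \<and> int (suc u) = beatty_map \<alpha> \<beta> \<gamma> \<delta> (int u)" if u: "u \<in> Hs" "K0 < u" for u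
  proof -
    obtain k where k: "1 \<le> k" "ia k = int u" "suc u = nat (ic k)" "beatty_map \<alpha> \<beta> \<gamma> \<delta> (int u) = ic k"
      using u(1) by (rule Hs_obtain)
    then have "0 < ic k" using above_ia[of k] u by linarith
    then have "real (suc u) = real_of_int (ic k)" "int (suc u) = ic k" using k by auto
    then show ?thesis using ic_near[of k] k(2,4) by (metis of_int_of_nat_eq)
  qed
  show "\<bar>real (suc u) - rq * real u\<bar> \<le> Cb" if "u \<in> Hs" "K0 < u" for u using near[OF that] by simp
  show "lamb * real u \<le> real (suc u)" if "u \<in> Hs" "K0 < u" for u
  proof -
    have "Cb / (rq - lamb) \<le> real u" using K0_Cb that(2) by linarith
    then have "Cb \<le> (rq - lamb) * real u" using lamb1 by (simp add: pos_divide_le_eq mult.commute)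
    then show ?thesis using near[OF that] by (simp add: left_diff_distrib) linarith
  qed
qed

context beatty
begin

lemma X_beatty: "X = beatty_shift m A \<alpha> \<beta> \<gamma> \<delta>"
proof -
  have eq: "(\<forall>u\<in>Hs. 1 \<le> suc u \<longrightarrow> A $$ (x u, x (suc u)) = 1) \<longleftrightarrow>
    (\<forall>k::nat. 1 \<le> k \<longrightarrow> 0 < ia k \<longrightarrow> 0 < ic k \<longrightarrow> A $$ (x (nat (ia k)), x (nat (ic k))) = 1)" for x
  proof (intro iffI ballI allI impI)
    fix k :: nat assume h: "\<forall>u\<in>Hs. 1 \<le> suc u \<longrightarrow> A $$ (x u, x (suc u)) = 1" and k: "1 \<le> k" "0 < ia k" "0 < ic k"
    have "nat (ia k) \<in> Hs" using k by (auto simp: Hs_def)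
    moreover have "suc (nat (ia k)) = nat (ic k)" using k map_ia[OF k(1)] by (simp add: suc_def)
    ultimately show "A $$ (x (nat (ia k)), x (nat (ic k))) = 1" using h k by fastforce
  next
    fix u assume h: "\<forall>k::nat. 1 \<le> k \<longrightarrow> 0 < ia k \<longrightarrow> 0 < ic k \<longrightarrow> A $$ (x (nat (ia k)), x (nat (ic k))) = 1"
      and u: "u \<in> Hs" "1 \<le> suc u"
    obtain k where k: "1 \<le> k" "ia k = int u" "suc u = nat (ic k)" using Hs_obtain[OF u(1)] by metis
    have "0 < ia k" "0 < ic k" using k u by (auto simp: Hs_def)
    then show "A $$ (x u, x (suc u)) = 1" using h k by (metis nat_int)
  qed
  show ?thesis unfolding X_def beatty_shift_def eq by (simp add: ia_def ic_def)
qed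

lemma Hs_iff: "1 \<le> v \<Longrightarrow> v \<in> Hs \<longleftrightarrow> int v \<in> beatty_set \<alpha> \<beta>"
  by (auto simp: Hs_def beatty_set_def ia_def eq_commute)

text \<open>A value \<open>ic k\<close> beyond \<open>K0\<close> belongs to an index with
  \<open>0 < ia k\<close>, so the predecessor is a genuine position.\<close>

lemma pr_iff_beatty: "K0 < v \<Longrightarrow> pr v \<noteq> 0 \<longleftrightarrow> int v \<in> beatty_set \<gamma> \<delta>"
proof
  assume v: "K0 < v" and p: "pr v \<noteq> 0"
  obtain k where "1 \<le> k" "suc (pr v) = nat (ic k)" using Hs_obtain[OF pr_H[OF v p]] by metis
  then have "1 \<le> k" "int v = ic k" using sc_pr[OF v p] v by auto
  then show "int v \<in> beatty_set \<gamma> \<delta>" using v beatty_set_iff[of v \<gamma> \<delta>] unfolding ic_def by force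
next
  assume v: "K0 < v" and "int v \<in> beatty_set \<gamma> \<delta>"
  then obtain k :: nat where k: "1 \<le> k" "int v = ic k"
    using beatty_set_iff[of v \<gamma> \<delta>] unfolding ic_def by force
  then have "0 < ia k" using above_ic[of k] v by simp
  then have "nat (ia k) \<in> Hs" "suc (nat (ia k)) = v" "nat (ia k) \<noteq> 0"
    using k map_ia[OF k(1)] by (auto simp: Hs_def suc_def)
  then show "pr v \<noteq> 0" using pr_iff[OF v, of "nat (ia k)"] by simp
qed

lemma count_H:
  assumes "K0 \<le> x" "x \<le> y"
  shows "\<bar>real (card {v. x < v \<and> v \<le> y \<and> v \<in> Hs}) - (real y - real x) / \<alpha>\<bar> \<le> 1"
proof -
  have "\<lfloor>\<beta>\<rfloor> \<le> int x" using K0_ia[of 0] assms by (simp add: ia_def)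
  from count_beatty[OF \<alpha>1 assms(2) this]
  have "\<bar>real (card {v. x < v \<and> v \<le> y \<and> (\<exists>k::nat. 1 \<le> k \<and> \<lfloor>\<alpha> * real k + \<beta>\<rfloor> = int v)}) - (real y - real x) / \<alpha>\<bar> \<le> 1" .
  moreover have "{v. x < v \<and> v \<le> y \<and> (\<exists>k::nat. 1 \<le> k \<and> \<lfloor>\<alpha> * real k + \<beta>\<rfloor> = int v)} = {v. x < v \<and> v \<le> y \<and> v \<in> Hs}"
    by (auto simp: Hs_def ia_def)
  ultimately show ?thesis by simp
qed

lemma count_pr:
  assumes "K0 \<le> x" "x \<le> y"
  shows "\<bar>real (card {v. x < v \<and> v \<le> y \<and> pr v \<noteq> 0}) - (real y - real x) / \<gamma>\<bar> \<le> 1"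
proof -
  have "\<lfloor>\<delta>\<rfloor> \<le> int x" using K0_ic[of 0] assms by (simp add: ic_def)
  from count_beatty[OF \<gamma>1 assms(2) this]
  have "\<bar>real (card {v. x < v \<and> v \<le> y \<and> (\<exists>k::nat. 1 \<le> k \<and> \<lfloor>\<gamma> * real k + \<delta>\<rfloor> = int v)}) - (real y - real x) / \<gamma>\<bar> \<le> 1" .
  moreover have "{v. x < v \<and> v \<le> y \<and> (\<exists>k::nat. 1 \<le> k \<and> \<lfloor>\<gamma> * real k + \<delta>\<rfloor> = int v)} = {v. x < v \<and> v \<le> y \<and> pr v \<noteq> 0}"
    using pr_iff_beatty beatty_set_iff assms by auto
  ultimately show ?thesis by simp
qed

text \<open>Constrained positions have density \<open>1 / \<alpha>\<close>, while positions with a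
  predecessor have only the smaller density \<open>1 / \<gamma>\<close>; the bound comes from
  counting alone.\<close>

lemma start_count_lower:
  assumes "K0 \<le> x" "x \<le> y"
  shows "(1 / \<alpha> - 1 / \<gamma>) * (real y - real x) - 2 \<le> real (card {s \<in> Hs. pr s = 0 \<and> x < s \<and> s \<le> y})"
proof -
  have "{v. x < v \<and> v \<le> y \<and> v \<in> Hs} \<subseteq> {s \<in> Hs. pr s = 0 \<and> x < s \<and> s \<le> y} \<union> {v. x < v \<and> v \<le> y \<and> pr v \<noteq> 0}"
    by auto
  then have "card {v. x < v \<and> v \<le> y \<and> v \<in> Hs} \<le> card ({s \<in> Hs. pr s = 0 \<and> x < s \<and> s \<le> y} \<union> {v. x < v \<and> v \<le> y \<and> pr v \<noteq> 0})"
    by (rule card_mono[rotated]) (auto intro: finite_subset[of _ "{..y}"])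
  also have "\<dots> \<le> card {s \<in> Hs. pr s = 0 \<and> x < s \<and> s \<le> y} + card {v. x < v \<and> v \<le> y \<and> pr v \<noteq> 0}"
    by (rule card_Un_le)
  finally have "real (card {v. x < v \<and> v \<le> y \<and> v \<in> Hs}) \<le>
      real (card {s \<in> Hs. pr s = 0 \<and> x < s \<and> s \<le> y}) + real (card {v. x < v \<and> v \<le> y \<and> pr v \<noteq> 0})" by linarith
  then show ?thesis using count_H[OF assms] count_pr[OF assms] by (simp add: left_diff_distrib)
qed

lemma start_total: "(\<lambda>n. real (card {v. K0 < v \<and> v \<le> n \<and> pr v = 0}) / real n) \<longlonglongrightarrow> 1 - 1 / \<gamma>"
proof -
  have g0: "0 < \<gamma>" using \<gamma>1 by simp
  have "(\<lambda>n. (real (card {v. K0 < v \<and> v \<le> n \<and> pr v = 0}) - real n * (1 - 1 / \<gamma>)) / real n) \<longlonglongrightarrow> 0"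
  proof (rule tendsto_bounded_over_n)
    fix n
    show "\<bar>real (card {v. K0 < v \<and> v \<le> n \<and> pr v = 0}) - real n * (1 - 1 / \<gamma>)\<bar> \<le> 1 + 2 * real K0"
    proof (cases "K0 \<le> n")
      case True
      have "card ({v. K0 < v \<and> v \<le> n \<and> pr v = 0} \<union> {v. K0 < v \<and> v \<le> n \<and> pr v \<noteq> 0}) =
         card {v. K0 < v \<and> v \<le> n \<and> pr v = 0} + card {v. K0 < v \<and> v \<le> n \<and> pr v \<noteq> 0}"
        by (rule card_Un_disjoint) (auto intro: finite_subset[of _ "{..n}"])
      moreover have "{v. K0 < v \<and> v \<le> n \<and> pr v = 0} \<union> {v. K0 < v \<and> v \<le> n \<and> pr v \<noteq> 0} = {K0<..n}" by auto
      ultimately have "real (card {v. K0 < v \<and> v \<le> n \<and> pr v = 0}) + real (card {v. K0 < v \<and> v \<le> n \<and> pr v \<noteq> 0}) = real n - real K0"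
        using True by (simp add: of_nat_diff flip: of_nat_add)
      moreover have "0 \<le> real K0 / \<gamma>" "real K0 / \<gamma> \<le> real K0" using \<gamma>1 by (simp_all add: divide_le_eq mult_le_cancel_left1)
      ultimately show ?thesis using count_pr[OF order_refl True]
        by (simp add: right_diff_distrib diff_divide_distrib)
    next
      case False
      then have e: "{v. K0 < v \<and> v \<le> n \<and> pr v = 0} = {}" by auto
      have g: "0 \<le> 1 - 1 / \<gamma>" "1 - 1 / \<gamma> \<le> 1" using \<gamma>1 by auto
      have "0 \<le> real n * (1 - 1 / \<gamma>)" "real n * (1 - 1 / \<gamma>) \<le> real n * 1"
        by (intro mult_nonneg_nonneg g) (simp, intro mult_left_mono g, simp)
      then show ?thesis unfolding e using False by simp
    qed
  qed
  from tendsto_add[OF this tendsto_const[of "1 - 1 / \<gamma>"]]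
  have "(\<lambda>n. (real (card {v. K0 < v \<and> v \<le> n \<and> pr v = 0}) - real n * (1 - 1 / \<gamma>)) / real n + (1 - 1 / \<gamma>)) \<longlonglongrightarrow> 1 - 1 / \<gamma>" by simp
  moreover have "\<forall>\<^sub>F n in sequentially. (real (card {v. K0 < v \<and> v \<le> n \<and> pr v = 0}) - real n * (1 - 1 / \<gamma>)) / real n + (1 - 1 / \<gamma>)
      = real (card {v. K0 < v \<and> v \<le> n \<and> pr v = 0}) / real n"
    using eventually_gt_at_top[of 0] by eventually_elim (simp add: diff_divide_distrib)
  ultimately show ?thesis by (rule Lim_transform_eventually)
qed

lemma dim_equality_iff:
  assumes X: "X \<noteq> {}"
  shows "(\<exists>D. has_minkowski_dim X D \<and> hausdorff_dim X = ereal D) \<longleftrightarrow>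
         (\<forall>i<m. \<forall>j<m. row_sum A i = row_sum A j)"
proof -
  have rs: "row_sum A i = (\<Sum>j<m. A $$ (i, j))" for i using A by (simp add: row_sum_def)
  show ?thesis
  proof
    assume eq: "\<forall>i<m. \<forall>j<m. row_sum A i = row_sum A j"
    show "\<exists>D. has_minkowski_dim X D \<and> hausdorff_dim X = ereal D"
    proof (rule equal_rows[OF _ X start_total])
      show "(\<Sum>j<m. A $$ (i, j)) = row_sum A 0" if "i < m" for i
        using eq that m2 unfolding rs[of i, symmetric] by (meson less_le_trans zero_less_numeral)
    qed
  next
    assume "\<exists>D. has_minkowski_dim X D \<and> hausdorff_dim X = ereal D"
    then obtain D where D: "has_minkowski_dim X D" "hausdorff_dim X = ereal D" by blast
    show "\<forall>i<m. \<forall>j<m. row_sum A i = row_sum A j"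
    proof (rule ccontr)
      assume "\<not> ?thesis"
      then obtain i j where ij: "i < m" "j < m" "row_sum A i \<noteq> row_sum A j" by blast
      have "0 < 1 / \<alpha> - 1 / \<gamma>" using \<alpha>1 \<alpha>\<gamma> by (simp add: field_simps)
      from unequal_rows[OF ij(1,2) _ X this start_count_lower D(1)] ij(3)
      have "hausdorff_dim X < ereal D" by (simp add: rs)
      then show False using D by simp
    qed
  qed
qed

lemma rl_eq_Suc: "rl v = Suc n \<longleftrightarrow> (\<forall>j<n. (suc ^^ j) v \<in> Hs) \<and> (suc ^^ n) v \<notin> Hs"
proof
  assume r: "rl v = Suc n"
  then have ex: "\<exists>j. (suc ^^ j) v \<notin> Hs" and l: "(LEAST j. (suc ^^ j) v \<notin> Hs) = n"
    by (auto simp: rl_def split: if_splits)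
  show "(\<forall>j<n. (suc ^^ j) v \<in> Hs) \<and> (suc ^^ n) v \<notin> Hs"
    using LeastI_ex[OF ex] not_less_Least[where P = "\<lambda>j. (suc ^^ j) v \<notin> Hs"] l by auto
next
  assume h: "(\<forall>j<n. (suc ^^ j) v \<in> Hs) \<and> (suc ^^ n) v \<notin> Hs"
  then have "(LEAST j. (suc ^^ j) v \<notin> Hs) = n" by (intro Least_equality) (auto simp: not_less[symmetric])
  then show "rl v = Suc n" using h by (auto simp: rl_def)
qed

lemma rl_eq_0: "rl v = 0 \<longleftrightarrow> (\<forall>j. (suc ^^ j) v \<in> Hs)"
  by (auto simp: rl_def)

text \<open>Orbits starting above \<open>K0\<close> remain there, so the truncation to naturals in
  \<open>suc\<close> is harmless.\<close>

lemma funpow_map: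
  assumes v: "K0 < v" and H: "\<And>j. j < n \<Longrightarrow> (suc ^^ j) v \<in> Hs"
  shows "(beatty_map \<alpha> \<beta> \<gamma> \<delta> ^^ n) (int v) = int ((suc ^^ n) v) \<and> K0 < (suc ^^ n) v \<and>
    (1 \<le> n \<longrightarrow> int ((suc ^^ n) v) \<in> beatty_set \<gamma> \<delta>)"
  using H
proof (induction n)
  case (Suc n)
  define u where "u = (suc ^^ n) v"
  have u: "(beatty_map \<alpha> \<beta> \<gamma> \<delta> ^^ n) (int v) = int u" "K0 < u" "u \<in> Hs"
    using Suc.IH Suc.prems by (auto simp: u_def)
  have sK: "K0 < suc u" using sc_K[OF u(3,2)] .
  have "beatty_map \<alpha> \<beta> \<gamma> \<delta> (int u) = int (suc u)" using sK by (simp add: suc_def)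
  moreover have "pr (suc u) \<noteq> 0" using pr_sc[OF u(3) sK] u by simp
  then have "int (suc u) \<in> beatty_set \<gamma> \<delta>" using pr_iff_beatty[OF sK] by simp
  ultimately show ?case using u sK by (simp add: u_def[symmetric])
qed (use v in simp)

text \<open>As for \<open>rl\<close>, the index \<open>0\<close> stands for infinity.\<close>

definition Ai :: "nat \<Rightarrow> int set" where
  "Ai i = (if i = 0 then chain_starts_inf \<alpha> \<beta> \<gamma> \<delta> else chain_starts \<alpha> \<beta> \<gamma> \<delta> i)"

lemma Ai_iff:
  assumes v: "K0 < v"
  shows "int v \<in> Ai i \<longleftrightarrow> pr v = 0 \<and> rl v = i"
proof -
  have Sg: "int v \<in> beatty_set \<gamma> \<delta> \<longleftrightarrow> pr v \<noteq> 0" using pr_iff_beatty[OF v] by simp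
  have Sa: "int v \<in> beatty_set \<alpha> \<beta> \<longleftrightarrow> v \<in> Hs" using Hs_iff[of v] v by simp
  have Sa': "int w \<in> beatty_set \<alpha> \<beta> \<longleftrightarrow> w \<in> Hs" if "K0 < w" for w using Hs_iff[of w] that by simp
  have allH: "\<forall>j<n. (suc ^^ j) v \<in> Hs"
    if "v \<in> Hs" "\<And>j. 1 \<le> j \<Longrightarrow> j < n \<Longrightarrow> (beatty_map \<alpha> \<beta> \<gamma> \<delta> ^^ j) (int v) \<in> beatty_set \<alpha> \<beta>" for n
    using that
  proof (induction n)
    case (Suc n)
    then have ih: "\<forall>j<n. (suc ^^ j) v \<in> Hs" by simp
    have "(suc ^^ n) v \<in> Hs"
    proof (cases "n = 0")
      case False
      then have "int ((suc ^^ n) v) \<in> beatty_set \<alpha> \<beta>" "K0 < (suc ^^ n) v"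
        using Suc.prems(2)[of n] funpow_map[OF v, of n] ih by auto
      then show ?thesis using Sa' by simp
    qed (use Suc in simp)
    then show ?case using ih less_Suc_eq by auto
  qed simp
  consider "i = 0" | "i = 1" | n where "i = Suc (Suc n)" by (metis One_nat_def not0_implies_Suc)
  then show ?thesis
  proof cases
    case 1
    show ?thesis
    proof
      assume "int v \<in> Ai i"
      then have h: "v \<in> Hs" "pr v = 0" "\<And>j. 1 \<le> j \<Longrightarrow> (beatty_map \<alpha> \<beta> \<gamma> \<delta> ^^ j) (int v) \<in> beatty_set \<alpha> \<beta>"
        using 1 Sa Sg by (auto simp: Ai_def chain_starts_inf_def)
      have "(suc ^^ j) v \<in> Hs" for j using allH[of "Suc j"] h by blast
      then show "pr v = 0 \<and> rl v = i" using h 1 rl_eq_0 by simp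
    next
      assume h: "pr v = 0 \<and> rl v = i"
      then have all: "(suc ^^ j) v \<in> Hs" for j using 1 rl_eq_0 by simp
      have "(beatty_map \<alpha> \<beta> \<gamma> \<delta> ^^ j) (int v) \<in> beatty_set \<alpha> \<beta> \<inter> beatty_set \<gamma> \<delta>" if "1 \<le> j" for j
        using funpow_map[OF v, of j] all Sa'[of "(suc ^^ j) v"] that by auto
      then show "int v \<in> Ai i" using 1 h Sa Sg all[of 0] by (auto simp: Ai_def chain_starts_inf_def)
    qed
  next
    case 2
    then show ?thesis using v Sa Sg rl_1_iff[of v] by (auto simp: Ai_def chain_starts_def)
  next
    case 3
    show ?thesis
    proof
      assume "int v \<in> Ai i"
      then have h: "v \<in> Hs" "pr v = 0"
        "\<And>j. 1 \<le> j \<Longrightarrow> j \<le> n \<Longrightarrow> (beatty_map \<alpha> \<beta> \<gamma> \<delta> ^^ j) (int v) \<in> beatty_set \<alpha> \<beta>"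
        "(beatty_map \<alpha> \<beta> \<gamma> \<delta> ^^ Suc n) (int v) \<notin> beatty_set \<alpha> \<beta>"
        using 3 Sa Sg by (auto simp: Ai_def chain_starts_def)
      have all: "\<forall>j<Suc n. (suc ^^ j) v \<in> Hs" using h by (intro allH) auto
      then have "(suc ^^ Suc n) v \<notin> Hs" using funpow_map[OF v, of "Suc n"] h(4) Sa'[of "(suc ^^ Suc n) v"] by simp
      then show "pr v = 0 \<and> rl v = i" using h(2) all 3 rl_eq_Suc[of v "Suc n"] by simp
    next
      assume h: "pr v = 0 \<and> rl v = i"
      then have all: "\<forall>j<Suc n. (suc ^^ j) v \<in> Hs" and last: "(suc ^^ Suc n) v \<notin> Hs"
        using 3 rl_eq_Suc[of v "Suc n"] by auto
      have 1: "(beatty_map \<alpha> \<beta> \<gamma> \<delta> ^^ j) (int v) \<in> beatty_set \<alpha> \<beta> \<inter> beatty_set \<gamma> \<delta>" if "1 \<le> j" "j \<le> n" for j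
        using funpow_map[OF v, of j] all Sa'[of "(suc ^^ j) v"] that by auto
      have 2: "(beatty_map \<alpha> \<beta> \<gamma> \<delta> ^^ Suc n) (int v) \<in> beatty_set \<gamma> \<delta> - beatty_set \<alpha> \<beta>"
        using funpow_map[OF v, of "Suc n"] all last Sa'[of "(suc ^^ Suc n) v"] by simp
      have "v \<in> Hs" using all by (metis funpow_0 zero_less_Suc)
      then show "int v \<in> Ai i" using 1 2 h 3 Sa Sg by (auto simp: Ai_def chain_starts_def)
    qed
  qed
qed

lemma Ai_pos: "x \<in> Ai i \<Longrightarrow> 0 < x"
  by (auto simp: Ai_def chain_starts_def chain_starts_inf_def beatty_set_def split: if_splits)

text \<open>The uniform limit is specialised to the intervals from 1 to \<open>n\<close>; positions
  up to \<open>K0\<close> change the count by a bounded amount.\<close>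

lemma density_starts:
  assumes d: "has_uniform_density (Ai i) c"
  shows "(\<lambda>n. real (card {v. K0 < v \<and> v \<le> n \<and> pr v = 0 \<and> rl v = i}) / real n) \<longlonglongrightarrow> c"
proof -
  have lim: "filterlim (\<lambda>n. (1, int n)) (inf (filtercomap (\<lambda>(n1, n2). n2 - n1) at_top) (principal {(n1, n2). 1 \<le> n1 \<and> n1 < n2})) sequentially"
    unfolding filterlim_inf filterlim_principal filterlim_filtercomap_iff o_def
  proof
    show "filterlim (\<lambda>n. case (1, int n) of (n1, n2) \<Rightarrow> n2 - n1) at_top sequentially"
      unfolding filterlim_at_top
    proof
      fix Z
      show "\<forall>\<^sub>F n in sequentially. Z \<le> (case (1, int n) of (n1, n2) \<Rightarrow> n2 - n1)"
        using eventually_ge_at_top[of "nat (Z + 1)"] by eventually_elim auto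
    qed
    show "\<forall>\<^sub>F n in sequentially. (1, int n) \<in> {(n1, n2). 1 \<le> n1 \<and> n1 < n2}"
      using eventually_gt_at_top[of 1] by eventually_elim auto
  qed
  define c' where "c' n = real (card (Ai i \<inter> {1..int n}))" for n
  have "(\<lambda>n. c' n / (real n - 1)) \<longlonglongrightarrow> c"
    using filterlim_compose[OF d[unfolded has_uniform_density_def] lim] by (simp add: c'_def)
  moreover have "(\<lambda>n. (real n - 1) / real n) \<longlonglongrightarrow> 1" by real_asymp
  ultimately have "(\<lambda>n. c' n / (real n - 1) * ((real n - 1) / real n)) \<longlonglongrightarrow> c * 1" by (rule tendsto_mult)
  moreover have "\<forall>\<^sub>F n in sequentially. c' n / (real n - 1) * ((real n - 1) / real n) = c' n / real n"
    using eventually_gt_at_top[of 1] by eventually_elim simp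
  ultimately have c': "(\<lambda>n. c' n / real n) \<longlonglongrightarrow> c * 1" by (rule Lim_transform_eventually)
  define B where "B n = {v. K0 < v \<and> v \<le> n \<and> pr v = 0 \<and> rl v = i}" for n
  have "(\<lambda>n. (real (card (B n)) - c' n) / real n) \<longlonglongrightarrow> 0"
  proof (rule tendsto_bounded_over_n)
    fix n
    have fB: "finite (B n)" by (rule finite_subset[of _ "{..n}"]) (auto simp: B_def)
    have s1: "int ` B n \<subseteq> Ai i \<inter> {1..int n}" using Ai_iff by (auto simp: B_def)
    have s2: "Ai i \<inter> {1..int n} \<subseteq> int ` B n \<union> {1..int K0}"
    proof
      fix x assume x: "x \<in> Ai i \<inter> {1..int n}"
      define v where "v = nat x"
      have xv: "x = int v" using x by (simp add: v_def)
      show "x \<in> int ` B n \<union> {1..int K0}"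
      proof (cases "K0 < v")
        case True
        then have "v \<in> B n" using Ai_iff[OF True, of i] x xv by (auto simp: B_def)
        then show ?thesis using xv by blast
      qed (use x xv in auto)
    qed
    have cB: "card (int ` B n) = card (B n)" by (intro card_image) (auto intro: inj_onI)
    have "card (B n) \<le> card (Ai i \<inter> {1..int n})" using card_mono[OF _ s1] cB by simp
    moreover have "card (Ai i \<inter> {1..int n}) \<le> card (int ` B n \<union> {1..int K0})" using fB by (intro card_mono s2) auto
    then have "card (Ai i \<inter> {1..int n}) \<le> card (B n) + K0"
      using card_Un_le[of "int ` B n" "{1..int K0}"] cB by simp
    ultimately show "\<bar>real (card (B n)) - c' n\<bar> \<le> real K0" unfolding c'_def by linarith
  qed
  from tendsto_add[OF this c'] show ?thesis unfolding B_def by (simp add: diff_divide_distrib)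
qed

end

section \<open>Densities of chains with a prescribed number of elements up to n\<close>

lemma down_closed_eq:
  fixes E :: "nat set"
  assumes "finite E" "\<And>d e. e \<in> E \<Longrightarrow> d < e \<Longrightarrow> d \<in> E"
  shows "E = {..<card E}"
proof -
  have "\<exists>k. E = {..<k}"
  proof (cases "E = {}")
    case False
    have "E = {..<Suc (Max E)}"
      using assms Max_in[OF assms(1) False] Max_ge[OF assms(1)] by (auto simp: less_Suc_eq_le le_less)
    then show ?thesis by blast
  qed auto
  then show ?thesis by auto
qed

lemma card_initial_segment:
  fixes y :: "nat \<Rightarrow> nat"
  assumes mono: "\<And>d e. d < e \<Longrightarrow> e < i \<Longrightarrow> y d < y e" and j: "1 \<le> j" "j \<le> i"
  shows "card {e. e < i \<and> y e \<le> n} = j \<longleftrightarrow> y (j - 1) \<le> n \<and> (j < i \<longrightarrow> \<not> y j \<le> n)"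
proof -
  define E where "E = {e. e < i \<and> y e \<le> n}"
  have "d \<in> E" if "e \<in> E" "d < e" for d e
    using that mono[of d e] by (auto simp: E_def)
  then have E: "E = {..<card E}" by (intro down_closed_eq) (auto simp: E_def)
  have mem: "e \<in> E \<longleftrightarrow> e < card E" for e using E by blast
  show ?thesis
  proof
    assume "card {e. e < i \<and> y e \<le> n} = j"
    then have c: "card E = j" by (simp add: E_def)
    show "y (j - 1) \<le> n \<and> (j < i \<longrightarrow> \<not> y j \<le> n)"
      using mem[of "j - 1"] mem[of j] j unfolding c by (auto simp: E_def)
  next
    assume "y (j - 1) \<le> n \<and> (j < i \<longrightarrow> \<not> y j \<le> n)"
    then have "j - 1 \<in> E" "j \<notin> E" using j by (auto simp: E_def)
    then have "card E = j" using mem[of "j - 1"] mem[of j] j by linarith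
    then show "card {e. e < i \<and> y e \<le> n} = j" by (simp add: E_def)
  qed
qed

lemma (in forest) window_density:
  assumes S: "S \<subseteq> H \<inter> {K<..}" and lim: "(\<lambda>n. real (card {u \<in> S. u \<le> n}) / real n) \<longlonglongrightarrow> c"
  shows "(\<lambda>n. real (card {u \<in> S. sc u \<le> n}) / real n) \<longlonglongrightarrow> c / q"
proof -
  have "(\<lambda>n. (real (card {u \<in> S. sc u \<le> n}) - real (card {u \<in> S. u \<le> fl n})) / real n) \<longlonglongrightarrow> 0"
  proof (rule tendsto_bounded_over_n)
    fix n
    show "\<bar>real (card {u \<in> S. sc u \<le> n}) - real (card {u \<in> S. u \<le> fl n})\<bar> \<le> 1 * (2 * \<bar>Cq\<bar> / q + 1)"
      using sc_window[of "\<lambda>_. 1" 1 S n] S by simp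
  qed
  from tendsto_add[OF this avg_fl[OF lim]] show ?thesis by (simp add: diff_divide_distrib)
qed

context beatty
begin

definition St :: "nat \<Rightarrow> nat set" where "St i = {v. K0 < v \<and> pr v = 0 \<and> rl v = i}"

lemma St_H:
  assumes "v \<in> St i" "p < i"
  shows "K0 < (suc ^^ p) v" "p < i - 1 \<Longrightarrow> (suc ^^ p) v \<in> Hs"
    "(beatty_map \<alpha> \<beta> \<gamma> \<delta> ^^ p) (int v) = int ((suc ^^ p) v)"
proof -
  have v: "K0 < v" "rl v = Suc (i - 1)" using assms by (auto simp: St_def)
  then have H: "(suc ^^ j) v \<in> Hs" if "j < i - 1" for j using rl_eq_Suc[of v "i - 1"] that by simp
  then show "p < i - 1 \<Longrightarrow> (suc ^^ p) v \<in> Hs" .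
  have "(suc ^^ j) v \<in> Hs" if "j < p" for j using H that assms(2) by simp
  from funpow_map[OF v(1) this]
  show "K0 < (suc ^^ p) v" "(beatty_map \<alpha> \<beta> \<gamma> \<delta> ^^ p) (int v) = int ((suc ^^ p) v)" by auto
qed

lemma St_less:
  assumes "v \<in> St i" "d < e" "e < i"
  shows "(suc ^^ d) v < (suc ^^ e) v"
  using assms(2,3)
proof (induction e)
  case (Suc e)
  have H: "(suc ^^ e) v \<in> Hs" "K0 < (suc ^^ e) v" using St_H[OF assms(1), of e] Suc by auto
  then have "(suc ^^ e) v < (suc ^^ Suc e) v" using sc_gt[OF H(1) sc_K[OF H]] by simp
  moreover have "(suc ^^ d) v \<le> (suc ^^ e) v" using Suc by (cases "d = e") auto
  ultimately show ?case by linarith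
qed simp

text \<open>Every application of \<open>suc\<close> stretches positions by \<open>rq\<close>, up to
  a bounded error, and so divides the density by \<open>rq\<close>.\<close>

lemma shifted_density:
  assumes lim: "(\<lambda>n. real (card {v \<in> St i. v \<le> n}) / real n) \<longlonglongrightarrow> c" and p: "p < i"
  shows "(\<lambda>n. real (card {v \<in> St i. (suc ^^ p) v \<le> n}) / real n) \<longlonglongrightarrow> c / rq ^ p"
proof -
  have "inj_on (suc ^^ p) (St i) \<and> (\<lambda>n. real (card {u \<in> (suc ^^ p) ` St i. u \<le> n}) / real n) \<longlonglongrightarrow> c / rq ^ p"
    using p
  proof (induction p)
    case 0
    then show ?case using lim by (simp add: id_def)
  next
    case (Suc p)
    define S where "S = (suc ^^ p) ` St i"
    have S: "S \<subseteq> Hs \<inter> {K0<..}" using St_H[of _ i p] Suc.prems by (auto simp: S_def)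
    have injS: "inj_on suc S" using sc_inj S by (rule inj_on_subset)
    have inj: "inj_on (suc ^^ Suc p) (St i)"
      using Suc.IH Suc.prems injS comp_inj_on[of "suc ^^ p" "St i" suc] by (simp add: S_def)
    have e1: "{u \<in> (suc ^^ Suc p) ` St i. u \<le> n} = suc ` {u \<in> S. suc u \<le> n}" for n
      by (auto simp: S_def)
    have e2: "card (suc ` {u \<in> S. suc u \<le> n}) = card {u \<in> S. suc u \<le> n}" for n
      using injS by (intro card_image) (rule inj_on_subset, auto)
    have "(\<lambda>n. real (card {u \<in> S. suc u \<le> n}) / real n) \<longlonglongrightarrow> c / rq ^ p / rq"
      using Suc.IH Suc.prems by (intro window_density[OF S]) (simp add: S_def)
    then have "(\<lambda>n. real (card {u \<in> (suc ^^ Suc p) ` St i. u \<le> n}) / real n) \<longlonglongrightarrow> c / rq ^ Suc p"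
      unfolding e1 e2 by (simp add: mult.commute)
    then show ?case using inj by blast
  qed
  moreover have "card {u \<in> (suc ^^ p) ` St i. u \<le> n} = card {v \<in> St i. (suc ^^ p) v \<le> n}"
    if "inj_on (suc ^^ p) (St i)" for n
  proof -
    have "{u \<in> (suc ^^ p) ` St i. u \<le> n} = (suc ^^ p) ` {v \<in> St i. (suc ^^ p) v \<le> n}" by auto
    then show ?thesis using that by (simp add: card_image inj_on_subset)
  qed
  ultimately show ?thesis by simp
qed

text \<open>The elements of a chain increase, so exactly \<open>j\<close> of them are at most
  \<open>n\<close> when the iterate \<open>j - 1\<close> is and the iterate \<open>j\<close>, which
  exists for \<open>j < i\<close> only, is not. The two counts have the densities given by
  \<open>shifted_density\<close>.\<close>

lemma chain_density_eq:
  assumes d: "has_uniform_density (chain_starts \<alpha> \<beta> \<gamma> \<delta> i) c" and j: "1 \<le> j" "j \<le> i"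
  shows "chain_density \<alpha> \<beta> \<gamma> \<delta> i j = c * (1 / rq ^ (j - 1) - (if j < i then 1 / rq ^ j else 0))"
proof -
  have Ai: "Ai i = chain_starts \<alpha> \<beta> \<gamma> \<delta> i" using j by (simp add: Ai_def)
  have lim: "(\<lambda>n. real (card {v \<in> St i. v \<le> n}) / real n) \<longlonglongrightarrow> c"
    using density_starts[of i c] d unfolding Ai by (simp add: St_def conj_ac)
  define N where "N p n = {v \<in> St i. (suc ^^ p) v \<le> n}" for p n
  have K0_less: "K0 < (suc ^^ p) v" if "v \<in> St i" "p < i" for p v using St_H[OF that] by simp
  define B where "B n = {v \<in> St i. card {e. e < i \<and> (suc ^^ e) v \<le> n} = j}" for n
  have v_le: "v \<le> (suc ^^ p) v" if "v \<in> St i" "p < i" for v p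
    using St_less[OF that(1), of 0 p] that by (cases "p = 0") auto
  have fN: "finite (N p n)" if "p < i" for p n
  proof (rule finite_subset[of _ "{..n}"])
    show "N p n \<subseteq> {..n}" using v_le that by (force simp: N_def)
  qed simp
  have B: "B n = N (j - 1) n - (if j < i then N j n else {})" for n
  proof -
    have "card {e. e < i \<and> (suc ^^ e) v \<le> n} = j \<longleftrightarrow> (suc ^^ (j - 1)) v \<le> n \<and> (j < i \<longrightarrow> \<not> (suc ^^ j) v \<le> n)"
      if "v \<in> St i" for v
      by (rule card_initial_segment[OF St_less[OF that] j])
    then show ?thesis unfolding B_def N_def by auto
  qed
  have sub: "N j n \<subseteq> N (j - 1) n" if "j < i" for n
    using St_less[of _ i "j - 1" j] that j by (fastforce simp: N_def)
  have cB: "real (card (B n)) = real (card (N (j - 1) n)) - (if j < i then real (card (N j n)) else 0)" for n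
  proof (cases "j < i")
    case True
    have "card (N j n) \<le> card (N (j - 1) n)" using sub[OF True] fN j by (intro card_mono) auto
    then show ?thesis unfolding B using True sub[OF True] fN by (simp add: card_Diff_subset of_nat_diff)
  qed (simp add: B)
  have Nlim: "(\<lambda>n. real (card (N p n)) / real n) \<longlonglongrightarrow> c / rq ^ p" if "p < i" for p
    unfolding N_def by (rule shifted_density[OF lim that])
  have Blim: "(\<lambda>n. real (card (B n)) / real n) \<longlonglongrightarrow> c / rq ^ (j - 1) - (if j < i then c / rq ^ j else 0)"
  proof (cases "j < i")
    case True
    then show ?thesis using tendsto_diff[OF Nlim[of "j - 1"] Nlim[of j]] by (simp add: cB diff_divide_distrib)
  next
    case False
    then show ?thesis using Nlim[of "j - 1"] j by (simp add: cB)
  qed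
  define C where "C n = {x \<in> chain_starts \<alpha> \<beta> \<gamma> \<delta> i.
     card ((\<lambda>e. (beatty_map \<alpha> \<beta> \<gamma> \<delta> ^^ e) x) ` {..<i} \<inter> {1..int n}) = j}" for n
  have CB: "int v \<in> C n \<longleftrightarrow> v \<in> B n" if v: "K0 < v" for v n
  proof -
    have "card ((\<lambda>e. (beatty_map \<alpha> \<beta> \<gamma> \<delta> ^^ e) (int v)) ` {..<i} \<inter> {1..int n}) = card {e. e < i \<and> (suc ^^ e) v \<le> n}"
      if St: "v \<in> St i"
    proof -
      have "(\<lambda>e. (beatty_map \<alpha> \<beta> \<gamma> \<delta> ^^ e) (int v)) ` {..<i} = (\<lambda>e. int ((suc ^^ e) v)) ` {..<i}"
        using St_H(3)[OF St] by (intro image_cong) auto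
      moreover have "(\<lambda>e. int ((suc ^^ e) v)) ` {..<i} \<inter> {1..int n} = (\<lambda>e. int ((suc ^^ e) v)) ` {e. e < i \<and> (suc ^^ e) v \<le> n}"
        using K0_less[OF St] by fastforce
      moreover have "inj_on (\<lambda>e. int ((suc ^^ e) v)) {e. e < i \<and> (suc ^^ e) v \<le> n}"
      proof (rule inj_onI)
        fix d e assume "d \<in> {e. e < i \<and> (suc ^^ e) v \<le> n}" "e \<in> {e. e < i \<and> (suc ^^ e) v \<le> n}"
          and eq: "int ((suc ^^ d) v) = int ((suc ^^ e) v)"
        then have "d < i" "e < i" by auto
        then show "d = e" using St_less[OF St, of d e] St_less[OF St, of e d] eq
          by (cases d e rule: linorder_cases) auto
      qed
      ultimately show ?thesis by (simp add: card_image)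
    qed
    moreover have "int v \<in> chain_starts \<alpha> \<beta> \<gamma> \<delta> i \<longleftrightarrow> v \<in> St i"
      using Ai_iff[OF v, of i] v unfolding Ai by (simp add: St_def)
    ultimately show ?thesis by (auto simp: C_def B_def)
  qed
  have fB: "finite (B n)" for n using fN[of "j - 1" n] j unfolding B by (intro finite_Diff) auto
  have "(\<lambda>n. (real (card (C n)) - real (card (B n))) / real n) \<longlonglongrightarrow> 0"
  proof (rule tendsto_bounded_over_n)
    fix n
    have s1: "int ` B n \<subseteq> C n" using CB by (auto simp: B_def St_def)
    have s2: "C n \<subseteq> int ` B n \<union> {1..int K0}"
    proof
      fix x assume x: "x \<in> C n"
      then have "x \<in> Ai i" unfolding Ai by (simp add: C_def)
      then have x0: "0 < x" by (rule Ai_pos)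
      define v where "v = nat x"
      have xv: "x = int v" using x0 by (simp add: v_def)
      show "x \<in> int ` B n \<union> {1..int K0}"
        using CB[of v n] x x0 xv by (cases "K0 < v") auto
    qed
    have cI: "card (int ` B n) = card (B n)" by (intro card_image) (auto intro: inj_onI)
    have fC: "finite (C n)" by (rule finite_subset[OF s2]) (use fB in auto)
    have "card (B n) \<le> card (C n)" using card_mono[OF fC s1] cI by simp
    moreover have "card (C n) \<le> card (int ` B n \<union> {1..int K0})" using fB by (intro card_mono s2) auto
    then have "card (C n) \<le> card (B n) + K0" using card_Un_le[of "int ` B n" "{1..int K0}"] cI by simp
    ultimately show "\<bar>real (card (C n)) - real (card (B n))\<bar> \<le> real K0" by linarith
  qed
  from tendsto_add[OF this Blim]
  have "(\<lambda>n. real (card (C n)) / real n) \<longlonglongrightarrow> c / rq ^ (j - 1) - (if j < i then c / rq ^ j else 0)"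
    by (simp add: diff_divide_distrib)
  then show ?thesis unfolding chain_density_def C_def by (subst limI) (auto simp: right_diff_distrib)
qed

text \<open>The sum in the denominator telescopes to \<open>c / rq ^ (i - k - 1)\<close>, and its
  last term is the fraction \<open>1 - 1 / rq\<close> of it, independently of \<open>i\<close> and
  \<open>k\<close>.\<close>

lemma chain_exponent:
  assumes d: "has_uniform_density (chain_starts \<alpha> \<beta> \<gamma> \<delta> i) c" and c: "c \<noteq> 0" and k: "1 \<le> k" "k < i"
  shows "- chain_density \<alpha> \<beta> \<gamma> \<delta> i (i - k) / (\<Sum>l=0..k. chain_density \<alpha> \<beta> \<gamma> \<delta> i (i - l)) = 1 / rq - 1"
proof -
  have q0: "0 < rq" using rq1 by simp
  have D: "chain_density \<alpha> \<beta> \<gamma> \<delta> i (i - l) = c * (1 / rq ^ (i - l - 1) - (if 0 < l then 1 / rq ^ (i - l) else 0))"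
    if "l < i" for l
    using chain_density_eq[OF d, of "i - l"] that by auto
  have S: "(\<Sum>l=0..k. chain_density \<alpha> \<beta> \<gamma> \<delta> i (i - l)) = c / rq ^ (i - k - 1)" if "k < i" for k
    using that
  proof (induction k)
    case 0
    then show ?case using D[of 0] by simp
  next
    case (Suc k)
    have "i - Suc k = i - k - 1" by simp
    then show ?case using Suc D[of "Suc k"] by (simp add: right_diff_distrib)
  qed
  obtain p where p: "i - k = Suc p" using k by (metis Suc_diff_Suc)
  have n: "chain_density \<alpha> \<beta> \<gamma> \<delta> i (i - k) = c * (1 / rq ^ p - 1 / rq ^ Suc p)"
    using D[OF k(2)] k unfolding p by simp
  have t: "(\<Sum>l=0..k. chain_density \<alpha> \<beta> \<gamma> \<delta> i (i - l)) = c / rq ^ p" using S[OF k(2)] unfolding p by simp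
  show ?thesis unfolding n t using q0 c by (simp add: field_simps)
qed

lemma is_sol_iff: "is_sol t \<longleftrightarrow> positive_solution A (\<gamma>/\<alpha>) (restrict t {..<m})"
  unfolding is_sol_def unfolding positive_solution_def rq_def using A(1) by auto

lemma positive_solution_is_sol: "positive_solution A (\<gamma>/\<alpha>) t \<Longrightarrow> is_sol t"
  unfolding is_sol_def unfolding positive_solution_def rq_def using A(1) by auto

lemma ex1_positive_solution: "\<exists>!t. positive_solution A (\<gamma>/\<alpha>) t"
proof (rule ex_ex1I)
  show "\<exists>t. positive_solution A (\<gamma>/\<alpha>) t" using sol_exists is_sol_iff by blast
  fix s t assume s: "positive_solution A (\<gamma>/\<alpha>) s" and t: "positive_solution A (\<gamma>/\<alpha>) t"
  have "s \<in> {..<m} \<rightarrow>\<^sub>E {0<..}" "t \<in> {..<m} \<rightarrow>\<^sub>E {0<..}"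
    using s t A(1) by (auto simp: positive_solution_def)
  then show "s = t"
    by (rule PiE_ext) (use sol_unique[OF positive_solution_is_sol[OF s] positive_solution_is_sol[OF t]] in simp)
qed

end

section \<open>The dimension formulas for Beatty shifts\<close>

locale beatty_density = beatty +
  fixes d :: "nat \<Rightarrow> real" and d_inf :: real
  assumes d: "\<And>i. 1 \<le> i \<Longrightarrow> has_uniform_density (chain_starts \<alpha> \<beta> \<gamma> \<delta> i) (d i)"
    and d_inf: "has_uniform_density (chain_starts_inf \<alpha> \<beta> \<gamma> \<delta>) d_inf"
    and add_up: "densities_add_up \<gamma> d d_inf"
begin

text \<open>The value \<open>d 0\<close> has no meaning as a density; as for \<open>rl\<close>, slot
  \<open>0\<close> is given to the infinite chains.\<close>

definition dens :: "nat \<Rightarrow> real" where "dens i = (if i = 0 then d_inf else d i)"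

lemma dens_sums: "dens sums (1 - 1 / \<gamma>)"
proof -
  have "(\<lambda>i. dens (Suc i)) sums (1 - 1 / \<gamma> - d_inf)" using add_up by (simp add: densities_add_up_def dens_def)
  then have "dens sums (1 - 1 / \<gamma> - d_inf + dens 0)" by (rule sums_Suc)
  then show ?thesis by (simp add: dens_def)
qed

sublocale density_forest m "\<lambda>i j. A $$ (i, j)" Hs suc rq Cb lamb K0 dens "1 - 1 / \<gamma>"
proof
  show "(\<lambda>n. real (card {v. K0 < v \<and> v \<le> n \<and> pr v = 0 \<and> rl v = i}) / real n) \<longlonglongrightarrow> dens i" for i
    using d[of i] d_inf by (intro density_starts) (auto simp: Ai_def dens_def)
qed (rule start_total dens_sums)+

lemma tau_eq: "tau p = (\<Sum>j. d (p + 1 + j)) + d_inf" and tau_Suc: "tau p = d (Suc p) + tau (Suc p)"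
proof -
  have s: "summable (\<lambda>i. dens i * (if i = 0 \<or> p < i then 1 else 0))" for p
    by (rule summable_dd_mult[of _ 1]) auto
  have t: "tau p = d_inf + (\<Sum>j. d (p + 1 + j))" for p
  proof -
    have "tau p = (\<Sum>j. dens (j + Suc p) * (if j + Suc p = 0 \<or> p < j + Suc p then 1 else 0)) +
        (\<Sum>i<Suc p. dens i * (if i = 0 \<or> p < i then 1 else 0))"
      unfolding tau_def by (rule suminf_split_initial_segment[OF s])
    also have "(\<Sum>i<Suc p. dens i * (if i = 0 \<or> p < i then 1 else 0)) = (\<Sum>i<Suc p. if i = 0 then d_inf else 0)"
      by (intro sum.cong) (auto simp: dens_def)
    also have "\<dots> = d_inf" by simp
    also have "(\<Sum>j. dens (j + Suc p) * (if j + Suc p = 0 \<or> p < j + Suc p then 1 else 0)) = (\<Sum>j. d (p + 1 + j))"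
      by (rule suminf_cong) (simp add: dens_def add.commute)
    finally show ?thesis by simp
  qed
  then show "tau p = (\<Sum>j. d (p + 1 + j)) + d_inf" by simp
  have "summable (\<lambda>j. d (p + 1 + j))"
  proof -
    have "summable (\<lambda>j. dens (j + Suc p))" using summable_dd by (simp only: summable_iff_shift)
    then show ?thesis by (simp add: dens_def add.commute)
  qed
  from suminf_split_head[OF this] have "(\<Sum>j. d (p + 1 + Suc j)) = (\<Sum>j. d (p + 1 + j)) - d (p + 1)" by simp
  then show "tau p = d (Suc p) + tau (Suc p)" using t[of p] t[of "Suc p"] by simp
qed

text \<open>By \<open>tau_Suc\<close> the coefficient in the series is
  \<open>tau i / rq ^ i - tau (Suc i) / rq ^ Suc i\<close>, with the index shifted by one.\<close>

lemma minkowski_formula: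
  assumes X: "X \<noteq> {}"
  defines "F \<equiv> \<lambda>i. (1 / (\<gamma>/\<alpha>) ^ (i-1) * d i
               + (1 / (\<gamma>/\<alpha>) ^ (i-1) - 1 / (\<gamma>/\<alpha>) ^ i) * ((\<Sum>j. d (i+1+j)) + d_inf))
              * log m (sum_mat (A ^\<^sub>m (i-1)))"
  shows "summable (\<lambda>i. F (i+1)) \<and> has_minkowski_dim X (\<Sum>i. F (i+1))"
proof -
  obtain D where D: "(\<lambda>i. (tau i / rq ^ i - tau (Suc i) / rq ^ Suc i) * ln (Q i) / ln (real m)) sums D"
    "has_minkowski_dim X D" using minkowski_dim[OF X] by blast
  have "F (i + 1) = (tau i / rq ^ i - tau (Suc i) / rq ^ Suc i) * ln (Q i) / ln (real m)" for i
  proof -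
    have "(\<Sum>j. d (i + 1 + 1 + j)) + d_inf = tau (Suc i)" using tau_eq[of "Suc i"] by simp
    moreover have "sum_mat (A ^\<^sub>m i) = Q i" using A(1) by (intro sum_mat_Q) auto
    ultimately have "F (i + 1) = (1 / rq ^ i * d (i + 1) + (1 / rq ^ i - 1 / rq ^ (i + 1)) * tau (Suc i)) * (ln (Q i) / ln (real m))"
      unfolding F_def by (simp add: rq_def log_def)
    also have "1 / rq ^ i * d (i + 1) + (1 / rq ^ i - 1 / rq ^ (i + 1)) * tau (Suc i)
        = (d (Suc i) + tau (Suc i)) / rq ^ i - tau (Suc i) / rq ^ Suc i"
      by (simp add: add_divide_distrib left_diff_distrib)
    finally show ?thesis by (simp add: tau_Suc[symmetric])
  qed
  then have "(\<lambda>i. F (i + 1)) sums D" using D(1) by simp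
  then show ?thesis using D(2) sums_summable sums_unique by metis
qed

lemma hausdorff_formula:
  assumes X: "X \<noteq> {}" and t: "positive_solution A (\<gamma>/\<alpha>) t"
  defines "G \<equiv> \<lambda>i. d i * log m (chain_total A (chain_density \<alpha> \<beta> \<gamma> \<delta>) i)"
  shows "summable (\<lambda>i. G (i+2)) \<and>
    hausdorff_dim X = ereal (d 1 + (\<Sum>i. G (i+2)) + d_inf * log m (\<Sum>i<m. t i))"
proof -
  interpret density_sol m "\<lambda>i j. A $$ (i, j)" Hs suc rq Cb lamb K0 dens "1 - 1 / \<gamma>" t
    by unfold_locales (rule positive_solution_is_sol[OF t])
  have G: "G (i + 2) = dens (i + 2) * ln (\<sigma> (i + 2)) / ln (real m)" for i
  \<comment> \<open>For density \<open>0\<close> the exponents degenerate to \<open>0 / 0\<close>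
    and \<open>chain_exponent\<close> does not apply, but the factor \<open>d (i + 2)\<close> makes
    the term vanish.\<close>
  proof (cases "d (i + 2) = 0")
    case False
    have "chain_total A (chain_density \<alpha> \<beta> \<gamma> \<delta>) (i + 2) = (\<Sum>y<m. Us (i + 2 - 1) y)"
      using A(1) chain_exponent[OF d[of "i + 2"] False] by (intro chain_total_eq) auto
    also have "\<dots> = \<sigma> (i + 2)" by (simp add: \<sigma>_def U_def)
    finally show ?thesis by (simp add: G_def dens_def log_def)
  qed (simp add: G_def dens_def)
  have s: "summable (\<lambda>i. dens i * ln (\<sigma> i))" by (rule summable_dd_mult[OF \<sigma>_bounds(2)])
  have s2: "summable (\<lambda>i. dens (i + 2) * ln (\<sigma> (i + 2)))" using s by (subst summable_iff_shift)
  have "hdim = (\<Sum>i. dens (i + 2) * ln (\<sigma> (i + 2))) + (\<Sum>i<2. dens i * ln (\<sigma> i))"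
    unfolding hdim_def by (rule suminf_split_initial_segment[OF s])
  also have "(\<Sum>i<2. dens i * ln (\<sigma> i)) = d_inf * ln (\<Sum>i<m. t i) + d 1 * ln (real m)"
    by (simp add: numeral_2_eq_2 dens_def \<sigma>_def U_def)
  finally have "hdim / ln (real m) = (\<Sum>i. dens (i + 2) * ln (\<sigma> (i + 2))) / ln (real m)
      + d_inf * log m (\<Sum>i<m. t i) + d 1"
    using ln_m_pos by (simp add: add_divide_distrib log_def)
  also have "(\<Sum>i. dens (i + 2) * ln (\<sigma> (i + 2))) / ln (real m) = (\<Sum>i. G (i + 2))"
    unfolding G by (rule suminf_divide[OF s2, symmetric])
  finally have "hdim / ln (real m) = d 1 + (\<Sum>i. G (i + 2)) + d_inf * log m (\<Sum>i<m. t i)" by simp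
  moreover have "summable (\<lambda>i. G (i + 2))" unfolding G by (rule summable_divide[OF s2])
  ultimately show ?thesis using hausdorff_dim_eq[OF X] by simp
qed

end

text \<open>Nonemptiness is an assumption because constraints with small indices can contradict each
  other: if both indices coincide, a diagonal entry of \<open>A\<close> has to be 1. In the last
  part the Minkowski dimension is not known beforehand to exist, hence the common value
  \<open>D\<close> is existentially quantified.\<close>

theorem theorem1p4:
  fixes m :: nat and A :: "real mat" and \<alpha> \<beta> \<gamma> \<delta> :: real
    and d :: "nat \<Rightarrow> real" and d_inf :: real
  assumes m: "2 \<le> m"
    and A: "A \<in> carrier_mat m m" "binary_mat A" "irreducible_mat A"
    and \<alpha>\<gamma>: "1 \<le> \<alpha>" "\<alpha> < \<gamma>"
    and d: "\<And>i. 1 \<le> i \<Longrightarrow> has_uniform_density (chain_starts \<alpha> \<beta> \<gamma> \<delta> i) (d i)"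
    and d_inf: "has_uniform_density (chain_starts_inf \<alpha> \<beta> \<gamma> \<delta>) d_inf"
    and nonempty: "beatty_shift m A \<alpha> \<beta> \<gamma> \<delta> \<noteq> {}"
  defines "X \<equiv> beatty_shift m A \<alpha> \<beta> \<gamma> \<delta>"
    and "dim_H \<equiv> Metric_space.hausdorff_dim (full_shift m) (shift_dist m)"
    and "has_dim_M \<equiv> Metric_space.has_minkowski_dim (full_shift m) (shift_dist m)"
    and "F \<equiv> \<lambda>i. (1 / (\<gamma>/\<alpha>) ^ (i-1) * d i
               + (1 / (\<gamma>/\<alpha>) ^ (i-1) - 1 / (\<gamma>/\<alpha>) ^ i) * ((\<Sum>j. d (i+1+j)) + d_inf))
              * log m (sum_mat (A ^\<^sub>m (i-1)))"
    and "G \<equiv> \<lambda>i. d i * log m (chain_total A (chain_density \<alpha> \<beta> \<gamma> \<delta>) i)"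
  shows "(densities_add_up \<gamma> d d_inf \<longrightarrow>
            summable (\<lambda>i. F (i+1)) \<and> has_dim_M X (\<Sum>i. F (i+1)))
       \<and> (primitive_mat A \<longrightarrow>
            (\<exists>!t. positive_solution A (\<gamma>/\<alpha>) t) \<and>
            (densities_add_up \<gamma> d d_inf \<longrightarrow>
               summable (\<lambda>i. G (i+2)) \<and>
               (\<forall>t. positive_solution A (\<gamma>/\<alpha>) t \<longrightarrow>
                  dim_H X = ereal (d 1 + (\<Sum>i. G (i+2)) + d_inf * log m (\<Sum>i<m. t i)))))
       \<and> ((\<exists>D. has_dim_M X D \<and> dim_H X = ereal D) \<longleftrightarrow>
            (\<forall>i<m. \<forall>j<m. row_sum A i = row_sum A j))"
proof -
  interpret B: beatty m A \<alpha> \<beta> \<gamma> \<delta>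
    by unfold_locales (use m A \<alpha>\<gamma> in auto)
  have X: "X = B.X" unfolding X_def B.X_beatty ..
  have ne: "B.X \<noteq> {}" using nonempty B.X_beatty by simp
  have 1: "summable (\<lambda>i. F (i+1)) \<and> has_dim_M X (\<Sum>i. F (i+1))" if "densities_add_up \<gamma> d d_inf"
  proof -
    interpret beatty_density m A \<alpha> \<beta> \<gamma> \<delta> d d_inf
      by unfold_locales (use d d_inf that in auto)
    show ?thesis unfolding X F_def has_dim_M_def by (rule minkowski_formula[OF ne])
  qed
  have 2: "\<exists>!t. positive_solution A (\<gamma>/\<alpha>) t" by (rule B.ex1_positive_solution)
  have 3: "summable (\<lambda>i. G (i+2)) \<and> dim_H X = ereal (d 1 + (\<Sum>i. G (i+2)) + d_inf * log m (\<Sum>i<m. t i))"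
    if "densities_add_up \<gamma> d d_inf" "positive_solution A (\<gamma>/\<alpha>) t" for t
  proof -
    interpret beatty_density m A \<alpha> \<beta> \<gamma> \<delta> d d_inf
      by unfold_locales (use d d_inf that in auto)
    show ?thesis unfolding X G_def dim_H_def by (rule hausdorff_formula[OF ne that(2)])
  qed
  have 4: "(\<exists>D. has_dim_M X D \<and> dim_H X = ereal D) \<longleftrightarrow> (\<forall>i<m. \<forall>j<m. row_sum A i = row_sum A j)"
    unfolding X dim_H_def has_dim_M_def by (rule B.dim_equality_iff[OF ne])
  obtain t where "positive_solution A (\<gamma>/\<alpha>) t" using 2 by blast
  then have 5: "summable (\<lambda>i. G (i+2))" if "densities_add_up \<gamma> d d_inf" using 3[OF that] by simp
  show ?thesis by (intro conjI impI allI 2 4) (use 1 3 5 in auto)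
qed

end
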